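(* Let $F'/F$ be unramified of degree $f$, $V$ an $F'$-vector space of dimension $n$, $G=R_{F'/F}(\mathrm{GL}(V))$, $\boldsymbol\mu=(\mu_j)_{j\in\mathbf Z/f\mathbf Z}$ with $\mu_j\in(\mathbf Z^n)_+$, and $b\in G(L)$. Then $\mathring X(\boldsymbol\mu,b)_K\neq\emptyset$ if and only if $[b]\in B(G,\boldsymbol\mu)$.
   Context: $F$ finite over $\mathbf Q_p$ with uniformizer $\pi$, $L$ the completion of its maximal unramified extension, $O_L$ its integers, $\sigma$ the Frobenius of $L/F$. Fix an embedding $F'\subset L$. Then $V\otimes_FL=\bigoplus_{j\in\mathbf Z/f\mathbf Z}N_j$, $N_j=\{v:(x\otimes1)v=(1\otimes\sigma^{-j}(x))v\ \forall x\in F'\}$, each an $n$-dimensional $L$-space. $G(L)=\mathrm{Aut}_{F'\otimes_FL}(V\otimes_FL)$; for $b\in G(L)$ put $F=b\cdot(\mathrm{id}_V\otimes\sigma)$, a $\sigma$-linear bijection with $F(N_{j-1})=N_j$. $(\mathbf Z^n)_+=\{\mu\in\mathbf Z^n:\mu_1\ge\dots\ge\mu_n\}$. For $O_L$-lattices $M,M'$ in an $n$-dimensional $L$-space, $\mathrm{inv}(M,M')=(\mu_1,\dots,\mu_n)\in(\mathbf Z^n)_+$ iff $M$ has a basis $e_1,\dots,e_n$ with $\pi^{\mu_1}e_1,\dots,\pi^{\mu_n}e_n$ a basis of $M'$. $\mathring X(\boldsymbol\mu,b)_K$ is the set of graded lattices $\tilde M=\bigoplus_j\tilde M_j$ ($\tilde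 M_j$ an $O_L$-lattice in $N_j$) with $\mathrm{inv}(\tilde M_j,F\tilde M_{j-1})=\mu_j$ for all $j\in\mathbf Z/f\mathbf Z$. $[b]$ is the $\sigma$-conjugacy class of $b$ and $B(G,\boldsymbol\mu)$ is Kottwitz's finite set of $\sigma$-conjugacy classes defined by the group-theoretic Mazur inequality; via Kottwitz's Shapiro bijection, $[b]\in B(G,\boldsymbol\mu)$ iff the slope vector of the $\sigma^f$-linear isocrystal $(N_0,F^f)$ (slopes normalized by $\mathrm{val}(\pi)=1$) is $\le\sum_j\mu_j$ in the dominance order on $\mathbf Q^n$. *)

theory Defs
  imports Main "Jordan_Normal_Form.Matrix"
begin

text \<open>L is modelled by an abstract field type 'a with a normalized discrete valuation
  v (only meaningful on nonzero elements), an automorphism sigma and an element pi.\<close>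

definition OL :: "('a::field \<Rightarrow> int) \<Rightarrow> 'a set" where
  "OL v = {x. x = 0 \<or> 0 \<le> v x}"

definition mL :: "('a::field \<Rightarrow> int) \<Rightarrow> 'a set" where
  "mL v = {x. x = 0 \<or> 1 \<le> v x}"

definition v_close :: "('a::field \<Rightarrow> int) \<Rightarrow> int \<Rightarrow> 'a \<Rightarrow> 'a \<Rightarrow> bool" where
  "v_close v N x y \<longleftrightarrow> x = y \<or> N \<le> v (x - y)"

definition v_complete :: "('a::field \<Rightarrow> int) \<Rightarrow> bool" where
  "v_complete v \<longleftrightarrow>
     (\<forall>s :: nat \<Rightarrow> 'a.
        (\<forall>N. \<exists>m. \<forall>i\<ge>m. \<forall>j\<ge>m. v_close v N (s i) (s j)) \<longrightarrow>
        (\<exists>l. \<forall>N. \<exists>m. \<forall>i\<ge>m. v_close v N (s i) l))"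

text \<open>The standing setting: L is a complete discretely valued field of characteristic 0,
  with algebraically closed residue field of characteristic p that is algebraic over F_p;
  sigma is a valuation-preserving field automorphism inducing x \<mapsto> x^q (q = p^r) on
  the residue field; F is the fixed field of sigma and pi is a uniformizer of F
  (sigma pi = pi, v pi = 1).  Up to isomorphism this is exactly
  (completion of F^ur, Frobenius of L/F, uniformizer of F) for F finite over Q_p.\<close>

definition local_setting ::
  "nat \<Rightarrow> ('a::field \<Rightarrow> int) \<Rightarrow> ('a \<Rightarrow> 'a) \<Rightarrow> 'a \<Rightarrow> bool" where
  "local_setting p v \<sigma> \<pi> \<longleftrightarrow>
     prime p \<and>
     (\<forall>n::nat. n > 0 \<longrightarrow> (of_nat n :: 'a) \<noteq> 0) \<and>
     (\<forall>x y. x \<noteq> 0 \<longrightarrow> y \<noteq> 0 \<longrightarrow> v (x * y) = v x + v y) \<and>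
     (\<forall>x y. x \<noteq> 0 \<longrightarrow> y \<noteq> 0 \<longrightarrow> x + y \<noteq> 0 \<longrightarrow> min (v x) (v y) \<le> v (x + y)) \<and>
     \<pi> \<noteq> 0 \<and> v \<pi> = 1 \<and> \<sigma> \<pi> = \<pi> \<and>
     1 \<le> v (of_nat p) \<and>
     v_complete v \<and>
     (\<forall>d::nat. \<forall>c :: nat \<Rightarrow> 'a. 1 \<le> d \<longrightarrow> (\<forall>i<d. c i \<in> OL v) \<longrightarrow>
        (\<exists>x\<in>OL v. x ^ d + (\<Sum>i<d. c i * x ^ i) \<in> mL v)) \<and>
     (\<forall>x\<in>OL v. \<exists>m::nat. 1 \<le> m \<and> x ^ (p ^ m) - x \<in> mL v) \<and>
     bij \<sigma> \<and> (\<forall>x y. \<sigma> (x + y) = \<sigma> x + \<sigma> y) \<and> (\<forall>x y. \<sigma> (x * y) = \<sigma> x * \<sigma> y) \<and>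
     \<sigma> 1 = 1 \<and> (\<forall>x. x \<noteq> 0 \<longrightarrow> v (\<sigma> x) = v x) \<and>
     (\<exists>r::nat. 1 \<le> r \<and> (\<forall>x\<in>OL v. \<sigma> x - x ^ (p ^ r) \<in> mL v))"

definition lattice_of :: "('a::field \<Rightarrow> int) \<Rightarrow> nat \<Rightarrow> 'a mat \<Rightarrow> 'a vec set" where
  "lattice_of v n A = {A *\<^sub>v c | c. c \<in> carrier_vec n \<and> (\<forall>i<n. c $ i \<in> OL v)}"

definition is_lattice :: "('a::field \<Rightarrow> int) \<Rightarrow> nat \<Rightarrow> 'a vec set \<Rightarrow> bool" where
  "is_lattice v n M \<longleftrightarrow> (\<exists>A. A \<in> carrier_mat n n \<and> invertible_mat A \<and> M = lattice_of v n A)"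

definition dominant :: "nat \<Rightarrow> int list \<Rightarrow> bool" where
  "dominant n \<mu> \<longleftrightarrow> length \<mu> = n \<and> sorted_wrt (\<ge>) \<mu>"

definition inv_is ::
  "('a::field \<Rightarrow> int) \<Rightarrow> 'a \<Rightarrow> nat \<Rightarrow> 'a vec set \<Rightarrow> 'a vec set \<Rightarrow> int list \<Rightarrow> bool" where
  "inv_is v \<pi> n M M' \<mu> \<longleftrightarrow> dominant n \<mu> \<and>
     (\<exists>A. A \<in> carrier_mat n n \<and> invertible_mat A \<and> M = lattice_of v n A \<and>
          M' = lattice_of v n (A * mat n n (\<lambda>(i,j). if i = j then \<pi> powi (\<mu> ! i) else 0)))"

text \<open>After choosing an F'-basis of V, each N_j is identified with L^n and b \<in> G(L)
  corresponds to a tuple (B_j)_{j \<in> Z/fZ} of invertible n x n matrices over L, such that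
  F : N_{j-1} \<rightarrow> N_j is x \<mapsto> B_j sigma(x).\<close>
definition Fmap :: "('a \<Rightarrow> 'a) \<Rightarrow> (nat \<Rightarrow> 'a::field mat) \<Rightarrow> nat \<Rightarrow> 'a vec \<Rightarrow> 'a vec" where
  "Fmap \<sigma> B j x = B j *\<^sub>v map_vec \<sigma> x"

text \<open>F^k starting on N_0, landing in N_{k mod f}.\<close>
fun Fiter :: "nat \<Rightarrow> ('a \<Rightarrow> 'a) \<Rightarrow> (nat \<Rightarrow> 'a::field mat) \<Rightarrow> nat \<Rightarrow> 'a vec \<Rightarrow> 'a vec" where
  "Fiter f \<sigma> B 0 x = x"
| "Fiter f \<sigma> B (Suc k) x = Fmap \<sigma> B (Suc k mod f) (Fiter f \<sigma> B k x)"

definition Frob_f :: "nat \<Rightarrow> ('a \<Rightarrow> 'a) \<Rightarrow> (nat \<Rightarrow> 'a::field mat) \<Rightarrow> 'a vec \<Rightarrow> 'a vec" where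
  "Frob_f f \<sigma> B = Fiter f \<sigma> B f"

definition ADLV_nonempty ::
  "('a::field \<Rightarrow> int) \<Rightarrow> ('a \<Rightarrow> 'a) \<Rightarrow> 'a \<Rightarrow> nat \<Rightarrow> nat \<Rightarrow> (nat \<Rightarrow> int list) \<Rightarrow> (nat \<Rightarrow> 'a mat) \<Rightarrow> bool" where
  "ADLV_nonempty v \<sigma> \<pi> n f \<mu> B \<longleftrightarrow>
     (\<exists>M :: nat \<Rightarrow> 'a vec set.
        (\<forall>j<f. is_lattice v n (M j)) \<and>
        (\<forall>j<f. inv_is v \<pi> n (M j) (Fmap \<sigma> B j ` M ((j + f - 1) mod f)) (\<mu> j)))"

text \<open>nu (sorted decreasingly, length n) is the slope vector of the isocrystal (L^n, Phi):
  there is a basis of L^n (columns of P) such that for each value lambda occurring in nu,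
  the L-span N_lambda of the basis vectors with index in I_lambda = {i. nu_i = lambda}
  is Phi-stable and isoclinic of slope lambda, namely lambda = r/s with s > 0 and the
  O_L-lattice spanned by those basis vectors satisfies Phi^s M = pi^r M.  Slopes are
  normalized by val(pi) = 1.  Thus N = (+)_lambda N_lambda with dim N_lambda = multiplicity
  of lambda in nu.\<close>
definition span_idx :: "'a::field set \<Rightarrow> nat \<Rightarrow> 'a mat \<Rightarrow> nat set \<Rightarrow> 'a vec set" where
  "span_idx R n P I = {P *\<^sub>v c | c. c \<in> carrier_vec n \<and> (\<forall>i<n. if i \<in> I then c $ i \<in> R else c $ i = 0)}"

definition is_slope_vector ::
  "('a::field \<Rightarrow> int) \<Rightarrow> 'a \<Rightarrow> nat \<Rightarrow> ('a vec \<Rightarrow> 'a vec) \<Rightarrow> rat list \<Rightarrow> bool" where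
  "is_slope_vector v \<pi> n \<Phi> \<nu> \<longleftrightarrow>
     length \<nu> = n \<and> sorted_wrt (\<ge>) \<nu> \<and>
     (\<exists>P. P \<in> carrier_mat n n \<and> invertible_mat P \<and>
        (\<forall>lam\<in>set \<nu>.
           (let I = {i. i < n \<and> \<nu> ! i = lam} in
             \<Phi> ` span_idx UNIV n P I \<subseteq> span_idx UNIV n P I \<and>
             (\<exists>r::int. \<exists>s::nat. 0 < s \<and> lam = of_int r / of_nat s \<and>
                (\<Phi> ^^ s) ` span_idx (OL v) n P I =
                (\<lambda>x. (\<pi> powi r) \<cdot>\<^sub>v x) ` span_idx (OL v) n P I))))"

definition slope_vector :: "('a::field \<Rightarrow> int) \<Rightarrow> 'a \<Rightarrow> nat \<Rightarrow> ('a vec \<Rightarrow> 'a vec) \<Rightarrow> rat list" where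
  "slope_vector v \<pi> n \<Phi> = (THE \<nu>. is_slope_vector v \<pi> n \<Phi> \<nu>)"

definition dominance_le :: "rat list \<Rightarrow> rat list \<Rightarrow> bool" where
  "dominance_le x y \<longleftrightarrow> length x = length y \<and>
     (\<forall>k\<le>length x. sum_list (take k x) \<le> sum_list (take k y)) \<and> sum_list x = sum_list y"

text \<open>[b] \<in> B(G,mu), via Kottwitz's Shapiro bijection: the slope vector of (N_0, F^f)
  is \<le> sum_j mu_j in the dominance order.\<close>
definition in_B_G_mu ::
  "('a::field \<Rightarrow> int) \<Rightarrow> ('a \<Rightarrow> 'a) \<Rightarrow> 'a \<Rightarrow> nat \<Rightarrow> nat \<Rightarrow> (nat \<Rightarrow> int list) \<Rightarrow> (nat \<Rightarrow> 'a mat) \<Rightarrow> bool" where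
  "in_B_G_mu v \<sigma> \<pi> n f \<mu> B \<longleftrightarrow>
     dominance_le (slope_vector v \<pi> n (Frob_f f \<sigma> B))
                  (map (\<lambda>i. of_int (\<Sum>j<f. \<mu> j ! i)) [0..<n])"

end

theory Submission
  imports Defs "Jordan_Normal_Form.Determinant"
begin

text \<open>
  Write \<open>\<Phi> = F ^ f\<close> for the semilinear map on \<open>N\<^sub>0\<close>.

  Slope decompositions exist because a cyclic vector turns \<open>\<Phi>\<close> into a twisted companion map: with \<open>r / s\<close> the
  smallest slope of its Newton polygon, \<open>\<pi>\<^bsup>-r\<^esup> \<Phi>\<^sup>s\<close> preserves a lattice without being topologically
  nilpotent, and its Fitting decomposition, lifted by completeness, either shows that \<open>\<Phi>\<close> is isoclinic
  or splits it into two smaller blocks.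

  If lattices with the prescribed invariants exist, comparing determinants on the \<open>\<Phi>\<close>-stable subspaces
  spanned by the largest slopes bounds the partial sums of the slopes at the break points, and concavity gives
  the remaining ones. The same inequality, applied to \<open>\<Phi>\<^sup>S\<close> in both directions, proves that the slope vector is
  unique.

  Conversely, let \<open>c\<close> be the monic twisted polynomial of degree \<open>n\<close> annihilating a cyclic vector \<open>x\<close>. Its
  coefficient of degree \<open>k\<close> has valuation at least the sum of the \<open>n - k\<close> smallest slopes, hence at least the sum
  of the \<open>n - k\<close> smallest entries of \<open>\<Sum>\<^sub>j \<mu>\<^sub>j\<close>. Therefore the truncated Horner sums of \<open>c\<close>, suitably scaled,
  span a lattice on which \<open>\<Phi>\<close> acts as an integral companion matrix times \<open>\<pi>\<close> to the power \<open>\<Sum>\<^sub>j \<mu>\<^sub>j\<close>.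
\<close>

section \<open>Valuations and matrices over a discretely valued field\<close>

text \<open>A slope decomposition is recorded by a basis \<open>P\<close>, one common denominator
  \<open>S\<close> and integers \<open>e i\<close>, so that the slopes are \<open>e i / S\<close>
  and \<Phi>^S acts as \<pi>^e times an element of GL_n(O_L). Being block diagonal along the slopes
  is the same as commuting with \<pi>^e, and because \<sigma> fixes \<pi> this survives every
  semilinear manipulation. The index j in Z/f is removed rather than carried along. For the
  inequality, a slope basis of N_0 is transported by F to the other N_j, so that F has the identity
  matrix on every step but one. For existence, it suffices to find one lattice in N_0 whose position
  relative to its image under \<Phi> is the sum of the \<mu>_j: transporting a suitable basis of it
  by F and scaling the basis vectors by powers of \<pi> distributes the sum over the f steps. Cyclic
  vectors rest on Dedekind's independence of the powers of \<sigma>^f. The residue field enters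
  here: on it \<sigma> is a Frobenius map of infinite order.\<close>

lemma mult_carrier_sq [simp]:
  "A \<in> carrier_mat n n \<Longrightarrow> B \<in> carrier_mat n n \<Longrightarrow> A * B \<in> carrier_mat n n"
  by (rule mult_carrier_mat)

lemma invertible_mat_obtain:
  assumes "invertible_mat A" "A \<in> carrier_mat n n"
  obtains B where "B \<in> carrier_mat n n" "A * B = 1\<^sub>m n" "B * A = 1\<^sub>m n"
proof -
  from assms obtain B where B: "A * B = 1\<^sub>m n" "B * A = 1\<^sub>m (dim_row B)"
    unfolding invertible_mat_def inverts_mat_def by auto
  have "dim_col B = n" using arg_cong[OF B(1), of dim_col] by simp
  moreover have "dim_row B = n" using arg_cong[OF B(2), of dim_col] assms(2) by simp
  ultimately show ?thesis using that[of B] B by auto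
qed

lemma invertible_matI:
  "A \<in> carrier_mat n n \<Longrightarrow> B \<in> carrier_mat n n \<Longrightarrow> A * B = 1\<^sub>m n \<Longrightarrow> B * A = 1\<^sub>m n \<Longrightarrow> invertible_mat A"
  unfolding invertible_mat_def inverts_mat_def by auto

lemma invertible_mat_iff_det:
  fixes A :: "'a::field mat"
  assumes "A \<in> carrier_mat n n"
  shows "invertible_mat A \<longleftrightarrow> det A \<noteq> 0"
proof
  assume "invertible_mat A"
  then obtain B where B: "B \<in> carrier_mat n n" "A * B = 1\<^sub>m n"
    using invertible_mat_obtain assms by metis
  from arg_cong[OF B(2), of det] show "det A \<noteq> 0"
    using det_mult[OF assms B(1)] by auto
next
  assume "det A \<noteq> 0"
  from det_non_zero_imp_unit[OF assms this, unfolded Units_def ring_mat_simps]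
  show "invertible_mat A" using assms invertible_matI by auto
qed

lemma invertible_mat_mult:
  fixes A :: "'a::field mat"
  assumes "A \<in> carrier_mat n n" "B \<in> carrier_mat n n" "invertible_mat A" "invertible_mat B"
  shows "invertible_mat (A * B)"
  using assms by (simp add: invertible_mat_iff_det[of _ n] det_mult)

lemma mult_left_cancel:
  fixes A :: "'a::field mat"
  assumes "invertible_mat A" "A \<in> carrier_mat n n" "X \<in> carrier_mat n m" "Y \<in> carrier_mat n m"
    and eq: "A * X = A * Y"
  shows "X = Y"
proof -
  obtain B where B: "B \<in> carrier_mat n n" "B * A = 1\<^sub>m n"
    using invertible_mat_obtain assms by metis
  have "B * (A * X) = X" "B * (A * Y) = Y"
    using assms(2-4) B by (simp_all add: assoc_mult_mat[symmetric, of _ n n _ n _ m])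
  then show ?thesis using eq by metis
qed

lemma mult_mat_vec_index:
  "A \<in> carrier_mat m n \<Longrightarrow> c \<in> carrier_vec n \<Longrightarrow> i < m \<Longrightarrow>
    (A *\<^sub>v c) $ i = (\<Sum>j<n. A $$ (i,j) * c $ j)"
  by (auto simp: scalar_prod_def atLeast0LessThan intro!: sum.cong)

lemma mult_mat_index:
  "A \<in> carrier_mat m n \<Longrightarrow> B \<in> carrier_mat n l \<Longrightarrow> i < m \<Longrightarrow> j < l \<Longrightarrow>
    (A * B) $$ (i,j) = (\<Sum>k<n. A $$ (i,k) * B $$ (k,j))"
  by (auto simp: scalar_prod_def atLeast0LessThan intro!: sum.cong)

lemma sum_delta_mult [simp]:
  fixes g :: "nat \<Rightarrow> 'a::semiring_1"
  shows "(\<Sum>j<n. (if i = j then a j else 0) * g j) = (if i < n then a i * g i else 0)"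
    "(\<Sum>j<n. g j * (if j = i then a j else 0)) = (if i < n then g i * a i else 0)"
proof -
  have "(\<Sum>j<n. (if i = j then a j else 0) * g j) = (\<Sum>j<n. if j = i then a i * g i else 0)"
    by (rule sum.cong) auto
  then show "(\<Sum>j<n. (if i = j then a j else 0) * g j) = (if i < n then a i * g i else 0)"
    by simp
  have "(\<Sum>j<n. g j * (if j = i then a j else 0)) = (\<Sum>j<n. if j = i then g i * a i else 0)"
    by (rule sum.cong) auto
  then show "(\<Sum>j<n. g j * (if j = i then a j else 0)) = (if i < n then g i * a i else 0)"
    by simp
qed

text \<open>The automorphism is not a parameter of the locale: the lemmas are applied to \<sigma>,
  to \<sigma>^f, to their powers and to their inverses, each satisfying \<open>aut\<close>.\<close>

locale dvf =
  fixes v :: "'a::field \<Rightarrow> int" and \<pi> :: 'a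
  assumes v_mult: "x \<noteq> 0 \<Longrightarrow> y \<noteq> 0 \<Longrightarrow> v (x * y) = v x + v y"
    and v_add: "x \<noteq> 0 \<Longrightarrow> y \<noteq> 0 \<Longrightarrow> x + y \<noteq> 0 \<Longrightarrow> min (v x) (v y) \<le> v (x + y)"
    and pi_nz [simp]: "\<pi> \<noteq> 0" and v_pi [simp]: "v \<pi> = 1"
    and complete: "v_complete v"
begin

text \<open>The value \<open>v 0\<close> is unspecified, so lower bounds on valuations treat 0
  separately.\<close>

definition vge :: "int \<Rightarrow> 'a \<Rightarrow> bool" where "vge N x \<longleftrightarrow> x = 0 \<or> N \<le> v x"

definition mge :: "int \<Rightarrow> 'a mat \<Rightarrow> bool" where
  "mge N A \<longleftrightarrow> (\<forall>i<dim_row A. \<forall>j<dim_col A. vge N (A $$ (i,j)))"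

text \<open>The group GL_n(O_L).\<close>

definition GLO :: "nat \<Rightarrow> 'a mat \<Rightarrow> bool" where
  "GLO n A \<longleftrightarrow> A \<in> carrier_mat n n \<and> mge 0 A \<and>
     (\<exists>B. B \<in> carrier_mat n n \<and> mge 0 B \<and> A * B = 1\<^sub>m n \<and> B * A = 1\<^sub>m n)"

definition dg :: "nat \<Rightarrow> (nat \<Rightarrow> int) \<Rightarrow> 'a mat" where
  "dg n e = mat n n (\<lambda>(i,j). if i = j then \<pi> powi (e i) else 0)"

text \<open>Fixing \<pi> makes every \<open>dg n e\<close> invariant, so that scalings by powers of
  \<pi> pass through semilinear maps unchanged.\<close>

definition aut :: "('a \<Rightarrow> 'a) \<Rightarrow> bool" where
  "aut \<tau> \<longleftrightarrow> bij \<tau> \<and> (\<forall>x y. \<tau> (x + y) = \<tau> x + \<tau> y) \<and> (\<forall>x y. \<tau> (x * y) = \<tau> x * \<tau> y) \<and>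
     \<tau> 1 = 1 \<and> (\<forall>x. x \<noteq> 0 \<longrightarrow> v (\<tau> x) = v x) \<and> \<tau> \<pi> = \<pi>"

section \<open>Ultrametric arithmetic\<close>

lemma OL_iff: "x \<in> OL v \<longleftrightarrow> vge 0 x" by (simp add: OL_def vge_def)

lemma v_one [simp]: "v 1 = 0"
  using v_mult[of 1 1] by simp

lemma v_uminus [simp]: "v (- x) = v x"
proof (cases "x = 0")
  case False
  have "v ((-1) * (-1)) = v (-1) + v (-1)" by (rule v_mult) auto
  then have "v (-1) = 0" by simp
  then show ?thesis using v_mult[of "-1" x] False by simp
qed simp

lemma v_inverse: "x \<noteq> 0 \<Longrightarrow> v (inverse x) = - v x"
  using v_mult[of x "inverse x"] by simp

lemma v_divide: "x \<noteq> 0 \<Longrightarrow> y \<noteq> 0 \<Longrightarrow> v (x / y) = v x - v y"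
  using v_mult[of x "inverse y"] by (simp add: v_inverse divide_inverse)

lemma v_pow: "x \<noteq> 0 \<Longrightarrow> v (x ^ k) = int k * v x"
  by (induction k) (auto simp: v_mult algebra_simps)

lemma v_powi [simp]: "v (\<pi> powi k) = k"
  by (cases "k \<ge> 0") (auto simp: power_int_def v_pow v_inverse)

lemma v_prod: "(\<And>i. i \<in> A \<Longrightarrow> g i \<noteq> 0) \<Longrightarrow> v (prod g A) = (\<Sum>i\<in>A. v (g i))"
  by (induction A rule: infinite_finite_induct) (auto simp: v_mult)

lemma vge_0 [simp]: "vge N 0" by (simp add: vge_def)
lemma vge_1 [simp]: "vge 0 1" by (simp add: vge_def)
lemma vge_mono: "vge N x \<Longrightarrow> M \<le> N \<Longrightarrow> vge M x" by (auto simp: vge_def)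
lemma vge_uminus [simp]: "vge N (- x) = vge N x" by (simp add: vge_def)
lemma vge_nz: "x \<noteq> 0 \<Longrightarrow> vge N x \<longleftrightarrow> N \<le> v x" by (simp add: vge_def)
lemma vge_powi [simp]: "vge N (\<pi> powi k) \<longleftrightarrow> N \<le> k" by (simp add: vge_def)

lemma vge_add: "vge N x \<Longrightarrow> vge N y \<Longrightarrow> vge N (x + y)"
  using v_add[of x y] unfolding vge_def by (cases "x = 0"; cases "y = 0"; cases "x + y = 0") simp_all

lemma vge_diff: "vge N x \<Longrightarrow> vge N y \<Longrightarrow> vge N (x - y)"
  using vge_add[of N x "- y"] by simp

lemma vge_mult: "vge N x \<Longrightarrow> vge M y \<Longrightarrow> vge (N + M) (x * y)"
  unfolding vge_def by (cases "x = 0"; cases "y = 0") (auto simp: v_mult)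

lemma vge_mult0: "vge 0 x \<Longrightarrow> vge M y \<Longrightarrow> vge M (x * y)" "vge M x \<Longrightarrow> vge 0 y \<Longrightarrow> vge M (x * y)"
  using vge_mult[of 0 x M y] vge_mult[of M x 0 y] by auto

lemma vge_sum: "(\<And>i. i \<in> A \<Longrightarrow> vge N (g i)) \<Longrightarrow> vge N (sum g A)"
  by (induction A rule: infinite_finite_induct) (auto intro: vge_add)

lemma vge_prod0: "(\<And>i. i \<in> A \<Longrightarrow> vge 0 (g i)) \<Longrightarrow> vge 0 (prod g A)"
  by (induction A rule: infinite_finite_induct) (auto intro: vge_mult0)

lemma vge_powi_mult: "vge N (\<pi> powi k * x) \<longleftrightarrow> vge (N - k) x"
  by (cases "x = 0") (auto simp: vge_def v_mult)

lemma vge_all_imp_0: "(\<And>N. vge N x) \<Longrightarrow> x = 0"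
  unfolding vge_def by (metis zle_add1_eq_le less_irrefl)

lemma vge_all_nat_imp_0: "(\<And>k::nat. vge (C + int k) x) \<Longrightarrow> x = 0"
proof (rule vge_all_imp_0)
  fix N assume a: "\<And>k::nat. vge (C + int k) x"
  show "vge N x" by (rule vge_mono[OF a[of "nat (N - C)"]]) simp
qed

lemma vge_lower_bound: "\<exists>C. vge C x" by (auto simp: vge_def)

lemma powi_pi_eq_iff [simp]: "\<pi> powi a = \<pi> powi b \<longleftrightarrow> a = b"
  by (metis v_powi)

lemma powi_add_pi: "\<pi> powi (a + b) = \<pi> powi a * \<pi> powi b"
  by (simp add: power_int_add)

lemma v_dominant_add:
  assumes "x \<noteq> 0" "vge (v x + 1) y"
  shows "x + y \<noteq> 0 \<and> v (x + y) = v x"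
proof -
  have "x + y \<noteq> 0" using assms unfolding vge_def by (auto simp: add_eq_0_iff)
  moreover have "vge (v x) (x + y)"
    using assms by (intro vge_add vge_mono[OF assms(2)]) (auto simp: vge_def)
  moreover have "\<not> vge (v x + 1) (x + y)"
    using vge_diff[of "v x + 1" "x + y" y] assms by (auto simp: vge_def)
  ultimately show ?thesis by (auto simp: vge_def)
qed

section \<open>Matrices with a lower bound on the valuations of their entries\<close>

lemma mge_mono: "mge N A \<Longrightarrow> M \<le> N \<Longrightarrow> mge M A"
  unfolding mge_def by (blast intro: vge_mono)

lemma mge_zero [simp]: "mge N (0\<^sub>m a b)" by (auto simp: mge_def)
lemma mge_one [simp]: "mge 0 (1\<^sub>m n)" by (auto simp: mge_def)

lemma mge_D: "mge N A \<Longrightarrow> A \<in> carrier_mat a b \<Longrightarrow> i < a \<Longrightarrow> j < b \<Longrightarrow> vge N (A $$ (i,j))"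
  by (auto simp: mge_def)

lemma mge_I: "A \<in> carrier_mat a b \<Longrightarrow> (\<And>i j. i < a \<Longrightarrow> j < b \<Longrightarrow> vge N (A $$ (i,j))) \<Longrightarrow> mge N A"
  by (auto simp: mge_def)

lemma mge_mult:
  assumes "mge N A" "mge M B" "A \<in> carrier_mat a b" "B \<in> carrier_mat b c"
  shows "mge (N + M) (A * B)"
  using assms by (intro mge_I[of _ a c]) (auto simp: mult_mat_index simp del: index_mult_mat
    intro!: vge_sum vge_mult elim!: mge_D)

lemma mge_mult0:
  "mge 0 A \<Longrightarrow> mge M B \<Longrightarrow> A \<in> carrier_mat a b \<Longrightarrow> B \<in> carrier_mat b c \<Longrightarrow> mge M (A * B)"
  "mge M A \<Longrightarrow> mge 0 B \<Longrightarrow> A \<in> carrier_mat a b \<Longrightarrow> B \<in> carrier_mat b c \<Longrightarrow> mge M (A * B)"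
  using mge_mult[of 0 A M B a b c] mge_mult[of M A 0 B a b c] by auto

lemma mge_add:
  "mge N A \<Longrightarrow> mge N B \<Longrightarrow> A \<in> carrier_mat a b \<Longrightarrow> B \<in> carrier_mat a b \<Longrightarrow> mge N (A + B)"
  by (intro mge_I[of _ a b]) (auto intro!: vge_add elim!: mge_D)

lemma mge_diff:
  "mge N A \<Longrightarrow> mge N B \<Longrightarrow> A \<in> carrier_mat a b \<Longrightarrow> B \<in> carrier_mat a b \<Longrightarrow> mge N (A - B)"
  by (intro mge_I[of _ a b]) (auto intro!: vge_diff elim!: mge_D)

lemma mge_smult: "mge N A \<Longrightarrow> vge M x \<Longrightarrow> mge (M + N) (x \<cdot>\<^sub>m A)"
  by (auto simp: mge_def intro!: vge_mult)

lemma mge_lower_bound: "\<exists>C. mge C A"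
proof -
  let ?I = "{..<dim_row A} \<times> {..<dim_col A}"
  obtain c where c: "\<And>i j. vge (c (i,j)) (A $$ (i,j))"
    using vge_lower_bound[of "A $$ _"] by (metis surj_pair)
  let ?C = "Min (insert 0 (c ` ?I))"
  have "mge ?C A" unfolding mge_def
    by (intro allI impI vge_mono[OF c] Min_le) auto
  then show ?thesis by blast
qed

lemma mge_all_nat_imp_0:
  assumes "\<And>k::nat. mge (C + int k) A" "A \<in> carrier_mat a b"
  shows "A = 0\<^sub>m a b"
  using assms by (intro eq_matI) (auto simp: mge_def intro!: vge_all_nat_imp_0[of C])

section \<open>Diagonal matrices of powers of the uniformizer\<close>

lemma dg_carrier [simp]: "dg n e \<in> carrier_mat n n" by (simp add: dg_def)

lemma dg_dim [simp]: "dim_row (dg n e) = n" "dim_col (dg n e) = n" by (simp_all add: dg_def)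

lemma dg_mult_index:
  assumes "A \<in> carrier_mat n m" "i < n" "j < m"
  shows "(dg n e * A) $$ (i,j) = \<pi> powi (e i) * A $$ (i,j)"
proof -
  have "(dg n e * A) $$ (i,j) = (\<Sum>k<n. dg n e $$ (i,k) * A $$ (k,j))"
    by (rule mult_mat_index) (use assms in auto)
  also have "\<dots> = (\<Sum>k<n. (if i = k then \<pi> powi (e k) else 0) * A $$ (k,j))"
    by (rule sum.cong) (use assms in \<open>auto simp: dg_def\<close>)
  finally show ?thesis using assms by simp
qed

lemma mult_dg_index:
  assumes "A \<in> carrier_mat m n" "i < m" "j < n"
  shows "(A * dg n e) $$ (i,j) = A $$ (i,j) * \<pi> powi (e j)"
proof -
  have "(A * dg n e) $$ (i,j) = (\<Sum>k<n. A $$ (i,k) * dg n e $$ (k,j))"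
    by (rule mult_mat_index) (use assms in auto)
  also have "\<dots> = (\<Sum>k<n. A $$ (i,k) * (if k = j then \<pi> powi (e k) else 0))"
    by (rule sum.cong) (use assms in \<open>auto simp: dg_def\<close>)
  finally show ?thesis using assms by simp
qed

lemma dg_mult_dg: "dg n e * dg n e' = dg n (\<lambda>i. e i + e' i)"
  by (rule eq_matI)
    (auto simp: mult_dg_index[of _ n n] powi_add_pi simp del: index_mult_mat(1), auto simp: dg_def powi_add_pi)

lemma dg_zero [simp]: "dg n (\<lambda>i. 0) = 1\<^sub>m n"
  by (rule eq_matI) (auto simp: dg_def)

lemma dg_inverse: "dg n e * dg n (\<lambda>i. - e i) = 1\<^sub>m n" "dg n (\<lambda>i. - e i) * dg n e = 1\<^sub>m n"
  by (simp_all add: dg_mult_dg)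

lemma dg_invertible [simp]: "invertible_mat (dg n e)"
  by (rule invertible_matI[of _ n "dg n (\<lambda>i. - e i)"]) (simp_all add: dg_inverse)

lemma det_dg: "det (dg n e) = (\<Prod>i<n. \<pi> powi (e i))"
proof -
  have "det (dg n e) = prod_list (diag_mat (dg n e))"
    by (rule det_upper_triangular[of _ n]) (auto simp: dg_def upper_triangular_def)
  also have "diag_mat (dg n e) = map (\<lambda>i. \<pi> powi (e i)) [0..<n]"
    by (auto simp: diag_mat_def dg_def)
  also have "prod_list \<dots> = (\<Prod>i<n. \<pi> powi (e i))"
    by (simp add: prod.distinct_set_conv_list[symmetric] atLeast0LessThan)
  finally show ?thesis .
qed

lemma v_det_dg: "v (det (dg n e)) = (\<Sum>i<n. e i)"
  by (simp add: det_dg v_prod)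

text \<open>This is how "block diagonal along the level sets of \<open>e\<close>" is encoded for all
  slope decompositions: commuting with \<pi>^e is stable under products and automorphisms and needs
  no bookkeeping of block sizes.\<close>

lemma mat_commute_dg_iff:
  assumes "A \<in> carrier_mat n n"
  shows "A * dg n e = dg n e * A \<longleftrightarrow> (\<forall>i<n. \<forall>j<n. e i \<noteq> e j \<longrightarrow> A $$ (i,j) = 0)" (is "?l = ?r")
proof -
  have "?l \<longleftrightarrow> (\<forall>i<n. \<forall>j<n. (A * dg n e) $$ (i,j) = (dg n e * A) $$ (i,j))"
    using assms by (auto simp: mat_eq_iff simp del: index_mult_mat(1))
  also have "\<dots> \<longleftrightarrow> (\<forall>i<n. \<forall>j<n. A $$ (i,j) * (\<pi> powi (e j) - \<pi> powi (e i)) = 0)"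
    using assms by (auto simp: mult_dg_index dg_mult_index algebra_simps simp del: index_mult_mat(1))
  also have "\<dots> \<longleftrightarrow> ?r" by (simp only: mult_eq_0_iff right_minus_eq powi_pi_eq_iff) metis
  finally show ?thesis .
qed

section \<open>The general linear group over the ring of integers\<close>

lemma GLO_carrier: "GLO n A \<Longrightarrow> A \<in> carrier_mat n n" by (simp add: GLO_def)
lemma GLO_mge: "GLO n A \<Longrightarrow> mge 0 A" by (simp add: GLO_def)

lemma GLO_invertible: "GLO n A \<Longrightarrow> invertible_mat A"
  unfolding GLO_def by (auto intro: invertible_matI)

lemma GLO_I: "A \<in> carrier_mat n n \<Longrightarrow> B \<in> carrier_mat n n \<Longrightarrow> mge 0 A \<Longrightarrow> mge 0 B \<Longrightarrow> A * B = 1\<^sub>m n \<Longrightarrow> GLO n A"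
  unfolding GLO_def using mat_mult_left_right_inverse[of A n B] by auto

lemma GLO_obtain:
  assumes "GLO n A"
  obtains B where "GLO n B" "A * B = 1\<^sub>m n" "B * A = 1\<^sub>m n"
proof -
  from assms obtain B where "A \<in> carrier_mat n n" "mge 0 A" "B \<in> carrier_mat n n" "mge 0 B"
    "A * B = 1\<^sub>m n" "B * A = 1\<^sub>m n" unfolding GLO_def by auto
  then show ?thesis by (intro that[of B]) (auto simp: GLO_def)
qed

lemma GLO_one [simp]: "GLO n (1\<^sub>m n)"
  by (rule GLO_I[of _ n "1\<^sub>m n"]) auto

lemma GLO_mult:
  assumes "GLO n A" "GLO n B"
  shows "GLO n (A * B)"
proof -
  obtain A' B' where *: "GLO n A'" "A * A' = 1\<^sub>m n" "GLO n B'" "B * B' = 1\<^sub>m n"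
    using GLO_obtain assms by metis
  note c = assms[THEN GLO_carrier] *(1,3)[THEN GLO_carrier]
  have "(A * B) * (B' * A') = A * (B * B') * A'"
    using c by (simp add: assoc_mult_mat[of _ n n _ n _ n])
  then show ?thesis using c * assms[THEN GLO_mge] *(1,3)[THEN GLO_mge]
    by (intro GLO_I[of _ n "B' * A'"]) (auto intro!: mge_mult0(1)[of _ _ _ n n n])
qed

lemma vge_det:
  assumes "A \<in> carrier_mat n n" "mge 0 A" shows "vge 0 (det A)"
  unfolding det_def'[OF assms(1)]
proof (rule vge_sum)
  fix p assume p: "p \<in> {p. p permutes {0..<n}}"
  have "vge 0 (signof p)" by (simp add: sign_def vge_def)
  then show "vge 0 (signof p * (\<Prod>i = 0..<n. A $$ (i, p i)))"
    using assms p by (intro vge_mult0 vge_prod0) (auto simp: mge_def permutes_in_image)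
qed

lemma GLO_det:
  assumes "GLO n A" shows "det A \<noteq> 0 \<and> v (det A) = 0"
proof -
  obtain B where B: "GLO n B" "A * B = 1\<^sub>m n" using GLO_obtain assms by metis
  note c = assms[THEN GLO_carrier] B(1)[THEN GLO_carrier]
  have d: "det A * det B = 1" using arg_cong[OF B(2), of det] det_mult[OF c] by simp
  then have nz: "det A \<noteq> 0" by auto
  have "det B \<noteq> 0" using d by auto
  then have "v (det A) = 0"
    using v_mult[OF nz, of "det B"] d vge_det[OF c(1) GLO_mge[OF assms]] vge_det[OF c(2) GLO_mge[OF B(1)]] nz
    by (auto simp: vge_def)
  with nz show ?thesis by simp
qed

text \<open>Cramer's rule: the adjugate of an integral matrix is integral, and it is divided by a
  unit.\<close>

lemma GLO_det_I:
  assumes A: "A \<in> carrier_mat n n" "mge 0 A" "det A \<noteq> 0" "v (det A) = 0"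
  shows "GLO n A"
proof -
  note adj = adj_mat[OF A(1)]
  let ?B = "inverse (det A) \<cdot>\<^sub>m adj_mat A"
  have md: "mge 0 (mat_delete A j i)" if "i < n" "j < n" for i j
    using A(2,1) that unfolding mat_delete_def mge_def by auto
  have "vge 0 (cofactor A j i)" if "i < n" "j < n" for i j
    unfolding cofactor_def using that md[OF that] A(1)
    by (intro vge_mult0 vge_det[of _ "n-1"]) (auto simp: vge_def v_pow mat_delete_carrier[of _ n n])
  then have "mge 0 (adj_mat A)" using A(1) unfolding adj_mat_def mge_def by auto
  then have "mge 0 ?B" using mge_smult[of 0 "adj_mat A" 0 "inverse (det A)"] A
    by (simp add: vge_def v_inverse)
  moreover have "A * ?B = 1\<^sub>m n"
    using A by (simp add: mult_smult_distrib[OF A(1) adj(1)] adj(2)) (auto intro!: eq_matI)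
  ultimately show ?thesis using A adj(1) by (intro GLO_I[of _ n ?B]) auto
qed

lemma GLO_invertible_mat:
  assumes "GLO n A" "A \<in> carrier_mat n n" "B \<in> carrier_mat n n" "A * B = 1\<^sub>m n"
  shows "GLO n B"
proof -
  obtain C where C: "GLO n C" "C * A = 1\<^sub>m n" using GLO_obtain assms by metis
  have "C * (A * B) = B" using assms(1-3) C GLO_carrier[OF C(1)]
    by (simp add: assoc_mult_mat[symmetric, of _ n n _ n _ n])
  then show ?thesis using C assms GLO_carrier[OF C(1)] by simp
qed

section \<open>Valuation-preserving automorphisms fixing the uniformizer\<close>

lemma aut_hom: "aut \<tau> \<Longrightarrow> comm_ring_hom \<tau>"
  by unfold_locales (auto simp: aut_def, metis add_cancel_right_left)

lemma aut_simps:
  assumes "aut \<tau>"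
  shows "\<tau> 0 = 0" "\<tau> 1 = 1" "\<tau> (x + y) = \<tau> x + \<tau> y" "\<tau> (x * y) = \<tau> x * \<tau> y" "\<tau> \<pi> = \<pi>"
    "\<tau> (- x) = - \<tau> x" "\<tau> (x - y) = \<tau> x - \<tau> y" "\<tau> x = 0 \<longleftrightarrow> x = 0"
proof -
  interpret comm_ring_hom \<tau> using assms by (rule aut_hom)
  show "\<tau> 0 = 0" "\<tau> 1 = 1" "\<tau> (x + y) = \<tau> x + \<tau> y" "\<tau> (x * y) = \<tau> x * \<tau> y" "\<tau> \<pi> = \<pi>"
    "\<tau> (- x) = - \<tau> x" "\<tau> (x - y) = \<tau> x - \<tau> y" using assms by (auto simp: hom_distribs aut_def)
  have "inj \<tau>" using assms by (simp add: aut_def bij_is_inj)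
  then show "\<tau> x = 0 \<longleftrightarrow> x = 0" using hom_zero injD[of \<tau> x 0] by auto
qed

lemma aut_v:
  assumes "aut \<tau>" shows "v (\<tau> x) = v x"
  using assms aut_simps(1)[OF assms] by (cases "x = 0") (simp_all add: aut_def)

lemma aut_vge:
  assumes "aut \<tau>" shows "vge N (\<tau> x) = vge N x"
  by (simp add: vge_def aut_v[OF assms] aut_simps(8)[OF assms])

lemma aut_inverse:
  assumes "aut \<tau>" shows "\<tau> (inverse x) = inverse (\<tau> x)"
proof (cases "x = 0")
  case False
  have "\<tau> x * \<tau> (inverse x) = 1"
    using False aut_simps(4)[OF assms, of x "inverse x"] aut_simps(2)[OF assms] by simp
  then show ?thesis by (metis inverse_unique)
qed (simp add: aut_simps(1)[OF assms])

lemma aut_power: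
  assumes "aut \<tau>" shows "\<tau> (x ^ k) = \<tau> x ^ k"
  by (induction k) (simp_all add: aut_simps(2,4)[OF assms])

lemma aut_powi:
  assumes "aut \<tau>" shows "\<tau> (\<pi> powi k) = \<pi> powi k"
  by (simp add: power_int_def aut_power[OF assms] aut_inverse[OF assms] aut_simps(5)[OF assms])

lemma aut_sum:
  assumes "aut \<tau>" shows "\<tau> (sum g A) = (\<Sum>i\<in>A. \<tau> (g i))"
  by (induction A rule: infinite_finite_induct) (simp_all add: aut_simps(1,3)[OF assms])

lemma aut_id [simp]: "aut id" by (simp add: aut_def)

lemma aut_comp:
  assumes "aut \<tau>" "aut \<tau>'" shows "aut (\<tau> \<circ> \<tau>')"
  unfolding aut_def
  by (intro conjI bij_comp) (use assms in \<open>simp_all add: aut_def aut_simps(8)[OF assms(2)]\<close>)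

lemma aut_funpow [simp]: "aut \<tau> \<Longrightarrow> aut (\<tau> ^^ k)"
  by (induction k) (simp_all add: aut_comp)

lemma aut_inv_into: "aut \<tau> \<Longrightarrow> aut (inv_into UNIV \<tau>)"
proof -
  assume a: "aut \<tau>"
  then have b: "bij \<tau>" by (simp add: aut_def)
  have e: "inv_into UNIV \<tau> x = y \<longleftrightarrow> x = \<tau> y" for x y using b by (metis bij_inv_eq_iff)
  have s: "\<tau> (inv_into UNIV \<tau> x) = x" for x using b by (simp add: bij_is_surj surj_f_inv_f)
  show "aut (inv_into UNIV \<tau>)"
    unfolding aut_def
  proof (intro conjI allI impI)
    show "bij (inv_into UNIV \<tau>)" using b by (rule bij_imp_bij_inv)
    show "v (inv_into UNIV \<tau> x) = v x" for x using aut_v[OF a, of "inv_into UNIV \<tau> x"] by (simp add: s)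
  qed (simp_all only: e s aut_simps[OF a])
qed

lemma aut_inv_simps: "aut \<tau> \<Longrightarrow> \<tau> (inv_into UNIV \<tau> x) = x" "aut \<tau> \<Longrightarrow> inv_into UNIV \<tau> (\<tau> x) = x"
  by (simp_all add: aut_def bij_is_surj surj_f_inv_f bij_is_inj)

lemma map_mat_mult:
  "aut \<tau> \<Longrightarrow> A \<in> carrier_mat a b \<Longrightarrow> B \<in> carrier_mat b c \<Longrightarrow>
    map_mat \<tau> (A * B) = map_mat \<tau> A * map_mat \<tau> B"
proof -
  assume "aut \<tau>" and c: "A \<in> carrier_mat a b" "B \<in> carrier_mat b c"
  then interpret comm_ring_hom \<tau> by (simp add: aut_hom)
  show ?thesis using mat_hom_mult[OF c] .
qed

lemma map_mat_one [simp]: "aut \<tau> \<Longrightarrow> map_mat \<tau> (1\<^sub>m n) = 1\<^sub>m n"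
  by (intro eq_matI) (auto simp: aut_simps(1,2)[of \<tau>])

lemma map_mat_zero: "aut \<tau> \<Longrightarrow> map_mat \<tau> (0\<^sub>m a b) = 0\<^sub>m a b"
  by (intro eq_matI) (auto simp: aut_simps(1)[of \<tau>])

lemma map_mat_dg [simp]: "aut \<tau> \<Longrightarrow> map_mat \<tau> (dg n e) = dg n e"
  by (intro eq_matI) (auto simp: aut_simps(1)[of \<tau>] aut_powi[of \<tau>] dg_def)

lemma map_mat_det: "aut \<tau> \<Longrightarrow> det (map_mat \<tau> A) = \<tau> (det A)"
proof -
  assume "aut \<tau>"
  then interpret comm_ring_hom \<tau> by (simp add: aut_hom)
  show ?thesis by simp
qed

lemma map_mat_invertible: "aut \<tau> \<Longrightarrow> A \<in> carrier_mat n n \<Longrightarrow> invertible_mat A \<Longrightarrow> invertible_mat (map_mat \<tau> A)"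
  by (simp add: invertible_mat_iff_det[of _ n] map_mat_det aut_simps(8)[of \<tau>])

lemma map_mat_mge [simp]: "aut \<tau> \<Longrightarrow> mge N (map_mat \<tau> A) = mge N A"
  by (auto simp: mge_def aut_vge[of \<tau>])

lemma map_mat_GLO: "aut \<tau> \<Longrightarrow> GLO n A \<Longrightarrow> GLO n (map_mat \<tau> A)"
proof -
  assume a: "aut \<tau>" and "GLO n A"
  then obtain B where B: "GLO n B" "A * B = 1\<^sub>m n" using GLO_obtain by metis
  note c = GLO_carrier[OF \<open>GLO n A\<close>] GLO_carrier[OF B(1)]
  show ?thesis using map_mat_mult[OF a c] a B c GLO_mge[OF \<open>GLO n A\<close>] GLO_mge[OF B(1)]
    by (intro GLO_I[of _ n "map_mat \<tau> B"]) auto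
qed

lemma map_mat_comp: "map_mat \<tau> (map_mat \<tau>' A) = map_mat (\<tau> \<circ> \<tau>') A"
  by (intro eq_matI) auto

lemma map_mat_id [simp]: "map_mat id A = A" "map_mat (\<lambda>x. x) A = A"
  by (intro eq_matI; auto)+

end

section \<open>Cyclic vectors\<close>

definition ip :: "nat \<Rightarrow> (nat \<Rightarrow> 'a::field) \<Rightarrow> (nat \<Rightarrow> 'a) \<Rightarrow> 'a" where
  "ip n z y = (\<Sum>k<n. z k * y k)"

definition indep :: "nat \<Rightarrow> nat \<Rightarrow> (nat \<Rightarrow> nat \<Rightarrow> 'a::field) \<Rightarrow> bool" where
  "indep n d y \<longleftrightarrow> (\<forall>u. (\<forall>k<n. (\<Sum>j<d. u j * y j k) = 0) \<longrightarrow> (\<forall>j<d. u j = 0))"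

lemma indepD: "indep n d y \<Longrightarrow> (\<And>k. k < n \<Longrightarrow> (\<Sum>j<d. u j * y j k) = 0) \<Longrightarrow> j < d \<Longrightarrow> u j = 0"
  unfolding indep_def by blast

lemma ip_add: "ip n z (\<lambda>k. x k + y k) = ip n z x + ip n z y"
  by (simp add: ip_def algebra_simps sum.distrib)

lemma ip_smult: "ip n z (\<lambda>k. c * x k) = c * ip n z x"
  by (simp add: ip_def sum_distrib_left algebra_simps)

lemma ip_sum: "ip n z (\<lambda>k. \<Sum>j\<in>A. u j * y j k) = (\<Sum>j\<in>A. u j * ip n z (y j))"
  unfolding ip_def sum_distrib_left sum_distrib_right
  by (subst sum.swap) (simp add: algebra_simps)

lemma ip_sum_left: "ip n (\<lambda>k. \<Sum>j\<in>A. u j * y j k) z = (\<Sum>j\<in>A. u j * ip n (y j) z)"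
  unfolding ip_def sum_distrib_left sum_distrib_right
  by (subst sum.swap) (simp add: algebra_simps)

lemma ip_diff_left: "ip n (\<lambda>k. x k - y k) z = ip n x z - ip n y z"
  by (simp add: ip_def algebra_simps sum_subtractf)

lemma ip_smult_left: "ip n (\<lambda>k. c * x k) z = c * ip n x z"
  by (simp add: ip_def sum_distrib_left algebra_simps)

lemma ip_cong: "(\<And>k. k < n \<Longrightarrow> y k = y' k) \<Longrightarrow> ip n z y = ip n z y'"
  by (simp add: ip_def)

lemma ip_unit_left: "k0 < n \<Longrightarrow> ip n (\<lambda>k. if k = k0 then 1 else 0) y = y k0"
proof -
  assume "k0 < n"
  have "(\<Sum>k<n. (if k = k0 then 1 else 0) * y k) = (\<Sum>k<n. if k = k0 then y k else 0)"
    by (rule sum.cong) auto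
  with \<open>k0 < n\<close> show ?thesis by (simp add: ip_def)
qed

lemma indep_mono:
  assumes "indep n d y" "e \<le> d" shows "indep n e y"
  unfolding indep_def
proof (intro allI impI)
  fix u j assume u: "\<forall>k<n. (\<Sum>j<e. u j * y j k) = 0" and j: "j < e"
  have "(\<Sum>j<d. (if j < e then u j else 0) * y j k) = (\<Sum>j<e. u j * y j k)" for k
    by (rule sum.mono_neutral_cong_right) (use assms in auto)
  then show "u j = 0" using indepD[OF assms(1), of "\<lambda>j. if j < e then u j else 0" j] u j assms(2) by auto
qed

text \<open>Dual functionals, built one vector at a time. A coordinate \<open>k0\<close> in which
  \<open>y d\<close> differs from its projection to the earlier vectors yields, after correction and
  scaling, a functional that kills those vectors and is 1 on \<open>y d\<close>; the earlier
  functionals are then corrected by multiples of it.\<close>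

lemma indep_left_inverse:
  fixes y :: "nat \<Rightarrow> nat \<Rightarrow> 'a::field"
  assumes "indep n d y"
  shows "\<exists>z. \<forall>i<d. \<forall>j<d. ip n (z i) (y j) = (if i = j then 1 else 0)"
  using assms
proof (induction d)
  case (Suc d)
  then obtain z where z: "\<And>i j. i < d \<Longrightarrow> j < d \<Longrightarrow> ip n (z i) (y j) = (if i = j then 1 else 0)"
    using indep_mono[of n "Suc d" y d] by auto
  define t where "t i = ip n (z i) (y d)" for i
  define r where "r k = y d k - (\<Sum>i<d. t i * y i k)" for k
  have "\<exists>k0<n. r k0 \<noteq> 0"
  proof (rule ccontr)
    assume "\<not> ?thesis"
    then have "(\<Sum>j<Suc d. (if j = d then - 1 else t j) * y j k) = 0" if "k < n" for k
      using that by (auto simp: r_def)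
    from indepD[OF Suc.prems this, of d] show False by simp
  qed
  then obtain k0 where k0: "k0 < n" "r k0 \<noteq> 0" by blast
  define l where "l k = inverse (r k0) * ((if k = k0 then 1 else 0) - (\<Sum>i<d. y i k0 * z i k))" for k
  have l: "ip n l x = inverse (r k0) * (x k0 - (\<Sum>i<d. y i k0 * ip n (z i) x))" for x
    unfolding l_def ip_smult_left ip_diff_left ip_sum_left ip_unit_left[OF k0(1)] ..
  have lj: "ip n l (y j) = 0" if "j < d" for j
  proof -
    have "(\<Sum>i<d. y i k0 * ip n (z i) (y j)) = (\<Sum>i<d. y i k0 * (if i = j then 1 else 0))"
      by (rule sum.cong) (use z that in auto)
    then show ?thesis using that by (simp add: l)
  qed
  have ld: "ip n l (y d) = 1"
    using k0 by (simp add: l t_def[symmetric]) (simp add: r_def mult.commute)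
  show ?case
  proof (intro exI allI impI)
    fix i j assume "i < Suc d" "j < Suc d"
    then show "ip n (if i = d then l else (\<lambda>k. z i k - t i * l k)) (y j) = (if i = j then 1 else 0)"
      by (auto simp: less_Suc_eq ip_diff_left ip_smult_left lj ld z t_def)
  qed
qed simp

text \<open>Besides the bound \<open>d \<le> n\<close>, this bounds the length of a chain of
  iterates inside one slope component, where all iterates are supported on one level set of the
  slopes.\<close>

lemma indep_dim:
  fixes y :: "nat \<Rightarrow> nat \<Rightarrow> 'a::field"
  assumes ind: "indep n d y" and J: "finite J" and supp: "\<And>j k. j < d \<Longrightarrow> k < n \<Longrightarrow> k \<notin> J \<Longrightarrow> y j k = 0"
  shows "d \<le> card J"
proof (rule ccontr)
  assume "\<not> ?thesis"
  then have lt: "card J < d" by simp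
  obtain g where g: "bij_betw g {0..<card J} J" using ex_bij_betw_nat_finite[OF J] by blast
  \<comment> \<open>The rows from \<open>card J\<close> on are zero, which makes the square matrix
    singular; a kernel vector is a relation among the \<open>y j\<close>.\<close>
  define A where "A = mat d d (\<lambda>(i,j). if i < card J then y j (g i) else 0)"
  have A: "A \<in> carrier_mat d d" by (simp add: A_def)
  have "\<not> invertible_mat A"
  proof
    assume "invertible_mat A"
    then obtain B where B: "B \<in> carrier_mat d d" "A * B = 1\<^sub>m d" using invertible_mat_obtain A by metis
    have "(A * B) $$ (card J, card J) = 0"
      by (subst mult_mat_index[OF A B(1)]) (use lt in \<open>auto simp: A_def\<close>)
    then show False using B(2) lt by simp
  qed
  then have "det A = 0" using invertible_mat_iff_det[OF A] by blast
  then obtain u where u: "u \<in> carrier_vec d" "u \<noteq> 0\<^sub>v d" "A *\<^sub>v u = 0\<^sub>v d"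
    using det_0_iff_vec_prod_zero_field[OF A] by blast
  have "(\<Sum>j<d. u $ j * y j k) = 0" if k: "k < n" for k
  proof (cases "k \<in> J")
    case True
    then obtain i where i: "i < card J" "g i = k" using g unfolding bij_betw_def
      by (metis imageE atLeastLessThan_iff)
    have "0 = (A *\<^sub>v u) $ i" using u(3) i lt by simp
    also have "\<dots> = (\<Sum>j<d. y j k * u $ j)"
      using i lt by (subst mult_mat_vec_index[OF A u(1)]) (auto simp: A_def intro!: sum.cong)
    finally show ?thesis by (simp add: mult.commute)
  qed (use supp k in simp)
  from indepD[OF ind this] have "u $ j = 0" if "j < d" for j using that by blast
  then show False using u(1,2) by auto
qed

section \<open>Semilinear maps on vectors and on bases\<close>

definition sl :: "('a \<Rightarrow> 'a) \<Rightarrow> 'a mat \<Rightarrow> 'a::field vec \<Rightarrow> 'a vec" where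
  "sl \<tau> b x = b *\<^sub>v map_vec \<tau> x"

text \<open>\<open>sl\<close> applied to each column: \<open>fr \<tau> b P = P * R\<close> says that
  the semilinear map has the matrix \<open>R\<close> in the basis \<open>P\<close>.\<close>

definition fr :: "('a \<Rightarrow> 'a) \<Rightarrow> 'a mat \<Rightarrow> 'a::field mat \<Rightarrow> 'a mat" where
  "fr \<tau> b X = b * map_mat \<tau> X"

lemma sl_carrier [simp]: "b \<in> carrier_mat n n \<Longrightarrow> sl \<tau> b x \<in> carrier_vec n"
  by (simp add: sl_def mult_mat_vec_def)

lemma sl_pow_carrier [simp]: "b \<in> carrier_mat n n \<Longrightarrow> x \<in> carrier_vec n \<Longrightarrow> (sl \<tau> b ^^ k) x \<in> carrier_vec n"
  by (induction k) auto

lemma fr_carrier [simp]: "b \<in> carrier_mat n n \<Longrightarrow> X \<in> carrier_mat n m \<Longrightarrow> fr \<tau> b X \<in> carrier_mat n m"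
  by (auto simp: fr_def)

lemma fr_pow_carrier [simp]: "b \<in> carrier_mat n n \<Longrightarrow> X \<in> carrier_mat n m \<Longrightarrow> (fr \<tau> b ^^ k) X \<in> carrier_mat n m"
  by (induction k) auto

lemma col_fr: "b \<in> carrier_mat n n \<Longrightarrow> X \<in> carrier_mat n m \<Longrightarrow> j < m \<Longrightarrow> col (fr \<tau> b X) j = sl \<tau> b (col X j)"
  by (intro eq_vecI) (auto simp: fr_def sl_def)

lemma col_fr_pow:
  assumes "b \<in> carrier_mat n n" "X \<in> carrier_mat n m" "j < m"
  shows "col ((fr \<tau> b ^^ k) X) j = (sl \<tau> b ^^ k) (col X j)"
  using assms by (induction k) (auto simp: col_fr[of _ n _ m])

context dvf
begin

text \<open>Infinite order of \<tau>, the condition under which its powers are linearly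
  independent.\<close>

definition aperiodic :: "('a \<Rightarrow> 'a) \<Rightarrow> bool" where
  "aperiodic \<tau> \<longleftrightarrow> (\<forall>m\<ge>1. \<exists>x. (\<tau> ^^ m) x \<noteq> x)"

lemma aperiodic_distinct:
  assumes "aut \<tau>" "aperiodic \<tau>" "i \<noteq> j"
  shows "\<exists>x. (\<tau> ^^ i) x \<noteq> (\<tau> ^^ j) x"
proof -
  have *: "\<exists>x. (\<tau> ^^ i) x \<noteq> (\<tau> ^^ j) x" if "i < j" for i j
  proof -
    have "1 \<le> j - i" using that by simp
    then obtain x where x: "(\<tau> ^^ (j - i)) x \<noteq> x" using assms(2) unfolding aperiodic_def by blast
    have "inj (\<tau> ^^ i)" using aut_funpow[OF assms(1), of i] by (simp add: aut_def bij_is_inj)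
    moreover have "\<tau> ^^ j = (\<tau> ^^ i) \<circ> (\<tau> ^^ (j - i))" using that by (simp flip: funpow_add)
    ultimately show ?thesis using x by (metis comp_apply injD)
  qed
  show ?thesis using *[of i j] *[of j i] assms(3) by (metis linorder_neqE_nat)
qed

text \<open>Dedekind's independence of characters for the powers of \<tau>. The relation at
  \<open>w * u\<close> minus \<open>(\<tau> ^^ j') w\<close> times the relation at \<open>u\<close>
  loses the term \<open>j'\<close>, while the choice of \<open>w\<close> keeps the term
  \<open>j\<close>.\<close>

lemma dedekind:
  assumes "aut \<tau>" "aperiodic \<tau>" "finite J" "j \<in> J" "a j \<noteq> 0"
  shows "\<exists>u. (\<Sum>i\<in>J. a i * (\<tau> ^^ i) u) \<noteq> 0"
  using assms(3-)
proof (induction "card J" arbitrary: J j a rule: less_induct)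
  case (less J j a)
  show ?case
  proof (rule ccontr)
    assume "\<not> ?thesis"
    then have z: "(\<Sum>i\<in>J. a i * (\<tau> ^^ i) u) = 0" for u by blast
    show False
    proof (cases "\<exists>j'\<in>J. j' \<noteq> j \<and> a j' \<noteq> 0")
      case False
      have "(\<Sum>i\<in>J. a i * (\<tau> ^^ i) 1) = (\<Sum>i\<in>J. if i = j then a j else 0)"
        by (rule sum.cong) (use False aut_simps(2)[OF aut_funpow[OF assms(1)]] in auto)
      then show False using z[of 1] less.prems by simp
    next
      case True
      then obtain j' where j': "j' \<in> J" "j' \<noteq> j" "a j' \<noteq> 0" by blast
      obtain w where w: "(\<tau> ^^ j) w \<noteq> (\<tau> ^^ j') w"
        using aperiodic_distinct[OF assms(1,2)] j'(2) by metis
      define a' where "a' i = a i * ((\<tau> ^^ i) w - (\<tau> ^^ j') w)" for i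
      have "\<exists>u. (\<Sum>i\<in>J - {j'}. a' i * (\<tau> ^^ i) u) \<noteq> 0"
      proof (rule less.hyps)
        show "card (J - {j'}) < card J" using less.prems(1) j'(1) by (rule card_Diff1_less)
      qed (use less.prems j' w in \<open>auto simp: a'_def\<close>)
      moreover have "(\<Sum>i\<in>J - {j'}. a' i * (\<tau> ^^ i) u) = 0" for u
      proof -
        have "(\<Sum>i\<in>J - {j'}. a' i * (\<tau> ^^ i) u) = (\<Sum>i\<in>J. a' i * (\<tau> ^^ i) u)"
          by (rule sum.mono_neutral_left) (use less.prems(1) in \<open>auto simp: a'_def\<close>)
        also have "\<dots> = (\<Sum>i\<in>J. a i * (\<tau> ^^ i) (w * u)) - (\<tau> ^^ j') w * (\<Sum>i\<in>J. a i * (\<tau> ^^ i) u)"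
          by (simp add: a'_def aut_simps(4)[OF aut_funpow[OF assms(1)]] sum_distrib_left
              sum_subtractf algebra_simps)
        finally show ?thesis by (simp add: z)
      qed
      ultimately show False by blast
    qed
  qed
qed

lemma sl_add:
  assumes "aut \<tau>" "b \<in> carrier_mat n n" "x \<in> carrier_vec n" "y \<in> carrier_vec n"
  shows "sl \<tau> b (x + y) = sl \<tau> b x + sl \<tau> b y"
proof -
  have "map_vec \<tau> (x + y) = map_vec \<tau> x + map_vec \<tau> y"
    using assms by (intro eq_vecI) (auto simp: aut_simps(3)[OF assms(1)])
  then show ?thesis using assms by (simp add: sl_def mult_add_distrib_mat_vec[of _ n n])
qed

lemma sl_smult:
  assumes "aut \<tau>" "b \<in> carrier_mat n n" "x \<in> carrier_vec n"
  shows "sl \<tau> b (c \<cdot>\<^sub>v x) = \<tau> c \<cdot>\<^sub>v sl \<tau> b x"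
proof -
  have "map_vec \<tau> (c \<cdot>\<^sub>v x) = \<tau> c \<cdot>\<^sub>v map_vec \<tau> x"
    using assms by (intro eq_vecI) (auto simp: aut_simps(4)[OF assms(1)])
  then show ?thesis using assms by (simp add: sl_def mult_mat_vec[of _ n n])
qed

lemma sl_pow_add:
  assumes "aut \<tau>" "b \<in> carrier_mat n n" "x \<in> carrier_vec n" "y \<in> carrier_vec n"
  shows "(sl \<tau> b ^^ k) (x + y) = (sl \<tau> b ^^ k) x + (sl \<tau> b ^^ k) y"
  by (induction k) (use assms in \<open>auto simp: sl_add[of _ _ n]\<close>)

lemma sl_pow_smult:
  assumes "aut \<tau>" "b \<in> carrier_mat n n" "x \<in> carrier_vec n"
  shows "(sl \<tau> b ^^ k) (c \<cdot>\<^sub>v x) = (\<tau> ^^ k) c \<cdot>\<^sub>v (sl \<tau> b ^^ k) x"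
  by (induction k) (use assms in \<open>auto simp: sl_smult[of _ _ n]\<close>)

lemma sl_surj:
  assumes "aut \<tau>" "b \<in> carrier_mat n n" "invertible_mat b" "y \<in> carrier_vec n"
  shows "\<exists>x\<in>carrier_vec n. sl \<tau> b x = y"
proof -
  obtain c where c: "c \<in> carrier_mat n n" "b * c = 1\<^sub>m n" using assms invertible_mat_obtain by metis
  let ?x = "map_vec (inv_into UNIV \<tau>) (c *\<^sub>v y)"
  have "map_vec \<tau> ?x = c *\<^sub>v y" using aut_inv_simps(1)[OF assms(1)] by (intro eq_vecI) auto
  then have "sl \<tau> b ?x = (b * c) *\<^sub>v y" using assms c(1)
    by (simp add: sl_def assoc_mult_mat_vec[of _ n n _ n])
  then show ?thesis using c assms by (intro bexI[of _ ?x]) auto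
qed

lemma sl_pow_surj:
  assumes "aut \<tau>" "b \<in> carrier_mat n n" "invertible_mat b" "y \<in> carrier_vec n"
  shows "\<exists>x\<in>carrier_vec n. (sl \<tau> b ^^ k) x = y"
  using assms(4)
proof (induction k arbitrary: y)
  case (Suc k)
  obtain z where "z \<in> carrier_vec n" "sl \<tau> b z = y" using sl_surj[OF assms(1-3) Suc.prems] by blast
  then show ?case using Suc.IH[of z] by auto
qed auto

text \<open>Take \<open>x\<close> with the largest number \<open>d\<close> of independent iterates.
  If \<open>d < n\<close>, replacing \<open>x\<close> by \<open>x + s t y\<close> with suitable
  \<open>t\<close>, \<open>y\<close> and a scalar \<open>s\<close> fixed by \<tau> gives
  \<open>d + 1\<close> independent iterates: the relevant determinant is a polynomial in
  \<open>s\<close>, and Dedekind's independence makes its constant term nonzero.\<close>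

lemma cyclic_vector_exists:
  assumes a: "aut \<tau>" "aperiodic \<tau>" and b: "b \<in> carrier_mat n n" "invertible_mat b"
  shows "\<exists>x\<in>carrier_vec n. indep n n (\<lambda>j k. ((sl \<tau> b ^^ j) x) $ k)"
proof -
  let ?\<Phi> = "\<lambda>j. sl \<tau> b ^^ j"
  let ?K = "\<lambda>x j k. (?\<Phi> j x) $ k"
  let ?S = "{d. \<exists>x\<in>carrier_vec n. indep n d (?K x)}"
  have bd: "d \<le> n" if "indep n d y" for d and y :: "nat \<Rightarrow> nat \<Rightarrow> 'a"
    using indep_dim[OF that, of "{..<n}"] by simp
  have S: "finite ?S" "0 \<in> ?S"
  proof -
    show "finite ?S" by (rule finite_subset[of _ "{..n}"]) (use bd in auto)
    show "0 \<in> ?S" by (auto simp: indep_def intro!: exI[of _ "0\<^sub>v n"])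
  qed
  define d where "d = Max ?S"
  have "d \<in> ?S" using Max_in[OF S(1)] S(2) unfolding d_def by blast
  then obtain x where x: "x \<in> carrier_vec n" "indep n d (?K x)" by blast
  have max: "\<not> indep n (Suc d) (?K x')" if "x' \<in> carrier_vec n" for x'
    using Max_ge[OF S(1), of "Suc d"] that unfolding d_def[symmetric] by auto
  have "d = n"
  proof (rule ccontr)
    assume "d \<noteq> n"
    then have dn: "d < n" using bd[OF x(2)] by simp
    obtain z where z: "\<And>i j. i < d \<Longrightarrow> j < d \<Longrightarrow> ip n (z i) (?K x j) = (if i = j then 1 else 0)"
      using indep_left_inverse[OF x(2)] by blast
    obtain u j0 where u: "\<And>k. k < n \<Longrightarrow> (\<Sum>j<Suc d. u j * ?K x j k) = 0" "j0 < Suc d" "u j0 \<noteq> 0"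
      using max[OF x(1)] unfolding indep_def by blast
    have ud: "u d \<noteq> 0"
    proof
      assume "u d = 0"
      then have "\<And>k. k < n \<Longrightarrow> (\<Sum>j<d. u j * ?K x j k) = 0" using u(1) by simp
      from indepD[OF x(2) this] u(2,3) \<open>u d = 0\<close> show False by (metis less_Suc_eq)
    qed
    define c where "c j = - u j / u d" for j
    have Kd: "?K x d k = (\<Sum>j<d. c j * ?K x j k)" if "k < n" for k
    proof -
      have "u d * ?K x d k = - (\<Sum>j<d. u j * ?K x j k)" using u(1)[OF that] by (simp add: add_eq_0_iff)
      then have "?K x d k = - (\<Sum>j<d. u j * ?K x j k) / u d" using ud by (simp add: field_simps)
      also have "\<dots> = (\<Sum>j<d. c j * ?K x j k)" by (simp add: c_def sum_divide_distrib sum_negf)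
      finally show ?thesis .
    qed
    \<comment> \<open>Otherwise the projection onto the span of the first \<open>d\<close> iterates
      would be the identity, and the \<open>z i\<close>, read by columns, would give
      \<open>n\<close> independent vectors of length \<open>d < n\<close>.\<close>
    have "\<exists>m<n. \<exists>k0<n. (if m = k0 then 1 else 0) \<noteq> (\<Sum>i<d. ?K x i k0 * z i m)"
    proof (rule ccontr)
      assume "\<not> ?thesis"
      then have e: "(\<Sum>i<d. ?K x i k * z i m) = (if m = k then 1 else 0)" if "m < n" "k < n" for m k
        using that by metis
      have "indep d n (\<lambda>m i. z i m)" unfolding indep_def
      proof (intro allI impI)
        fix w k assume w: "\<forall>i<d. (\<Sum>m<n. w m * z i m) = 0" and k: "k < n"
        have "w k = (\<Sum>m<n. w m * (if m = k then 1 else 0))" using k by simp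
        also have "\<dots> = (\<Sum>m<n. w m * (\<Sum>i<d. ?K x i k * z i m))"
          by (rule sum.cong) (use k e in simp_all)
        also have "\<dots> = (\<Sum>i<d. ?K x i k * (\<Sum>m<n. w m * z i m))"
          unfolding sum_distrib_left by (subst sum.swap) (simp add: algebra_simps)
        finally show "w k = 0" using w by simp
      qed
      from indep_dim[OF this, of "{..<d}"] dn show False by simp
    qed
    then obtain m k0 where mk: "m < n" "k0 < n" "(if m = k0 then 1 else 0) \<noteq> (\<Sum>i<d. ?K x i k0 * z i m)"
      by blast
    \<comment> \<open>The \<open>k0\<close>-th coordinate of the complementary projection: it
      vanishes on the iterates of \<open>x\<close> but not on the unit vector
      \<open>m\<close>.\<close>
    define l where "l k = (if k = k0 then 1 else 0) - (\<Sum>i<d. ?K x i k0 * z i k)" for k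
    have l: "ip n l y = y k0 - (\<Sum>i<d. ?K x i k0 * ip n (z i) y)" for y
      unfolding l_def ip_diff_left ip_sum_left ip_unit_left[OF mk(2)] ..
    have lj: "ip n l (?K x j) = 0" if "j < d" for j
    proof -
      have "(\<Sum>i<d. ?K x i k0 * ip n (z i) (?K x j)) = (\<Sum>i<d. ?K x i k0 * (if i = j then 1 else 0))"
        by (rule sum.cong) (use z that in auto)
      then show ?thesis using that by (simp add: l)
    qed
    have zd: "ip n w (?K x d) = (\<Sum>j<d. c j * ip n w (?K x j))" for w
      unfolding ip_sum[symmetric] by (rule ip_cong) (rule Kd)
    have lK: "ip n l (?K x j) = 0" if "j \<le> d" for j
      using lj that by (cases "j = d") (auto simp: zd)
    \<comment> \<open>Surjectivity of \<Phi>^d makes \<open>l\<close> nonzero on the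
      \<open>d\<close>-th iterate of \<open>y\<close>.\<close>
    obtain y where y: "y \<in> carrier_vec n" "?\<Phi> d y = unit_vec n m"
      using sl_pow_surj[OF a(1) b, of "unit_vec n m"] by auto
    define g where "g j = ip n l (?K y j)" for j
    have "g d = (\<Sum>k<n. l k * (if k = m then 1 else 0))"
      unfolding g_def ip_def y(2) by (rule sum.cong) (use mk in \<open>auto simp: unit_vec_def\<close>)
    then have gd: "g d \<noteq> 0" using mk by (auto simp: l_def)
    \<comment> \<open>Subtracting from the column of \<Phi>^d \<open>x\<close> its expression by the
      earlier columns reduces the determinant at \<open>s = 0\<close> to the twisted polynomial with
      coefficients \<open>?a\<close>, evaluated at \<open>t\<close>.\<close>
    let ?a = "\<lambda>j. if j = d then g d else - c j * g j"
    obtain t where t: "(\<Sum>j\<le>d. ?a j * (\<tau> ^^ j) t) \<noteq> 0"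
      using dedekind[OF a, of "{..d}" d ?a] gd by auto
    \<comment> \<open>The iterates of \<open>x + s t y\<close> tested against the \<open>z i\<close>
      and \<open>l\<close>. As \<open>l\<close> kills the iterates of \<open>x\<close>, its row is a
      multiple of \<open>s\<close>; this factor is divided out so that the determinant need not
      vanish at \<open>s = 0\<close>.\<close>
    define A where "A s = mat (Suc d) (Suc d) (\<lambda>(i,j). if i < d then
        ip n (z i) (?K x j) + s * ((\<tau> ^^ j) t * ip n (z i) (?K y j)) else (\<tau> ^^ j) t * g j)" for s
    define Pm where "Pm = mat (Suc d) (Suc d) (\<lambda>(i,j). if i < d then
        [: ip n (z i) (?K x j), (\<tau> ^^ j) t * ip n (z i) (?K y j) :] else [: (\<tau> ^^ j) t * g j :])"
    have A: "A s \<in> carrier_mat (Suc d) (Suc d)" for s by (simp add: A_def)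
    have poly_det: "poly (det Pm) s = det (A s)" for s
    proof -
      interpret comm_ring_hom "\<lambda>p. poly p s" by unfold_locales auto
      have "map_mat (\<lambda>p. poly p s) Pm = A s" by (rule eq_matI) (auto simp: A_def Pm_def)
      then show ?thesis using hom_det[of Pm] by simp
    qed
    have "det (A 0) \<noteq> 0"
    proof
      assume "det (A 0) = 0"
      then obtain w where w: "w \<in> carrier_vec (Suc d)" "w \<noteq> 0\<^sub>v (Suc d)" "A 0 *\<^sub>v w = 0\<^sub>v (Suc d)"
        using det_0_iff_vec_prod_zero_field[OF A] by blast
      have row: "(\<Sum>j<Suc d. A 0 $$ (i,j) * w $ j) = 0" if "i < Suc d" for i
        using mult_mat_vec_index[OF A[of 0] w(1) that] w(3) that by simp
      have wi: "w $ i = - c i * w $ d" if i: "i < d" for i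
      proof -
        have zdi: "ip n (z i) (?K x d) = c i"
        proof -
          have "ip n (z i) (?K x d) = (\<Sum>j<d. c j * (if j = i then 1 else 0))"
            unfolding zd by (rule sum.cong) (use z i in auto)
          then show ?thesis using i by simp
        qed
        have "0 = (\<Sum>j<d. A 0 $$ (i,j) * w $ j) + A 0 $$ (i,d) * w $ d" using row[of i] i by simp
        also have "(\<Sum>j<d. A 0 $$ (i,j) * w $ j) = (\<Sum>j<d. (if i = j then 1 else 0) * w $ j)"
          by (rule sum.cong) (use z i in \<open>auto simp: A_def\<close>)
        finally show ?thesis using i zdi by (simp add: A_def add_eq_0_iff)
      qed
      have "0 = (\<Sum>j<Suc d. ((\<tau> ^^ j) t * g j) * w $ j)" using row[of d] by (simp add: A_def)
      also have "\<dots> = (\<Sum>j<Suc d. w $ d * (?a j * (\<tau> ^^ j) t))"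
        by (rule sum.cong) (auto simp: wi less_Suc_eq)
      also have "\<dots> = w $ d * (\<Sum>j\<le>d. ?a j * (\<tau> ^^ j) t)"
        unfolding sum_distrib_left lessThan_Suc_atMost ..
      finally have "w $ d = 0" using t by simp
      then have "w $ i = 0" if "i < Suc d" for i using wi that by (cases "i = d") auto
      then show False using w(1,2) by auto
    qed
    then have "det Pm \<noteq> 0" using poly_det[of 0] by auto
    then have fin: "finite {s. poly (det Pm) s = 0}" by (rule poly_roots_finite)
    \<comment> \<open>The powers of \<pi> are infinitely many values fixed by \<tau>: one of them
      avoids the finitely many roots, and it passes unchanged through the iterates.\<close>
    have inf: "infinite (range (\<lambda>k::nat. \<pi> ^ k))"
    proof (rule range_inj_infinite, rule injI)
      fix k l :: nat assume "\<pi> ^ k = \<pi> ^ l"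
      from arg_cong[OF this, of v] show "k = l" by (simp add: v_pow)
    qed
    have "\<not> range (\<lambda>k::nat. \<pi> ^ k) \<subseteq> {s. poly (det Pm) s = 0}"
      using finite_subset[OF _ fin] inf by metis
    then obtain k :: nat where k: "poly (det Pm) (\<pi> ^ k) \<noteq> 0" by auto
    let ?s = "\<pi> ^ k"
    define x' where "x' = x + (?s * t) \<cdot>\<^sub>v y"
    have x': "x' \<in> carrier_vec n" using x y by (simp add: x'_def)
    have Kx': "?K x' j k' = ?K x j k' + ?s * (\<tau> ^^ j) t * ?K y j k'" if "k' < n" for j k'
    proof -
      have "(\<tau> ^^ j) ?s = ?s"
        using aut_simps(5)[OF aut_funpow[OF a(1)]] aut_power[OF aut_funpow[OF a(1)]] by metis
      then show ?thesis using x y that b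
        by (simp add: x'_def carrier_vecD[OF sl_pow_carrier[OF b(1) y(1), of j \<tau>]] sl_pow_add[OF a(1) b(1)] sl_pow_smult[OF a(1) b(1)] aut_simps(4)[OF aut_funpow[OF a(1)]])
    qed
    have "indep n (Suc d) (?K x')" unfolding indep_def
    proof (intro allI impI)
      fix w j assume w: "\<forall>k<n. (\<Sum>j<Suc d. w j * ?K x' j k) = 0" and j: "j < Suc d"
      have q0: "(\<Sum>j<Suc d. w j * ip n h (?K x' j)) = 0" for h
        unfolding ip_sum[symmetric] using w by (simp add: ip_def)
      have q: "(\<Sum>j<Suc d. w j * (ip n h (?K x j) + ?s * (\<tau> ^^ j) t * ip n h (?K y j))) = 0" for h
      proof -
        have "ip n h (?K x' j) = ip n h (?K x j) + ?s * (\<tau> ^^ j) t * ip n h (?K y j)" for j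
          unfolding ip_add[symmetric] ip_smult[symmetric] by (rule ip_cong) (rule Kx')
        then show ?thesis using q0[of h] by simp
      qed
      have "A ?s *\<^sub>v vec (Suc d) w = 0\<^sub>v (Suc d)"
      proof (rule eq_vecI)
        fix i assume "i < dim_vec (0\<^sub>v (Suc d) :: 'a vec)"
        then have i: "i < Suc d" by simp
        have "(A ?s *\<^sub>v vec (Suc d) w) $ i = (\<Sum>j<Suc d. A ?s $$ (i,j) * w j)"
          by (subst mult_mat_vec_index[OF A _ i]) auto
        also have "\<dots> = 0"
        proof (cases "i < d")
          case True
          have "(\<Sum>j<Suc d. A ?s $$ (i,j) * w j) =
              (\<Sum>j<Suc d. w j * (ip n (z i) (?K x j) + ?s * (\<tau> ^^ j) t * ip n (z i) (?K y j)))"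
            by (rule sum.cong) (use True i in \<open>auto simp: A_def algebra_simps\<close>)
          then show ?thesis using q[of "z i"] by simp
        next
          case False
          have "(\<Sum>j<Suc d. w j * (?s * (\<tau> ^^ j) t * g j)) = 0"
            using q[of l] lK by (simp add: g_def)
          then have "?s * (\<Sum>j<Suc d. (\<tau> ^^ j) t * g j * w j) = 0"
            unfolding sum_distrib_left by (simp add: algebra_simps)
          then have "(\<Sum>j<Suc d. (\<tau> ^^ j) t * g j * w j) = 0" by simp
          moreover have "(\<Sum>j<Suc d. A ?s $$ (i,j) * w j) = (\<Sum>j<Suc d. (\<tau> ^^ j) t * g j * w j)"
            by (rule sum.cong) (use False i in \<open>auto simp: A_def\<close>)
          ultimately show ?thesis by simp
        qed
        finally show "(A ?s *\<^sub>v vec (Suc d) w) $ i = 0\<^sub>v (Suc d) $ i" using i by simp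
      qed (simp add: A_def)
      then have "vec (Suc d) w = 0\<^sub>v (Suc d)"
        using k det_0_iff_vec_prod_zero_field[OF A, of ?s] poly_det[of ?s] vec_carrier by metis
      then show "w j = 0" using j by (metis index_vec index_zero_vec(1))
    qed
    then show False using max[OF x'] by blast
  qed
  then show ?thesis using x by blast
qed

end

section \<open>Slope bases and the Iwasawa decomposition\<close>

context dvf
begin

lemma fr_mult:
  assumes "aut \<tau>" "b \<in> carrier_mat n n" "X \<in> carrier_mat n m" "C \<in> carrier_mat m l"
  shows "fr \<tau> b (X * C) = fr \<tau> b X * map_mat \<tau> C"
  using assms by (simp add: fr_def map_mat_mult[of \<tau> X n m C l] assoc_mult_mat[of _ n n _ m _ l])

lemma fr_pow_mult:
  assumes "aut \<tau>" "b \<in> carrier_mat n n" "X \<in> carrier_mat n m" "C \<in> carrier_mat m l"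
  shows "(fr \<tau> b ^^ k) (X * C) = (fr \<tau> b ^^ k) X * map_mat (\<tau> ^^ k) C"
  by (induction k) (use assms in \<open>simp_all add: fr_mult[of _ _ n _ m _ l] map_mat_comp comp_def\<close>)

lemma fr_conj:
  assumes "aut \<tau>" "b \<in> carrier_mat n n" "P \<in> carrier_mat n n" "R \<in> carrier_mat n n"
    "fr \<tau> b P = P * R" "X \<in> carrier_mat n m"
  shows "(fr \<tau> b ^^ k) (P * X) = P * (fr \<tau> R ^^ k) X"
proof (induction k)
  case (Suc k)
  have "fr \<tau> b (P * (fr \<tau> R ^^ k) X) = P * R * map_mat \<tau> ((fr \<tau> R ^^ k) X)"
    using assms by (subst fr_mult[of _ _ n _ n _ m]) auto
  also have "\<dots> = P * fr \<tau> R ((fr \<tau> R ^^ k) X)"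
    unfolding fr_def using assms by (subst assoc_mult_mat[of _ n n _ n _ m]) (auto simp: fr_def[symmetric])
  finally show ?case using Suc by simp
qed simp

lemma fr_one: "aut \<tau> \<Longrightarrow> b \<in> carrier_mat n n \<Longrightarrow> fr \<tau> b (1\<^sub>m n) = b"
  by (simp add: fr_def)

lemma fr_pow_eq:
  assumes "aut \<tau>" "b \<in> carrier_mat n n" "X \<in> carrier_mat n m"
  shows "(fr \<tau> b ^^ k) X = (fr \<tau> b ^^ k) (1\<^sub>m n) * map_mat (\<tau> ^^ k) X"
  using fr_pow_mult[OF assms(1,2) one_carrier_mat assms(3), of k] assms(3) by simp

lemma fr_invertible:
  "aut \<tau> \<Longrightarrow> b \<in> carrier_mat n n \<Longrightarrow> invertible_mat b \<Longrightarrow> X \<in> carrier_mat n n \<Longrightarrow> invertible_mat X \<Longrightarrow>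
    invertible_mat (fr \<tau> b X)"
  unfolding fr_def by (intro invertible_mat_mult[of _ n] map_mat_invertible[of _ _ n]) auto

lemma fr_pow_invertible:
  "aut \<tau> \<Longrightarrow> b \<in> carrier_mat n n \<Longrightarrow> invertible_mat b \<Longrightarrow> X \<in> carrier_mat n n \<Longrightarrow> invertible_mat X \<Longrightarrow>
    invertible_mat ((fr \<tau> b ^^ k) X)"
  by (induction k) (auto intro: fr_invertible[of _ _ n])

lemma one_invertible [simp]: "invertible_mat (1\<^sub>m n :: 'b::field mat)"
  by (rule invertible_matI[of _ n "1\<^sub>m n"]) auto

text \<open>The columns of \<open>P\<close> form a basis in which the semilinear map with matrix \<open>b\<close> is block diagonal
  along the level sets of \<open>e\<close>, and on the block of value \<open>e i\<close> it is isoclinic of slope \<open>e i / S\<close>.\<close>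

definition slope_basis :: "('a \<Rightarrow> 'a) \<Rightarrow> 'a mat \<Rightarrow> nat \<Rightarrow> 'a mat \<Rightarrow> nat \<Rightarrow> (nat \<Rightarrow> int) \<Rightarrow> bool" where
  "slope_basis \<tau> b n P S e \<longleftrightarrow> P \<in> carrier_mat n n \<and> invertible_mat P \<and> 0 < S \<and>
     (\<exists>R. R \<in> carrier_mat n n \<and> fr \<tau> b P = P * R \<and> R * dg n e = dg n e * R) \<and>
     (\<exists>K. GLO n K \<and> (fr \<tau> b ^^ S) P = P * (dg n e * K))"

lemma fr_pow_commute_dg:
  assumes "aut \<tau>" "R \<in> carrier_mat n n" "R * dg n e = dg n e * R" "X \<in> carrier_mat n n" "X * dg n e = dg n e * X"
  shows "(fr \<tau> R ^^ k) X * dg n e = dg n e * (fr \<tau> R ^^ k) X"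
proof (induction k)
  case (Suc k)
  let ?Y = "(fr \<tau> R ^^ k) X"
  have Y: "?Y \<in> carrier_mat n n" using assms by auto
  have "R * map_mat \<tau> ?Y * dg n e = R * map_mat \<tau> (?Y * dg n e)"
    using assms Y by (simp add: map_mat_mult[of \<tau> _ n n _ n] assoc_mult_mat[of _ n n _ n _ n])
  also have "\<dots> = R * dg n e * map_mat \<tau> ?Y"
    using assms(1-2) Y by (simp add: Suc map_mat_mult[of \<tau> _ n n _ n] assoc_mult_mat[of _ n n _ n _ n])
  also have "\<dots> = dg n e * (R * map_mat \<tau> ?Y)"
    using assms Y by (simp add: assoc_mult_mat[of _ n n _ n _ n])
  finally show ?case by (simp only: funpow.simps comp_apply fr_def[of \<tau> R ?Y])
qed (use assms in simp)

text \<open>In the basis \<open>P\<close> the iterate \<Phi>^S has the matrix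
  \<open>dg n e * K\<close> and is also a twisted product of copies of \<open>R\<close>; hence it is
  block diagonal, and so is \<open>K\<close>.\<close>

lemma slope_basis_obtain:
  assumes "aut \<tau>" "b \<in> carrier_mat n n" "slope_basis \<tau> b n P S e"
  obtains R K where "P \<in> carrier_mat n n" "invertible_mat P" "0 < S"
    "R \<in> carrier_mat n n" "fr \<tau> b P = P * R" "R * dg n e = dg n e * R"
    "GLO n K" "(fr \<tau> b ^^ S) P = P * (dg n e * K)" "K * dg n e = dg n e * K"
    "(fr \<tau> R ^^ S) (1\<^sub>m n) = dg n e * K"
proof -
  from assms(3) obtain R K where *: "P \<in> carrier_mat n n" "invertible_mat P" "0 < S"
    "R \<in> carrier_mat n n" "fr \<tau> b P = P * R" "R * dg n e = dg n e * R"
    "GLO n K" "(fr \<tau> b ^^ S) P = P * (dg n e * K)" unfolding slope_basis_def by blast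
  have K: "K \<in> carrier_mat n n" using *(7) by (rule GLO_carrier)
  have RS: "(fr \<tau> R ^^ S) (1\<^sub>m n) = dg n e * K"
  proof (rule mult_left_cancel[OF *(2,1)])
    show "P * (fr \<tau> R ^^ S) (1\<^sub>m n) = P * (dg n e * K)"
      using fr_conj[OF assms(1,2) *(1,4,5) one_carrier_mat, of S] *(1,8) by simp
  qed (use * K in auto)
  have "dg n e * (K * dg n e) = dg n e * (dg n e * K)"
    using fr_pow_commute_dg[OF assms(1) *(4,6) one_carrier_mat, of S] K
    by (simp add: RS assoc_mult_mat[of _ n n _ n _ n])
  then have KD: "K * dg n e = dg n e * K"
    by (rule mult_left_cancel[of "dg n e" n _ n, rotated -1]) (use K in auto)
  show ?thesis by (rule that[OF *(1-8) KD RS])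
qed

lemma map_mat_commute_dg:
  assumes "aut \<tau>" "K \<in> carrier_mat n n" "K * dg n e = dg n e * K"
  shows "map_mat \<tau> K * dg n e = dg n e * map_mat \<tau> K"
  using arg_cong[OF assms(3), of "map_mat \<tau>"] assms(1,2) by (simp add: map_mat_mult[of \<tau> _ n n _ n])

text \<open>Enlarging the denominator, needed to compare two slope bases. Block diagonality of
  \<open>K\<close> lets \<pi>^e move past it, and powers of \<tau> preserve both GL_n(O_L) and
  \<pi>^e.\<close>

lemma slope_basis_multiple:
  assumes a: "aut \<tau>" "b \<in> carrier_mat n n" "slope_basis \<tau> b n P S e" and t: "0 < t"
  shows "slope_basis \<tau> b n P (S * t) (\<lambda>i. int t * e i)"
proof -
  from slope_basis_obtain[OF a] obtain R K where s: "P \<in> carrier_mat n n" "invertible_mat P" "0 < S"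
    "R \<in> carrier_mat n n" "fr \<tau> b P = P * R" "R * dg n e = dg n e * R"
    "GLO n K" "(fr \<tau> b ^^ S) P = P * (dg n e * K)" "K * dg n e = dg n e * K" by metis
  note K = GLO_carrier[OF s(7)]
  have "\<exists>Kt. GLO n Kt \<and> Kt * dg n e = dg n e * Kt \<and> (fr \<tau> b ^^ (S * t)) P = P * (dg n (\<lambda>i. int t * e i) * Kt)" for t
  proof (induction t)
    case 0
    show ?case using s(1) by (intro exI[of _ "1\<^sub>m n"]) simp
  next
    case (Suc t)
    then obtain Kt where Kt: "GLO n Kt" "Kt * dg n e = dg n e * Kt"
      "(fr \<tau> b ^^ (S * t)) P = P * (dg n (\<lambda>i. int t * e i) * Kt)" by blast
    note Ktc = GLO_carrier[OF Kt(1)]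
    let ?K' = "map_mat (\<tau> ^^ (S * t)) K" let ?D = "dg n (\<lambda>i. int t * e i)"
    have K': "?K' \<in> carrier_mat n n" "GLO n ?K'" "?K' * dg n e = dg n e * ?K'"
      using K map_mat_GLO[OF aut_funpow[OF a(1)] s(7)] map_mat_commute_dg[OF aut_funpow[OF a(1)] K s(9)] by auto
    have "(fr \<tau> b ^^ (S * Suc t)) P = (fr \<tau> b ^^ (S * t)) (P * (dg n e * K))"
      by (simp add: funpow_add add.commute[of S] s(8)[symmetric])
    also have "\<dots> = P * (?D * Kt) * (dg n e * ?K')"
      using a s(1) K by (subst fr_pow_mult[of _ _ n _ n _ n]) (auto simp: Kt(3) map_mat_mult[of _ _ n n _ n])
    also have "\<dots> = P * (?D * (Kt * dg n e) * ?K')"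
      using s(1) Ktc K' by (simp add: assoc_mult_mat[of _ n n _ n _ n])
    also have "\<dots> = P * ((?D * dg n e) * (Kt * ?K'))"
      unfolding Kt(2) using s(1) Ktc K' by (simp add: assoc_mult_mat[of _ n n _ n _ n])
    also have "?D * dg n e = dg n (\<lambda>i. int (Suc t) * e i)"
      unfolding dg_mult_dg by (simp add: algebra_simps)
    finally have 1: "(fr \<tau> b ^^ (S * Suc t)) P = P * (dg n (\<lambda>i. int (Suc t) * e i) * (Kt * ?K'))" .
    have "Kt * ?K' * dg n e = Kt * dg n e * ?K'"
      using K' Ktc by (simp add: assoc_mult_mat[of _ n n _ n _ n])
    also have "\<dots> = dg n e * (Kt * ?K')"
      using K' Ktc by (simp add: Kt(2) assoc_mult_mat[of _ n n _ n _ n])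
    finally show ?case using 1 GLO_mult[OF Kt(1) K'(2)] by blast
  qed
  from this[of t] obtain Kt where Kt: "GLO n Kt" "(fr \<tau> b ^^ (S * t)) P = P * (dg n (\<lambda>i. int t * e i) * Kt)" by blast
  have "R * dg n (\<lambda>i. int t * e i) = dg n (\<lambda>i. int t * e i) * R"
    using s(6) mat_commute_dg_iff[OF s(4)] by simp
  then show ?thesis unfolding slope_basis_def using s t Kt by auto
qed

section \<open>Permutation matrices and triangular bases of lattices\<close>

definition pmat :: "nat \<Rightarrow> (nat \<Rightarrow> nat) \<Rightarrow> 'a mat" where
  "pmat n g = mat n n (\<lambda>(i,j). if i = g j then 1 else 0)"

lemma pmat_carrier [simp]: "pmat n g \<in> carrier_mat n n" by (simp add: pmat_def)

lemma mult_pmat_index: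
  assumes "A \<in> carrier_mat m n" "i < m" "j < n" "g j < n"
  shows "(A * pmat n g) $$ (i,j) = A $$ (i, g j)"
proof -
  have "(A * pmat n g) $$ (i,j) = (\<Sum>k<n. A $$ (i,k) * (if k = g j then 1 else 0))"
    by (subst mult_mat_index[OF assms(1) pmat_carrier assms(2,3)])
      (rule sum.cong, use assms in \<open>auto simp: pmat_def\<close>)
  then show ?thesis using assms by simp
qed

lemma pmat_mult_index:
  assumes "A \<in> carrier_mat n m" "i < n" "j < m" "bij_betw g {..<n} {..<n}" "k < n" "g k = i"
  shows "(pmat n g * A) $$ (i,j) = A $$ (k, j)"
proof -
  have "(i = g l) = (k = l)" if "l < n" for l
    using assms that unfolding bij_betw_def inj_on_def by auto
  then have "(pmat n g * A) $$ (i,j) = (\<Sum>l<n. (if k = l then 1 else 0) * A $$ (l,j))"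
    by (subst mult_mat_index[OF pmat_carrier assms(1,2,3)])
      (rule sum.cong, use assms in \<open>auto simp: pmat_def\<close>)
  then show ?thesis using assms by simp
qed

lemma pmat_inverse:
  assumes "bij_betw g {..<n} {..<n}" "\<And>i. i < n \<Longrightarrow> h i < n \<and> g (h i) = i"
  shows "pmat n g * pmat n h = 1\<^sub>m n"
proof (rule eq_matI)
  fix i j assume "i < dim_row (1\<^sub>m n :: 'a mat)" "j < dim_col (1\<^sub>m n :: 'a mat)"
  then have ij: "i < n" "j < n" by auto
  then have "(pmat n g * pmat n h) $$ (i,j) = pmat n g $$ (i, h j)"
    using assms(2)[of j] by (intro mult_pmat_index[of _ n]) auto
  then show "(pmat n g * pmat n h) $$ (i,j) = 1\<^sub>m n $$ (i,j)"
    using assms(2)[of j] ij by (auto simp: pmat_def)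
qed (auto simp: pmat_def)

lemma bij_betw_inv_obtain:
  assumes "bij_betw g {..<n::nat} {..<n}"
  obtains h where "\<And>i. i < n \<Longrightarrow> h i < n \<and> g (h i) = i" "\<And>i. i < n \<Longrightarrow> g i < n"
proof -
  have "\<forall>i. \<exists>j. i < n \<longrightarrow> j < n \<and> g j = i" using assms unfolding bij_betw_def by (metis imageE lessThan_iff)
  then obtain h where "\<And>i. i < n \<Longrightarrow> h i < n \<and> g (h i) = i" by metis
  moreover have "\<And>i. i < n \<Longrightarrow> g i < n" using assms unfolding bij_betw_def by auto
  ultimately show ?thesis by (rule that)
qed

lemma pmat_GLO:
  assumes "bij_betw g {..<n} {..<n}" shows "GLO n (pmat n g)"
proof -
  obtain h where h: "\<And>i. i < n \<Longrightarrow> h i < n \<and> g (h i) = i" using bij_betw_inv_obtain[OF assms] by metis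
  show ?thesis
    by (rule GLO_I[of _ n "pmat n h"]) (use pmat_inverse[OF assms h] in \<open>auto simp: mge_def pmat_def\<close>)
qed

text \<open>A primitive row, integral with a unit entry, completes to an element of GL_n(O_L): it
  replaces the row \<open>j0\<close> of the identity, and that row is then moved to the
  bottom.\<close>

lemma primitive_last_row:
  assumes y: "\<And>j. j < n \<Longrightarrow> vge 0 (y j)" and j0: "j0 < n" "y j0 \<noteq> 0" "v (y j0) = 0"
  shows "\<exists>W. GLO n W \<and> (\<forall>j<n. W $$ (n - 1, j) = y j)"
proof -
  define W0 where "W0 = mat n n (\<lambda>(i,j). if i = j0 then y j else if i = j then 1 else 0)"
  define z where "z j = (if j = j0 then inverse (y j0) else - y j * inverse (y j0))" for j
  define W1 where "W1 = mat n n (\<lambda>(i,j). if i = j0 then z j else if i = j then 1 else 0)"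
  have c: "W0 \<in> carrier_mat n n" "W1 \<in> carrier_mat n n" by (auto simp: W0_def W1_def)
  have "W0 * W1 = 1\<^sub>m n"
  proof (rule eq_matI)
    fix i j assume "i < dim_row (1\<^sub>m n :: 'a mat)" "j < dim_col (1\<^sub>m n :: 'a mat)"
    then have ij: "i < n" "j < n" by auto
    have e: "(W0 * W1) $$ (i,j) = (\<Sum>k<n. W0 $$ (i,k) * W1 $$ (k,j))" by (rule mult_mat_index[OF c ij])
    show "(W0 * W1) $$ (i,j) = 1\<^sub>m n $$ (i,j)"
    proof (cases "i = j0")
      case False
      have "(\<Sum>k<n. W0 $$ (i,k) * W1 $$ (k,j)) = (\<Sum>k<n. (if i = k then 1 else 0) * W1 $$ (k,j))"
        by (rule sum.cong) (use ij False in \<open>auto simp: W0_def\<close>)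
      then show ?thesis using e ij False by (simp add: W1_def)
    next
      case True
      have "(\<Sum>k<n. W0 $$ (i,k) * W1 $$ (k,j)) =
          (\<Sum>k<n. (if k = j0 then y j0 * z j else 0) + (if k = j then (if j = j0 then 0 else y j) else 0))"
        by (rule sum.cong) (use ij True in \<open>auto simp: W0_def W1_def\<close>)
      also have "\<dots> = y j0 * z j + (if j = j0 then 0 else y j)" using ij j0 by (simp add: sum.distrib)
      finally show ?thesis using e ij j0 True by (auto simp: z_def)
    qed
  qed (auto simp: W0_def W1_def)
  moreover have "vge 0 (z j)" if "j < n" for j
    using y[OF that] j0 by (auto simp: z_def vge_nz v_inverse intro!: vge_mult0)
  ultimately have W0: "GLO n W0"
    by (intro GLO_I[of _ n W1]) (use y c in \<open>auto simp: mge_def W0_def W1_def\<close>)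
  define g where "g i = (if i = n - 1 then j0 else if i = j0 then n - 1 else i)" for i
  have gb: "bij_betw g {..<n} {..<n}"
    by (rule bij_betw_byWitness[where f' = g]) (use j0 in \<open>auto simp: g_def\<close>)
  have "(pmat n g * W0) $$ (n - 1, j) = y j" if "j < n" for j
    by (subst pmat_mult_index[OF c(1) _ that gb j0(1)]) (use j0 that in \<open>auto simp: g_def W0_def\<close>)
  then show ?thesis using GLO_mult[OF pmat_GLO[OF gb] W0] by blast
qed

lemma GLO_four_block:
  assumes "GLO a A" "GLO d D"
  shows "GLO (a + d) (four_block_mat A (0\<^sub>m a d) (0\<^sub>m d a) D)"
proof -
  obtain A' D' where *: "GLO a A'" "A * A' = 1\<^sub>m a" "GLO d D'" "D * D' = 1\<^sub>m d" using GLO_obtain assms by metis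
  note c = assms[THEN GLO_carrier] *(1,3)[THEN GLO_carrier]
  note m = assms[THEN GLO_mge] *(1,3)[THEN GLO_mge]
  show ?thesis
  proof (rule GLO_I)
    show "four_block_mat A (0\<^sub>m a d) (0\<^sub>m d a) D * four_block_mat A' (0\<^sub>m a d) (0\<^sub>m d a) D' = 1\<^sub>m (a + d)"
      using c by (subst mult_four_block_mat[of _ a a _ d _ d _ _ a _ d]) (auto simp: *)
  qed (use c m in \<open>auto simp: mge_def\<close>)
qed

text \<open>Dividing by an entry of least valuation makes the row primitive.\<close>

lemma primitive_scale:
  fixes n :: nat
  assumes ex: "\<exists>j<n. y j \<noteq> (0::'a)"
  shows "\<exists>t. t \<noteq> 0 \<and> (\<forall>j<n. vge 0 (y j / t)) \<and> (\<exists>j<n. y j / t \<noteq> 0 \<and> v (y j / t) = 0)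
     \<and> (\<exists>j<n. t = y j)"
proof -
  let ?J = "{j. j < n \<and> y j \<noteq> 0}"
  have J: "finite ?J" by (rule finite_subset[of _ "{..<n}"]) auto
  moreover have "?J \<noteq> {}" using ex by auto
  ultimately have "Min ((\<lambda>j. v (y j)) ` ?J) \<in> (\<lambda>j. v (y j)) ` ?J" by (intro Min_in) auto
  then obtain j0 where j0: "j0 \<in> ?J" "v (y j0) = Min ((\<lambda>j. v (y j)) ` ?J)" by auto
  have "v (y j0) \<le> v (y j)" if "j \<in> ?J" for j
    unfolding j0(2) by (rule Min_le) (use J that in auto)
  then have "vge 0 (y j / y j0)" if "j < n" for j
    using that j0(1) by (cases "y j = 0") (auto simp: vge_nz v_divide)
  with j0(1) show ?thesis
    by (intro exI[of _ "y j0"]) (auto simp: v_divide)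
qed

lemma invertible_row_nz:
  fixes A :: "'a mat"
  assumes "A \<in> carrier_mat n n" "invertible_mat A" "i < n"
  shows "\<exists>j<n. A $$ (i,j) \<noteq> 0"
proof (rule ccontr)
  assume "\<not> ?thesis"
  then have z: "\<And>j. j < n \<Longrightarrow> A $$ (i,j) = 0" by blast
  obtain B where B: "B \<in> carrier_mat n n" "A * B = 1\<^sub>m n" using assms invertible_mat_obtain by metis
  have "(A * B) $$ (i,i) = 0" by (subst mult_mat_index[OF assms(1) B(1)]) (use z assms in auto)
  then show False using B assms by simp
qed

text \<open>Column operations over O_L bring the last row to the form (0, ..., 0, t): divided by
  \<open>t\<close> it is primitive, hence the last row of some \<open>W\<close> in GL_n(O_L), and
  the inverse of \<open>W\<close> does it. Induction treats the upper left block. In terms of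
  lattices, every lattice has a basis adapted to the standard flag.\<close>

lemma iwasawa:
  assumes "g \<in> carrier_mat n n" "invertible_mat g"
  shows "\<exists>k. GLO n k \<and> upper_triangular (g * k)"
  using assms
proof (induction n arbitrary: g)
  case 0
  then show ?case by (intro exI[of _ "1\<^sub>m 0"]) auto
next
  case (Suc m)
  let ?n = "Suc m"
  have "\<exists>j<?n. g $$ (m,j) \<noteq> 0" using invertible_row_nz[OF Suc.prems, of m] by simp
  from primitive_scale[OF this] obtain t where t: "t \<noteq> 0" "\<And>j. j < ?n \<Longrightarrow> vge 0 (g $$ (m,j) / t)"
    "\<exists>j<?n. g $$ (m,j) / t \<noteq> 0 \<and> v (g $$ (m,j) / t) = 0" by auto
  obtain W where W: "GLO ?n W" "\<And>j. j < ?n \<Longrightarrow> W $$ (m,j) = g $$ (m,j) / t"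
  proof -
    obtain j where j: "j < ?n" "g $$ (m,j) / t \<noteq> 0" "v (g $$ (m,j) / t) = 0" using t(3) by blast
    from primitive_last_row[of ?n "\<lambda>j. g $$ (m,j) / t", OF t(2) j] show ?thesis using that by auto
  qed
  obtain k1 where k1: "GLO ?n k1" "W * k1 = 1\<^sub>m ?n" using GLO_obtain[OF W(1)] by metis
  note c = Suc.prems(1) GLO_carrier[OF W(1)] GLO_carrier[OF k1(1)]
  define h where "h = g * k1"
  have h: "h \<in> carrier_mat ?n ?n" "invertible_mat h"
    using c Suc.prems(2) GLO_invertible[OF k1(1)] by (auto simp: h_def intro!: invertible_mat_mult[of _ ?n])
  have last: "h $$ (m,j) = (if j = m then t else 0)" if "j < ?n" for j
  proof -
    have "h $$ (m,j) = (\<Sum>k<?n. g $$ (m,k) * k1 $$ (k,j))"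
      unfolding h_def by (rule mult_mat_index[OF c(1,3)]) (use that in auto)
    also have "\<dots> = (\<Sum>k<?n. t * (W $$ (m,k) * k1 $$ (k,j)))"
      by (rule sum.cong) (use W(2) t(1) in auto)
    also have "\<dots> = t * (W * k1) $$ (m,j)"
      by (subst mult_mat_index[OF c(2,3)]) (use that in \<open>auto simp: sum_distrib_left simp del: sum.lessThan_Suc\<close>)
    finally show ?thesis using that k1(2) by simp
  qed
  define g' where "g' = mat m m (\<lambda>(i,j). h $$ (i,j))"
  define q where "q = mat m 1 (\<lambda>(i,j). h $$ (i,m))"
  define tt where "tt = mat 1 1 (\<lambda>(i,j). t)"
  have hb: "h = four_block_mat g' q (0\<^sub>m 1 m) tt"
    by (rule eq_matI) (use h last in \<open>auto simp: g'_def q_def tt_def less_Suc_eq\<close>)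
  have gc: "g' \<in> carrier_mat m m" "q \<in> carrier_mat m 1" "tt \<in> carrier_mat 1 1"
    by (auto simp: g'_def q_def tt_def)
  have "det h = det g' * det tt" unfolding hb
    by (rule det_four_block_mat_lower_left_zero[OF gc(1,2) _ gc(3)]) simp
  then have "invertible_mat g'" using h gc invertible_mat_iff_det by (metis mult_eq_0_iff)
  from Suc.IH[OF gc(1) this] obtain k' where k': "GLO m k'" "upper_triangular (g' * k')" by blast
  note k'c = GLO_carrier[OF k'(1)]
  define k2 where "k2 = four_block_mat k' (0\<^sub>m m 1) (0\<^sub>m 1 m) (1\<^sub>m 1)"
  have k2: "GLO ?n k2" using GLO_four_block[OF k'(1) GLO_one[of 1]] by (simp add: k2_def)
  have "h * k2 = four_block_mat (g' * k') q (0\<^sub>m 1 m) tt"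
    unfolding hb k2_def using gc k'c
    by (subst mult_four_block_mat[of _ m m _ 1 _ 1 _ _ m _ 1]) auto
  then have "upper_triangular (h * k2)"
    using k'(2) gc k'c by (auto simp: upper_triangular_def)
  moreover have "h * k2 = g * (k1 * k2)"
    unfolding h_def using c GLO_carrier[OF k2] by (simp add: assoc_mult_mat[of _ ?n ?n _ ?n _ ?n])
  ultimately show ?case using GLO_mult[OF k1(1) k2] by auto
qed

section \<open>Block triangular matrices, the stabilizers of the span of the first k basis
  vectors\<close>

definition upk :: "nat \<Rightarrow> nat \<Rightarrow> 'a mat \<Rightarrow> bool" where
  "upk n k A \<longleftrightarrow> (\<forall>i j. k \<le> i \<longrightarrow> i < n \<longrightarrow> j < k \<longrightarrow> A $$ (i,j) = 0)"

definition top_left :: "nat \<Rightarrow> 'a mat \<Rightarrow> 'a mat" where "top_left k A = mat k k (\<lambda>(i,j). A $$ (i,j))"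

definition bottom_right :: "nat \<Rightarrow> nat \<Rightarrow> 'a mat \<Rightarrow> 'a mat" where
  "bottom_right n k A = mat (n - k) (n - k) (\<lambda>(i,j). A $$ (k + i, k + j))"

lemma top_left_carrier [simp]: "top_left k A \<in> carrier_mat k k" by (simp add: top_left_def)
lemma bottom_right_carrier [simp]: "bottom_right n k A \<in> carrier_mat (n - k) (n - k)" by (simp add: bottom_right_def)

lemma det_upk:
  assumes "A \<in> carrier_mat n n" "k \<le> n" "upk n k A"
  shows "det A = det (top_left k A) * det (bottom_right n k A)"
proof -
  define U where "U = mat k (n - k) (\<lambda>(i,j). A $$ (i, k + j))"
  have "A = four_block_mat (top_left k A) U (0\<^sub>m (n - k) k) (bottom_right n k A)"
    by (rule eq_matI) (use assms in \<open>auto simp: top_left_def bottom_right_def U_def upk_def\<close>)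
  then show ?thesis
    using det_four_block_mat_lower_left_zero[of "top_left k A" k U "n - k" "0\<^sub>m (n - k) k" "bottom_right n k A"]
    by (metis U_def bottom_right_carrier mat_carrier top_left_carrier)
qed

lemma top_left_mult:
  assumes "A \<in> carrier_mat n n" "B \<in> carrier_mat n n" "k \<le> n" "upk n k B"
  shows "top_left k (A * B) = top_left k A * top_left k B"
proof (rule eq_matI)
  fix i j assume "i < dim_row (top_left k A * top_left k B)" "j < dim_col (top_left k A * top_left k B)"
  then have ij: "i < k" "j < k" by (auto simp: top_left_def)
  have "(A * B) $$ (i,j) = (\<Sum>l<n. A $$ (i,l) * B $$ (l,j))"
    by (rule mult_mat_index[OF assms(1,2)]) (use assms ij in auto)
  also have "\<dots> = (\<Sum>l<k. A $$ (i,l) * B $$ (l,j))"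
    by (rule sum.mono_neutral_right) (use assms ij in \<open>auto simp: upk_def\<close>)
  also have "\<dots> = (top_left k A * top_left k B) $$ (i,j)"
    by (subst mult_mat_index[of _ k k _ k]) (use ij in \<open>auto simp: top_left_def\<close>)
  finally show "top_left k (A * B) $$ (i,j) = (top_left k A * top_left k B) $$ (i,j)" using ij by (simp add: top_left_def)
qed (auto simp: top_left_def)

lemma upk_mult:
  assumes "A \<in> carrier_mat n n" "B \<in> carrier_mat n n" "k \<le> n" "upk n k A" "upk n k B"
  shows "upk n k (A * B)"
  unfolding upk_def
proof (intro allI impI)
  fix i j assume ij: "k \<le> i" "i < n" "j < k"
  have "(A * B) $$ (i,j) = (\<Sum>l<n. A $$ (i,l) * B $$ (l,j))"
    by (rule mult_mat_index[OF assms(1,2)]) (use assms ij in auto)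
  also have "\<dots> = 0" by (rule sum.neutral) (use assms ij in \<open>auto simp: upk_def; metis not_le\<close>)
  finally show "(A * B) $$ (i,j) = 0" .
qed

lemma upk_map: "aut \<tau> \<Longrightarrow> A \<in> carrier_mat n n \<Longrightarrow> k \<le> n \<Longrightarrow> upk n k A \<Longrightarrow> upk n k (map_mat \<tau> A)"
  unfolding upk_def by (auto simp: aut_simps(1)[of \<tau>])

lemma top_left_map: "A \<in> carrier_mat n n \<Longrightarrow> k \<le> n \<Longrightarrow> top_left k (map_mat \<tau> A) = map_mat \<tau> (top_left k A)"
  by (rule eq_matI) (auto simp: top_left_def)

lemma upk_one [simp]: "k \<le> n \<Longrightarrow> upk n k (1\<^sub>m n)" by (auto simp: upk_def)
lemma top_left_one [simp]: "k \<le> n \<Longrightarrow> top_left k (1\<^sub>m n) = 1\<^sub>m k" by (rule eq_matI) (auto simp: top_left_def)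
lemma top_left_full [simp]: "A \<in> carrier_mat n n \<Longrightarrow> top_left n A = A" by (rule eq_matI) (auto simp: top_left_def)
lemma upk_dg [simp]: "k \<le> n \<Longrightarrow> upk n k (dg n e)" by (auto simp: upk_def dg_def)
lemma top_left_dg [simp]: "k \<le> n \<Longrightarrow> top_left k (dg n e) = dg k e" by (rule eq_matI) (auto simp: top_left_def dg_def)
lemma upk_full [simp]: "upk n n A" by (auto simp: upk_def)

lemma upk_upper_triangular: "A \<in> carrier_mat n n \<Longrightarrow> upper_triangular A \<Longrightarrow> upk n k A"
  by (auto simp: upk_def upper_triangular_def)

text \<open>The lower right block of \<open>T\<close> is invertible and kills the columns of the
  lower left block of \<open>g\<close>.\<close>

lemma upk_solve:
  assumes T: "T \<in> carrier_mat n n" "invertible_mat T" "upk n k T" and g: "g \<in> carrier_mat n n"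
    and k: "k \<le> n" and Tg: "upk n k (T * g)"
  shows "upk n k g"
  unfolding upk_def
proof (intro allI impI)
  fix i j assume ij: "k \<le> i" "i < n" "j < k"
  define w where "w = vec (n - k) (\<lambda>l. g $$ (k + l, j))"
  have "bottom_right n k T *\<^sub>v w = 0\<^sub>v (n - k)"
  proof (rule eq_vecI)
    fix r assume "r < dim_vec (0\<^sub>v (n - k) :: 'a vec)"
    then have r: "r < n - k" by simp
    have "0 = (T * g) $$ (k + r, j)" using Tg ij r by (auto simp: upk_def)
    also have "\<dots> = (\<Sum>l<n. T $$ (k + r, l) * g $$ (l, j))"
      by (rule mult_mat_index[OF T(1) g]) (use ij r k in auto)
    also have "\<dots> = (\<Sum>l\<in>{k..<n}. T $$ (k + r, l) * g $$ (l, j))"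
      by (rule sum.mono_neutral_right) (use T(3) r in \<open>auto simp: upk_def\<close>)
    also have "\<dots> = (\<Sum>l<n - k. T $$ (k + r, k + l) * g $$ (k + l, j))"
      by (rule sum.reindex_bij_witness[of _ "\<lambda>l. k + l" "\<lambda>l. l - k"]) auto
    also have "\<dots> = (bottom_right n k T *\<^sub>v w) $ r"
      by (subst mult_mat_vec_index[of _ "n - k" "n - k"]) (use r in \<open>auto simp: bottom_right_def w_def\<close>)
    finally show "(bottom_right n k T *\<^sub>v w) $ r = 0\<^sub>v (n - k) $ r" using r by simp
  qed (simp add: bottom_right_def)
  moreover have "det (bottom_right n k T) \<noteq> 0"
    using det_upk[OF T(1) k T(3)] T invertible_mat_iff_det[OF T(1)] by auto
  ultimately have "w = 0\<^sub>v (n - k)"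
    using det_0_iff_vec_prod_zero_field[OF bottom_right_carrier] by (metis w_def vec_carrier)
  then have "w $ (i - k) = 0" using ij by simp
  moreover have "w $ (i - k) = g $$ (k + (i - k), j)" unfolding w_def by (rule index_vec) (use ij in arith)
  moreover have "k + (i - k) = i" using ij by arith
  ultimately show "g $$ (i,j) = 0" by metis
qed

end

text \<open>An exchange argument: the entry at \<open>n - card J\<close> separates the values on the
  tail outside \<open>J\<close> from those on \<open>J\<close> outside the tail.\<close>

lemma sum_subset_ge_tail:
  fixes \<mu> :: "nat \<Rightarrow> int"
  assumes anti: "\<And>i j. i \<le> j \<Longrightarrow> j < n \<Longrightarrow> \<mu> j \<le> \<mu> i" and J: "J \<subseteq> {..<n}"
  shows "(\<Sum>i\<in>{n - card J..<n}. \<mu> i) \<le> (\<Sum>i\<in>J. \<mu> i)"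
proof (cases "J = {}")
  case False
  define T where "T = {n - card J..<n}"
  have fin: "finite J" using J finite_subset by blast
  have cJ: "card J \<le> n" "0 < card J" using card_mono[OF _ J] False fin by (auto simp: card_gt_0_iff)
  define c where "c = \<mu> (n - card J)"
  have cards: "card (J - T) = card (T - J)"
  proof -
    have "card J = card T" using cJ by (simp add: T_def)
    moreover have "finite T" by (simp add: T_def)
    ultimately show ?thesis using fin card_Diff_subset_Int[of J T] card_Diff_subset_Int[of T J]
      by (simp add: Int_commute)
  qed
  have "(\<Sum>i\<in>T - J. \<mu> i) \<le> of_nat (card (T - J)) * c"
    by (rule sum_bounded_above) (use cJ in \<open>auto simp: T_def c_def intro!: anti\<close>)
  also have "\<dots> = of_nat (card (J - T)) * c" by (simp add: cards)
  also have "\<dots> \<le> (\<Sum>i\<in>J - T. \<mu> i)"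
    by (rule sum_bounded_below) (use cJ J in \<open>auto simp: T_def c_def intro!: anti\<close>)
  finally have "(\<Sum>i\<in>T - J. \<mu> i) \<le> (\<Sum>i\<in>J - T. \<mu> i)" .
  moreover have "(\<Sum>i\<in>T. \<mu> i) = (\<Sum>i\<in>T - J. \<mu> i) + (\<Sum>i\<in>T \<inter> J. \<mu> i)"
    by (subst sum.Int_Diff[of T _ J]) (auto simp: T_def)
  moreover have "(\<Sum>i\<in>J. \<mu> i) = (\<Sum>i\<in>J - T. \<mu> i) + (\<Sum>i\<in>T \<inter> J. \<mu> i)"
    by (subst sum.Int_Diff[of J _ T]) (auto simp: fin Int_commute)
  ultimately show ?thesis by (simp add: T_def)
qed simp

section \<open>Mazur's inequality and uniqueness of slopes\<close>

lemma partial_sums_le_of_breaks: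
  fixes e m :: "nat \<Rightarrow> int"
  assumes total: "(\<Sum>i<n. e i) = (\<Sum>i<n. m i)"
    and anti: "\<And>i j. i \<le> j \<Longrightarrow> j < n \<Longrightarrow> m j \<le> m i"
    and breaks: "\<And>k. 0 < k \<Longrightarrow> k < n \<Longrightarrow> e k < e (k - 1) \<Longrightarrow> (\<Sum>i<k. e i) \<le> (\<Sum>i<k. m i)"
    and k: "k \<le> n"
  shows "(\<Sum>i<k. e i) \<le> (\<Sum>i<k. m i)"
proof (rule ccontr)
  \<comment> \<open>The largest index at which the difference of the partial sums is maximal is a break point of \<open>e\<close>.\<close>
  assume neg: "\<not> ?thesis"
  define D where "D k = (\<Sum>i<k. e i) - (\<Sum>i<k. m i)" for k
  define X where "X = Max (D ` {..n})"
  define q where "q = Max {j. j \<le> n \<and> D j = X}"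
  have fin: "finite {j. j \<le> n \<and> D j = X}" by simp
  have "X \<in> D ` {..n}" unfolding X_def by (rule Max_in) auto
  then have "{j. j \<le> n \<and> D j = X} \<noteq> {}" by auto
  from Max_in[OF fin this] have q: "q \<le> n" "D q = X" unfolding q_def by auto
  have le: "D j \<le> X" if "j \<le> n" for j unfolding X_def by (rule Max_ge) (use that in auto)
  have "X > 0" using le[OF k] neg by (simp add: D_def)
  moreover have "D 0 = 0" "D n = 0" using total by (auto simp: D_def)
  ultimately have "q \<noteq> 0" "q \<noteq> n" using q(2) by (metis less_irrefl)+
  then have q': "0 < q" "q < n" using q by auto
  have "D (Suc q) \<noteq> X" using Max_ge[OF fin, of "Suc q"] q' unfolding q_def[symmetric] by auto
  then have "D (Suc q) < D q" using le[of "Suc q"] q q' by simp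
  moreover have "D (q - 1) \<le> D q" using le[of "q - 1"] q q' by simp
  moreover have "D q = D (q - 1) + (e (q - 1) - m (q - 1))" using q'(1) by (cases q) (auto simp: D_def)
  moreover have "D (Suc q) = D q + (e q - m q)" by (simp add: D_def)
  moreover have "m q \<le> m (q - 1)" using anti[of "q - 1" q] q' by simp
  ultimately have "e q < e (q - 1)" by linarith
  from breaks[OF q' this] \<open>X > 0\<close> q(2) show False by (simp add: D_def)
qed

context dvf
begin

definition antitone :: "nat \<Rightarrow> (nat \<Rightarrow> int) \<Rightarrow> bool" where
  "antitone n \<mu> \<longleftrightarrow> (\<forall>i j. i \<le> j \<longrightarrow> j < n \<longrightarrow> \<mu> j \<le> \<mu> i)"

text \<open>Expand the determinant multilinearly over rows, as in the Cauchy-Binet formula: a term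
  picks for each row an index \<open>f i\<close> of \<pi>^\<mu>. A repeated index gives a zero
  determinant, and distinct ones contribute at least the sum of the \<open>n - k\<close> smallest
  entries of \<mu>.\<close>

lemma minor_bound:
  assumes k1: "GLO n k1" and k2: "GLO n k2" and anti: "antitone n \<mu>" and k: "k \<le> n"
  shows "vge (\<Sum>i\<in>{k..<n}. \<mu> i) (det (bottom_right n k (k1 * (dg n \<mu> * k2))))"
proof -
  note c = GLO_carrier[OF k1] GLO_carrier[OF k2]
  define l where "l = n - k"
  define X where "X = mat l n (\<lambda>(i,m). k1 $$ (k + i, m))"
  define Y0 where "Y0 = mat n l (\<lambda>(m,j). k2 $$ (m, k + j))"
  have cX: "X \<in> carrier_mat l n" "Y0 \<in> carrier_mat n l" "dg n \<mu> * Y0 \<in> carrier_mat n l"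
    by (auto simp: X_def Y0_def)
  have rowY: "row (dg n \<mu> * Y0) m = \<pi> powi (\<mu> m) \<cdot>\<^sub>v row Y0 m" if "m < n" for m
    by (rule eq_vecI) (use that cX in \<open>auto simp: dg_mult_index[OF cX(2)] simp del: index_mult_mat(1)\<close>)
  have "bottom_right n k (k1 * (dg n \<mu> * k2)) = X * (dg n \<mu> * Y0)"
  proof (rule eq_matI)
    fix i j assume "i < dim_row (X * (dg n \<mu> * Y0))" "j < dim_col (X * (dg n \<mu> * Y0))"
    then have ij: "i < l" "j < l" by (auto simp: X_def Y0_def)
    have "(k1 * (dg n \<mu> * k2)) $$ (k + i, k + j) = (\<Sum>m<n. k1 $$ (k + i, m) * (dg n \<mu> * k2) $$ (m, k + j))"
      by (rule mult_mat_index[of _ n n _ n]) (use c ij in \<open>auto simp: l_def\<close>)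
    also have "\<dots> = (\<Sum>m<n. X $$ (i, m) * (dg n \<mu> * Y0) $$ (m, j))"
      using ij c cX by (intro sum.cong) (auto simp: dg_mult_index[of _ n n] dg_mult_index[of _ n l] X_def Y0_def l_def simp del: index_mult_mat(1))
    also have "\<dots> = (X * (dg n \<mu> * Y0)) $$ (i,j)"
      by (rule mult_mat_index[symmetric, OF cX(1,3) ij])
    finally show "bottom_right n k (k1 * (dg n \<mu> * k2)) $$ (i,j) = (X * (dg n \<mu> * Y0)) $$ (i,j)"
      using ij by (simp add: bottom_right_def l_def)
  qed (auto simp: bottom_right_def X_def Y0_def l_def)
  also have "det \<dots> = (\<Sum>f | (\<forall>i\<in>{0..<l}. f i \<in> {0..<n}) \<and> (\<forall>i. i \<notin> {0..<l} \<longrightarrow> f i = i).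
      det (mat\<^sub>r l l (\<lambda>i. X $$ (i, f i) \<cdot>\<^sub>v row (dg n \<mu> * Y0) (f i))))"
    unfolding mat_mul_finsum_alt[OF cX(1,3)]
    by (rule det_linear_rows_sum) (use cX in auto)
  also have "vge (\<Sum>i\<in>{k..<n}. \<mu> i) \<dots>"
  proof (rule vge_sum)
    fix f assume "f \<in> {f. (\<forall>i\<in>{0..<l}. f i \<in> {0..<n}) \<and> (\<forall>i. i \<notin> {0..<l} \<longrightarrow> f i = i)}"
    then have f: "\<And>i. i < l \<Longrightarrow> f i < n" by auto
    let ?Z = "mat\<^sub>r l l (\<lambda>i. row Y0 (f i))"
    have Z: "?Z \<in> carrier_mat l l" by simp
    have "mat\<^sub>r l l (\<lambda>i. X $$ (i, f i) \<cdot>\<^sub>v row (dg n \<mu> * Y0) (f i)) =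
        mat\<^sub>r l l (\<lambda>i. (X $$ (i, f i) * \<pi> powi (\<mu> (f i))) \<cdot>\<^sub>v row Y0 (f i))"
      by (rule eq_matI) (use f cX in \<open>auto simp: rowY\<close>)
    also have "det \<dots> = (\<Prod>i\<in>{0..<l}. X $$ (i, f i) * \<pi> powi (\<mu> (f i))) * det ?Z"
      by (rule det_rows_mul) (use cX in auto)
    also have "vge (\<Sum>i\<in>{k..<n}. \<mu> i) \<dots>"
    proof (cases "inj_on f {0..<l}")
      case True
      have "card (f ` {0..<l}) = l" using True by (simp add: card_image)
      then have "{n - card (f ` {0..<l})..<n} = {k..<n}" using k by (simp add: l_def)
      then have "(\<Sum>i\<in>{k..<n}. \<mu> i) \<le> (\<Sum>i\<in>f ` {0..<l}. \<mu> i)"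
        using sum_subset_ge_tail[of n \<mu> "f ` {0..<l}"] anti f
        by (metis antitone_def atLeastLessThan_iff image_subsetI lessThan_iff)
      also have "\<dots> = (\<Sum>i\<in>{0..<l}. \<mu> (f i))" using True by (simp add: sum.reindex)
      finally have "vge (\<Sum>i\<in>{k..<n}. \<mu> i) (\<Prod>i\<in>{0..<l}. \<pi> powi (\<mu> (f i)))"
        by (simp add: vge_def v_prod)
      moreover have "vge 0 (\<Prod>i\<in>{0..<l}. X $$ (i, f i))"
        by (rule vge_prod0) (use f GLO_mge[OF k1] c in \<open>auto simp: X_def mge_def l_def\<close>)
      moreover have "vge 0 (det ?Z)"
        by (rule vge_det[OF Z]) (use f GLO_mge[OF k2] c in \<open>auto simp: Y0_def mge_def l_def\<close>)
      ultimately show ?thesis by (simp add: prod.distrib vge_mult0)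
    next
      case False
      then obtain i j where ij: "i < l" "j < l" "i \<noteq> j" "f i = f j" by (auto simp: inj_on_def)
      have "det ?Z = 0"
        by (rule det_identical_rows[OF Z ij(3,1,2)]) (use ij cX f in \<open>auto intro!: eq_vecI\<close>)
      then show ?thesis by simp
    qed
    finally show "vge (\<Sum>i\<in>{k..<n}. \<mu> i) (det (mat\<^sub>r l l (\<lambda>i. X $$ (i, f i) \<cdot>\<^sub>v row (dg n \<mu> * Y0) (f i))))" .
  qed
  finally show ?thesis .
qed

text \<open>The valuation of \<open>det g\<close> is the full sum of \<mu>, so the lower bound for
  the bottom right block becomes an upper bound for the top left block.\<close>

lemma block_bound:
  assumes k1: "GLO n k1" and k2: "GLO n k2" and anti: "antitone n \<mu>" and k: "k \<le> n"
    and g: "g = k1 * (dg n \<mu> * k2)" and up: "upk n k g"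
  shows "det (top_left k g) \<noteq> 0" "v (det (top_left k g)) \<le> (\<Sum>i<k. \<mu> i)" "k = n \<Longrightarrow> v (det (top_left k g)) = (\<Sum>i<k. \<mu> i)"
proof -
  note c = GLO_carrier[OF k1] GLO_carrier[OF k2]
  have gc: "g \<in> carrier_mat n n" using c by (simp add: g)
  have "det g = det k1 * (det (dg n \<mu>) * det k2)" unfolding g using c by (simp add: det_mult[of _ n])
  then have dg: "det g \<noteq> 0" "v (det g) = (\<Sum>i<n. \<mu> i)"
    using GLO_det[OF k1] GLO_det[OF k2] v_det_dg[of n \<mu>] invertible_mat_iff_det[OF dg_carrier, of n \<mu>]
    by (auto simp: v_mult)
  have split: "det g = det (top_left k g) * det (bottom_right n k g)" by (rule det_upk[OF gc k up])
  then show nz: "det (top_left k g) \<noteq> 0" using dg by auto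
  have nz2: "det (bottom_right n k g) \<noteq> 0" using dg split by auto
  have "(\<Sum>i\<in>{k..<n}. \<mu> i) \<le> v (det (bottom_right n k g))"
    using minor_bound[OF k1 k2 anti k] nz2 by (simp add: g vge_def)
  moreover have "(\<Sum>i<n. \<mu> i) = (\<Sum>i<k. \<mu> i) + (\<Sum>i\<in>{k..<n}. \<mu> i)"
    using k sum.atLeastLessThan_concat[of 0 k n \<mu>] by (simp add: lessThan_atLeast0)
  ultimately show "v (det (top_left k g)) \<le> (\<Sum>i<k. \<mu> i)"
    using dg(2) split v_mult[OF nz nz2] by simp
  show "v (det (top_left k g)) = (\<Sum>i<k. \<mu> i)" if "k = n"
    using that dg(2) gc by simp
qed

lemma sum_cyclic_shift:
  fixes t :: "nat \<Rightarrow> int"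
  assumes "1 \<le> f"
  shows "(\<Sum>j<f. t ((j + f - 1) mod f)) = (\<Sum>j<f. t j)"
proof -
  have "bij_betw (\<lambda>j. (j + f - 1) mod f) {..<f} {..<f}"
  proof (rule bij_betw_byWitness[where f' = "\<lambda>j. (j + 1) mod f"])
    show "\<forall>a\<in>{..<f}. ((a + f - 1) mod f + 1) mod f = a"
      using assms by (simp add: mod_add_left_eq del: One_nat_def)
    show "\<forall>a'\<in>{..<f}. ((a' + 1) mod f + f - 1) mod f = a'"
    proof
      fix a' assume a: "a' \<in> {..<f}"
      have "((a' + 1) mod f + f - 1) mod f = ((a' + 1) mod f + (f - 1)) mod f" using assms by simp
      also have "\<dots> = (a' + 1 + (f - 1)) mod f" by (rule mod_add_left_eq)
      also have "\<dots> = a'" using assms a by simp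
      finally show "((a' + 1) mod f + f - 1) mod f = a'" .
    qed
  qed (use assms in auto)
  then show ?thesis by (rule sum.reindex_bij_betw)
qed

text \<open>Here \<open>N j\<close> is a basis of the j-th lattice in coordinates adapted to a
  stable subspace of rank \<open>k\<close>, and \<open>R j\<close> is the matrix of the semilinear
  map in these coordinates. By Iwasawa the lattices have triangular bases \<open>T j\<close>, in
  which the map has a block triangular matrix \<open>g\<close> in the double coset of \<pi>^\<mu>.
  The top block of \<open>g\<close> is bounded, and the volumes of the \<open>T j\<close> telescope
  around the cycle. It is stated for general \<open>U j\<close> and \<open>R j\<close> so that it
  also serves, with one index, for the uniqueness of slopes.\<close>

lemma mazur_blocks:
  fixes f :: nat and N R U V :: "nat \<Rightarrow> 'a mat" and \<mu> :: "nat \<Rightarrow> nat \<Rightarrow> int"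
  assumes a: "aut \<sigma>" and f: "1 \<le> f" and k: "k \<le> n"
    and N: "\<And>j. j < f \<Longrightarrow> N j \<in> carrier_mat n n \<and> invertible_mat (N j)"
    and R: "\<And>j. j < f \<Longrightarrow> R j \<in> carrier_mat n n \<and> upk n k (R j)"
    and UV: "\<And>j. j < f \<Longrightarrow> GLO n (U j) \<and> GLO n (V j)"
    and anti: "\<And>j. j < f \<Longrightarrow> antitone n (\<mu> j)"
    and eq: "\<And>j. j < f \<Longrightarrow> N j * (U j * (dg n (\<mu> j) * V j)) = R j * map_mat \<sigma> (N ((j + f - 1) mod f))"
  shows "(\<Sum>j<f. v (det (top_left k (R j)))) \<le> (\<Sum>j<f. \<Sum>i<k. \<mu> j i)"
    and "k = n \<Longrightarrow> (\<Sum>j<f. v (det (top_left k (R j)))) = (\<Sum>j<f. \<Sum>i<k. \<mu> j i)"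
proof -
  have "\<forall>j. \<exists>h. j < f \<longrightarrow> GLO n h \<and> upper_triangular (N j * h)" using iwasawa N by blast
  then obtain h where h: "\<And>j. j < f \<Longrightarrow> GLO n (h j) \<and> upper_triangular (N j * h j)" by metis
  define T where "T j = N j * h j" for j
  have hc: "h j \<in> carrier_mat n n" if "j < f" for j using h[OF that] GLO_carrier by blast
  have T: "T j \<in> carrier_mat n n" "invertible_mat (T j)" "upk n k (T j)" if "j < f" for j
    using N[OF that] h[OF that] hc[OF that]
    by (auto simp: T_def GLO_invertible intro!: invertible_mat_mult[of _ n] upk_upper_triangular)
  have Tnz: "det (top_left k (T j)) \<noteq> 0" if "j < f" for j
    using det_upk[OF T(1)[OF that] k T(3)[OF that]] T[OF that] invertible_mat_iff_det[OF T(1)[OF that]] by auto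
  \<comment> \<open>The valuation of the volume of the intersection of the lattice with the
    subspace.\<close>
  define t where "t j = v (det (top_left k (T j)))" for j
  let ?p = "\<lambda>j. (j + f - 1) mod f"
  have key: "v (det (top_left k (R j))) + t (?p j) - t j \<le> (\<Sum>i<k. \<mu> j i) \<and>
    (k = n \<longrightarrow> v (det (top_left k (R j))) + t (?p j) - t j = (\<Sum>i<k. \<mu> j i))" if j: "j < f" for j
  proof -
    have p: "?p j < f" using f by simp
    obtain h' where h': "GLO n h'" "h j * h' = 1\<^sub>m n" using GLO_obtain h[OF j] by metis
    note h'c = GLO_carrier[OF h'(1)]
    let ?s = "map_mat \<sigma> (h (?p j))" let ?sN = "map_mat \<sigma> (N (?p j))"
    have s: "GLO n ?s" "?s \<in> carrier_mat n n" using map_mat_GLO[OF a] h[OF p] hc[OF p] by auto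
    have UVc: "U j \<in> carrier_mat n n" "V j \<in> carrier_mat n n" using UV[OF j] GLO_carrier by auto
    have Nc: "N j \<in> carrier_mat n n" "N (?p j) \<in> carrier_mat n n" "R j \<in> carrier_mat n n"
      using N[OF j] N[OF p] R[OF j] by auto
    \<comment> \<open>This is the inverse of \<open>T j\<close> times \<open>R j\<close> times
      \<sigma> of the previous \<open>T\<close>, written so as to exhibit its double coset.\<close>
    define g where "g = (h' * U j) * (dg n (\<mu> j) * (V j * ?s))"
    have gc: "g \<in> carrier_mat n n" using h'c UVc s by (simp add: g_def)
    have "T j * g = N j * (h j * h') * (U j * (dg n (\<mu> j) * V j)) * ?s"
      unfolding g_def T_def using Nc hc[OF j] h'c UVc s(2) by (simp add: assoc_mult_mat[of _ n n _ n _ n])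
    also have "\<dots> = R j * (?sN * ?s)"
      using Nc h' UVc s(2) by (simp add: eq[OF j] assoc_mult_mat[of _ n n _ n _ n])
    also have "\<dots> = R j * map_mat \<sigma> (T (?p j))"
      using Nc hc[OF p] by (simp add: T_def map_mat_mult[OF a, of _ n n _ n])
    finally have Tg: "T j * g = R j * map_mat \<sigma> (T (?p j))" .
    have sT: "map_mat \<sigma> (T (?p j)) \<in> carrier_mat n n" "upk n k (map_mat \<sigma> (T (?p j)))"
      using T[OF p] upk_map[OF a _ k] by auto
    have "upk n k (T j * g)" unfolding Tg by (rule upk_mult[OF Nc(3) sT(1) k _ sT(2)]) (use R[OF j] in simp)
    then have up: "upk n k g" by (intro upk_solve[OF T[OF j] gc k])
    have glo: "GLO n (h' * U j)" "GLO n (V j * ?s)" using GLO_mult h' UV[OF j] s by auto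
    note bb = block_bound[OF glo anti[OF j] k g_def up]
    have "det (top_left k (T j)) * det (top_left k g) = det (top_left k (R j)) * \<sigma> (det (top_left k (T (?p j))))"
      using arg_cong[OF Tg, of "\<lambda>M. det (top_left k M)"] T[OF j] gc up Nc(3) sT k
      by (simp only: top_left_mult[of _ n] top_left_map[OF T(1)[OF p] k] det_mult[of _ k] top_left_carrier map_carrier_mat
          map_mat_det[OF a])
    moreover have "\<sigma> (det (top_left k (T (?p j)))) \<noteq> 0" using Tnz[OF p] aut_simps(8)[OF a] by simp
    ultimately have "t j + v (det (top_left k g)) = v (det (top_left k (R j))) + t (?p j)"
      using Tnz[OF j] bb(1) aut_v[OF a] v_mult unfolding t_def by (metis mult_eq_0_iff)
    then show ?thesis using bb(2,3) by auto
  qed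
  have s: "(\<Sum>j<f. v (det (top_left k (R j))) + t (?p j) - t j) = (\<Sum>j<f. v (det (top_left k (R j))))"
    by (simp add: sum_subtractf sum.distrib sum_cyclic_shift[OF f] del: One_nat_def)
  have "(\<Sum>j<f. v (det (top_left k (R j))) + t (?p j) - t j) \<le> (\<Sum>j<f. \<Sum>i<k. \<mu> j i)"
    by (rule sum_mono) (use key in simp)
  then show "(\<Sum>j<f. v (det (top_left k (R j)))) \<le> (\<Sum>j<f. \<Sum>i<k. \<mu> j i)" using s by simp
  show "(\<Sum>j<f. v (det (top_left k (R j)))) = (\<Sum>j<f. \<Sum>i<k. \<mu> j i)" if "k = n"
    unfolding s[symmetric] by (rule sum.cong) (use key that in simp_all)
qed

text \<open>At a strict drop of \<open>e\<close>, every position of the lower left block joins two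
  different levels.\<close>

lemma upk_of_break:
  assumes "A \<in> carrier_mat n n" "A * dg n e = dg n e * A" "antitone n e" "0 < k" "k < n" "e k < e (k - 1)"
  shows "upk n k A"
  unfolding upk_def
proof (intro allI impI)
  fix i j assume ij: "k \<le> i" "i < n" "j < k"
  then have "e i \<le> e k" "e (k - 1) \<le> e j" using assms(3,5) unfolding antitone_def by auto
  then have "e i \<noteq> e j" using assms(6) by simp
  then show "A $$ (i,j) = 0" using assms(2) ij assms(5) mat_commute_dg_iff[OF assms(1)] by auto
qed

lemma commute_inverse:
  fixes A :: "'a mat"
  assumes "A \<in> carrier_mat n n" "B \<in> carrier_mat n n" "D \<in> carrier_mat n n" "A * B = 1\<^sub>m n" "A * D = D * A"
  shows "B * D = D * B"
proof -
  have BA: "B * A = 1\<^sub>m n" using mat_mult_left_right_inverse[OF assms(1,2,4)] .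
  have "B * D = B * (D * A) * B" using assms(1-4) by (simp add: assoc_mult_mat[of _ n n _ n _ n])
  also have "\<dots> = (B * A) * (D * B)" unfolding assms(5)[symmetric]
    using assms(1-3) by (simp add: assoc_mult_mat[of _ n n _ n _ n])
  finally show ?thesis using assms BA by simp
qed

text \<open>The hypothesis on all \<open>A\<close> expresses that \<open>k\<close> is a boundary
  between levels; it covers both the break points of \<open>e\<close> and \<open>k = n\<close>. Then
  \<open>K\<close> and its inverse are block triangular, so the top block of \<open>K\<close> is
  again invertible over O_L.\<close>

lemma v_det_top_left_GLO:
  assumes K: "GLO n K" "K * dg n e = dg n e * K" and br: "\<And>A. A \<in> carrier_mat n n \<Longrightarrow> A * dg n e = dg n e * A \<Longrightarrow> upk n k A"
    and k: "k \<le> n"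
  shows "det (top_left k (dg n e * K)) \<noteq> 0 \<and> v (det (top_left k (dg n e * K))) = (\<Sum>i<k. e i)"
proof -
  obtain B where B: "GLO n B" "K * B = 1\<^sub>m n" using GLO_obtain[OF K(1)] by metis
  note c = GLO_carrier[OF K(1)] GLO_carrier[OF B(1)]
  have "B * dg n e = dg n e * B" by (rule commute_inverse[OF c dg_carrier B(2) K(2)])
  then have up: "upk n k K" "upk n k B" using br c K(2) by auto
  have "top_left k K * top_left k B = 1\<^sub>m k" using top_left_mult[OF c k up(2)] B(2) k by simp
  then have "GLO k (top_left k K)"
    by (intro GLO_I[of _ k "top_left k B"]) (use GLO_mge[OF K(1)] GLO_mge[OF B(1)] c k in \<open>auto simp: mge_def top_left_def\<close>)
  then have "det (top_left k K) \<noteq> 0" "v (det (top_left k K)) = 0" using GLO_det by auto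
  moreover have "det (top_left k (dg n e * K)) = det (dg k e) * det (top_left k K)"
    using top_left_mult[OF dg_carrier c(1) k up(1)] k by (simp add: det_mult[of _ k])
  ultimately show ?thesis using v_det_dg[of k e] invertible_mat_iff_det[OF dg_carrier, of k e]
    by (auto simp: v_mult)
qed

lemma v_det_fr_pow:
  assumes "aut \<tau>" "R \<in> carrier_mat n n" "det R \<noteq> 0"
  shows "det ((fr \<tau> R ^^ k) (1\<^sub>m n)) \<noteq> 0 \<and> v (det ((fr \<tau> R ^^ k) (1\<^sub>m n))) = int k * v (det R)"
proof (induction k)
  case (Suc k)
  let ?X = "(fr \<tau> R ^^ k) (1\<^sub>m n)"
  have "?X \<in> carrier_mat n n" using assms by auto
  then have "det (fr \<tau> R ?X) = det R * \<tau> (det ?X)"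
    using assms by (simp add: fr_def[of \<tau> R ?X] det_mult[of _ n] map_mat_det[OF assms(1)])
  then show ?case using Suc assms(3) aut_v[OF assms(1), of "det ?X"] aut_simps(8)[OF assms(1), of "det ?X"]
    by (auto simp: v_mult algebra_simps)
qed simp

lemma top_left_fr_pow:
  assumes a: "aut \<tau>" and R: "R \<in> carrier_mat n n" "upk n k R" and k: "k \<le> n"
  shows "upk n k ((fr \<tau> R ^^ l) (1\<^sub>m n)) \<and> top_left k ((fr \<tau> R ^^ l) (1\<^sub>m n)) = (fr \<tau> (top_left k R) ^^ l) (1\<^sub>m k)"
proof (induction l)
  case (Suc l)
  let ?X = "(fr \<tau> R ^^ l) (1\<^sub>m n)"
  have X: "?X \<in> carrier_mat n n" using R by auto
  have m: "map_mat \<tau> ?X \<in> carrier_mat n n" "upk n k (map_mat \<tau> ?X)" using X upk_map[OF a X k] Suc by auto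
  have e: "fr \<tau> R ?X = R * map_mat \<tau> ?X" by (rule fr_def)
  have "top_left k (fr \<tau> R ?X) = top_left k R * map_mat \<tau> ((fr \<tau> (top_left k R) ^^ l) (1\<^sub>m k))"
    unfolding e top_left_mult[OF R(1) m(1) k m(2)] top_left_map[OF X k] using Suc by simp
  then have "top_left k (fr \<tau> R ?X) = fr \<tau> (top_left k R) ((fr \<tau> (top_left k R) ^^ l) (1\<^sub>m k))"
    by (simp only: fr_def[of \<tau> "top_left k R" "(fr \<tau> (top_left k R) ^^ l) (1\<^sub>m k)"])
  moreover have "upk n k (fr \<tau> R ?X)" unfolding e by (rule upk_mult[OF R(1) m(1) k R(2) m(2)])
  ultimately show ?case by simp
qed (use k in simp)

text \<open>The top block of the \<open>S\<close>-fold twisted product of \<open>R\<close> is the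
  twisted product of the top block, and it equals the top block of \<pi>^e \<open>K\<close>.\<close>

lemma slope_block_det:
  assumes a: "aut \<tau>" and b: "b \<in> carrier_mat n n" and R: "R \<in> carrier_mat n n" "R * dg n e = dg n e * R"
    and K: "GLO n K" "K * dg n e = dg n e * K" and RS: "(fr \<tau> R ^^ S) (1\<^sub>m n) = dg n e * K"
    and br: "\<And>A. A \<in> carrier_mat n n \<Longrightarrow> A * dg n e = dg n e * A \<Longrightarrow> upk n k A" and k: "k \<le> n" and S: "0 < S"
  shows "int S * v (det (top_left k R)) = (\<Sum>i<k. e i)"
proof -
  have t: "top_left k (dg n e * K) = (fr \<tau> (top_left k R) ^^ S) (1\<^sub>m k)"
    using top_left_fr_pow[OF a R(1) br[OF R] k, of S] RS by simp
  have nz: "det (top_left k R) \<noteq> 0"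
  proof
    assume z: "det (top_left k R) = 0"
    obtain S' where S': "S = Suc S'" using S by (cases S) auto
    let ?X = "(fr \<tau> (top_left k R) ^^ S') (1\<^sub>m k)"
    have "det (fr \<tau> (top_left k R) ?X) = det (top_left k R) * det (map_mat \<tau> ?X)"
      unfolding fr_def[of \<tau> "top_left k R" ?X] by (rule det_mult[of _ k]) auto
    then have "det (top_left k (dg n e * K)) = 0" using z by (simp add: t S')
    then show False using v_det_top_left_GLO[OF K br k] by auto
  qed
  show ?thesis using v_det_fr_pow[OF a top_left_carrier nz, of S] v_det_top_left_GLO[OF K br k] by (simp add: t)
qed

text \<open>The O_L-span of the columns of \<open>P'\<close> is a lattice whose position relative to
  its image under \<Phi>^S is \<open>e'\<close>, while \<open>P\<close> exhibits stable subspaces on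
  which the determinants have valuations given by partial sums of \<open>e\<close>. So Mazur's
  inequality applies to \<Phi>^S with a single index.\<close>

lemma slope_basis_unique_le:
  assumes a: "aut \<tau>" and b: "b \<in> carrier_mat n n" and s: "slope_basis \<tau> b n P S e" "slope_basis \<tau> b n P' S e'"
    and anti: "antitone n e" "antitone n e'" and k: "k \<le> n"
  shows "(\<Sum>i<k. e i) \<le> (\<Sum>i<k. e' i)"
proof -
  from slope_basis_obtain[OF a b s(1)] obtain R K where P: "P \<in> carrier_mat n n" "invertible_mat P"
    "GLO n K" "(fr \<tau> b ^^ S) P = P * (dg n e * K)" "K * dg n e = dg n e * K" by metis
  from slope_basis_obtain[OF a b s(2)] obtain R' K' where P': "P' \<in> carrier_mat n n" "invertible_mat P'"
    "GLO n K'" "(fr \<tau> b ^^ S) P' = P' * (dg n e' * K')" by metis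
  obtain Q where Q: "Q \<in> carrier_mat n n" "P * Q = 1\<^sub>m n" "Q * P = 1\<^sub>m n" using invertible_mat_obtain P(1,2) by metis
  define N where "N = Q * P'"
  note K = GLO_carrier[OF P(3)] GLO_carrier[OF P'(3)]
  have N: "N \<in> carrier_mat n n" "invertible_mat N"
    using Q P P' invertible_matI[OF Q(1) P(1) Q(3,2)] by (auto simp: N_def intro!: invertible_mat_mult[of _ n])
  have PN: "P * N = P'" using Q P(1) P'(1) by (simp add: N_def assoc_mult_mat[symmetric, of _ n n _ n _ n])
  have "P * (N * (1\<^sub>m n * (dg n e' * K'))) = (P * N) * (dg n e' * K')"
    using P(1) N K by (simp add: assoc_mult_mat[of _ n n _ n _ n])
  also have "\<dots> = (fr \<tau> b ^^ S) (P * N)" unfolding PN P'(4) ..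
  also have "\<dots> = P * ((dg n e * K) * map_mat (\<tau> ^^ S) N)"
    using P(1) N K by (simp add: fr_pow_mult[OF a b P(1) N(1)] P(4) assoc_mult_mat[of _ n n _ n _ n])
  finally have eq: "N * (1\<^sub>m n * (dg n e' * K')) = (dg n e * K) * map_mat (\<tau> ^^ S) N"
    by (rule mult_left_cancel[OF P(2,1), of _ n, rotated -1]) (use N K in auto)
  have mz: "(\<Sum>j<1::nat. v (det (top_left k (dg n e * K)))) \<le> (\<Sum>j<1::nat. \<Sum>i<k. e' i)"
    "k = n \<Longrightarrow> (\<Sum>j<1::nat. v (det (top_left k (dg n e * K)))) = (\<Sum>j<1::nat. \<Sum>i<k. e' i)"
    if "k \<le> n" "upk n k (dg n e * K)" for k
  proof -
    show "(\<Sum>j<1::nat. v (det (top_left k (dg n e * K)))) \<le> (\<Sum>j<1::nat. \<Sum>i<k. e' i)"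
      by (rule mazur_blocks(1)[OF aut_funpow[OF a], of 1 k n "\<lambda>_. N" "\<lambda>_. dg n e * K" "\<lambda>_. 1\<^sub>m n" "\<lambda>_. K'" "\<lambda>_. e'" S])
        (use that N K P'(3) anti eq in auto)
    show "(\<Sum>j<1::nat. v (det (top_left k (dg n e * K)))) = (\<Sum>j<1::nat. \<Sum>i<k. e' i)" if "k = n"
      by (rule mazur_blocks(2)[OF aut_funpow[OF a], of 1 k n "\<lambda>_. N" "\<lambda>_. dg n e * K" "\<lambda>_. 1\<^sub>m n" "\<lambda>_. K'" "\<lambda>_. e'" S])
        (use that N K P'(3) anti eq in auto)
  qed
  have DK: "(dg n e * K) * dg n e = dg n e * (dg n e * K)"
    using K P(5) by (simp add: assoc_mult_mat[of _ n n _ n _ n])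
  show ?thesis
  proof (rule partial_sums_le_of_breaks[OF _ _ _ k])
    have "v (det (top_left n (dg n e * K))) = (\<Sum>i<n. e i)" using v_det_top_left_GLO[OF P(3,5), of n] by simp
    then show "(\<Sum>i<n. e i) = (\<Sum>i<n. e' i)" using mz(2)[of n] by simp
    show "e' j \<le> e' i" if "i \<le> j" "j < n" for i j using anti(2) that by (auto simp: antitone_def)
    fix k assume k: "0 < k" "k < n" "e k < e (k - 1)"
    note br = upk_of_break[OF _ _ anti(1) k]
    have "v (det (top_left k (dg n e * K))) = (\<Sum>i<k. e i)" using v_det_top_left_GLO[OF P(3,5) br] k by simp
    then show "(\<Sum>i<k. e i) \<le> (\<Sum>i<k. e' i)" using mz(1)[of k] br[OF _ DK] k K by simp
  qed
qed

lemma slope_basis_unique: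
  assumes "aut \<tau>" "b \<in> carrier_mat n n" "slope_basis \<tau> b n P S e" "slope_basis \<tau> b n P' S' e'"
    "antitone n e" "antitone n e'" "i < n"
  shows "int S' * e i = int S * e' i"
proof -
  have S: "0 < S" "0 < S'" using assms unfolding slope_basis_def by auto
  have s: "slope_basis \<tau> b n P (S * S') (\<lambda>i. int S' * e i)" "slope_basis \<tau> b n P' (S * S') (\<lambda>i. int S * e' i)"
    using slope_basis_multiple[OF assms(1,2,3) S(2)] slope_basis_multiple[OF assms(1,2,4) S(1)] by (auto simp: mult.commute)
  have an: "antitone n (\<lambda>i. int S' * e i)" "antitone n (\<lambda>i. int S * e' i)"
    using assms(5,6) by (auto simp: antitone_def mult_left_mono)
  have eq: "(\<Sum>i<k. int S' * e i) = (\<Sum>i<k. int S * e' i)" if "k \<le> n" for k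
    using slope_basis_unique_le[OF assms(1,2) s an that] slope_basis_unique_le[OF assms(1,2) s(2,1) an(2,1) that] by simp
  show ?thesis using eq[of "Suc i"] eq[of i] assms(7) by simp
qed

end

section \<open>Block diagonalization by contraction\<close>

context dvf
begin

text \<open>Banach's fixed point theorem in the \<pi>-adic topology, entry by entry. Contraction is
  asked for on the ball \<open>mge \<kappa>\<close> because one of the maps it is applied to is
  quadratic.\<close>

lemma contraction_fixpoint:
  fixes T :: "'a mat \<Rightarrow> 'a mat"
  assumes closed: "\<And>X. X \<in> carrier_mat p q \<Longrightarrow> mge \<kappa> X \<Longrightarrow> T X \<in> carrier_mat p q \<and> mge \<kappa> (T X)"
    and contr: "\<And>X Y N. X \<in> carrier_mat p q \<Longrightarrow> mge \<kappa> X \<Longrightarrow> Y \<in> carrier_mat p q \<Longrightarrow> mge \<kappa> Y \<Longrightarrow>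
      \<kappa> \<le> N \<Longrightarrow> mge N (X - Y) \<Longrightarrow> mge (N + 1) (T X - T Y)"
  shows "\<exists>X. X \<in> carrier_mat p q \<and> mge \<kappa> X \<and> T X = X"
proof -
  define X where "X k = (T ^^ k) (0\<^sub>m p q)" for k
  have Xc: "X k \<in> carrier_mat p q \<and> mge \<kappa> (X k)" for k
    by (induction k) (auto simp: X_def closed)
  have step: "mge (\<kappa> + int k) (X (Suc k) - X k)" for k
  proof (induction k)
    case 0
    show ?case using Xc[of 1] Xc[of 0] by (auto intro!: mge_diff[of _ _ _ p q])
  next
    case (Suc k)
    have "mge (\<kappa> + int k + 1) (T (X (Suc k)) - T (X k))"
      by (rule contr) (use Xc Suc in auto)
    then show ?case by (simp add: X_def add.commute add.left_commute)
  qed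
  have diff: "vge (\<kappa> + int m) (X (m + l) $$ (i,j) - X m $$ (i,j))" if "i < p" "j < q" for m l i j
  proof (induction l)
    case (Suc l)
    have "vge (\<kappa> + int (m + l)) ((X (Suc (m + l)) - X (m + l)) $$ (i,j))"
      by (rule mge_D[OF step, of _ p q]) (use Xc[of "m + l"] that in \<open>auto intro: minus_carrier_mat\<close>)
    then have "vge (\<kappa> + int m) (X (Suc (m + l)) $$ (i,j) - X (m + l) $$ (i,j))"
      using Xc[of "m + l"] that by (auto elim!: vge_mono)
    from vge_add[OF this Suc] show ?case by simp
  qed simp
  have diff': "vge (\<kappa> + int m) (X k $$ (i,j) - X m $$ (i,j))" if "i < p" "j < q" "m \<le> k" for m k i j
    using diff[OF that(1,2), of m "k - m"] that(3) by simp
  have "\<exists>l. \<forall>N. \<exists>m. \<forall>k\<ge>m. v_close v N (X k $$ (i,j)) l" if ij: "i < p" "j < q" for i j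
  proof -
    have "\<exists>m. \<forall>k\<ge>m. \<forall>k'\<ge>m. v_close v N (X k $$ (i,j)) (X k' $$ (i,j))" for N
    proof (intro exI allI impI)
      fix k k' assume k: "nat (N - \<kappa>) \<le> k" "nat (N - \<kappa>) \<le> k'"
      let ?m = "nat (N - \<kappa>)"
      have "vge (\<kappa> + int ?m) ((X k $$ (i,j) - X ?m $$ (i,j)) - (X k' $$ (i,j) - X ?m $$ (i,j)))"
        by (intro vge_diff diff' ij k)
      then have "vge N (X k $$ (i,j) - X k' $$ (i,j))" by (auto elim!: vge_mono)
      then show "v_close v N (X k $$ (i,j)) (X k' $$ (i,j))" by (auto simp: v_close_def vge_def)
    qed
    then show ?thesis using complete[unfolded v_complete_def, rule_format, of "\<lambda>k. X k $$ (i,j)"] by blast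
  qed
  then obtain l where l: "\<And>i j N. i < p \<Longrightarrow> j < q \<Longrightarrow> \<exists>m. \<forall>k\<ge>m. v_close v N (X k $$ (i,j)) (l i j)"
    by metis
  define L where "L = mat p q (\<lambda>(i,j). l i j)"
  have Lc: "L \<in> carrier_mat p q" by (simp add: L_def)
  have lim: "mge (\<kappa> + int m) (X m - L)" for m
  proof (rule mge_I[of _ p q])
    fix i j assume ij: "i < p" "j < q"
    obtain m' where m': "\<And>k. k \<ge> m' \<Longrightarrow> v_close v (\<kappa> + int m) (X k $$ (i,j)) (l i j)" using l[OF ij] by blast
    let ?k = "max m m'"
    have "vge (\<kappa> + int m) (X ?k $$ (i,j) - l i j)" using m'[of ?k] by (auto simp: v_close_def vge_def)
    from vge_diff[OF this diff'[OF ij, of m ?k]] show "vge (\<kappa> + int m) ((X m - L) $$ (i,j))"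
      using ij Xc[of m] Lc by (simp add: L_def)
  qed (use Xc Lc in auto)
  have "mge \<kappa> L"
  proof -
    have "mge \<kappa> (X 0 - (X 0 - L))" by (rule mge_diff[of _ _ _ p q]) (use lim[of 0] Xc[of 0] Lc in auto)
    moreover have "X 0 - (X 0 - L) = L" by (rule eq_matI) (use Xc[of 0] Lc in auto)
    ultimately show ?thesis by simp
  qed
  note TL = closed[OF Lc this]
  have "mge (\<kappa> + int m) (T L - L)" for m
  proof -
    have 1: "mge (\<kappa> + int m + 1) (T (X m) - T L)"
      by (rule contr) (use lim Xc Lc \<open>mge \<kappa> L\<close> in auto)
    have TX: "T (X m) = X (Suc m)" by (simp add: X_def)
    have 2: "mge (\<kappa> + int m + 1) (X (Suc m) - L)" using lim[of "Suc m"] by (simp add: add.commute add.left_commute)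
    have "mge (\<kappa> + int m + 1) ((X (Suc m) - L) - (X (Suc m) - T L))"
      by (rule mge_diff[of _ _ _ p q]) (use 1 2 TX Xc[of "Suc m"] TL Lc in auto)
    moreover have "(X (Suc m) - L) - (X (Suc m) - T L) = T L - L"
      by (rule eq_matI) (use Xc[of "Suc m"] TL Lc in auto)
    ultimately show ?thesis by (auto elim: mge_mono)
  qed
  from mge_all_nat_imp_0[OF this minus_carrier_mat[OF Lc]] have z: "T L - L = 0\<^sub>m p q" .
  have "T L = L"
  proof (rule eq_matI)
    fix i j assume ij: "i < dim_row L" "j < dim_col L"
    then have "(T L - L) $$ (i,j) = 0" using z Lc by simp
    then show "T L $$ (i,j) = L $$ (i,j)" using ij TL Lc by simp
  qed (use TL Lc in auto)
  then show ?thesis using Lc \<open>mge \<kappa> L\<close> by blast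
qed

text \<open>Singularity modulo \<pi>, expressed inside L: a primitive row \<open>y / t\<close> whose
  product with \<open>A\<close> is divisible by \<pi> comes from a left kernel vector if
  \<open>det A = 0\<close>, and otherwise from a row of the inverse of \<open>A\<close> with a
  non-integral entry. This row becomes the last row of \<open>W\<close>.\<close>

lemma not_GLO_row:
  assumes A: "A \<in> carrier_mat n n" "mge 0 A" "\<not> GLO n A"
  shows "\<exists>W. GLO n W \<and> (\<forall>j<n. vge 1 ((W * A) $$ (n - 1, j))) \<and> 0 < n"
proof -
  have "\<exists>y t. t \<noteq> 0 \<and> (\<forall>j<n. vge 0 (y j / t)) \<and> (\<exists>j<n. y j / t \<noteq> 0 \<and> v (y j / t) = 0)
      \<and> (\<forall>j<n. vge 1 ((\<Sum>k<n. y k * A $$ (k,j)) / t))"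
  proof (cases "det A = 0")
    case True
    then have "det (transpose_mat A) = 0" using A(1) by (simp add: det_transpose)
    then obtain w where w: "w \<in> carrier_vec n" "w \<noteq> 0\<^sub>v n" "transpose_mat A *\<^sub>v w = 0\<^sub>v n"
      using det_0_iff_vec_prod_zero_field[of "transpose_mat A" n] A(1) by auto
    have "\<exists>j<n. w $ j \<noteq> 0" using w(1,2) by (metis eq_vecI carrier_vecD index_zero_vec(1,2))
    from primitive_scale[OF this] obtain t where t: "t \<noteq> 0" "\<forall>j<n. vge 0 (w $ j / t)"
      "\<exists>j<n. w $ j / t \<noteq> 0 \<and> v (w $ j / t) = 0" by blast
    have "(\<Sum>k<n. w $ k * A $$ (k,j)) = 0" if "j < n" for j
    proof -
      have "0 = (transpose_mat A *\<^sub>v w) $ j" using w(3) that by simp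
      also have "\<dots> = (\<Sum>k<n. transpose_mat A $$ (j,k) * w $ k)"
        by (rule mult_mat_vec_index) (use A w that in auto)
      also have "\<dots> = (\<Sum>k<n. w $ k * A $$ (k,j))"
        by (rule sum.cong) (use A that in \<open>auto simp: mult.commute\<close>)
      finally show ?thesis by simp
    qed
    then show ?thesis using t by (intro exI[of _ "\<lambda>k. w $ k"] exI[of _ t]) auto
  next
    case False
    then obtain B where B: "B \<in> carrier_mat n n" "A * B = 1\<^sub>m n" "B * A = 1\<^sub>m n"
      using invertible_mat_iff_det[OF A(1)] invertible_mat_obtain A(1) by metis
    have "\<not> mge 0 B" using A B GLO_I by blast
    then obtain i j0 where ij: "i < n" "j0 < n" "\<not> vge 0 (B $$ (i,j0))" using B(1) by (auto simp: mge_def)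
    have "\<exists>j<n. B $$ (i,j) \<noteq> 0" using ij by (metis vge_0)
    from primitive_scale[OF this] obtain t where t: "t \<noteq> 0" "\<forall>j<n. vge 0 (B $$ (i,j) / t)"
      "\<exists>j<n. B $$ (i,j) / t \<noteq> 0 \<and> v (B $$ (i,j) / t) = 0" by blast
    have "B $$ (i,j0) \<noteq> 0" "v (B $$ (i,j0)) < 0" using ij(3) by (auto simp: vge_def)
    \<comment> \<open>The row times \<open>A\<close> is a unit vector, and dividing it by an element
      of negative valuation makes it divisible by \<pi>.\<close>
    then have vt: "v t < 0" using t(1,2) ij(2) by (auto simp: vge_def v_divide)
    have "vge 1 ((\<Sum>k<n. B $$ (i,k) * A $$ (k,j)) / t)" if "j < n" for j
    proof -
      have "(\<Sum>k<n. B $$ (i,k) * A $$ (k,j)) = (if i = j then 1 else 0)"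
        using mult_mat_index[OF B(1) A(1) ij(1) that] B(3) ij(1) that by simp
      then show ?thesis using vt t(1) by (auto simp: vge_def v_divide)
    qed
    then show ?thesis using t by (intro exI[of _ "\<lambda>k. B $$ (i,k)"] exI[of _ t]) auto
  qed
  then obtain y t j0 where y: "t \<noteq> 0" "\<And>j. j < n \<Longrightarrow> vge 0 (y j / t)" "j0 < n" "y j0 / t \<noteq> 0" "v (y j0 / t) = 0"
    "\<And>j. j < n \<Longrightarrow> vge 1 ((\<Sum>k<n. y k * A $$ (k,j)) / t)" by blast
  obtain W where W: "GLO n W" "\<And>j. j < n \<Longrightarrow> W $$ (n - 1, j) = y j / t"
    using primitive_last_row[of n "\<lambda>j. y j / t", OF y(2) y(3-5)] by auto
  have "vge 1 ((W * A) $$ (n - 1, j))" if "j < n" for j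
  proof -
    have "(W * A) $$ (n - 1, j) = (\<Sum>k<n. W $$ (n - 1, k) * A $$ (k,j))"
      by (rule mult_mat_index[OF GLO_carrier[OF W(1)] A(1)]) (use that in auto)
    also have "\<dots> = (\<Sum>k<n. y k * A $$ (k,j)) / t"
      unfolding sum_divide_distrib by (rule sum.cong) (use W(2) in auto)
    finally show ?thesis using y(6)[OF that] by simp
  qed
  then show ?thesis using W(1) y(3) by auto
qed

definition fb :: "nat \<Rightarrow> nat \<Rightarrow> 'a mat \<Rightarrow> 'a mat \<Rightarrow> 'a mat" where
  "fb a d A D = four_block_mat A (0\<^sub>m a d) (0\<^sub>m d a) D"

lemma fb_carrier [simp]: "A \<in> carrier_mat a a \<Longrightarrow> D \<in> carrier_mat d d \<Longrightarrow> fb a d A D \<in> carrier_mat (a + d) (a + d)"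
  by (simp add: fb_def)

lemma fb_mult:
  assumes "A \<in> carrier_mat a a" "D \<in> carrier_mat d d" "A' \<in> carrier_mat a a" "D' \<in> carrier_mat d d"
  shows "fb a d A D * fb a d A' D' = fb a d (A * A') (D * D')"
  unfolding fb_def using assms by (subst mult_four_block_mat[of _ a a _ d _ d _ _ a _ d]) auto

lemma fb_map:
  "aut \<tau> \<Longrightarrow> A \<in> carrier_mat a a \<Longrightarrow> D \<in> carrier_mat d d \<Longrightarrow> map_mat \<tau> (fb a d A D) = fb a d (map_mat \<tau> A) (map_mat \<tau> D)"
  unfolding fb_def by (subst map_four_block_mat[of _ a a _ d _ d]) (auto simp: map_mat_zero)

lemma fb_GLO: "GLO a A \<Longrightarrow> GLO d D \<Longrightarrow> GLO (a + d) (fb a d A D)"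
  unfolding fb_def by (rule GLO_four_block)

lemma fb_dg: "fb a d (dg a e1) (dg d e2) = dg (a + d) (\<lambda>i. if i < a then e1 i else e2 (i - a))"
  by (rule eq_matI) (auto simp: fb_def dg_def)

lemma fb_det: "A \<in> carrier_mat a a \<Longrightarrow> D \<in> carrier_mat d d \<Longrightarrow> det (fb a d A D) = det A * det D"
  unfolding fb_def by (rule det_four_block_mat_lower_left_zero) auto

lemma fb_invertible:
  "A \<in> carrier_mat a a \<Longrightarrow> D \<in> carrier_mat d d \<Longrightarrow> invertible_mat (fb a d A D) \<longleftrightarrow> invertible_mat A \<and> invertible_mat D"
  by (simp add: invertible_mat_iff_det[of _ "a + d"] invertible_mat_iff_det[of _ a] invertible_mat_iff_det[of _ d] fb_det)

text \<open>The equation says that the columns of the matrix with blocks 1 and \<open>X\<close> span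
  a stable subspace. It is solved for \<open>X\<close> by inverting \<open>G0\<close> on the right;
  the quadratic and the linear term then contract because \<open>X\<close> and \<open>D0\<close> are
  divisible by \<pi>.\<close>

lemma riccati:
  assumes a: "aut \<eta>" and G0: "GLO a G0" and B: "B \<in> carrier_mat a d" "mge 0 B"
    and C: "C \<in> carrier_mat d a" "mge 1 C" and D: "D0 \<in> carrier_mat d d" "mge 1 D0"
  shows "\<exists>X. X \<in> carrier_mat d a \<and> mge 1 X \<and>
    C + D0 * map_mat \<eta> X = X * (G0 + B * map_mat \<eta> X)"
proof -
  obtain H where H: "GLO a H" "G0 * H = 1\<^sub>m a" "H * G0 = 1\<^sub>m a" using GLO_obtain[OF G0] by metis
  note Hc = GLO_carrier[OF H(1)] GLO_mge[OF H(1)]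
  note Gc = GLO_carrier[OF G0]
  define E where "E X = C + D0 * map_mat \<eta> X - X * (B * map_mat \<eta> X)" for X
  have Ec: "E X \<in> carrier_mat d a" if "X \<in> carrier_mat d a" for X
    unfolding E_def using that B C D by auto
  have Em: "mge 1 (E X)" if "X \<in> carrier_mat d a" "mge 1 X" for X
  proof -
    have 1: "mge 1 (D0 * map_mat \<eta> X)"
      by (rule mge_mono[OF mge_mult[of 1 D0 1 "map_mat \<eta> X" d d a]]) (use that D a in auto)
    have 2: "mge 1 (B * map_mat \<eta> X)"
      by (rule mge_mult0(1)[of _ _ _ a d a]) (use that B a in auto)
    have 3: "mge 1 (X * (B * map_mat \<eta> X))"
      by (rule mge_mono[OF mge_mult[of 1 X 1 "B * map_mat \<eta> X" d a a]]) (use that B 2 in auto)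
    show ?thesis unfolding E_def
      by (intro mge_diff[of _ _ _ d a] mge_add[of _ _ _ d a]) (use 1 3 that B C D in auto)
  qed
  have "\<exists>X. X \<in> carrier_mat d a \<and> mge 1 X \<and> E X * H = X"
  proof (rule contraction_fixpoint)
    fix X assume "X \<in> carrier_mat d a" "mge 1 X"
    then show "E X * H \<in> carrier_mat d a \<and> mge 1 (E X * H)"
      using mge_mult0(2)[of 1 "E X" H d a a] Ec[of X] Em[of X] Hc mult_carrier_mat[of "E X" d a H a] by auto
  next
    fix X Y N assume XY: "X \<in> carrier_mat d a" "mge 1 X" "Y \<in> carrier_mat d a" "mge 1 Y" "1 \<le> N" "mge N (X - Y)"
    let ?M = "map_mat \<eta> (X - Y)"
    have M: "?M \<in> carrier_mat d a" "mge N ?M" using XY a by auto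
    have ME: "map_mat \<eta> X - map_mat \<eta> Y = ?M"
      by (rule eq_matI) (use XY in \<open>auto simp: aut_simps(7)[OF a]\<close>)
    have dE: "E X - E Y = D0 * ?M - ((X - Y) * (B * map_mat \<eta> X) + Y * (B * ?M))"
    proof -
      have 1: "D0 * ?M = D0 * map_mat \<eta> X - D0 * map_mat \<eta> Y"
        unfolding ME[symmetric] by (rule mult_minus_distrib_mat[of _ d d _ a]) (use D XY in auto)
      have 2: "(X - Y) * (B * map_mat \<eta> X) = X * (B * map_mat \<eta> X) - Y * (B * map_mat \<eta> X)"
        by (rule minus_mult_distrib_mat[of _ d a _ _ a]) (use B XY in auto)
      have 3: "Y * (B * ?M) = Y * (B * map_mat \<eta> X) - Y * (B * map_mat \<eta> Y)"
      proof -
        have "B * ?M = B * map_mat \<eta> X - B * map_mat \<eta> Y"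
          unfolding ME[symmetric] by (rule mult_minus_distrib_mat[of _ a d _ a]) (use B XY in auto)
        then show ?thesis using B XY by (simp add: mult_minus_distrib_mat[of _ d a _ a])
      qed
      show ?thesis unfolding 1 2 3 E_def
        by (rule eq_matI) (use B C D XY in \<open>auto simp del: index_mult_mat(1)\<close>)
    qed
    have "mge (N + 1) (E X - E Y)" unfolding dE
    proof (intro mge_diff[of _ _ _ d a] mge_add[of _ _ _ d a])
      show "mge (N + 1) (D0 * ?M)" using mge_mult[of 1 D0 N ?M d d a] D M by (simp add: add.commute)
      have "mge 1 (B * map_mat \<eta> X)" by (rule mge_mult0(1)[of _ _ _ a d a]) (use XY B a in auto)
      then show "mge (N + 1) ((X - Y) * (B * map_mat \<eta> X))"
        by (intro mge_mult[of _ _ _ _ d a a]) (use XY B in auto)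
      have "mge N (B * ?M)" by (rule mge_mult0(1)[of _ _ _ a d a]) (use B M in auto)
      from mge_mult[OF XY(4) this XY(3) mult_carrier_mat[OF B(1) M(1)]]
      show "mge (N + 1) (Y * (B * ?M))" by (simp add: add.commute)
    qed (use B C D XY M in auto)
    then have "mge (N + 1) ((E X - E Y) * H)"
      by (rule mge_mult0(2)[OF _ Hc(2) minus_carrier_mat[OF Ec[OF XY(3)]] Hc(1)])
    then show "mge (N + 1) (E X * H - E Y * H)"
      using minus_mult_distrib_mat[OF Ec[OF XY(1)] Ec[OF XY(3)] Hc(1)] by simp
  qed
  then obtain X where X: "X \<in> carrier_mat d a" "mge 1 X" "E X * H = X" by blast
  have "X * G0 = E X * (H * G0)"
    using X(3) assoc_mult_mat[OF Ec[OF X(1)] Hc(1) Gc] by simp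
  then have XG: "X * G0 = E X" using Ec[OF X(1)] H(3) by simp
  have "X * (G0 + B * map_mat \<eta> X) = X * G0 + X * (B * map_mat \<eta> X)"
    by (rule mult_add_distrib_mat[of _ d a _ a]) (use X Gc B in auto)
  also have "\<dots> = C + D0 * map_mat \<eta> X" unfolding XG E_def
    by (rule eq_matI) (use X B C D in \<open>auto simp del: index_mult_mat(1)\<close>)
  finally show ?thesis using X by metis
qed

text \<open>Removing the upper right block is a linear problem. Solving for \<eta>(Z) by means of
  the inverse of \<open>G0\<close> and then applying the inverse of \<eta> gives a contraction,
  because \<open>D\<close> and \<open>E\<close> are divisible by \<pi>.\<close>

lemma linear_split:
  assumes a: "aut \<eta>" and G0: "GLO a G0" and E: "E \<in> carrier_mat a a" "mge 1 E"
    and B: "B \<in> carrier_mat a d" "mge 0 B" and D: "D \<in> carrier_mat d d" "mge 1 D"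
  shows "\<exists>Z. Z \<in> carrier_mat a d \<and> (G0 + E) * map_mat \<eta> Z + B = Z * D"
proof -
  obtain H where H: "GLO a H" "G0 * H = 1\<^sub>m a" "H * G0 = 1\<^sub>m a" using GLO_obtain[OF G0] by metis
  note Hc = GLO_carrier[OF H(1)] GLO_mge[OF H(1)]
  note Gc = GLO_carrier[OF G0]
  define \<rho> where "\<rho> = inv_into UNIV \<eta>"
  have ar: "aut \<rho>" using aut_inv_into[OF a] by (simp add: \<rho>_def)
  define Q where "Q Z = Z * D - B - E * map_mat \<eta> Z" for Z
  have Qc: "Q Z \<in> carrier_mat a d" if "Z \<in> carrier_mat a d" for Z
    unfolding Q_def using that B D E by auto
  have Qm: "mge 0 (Q Z)" if "Z \<in> carrier_mat a d" "mge 0 Z" for Z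
    unfolding Q_def
    by (intro mge_diff[of _ _ _ a d] mge_mult0(2)[of _ _ _ a d d] mge_mult0(1)[of _ _ _ a a d])
      (use that B D E a mge_mono[OF D(2), of 0] mge_mono[OF E(2), of 0] in auto)
  define T where "T Z = map_mat \<rho> (H * Q Z)" for Z
  have "\<exists>Z. Z \<in> carrier_mat a d \<and> mge 0 Z \<and> T Z = Z"
  proof (rule contraction_fixpoint)
    fix Z assume "Z \<in> carrier_mat a d" "mge 0 Z"
    then show "T Z \<in> carrier_mat a d \<and> mge 0 (T Z)"
      unfolding T_def using mge_mult0(1)[of H 0 "Q Z" a a d] Qc Qm Hc ar by auto
  next
    fix X Y N assume XY: "X \<in> carrier_mat a d" "mge 0 X" "Y \<in> carrier_mat a d" "mge 0 Y" "0 \<le> N" "mge N (X - Y)"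
    let ?M = "map_mat \<eta> (X - Y)"
    have M: "?M \<in> carrier_mat a d" "mge N ?M" using XY a by auto
    have ME: "map_mat \<eta> X - map_mat \<eta> Y = ?M"
      by (rule eq_matI) (use XY in \<open>auto simp: aut_simps(7)[OF a]\<close>)
    have dQ: "Q X - Q Y = (X - Y) * D - E * ?M"
    proof -
      have 1: "(X - Y) * D = X * D - Y * D" by (rule minus_mult_distrib_mat[of _ a d _ _ d]) (use D XY in auto)
      have 2: "E * ?M = E * map_mat \<eta> X - E * map_mat \<eta> Y"
        unfolding ME[symmetric] by (rule mult_minus_distrib_mat[of _ a a _ d]) (use E XY in auto)
      show ?thesis unfolding 1 2 Q_def
        by (rule eq_matI) (use B D E XY in \<open>auto simp del: index_mult_mat(1)\<close>)
    qed
    have "mge (N + 1) (Q X - Q Y)" unfolding dQ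
    proof (intro mge_diff[of _ _ _ a d])
      show "mge (N + 1) ((X - Y) * D)" by (intro mge_mult[of _ _ _ _ a d d]) (use XY D in auto)
      show "mge (N + 1) (E * ?M)" using mge_mult[of 1 E N ?M a a d] E M by (simp add: add.commute)
    qed (use XY D E in auto)
    moreover have "Q X - Q Y \<in> carrier_mat a d" using Qc[OF XY(3)] by (rule minus_carrier_mat)
    ultimately have "mge (N + 1) (H * (Q X - Q Y))" by (rule mge_mult0(1)[OF Hc(2) _ Hc(1)])
    then have "mge (N + 1) (map_mat \<rho> (H * Q X - H * Q Y))"
      using mult_minus_distrib_mat[OF Hc(1) Qc[OF XY(1)] Qc[OF XY(3)]] ar by simp
    moreover have map_diff: "map_mat \<rho> (A - B) = map_mat \<rho> A - map_mat \<rho> B"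
      if "A \<in> carrier_mat a d" "B \<in> carrier_mat a d" for A B
      by (rule eq_matI) (use that in \<open>auto simp: aut_simps(7)[OF ar]\<close>)
    have "map_mat \<rho> (H * Q X - H * Q Y) = T X - T Y" unfolding T_def
      by (rule map_diff) (use Qc[OF XY(1)] Qc[OF XY(3)] Hc(1) in \<open>auto intro: mult_carrier_mat\<close>)
    ultimately show "mge (N + 1) (T X - T Y)" by simp
  qed
  then obtain Z where Z: "Z \<in> carrier_mat a d" "T Z = Z" by blast
  have "map_mat \<eta> Z = map_mat \<eta> (T Z)" by (simp add: Z(2))
  also have "\<dots> = H * Q Z" unfolding T_def
    by (rule eq_matI) (auto simp: \<rho>_def aut_inv_simps[OF a])
  finally have "G0 * map_mat \<eta> Z = (G0 * H) * Q Z"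
    using assoc_mult_mat[OF Gc Hc(1) Qc[OF Z(1)]] by simp
  then have GZ: "G0 * map_mat \<eta> Z = Q Z" using H(2) Qc[OF Z(1)] by simp
  have "(G0 + E) * map_mat \<eta> Z = G0 * map_mat \<eta> Z + E * map_mat \<eta> Z"
    by (rule add_mult_distrib_mat[of _ a a _ _ d]) (use Z Gc E in auto)
  then have "(G0 + E) * map_mat \<eta> Z + B = Z * D" unfolding GZ Q_def
    by (intro eq_matI) (use Z B D E in \<open>auto simp del: index_mult_mat(1)\<close>)
  then show ?thesis using Z(1) by blast
qed

text \<open>A Hensel-type lift of the Fitting decomposition modulo \<pi>: \<open>W1\<close>, from
  the Riccati equation, turns the invertible part into a stable subspace; \<open>W2\<close> then
  finds a stable complement, on which the map is divisible by \<pi>.\<close>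

lemma block_diagonalize:
  assumes a: "aut \<eta>" and G0: "GLO a G0" and B: "B \<in> carrier_mat a d" "mge 0 B"
    and C: "C \<in> carrier_mat d a" "mge 1 C" and D: "D0 \<in> carrier_mat d d" "mge 1 D0"
  shows "\<exists>W E D. W \<in> carrier_mat (a + d) (a + d) \<and> invertible_mat W \<and> E \<in> carrier_mat a a \<and> mge 1 E \<and>
    D \<in> carrier_mat d d \<and> mge 1 D \<and>
    four_block_mat G0 B C D0 * map_mat \<eta> W = W * fb a d (G0 + E) D"
proof -
  note Gc = GLO_carrier[OF G0]
  obtain X where X: "X \<in> carrier_mat d a" "mge 1 X"
    "C + D0 * map_mat \<eta> X = X * (G0 + B * map_mat \<eta> X)" using riccati[OF assms] by blast
  define E where "E = B * map_mat \<eta> X"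
  have E: "E \<in> carrier_mat a a" "mge 1 E"
    unfolding E_def using B X a by (auto intro!: mge_mult0(1)[of _ _ _ a d a])
  define D where "D = D0 - X * B"
  have D': "D \<in> carrier_mat d d" "mge 1 D"
    unfolding D_def using assms(7,8) B X by (auto intro!: mge_diff[of _ _ _ d d] mge_mult0(2)[of _ _ _ d a d])
  obtain Z where Z: "Z \<in> carrier_mat a d" "(G0 + E) * map_mat \<eta> Z + B = Z * D"
    using linear_split[OF a G0 E B D'] by blast
  let ?n = "a + d"
  define W1 where "W1 = four_block_mat (1\<^sub>m a) (0\<^sub>m a d) X (1\<^sub>m d)"
  define W2 where "W2 = four_block_mat (1\<^sub>m a) Z (0\<^sub>m d a) (1\<^sub>m d)"
  define M where "M = four_block_mat (G0 + E) B (0\<^sub>m d a) D"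
  have c: "W1 \<in> carrier_mat ?n ?n" "W2 \<in> carrier_mat ?n ?n" "M \<in> carrier_mat ?n ?n"
    using X Z Gc E D' by (auto simp: W1_def W2_def M_def)
  have "det W1 = det (1\<^sub>m a) * det (1\<^sub>m d)" unfolding W1_def
    by (rule det_four_block_mat_upper_right_zero) (use X in auto)
  then have i1: "invertible_mat W1" using invertible_mat_iff_det[OF c(1)] by simp
  have "det W2 = det (1\<^sub>m a) * det (1\<^sub>m d)" unfolding W2_def
    by (rule det_four_block_mat_lower_left_zero) (use Z in auto)
  then have i2: "invertible_mat W2" using invertible_mat_iff_det[OF c(2)] by simp
  have mW1: "map_mat \<eta> W1 = four_block_mat (1\<^sub>m a) (0\<^sub>m a d) (map_mat \<eta> X) (1\<^sub>m d)"
    unfolding W1_def using X a by (subst map_four_block_mat[of _ a a _ d _ d]) (auto simp: map_mat_zero)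
  have mW2: "map_mat \<eta> W2 = four_block_mat (1\<^sub>m a) (map_mat \<eta> Z) (0\<^sub>m d a) (1\<^sub>m d)"
    unfolding W2_def using Z a by (subst map_four_block_mat[of _ a a _ d _ d]) (auto simp: map_mat_zero)
  have XB: "X * B + D = D0" unfolding D_def
    by (rule eq_matI) (use X B assms(7) in \<open>auto simp del: index_mult_mat(1)\<close>)
  have s1: "four_block_mat G0 B C D0 * map_mat \<eta> W1 = W1 * M"
  proof -
    have "four_block_mat G0 B C D0 * map_mat \<eta> W1 = four_block_mat (G0 + E) B (X * (G0 + E)) D0"
      unfolding mW1 using X B C Gc assms(7)
      by (subst mult_four_block_mat[of _ a a _ d _ d _ _ a _ d]) (auto simp: E_def)
    moreover have "W1 * M = four_block_mat (G0 + E) B (X * (G0 + E)) (X * B + D)"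
      unfolding W1_def M_def using X B Gc E D'
      by (subst mult_four_block_mat[of _ a a _ d _ d _ _ a _ d]) auto
    ultimately show ?thesis by (simp add: XB)
  qed
  have s2: "M * map_mat \<eta> W2 = W2 * fb a d (G0 + E) D"
  proof -
    have "M * map_mat \<eta> W2 = four_block_mat (G0 + E) ((G0 + E) * map_mat \<eta> Z + B) (0\<^sub>m d a) D"
      unfolding mW2 M_def using Z B Gc E D'
      by (subst mult_four_block_mat[of _ a a _ d _ d _ _ a _ d]) auto
    moreover have "W2 * fb a d (G0 + E) D = four_block_mat (G0 + E) (Z * D) (0\<^sub>m d a) D"
      unfolding W2_def fb_def using Z B Gc E D'
      by (subst mult_four_block_mat[of _ a a _ d _ d _ _ a _ d]) auto
    ultimately show ?thesis by (simp add: Z(2))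
  qed
  have fc: "four_block_mat G0 B C D0 \<in> carrier_mat ?n ?n" using Gc B C assms(7) by auto
  have fbc: "fb a d (G0 + E) D \<in> carrier_mat ?n ?n" using Gc E D' by simp
  have "four_block_mat G0 B C D0 * map_mat \<eta> (W1 * W2) = (four_block_mat G0 B C D0 * map_mat \<eta> W1) * map_mat \<eta> W2"
    using c fc by (simp add: map_mat_mult[OF a c(1,2)] assoc_mult_mat[of _ ?n ?n _ ?n _ ?n])
  also have "\<dots> = W1 * (M * map_mat \<eta> W2)"
    unfolding s1 using c by (simp add: assoc_mult_mat[of _ ?n ?n _ ?n _ ?n])
  also have "\<dots> = (W1 * W2) * fb a d (G0 + E) D"
    using c fbc by (simp add: s2 assoc_mult_mat[of _ ?n ?n _ ?n _ ?n])
  finally show ?thesis using c i1 i2 E D' invertible_mat_mult[OF c(1,2)]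
    by (intro exI[of _ "W1 * W2"] exI[of _ E] exI[of _ D]) auto
qed

text \<open>The off-diagonal blocks of \<open>R\<close> intertwine an invertible operator with one
  divisible by \<pi>, so any bound on their valuations improves by one, and they vanish. This
  transfers a splitting found for a power of \<Phi> to \<Phi> itself.\<close>

lemma commuting_block_diagonal:
  assumes a: "aut \<tau>" "aut \<eta>" and G0: "GLO a G0" and E: "E \<in> carrier_mat a a" "mge 1 E"
    and D: "D \<in> carrier_mat d d" "mge 1 D" and R: "R \<in> carrier_mat (a + d) (a + d)"
    and eq: "R * map_mat \<tau> (fb a d (G0 + E) D) = fb a d (G0 + E) D * map_mat \<eta> R"
  shows "\<exists>R1 R2. R1 \<in> carrier_mat a a \<and> R2 \<in> carrier_mat d d \<and> R = fb a d R1 R2"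
proof -
  note Gc = GLO_carrier[OF G0]
  obtain H where H: "GLO a H" "G0 * H = 1\<^sub>m a" "H * G0 = 1\<^sub>m a" using GLO_obtain[OF G0] by metis
  note Hc = GLO_carrier[OF H(1)] GLO_mge[OF H(1)]
  define R1 where "R1 = mat a a (\<lambda>(i,j). R $$ (i,j))"
  define S1 where "S1 = mat a d (\<lambda>(i,j). R $$ (i,a + j))"
  define S2 where "S2 = mat d a (\<lambda>(i,j). R $$ (a + i,j))"
  define R2 where "R2 = mat d d (\<lambda>(i,j). R $$ (a + i,a + j))"
  have c: "R1 \<in> carrier_mat a a" "S1 \<in> carrier_mat a d" "S2 \<in> carrier_mat d a" "R2 \<in> carrier_mat d d"
    by (auto simp: R1_def S1_def S2_def R2_def)
  have Rb: "R = four_block_mat R1 S1 S2 R2"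
    by (rule eq_matI) (use R in \<open>auto simp: R1_def S1_def S2_def R2_def\<close>)
  let ?G = "G0 + E"
  have Gc': "?G \<in> carrier_mat a a" using Gc E by simp
  have L: "R * map_mat \<tau> (fb a d ?G D) =
      four_block_mat (R1 * map_mat \<tau> ?G) (S1 * map_mat \<tau> D) (S2 * map_mat \<tau> ?G) (R2 * map_mat \<tau> D)"
    unfolding fb_map[OF a(1) Gc' D(1)] Rb unfolding fb_def using c Gc' D
    by (subst mult_four_block_mat[of _ a a _ d _ d _ _ a _ d]) auto
  have Rr: "fb a d ?G D * map_mat \<eta> R =
      four_block_mat (?G * map_mat \<eta> R1) (?G * map_mat \<eta> S1) (D * map_mat \<eta> S2) (D * map_mat \<eta> R2)"
    unfolding Rb unfolding fb_def using c Gc' D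
    by (subst map_four_block_mat[of _ a a _ d _ d], auto,
        subst mult_four_block_mat[of _ a a _ d _ d _ _ a _ d], auto)
  have e12: "S1 * map_mat \<tau> D = ?G * map_mat \<eta> S1"
  proof (rule eq_matI)
    fix i j assume "i < dim_row (?G * map_mat \<eta> S1)" "j < dim_col (?G * map_mat \<eta> S1)"
    then have ij: "i < a" "j < d" using c Gc' E by auto
    from arg_cong[OF eq[unfolded L Rr], of "\<lambda>M. M $$ (i, a + j)"]
    show "(S1 * map_mat \<tau> D) $$ (i,j) = (?G * map_mat \<eta> S1) $$ (i,j)"
      using ij c Gc Gc' E D by (simp del: index_mult_mat(1))
  qed (use c D Gc' E in auto)
  have e21: "S2 * map_mat \<tau> ?G = D * map_mat \<eta> S2"
  proof (rule eq_matI)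
    fix i j assume "i < dim_row (D * map_mat \<eta> S2)" "j < dim_col (D * map_mat \<eta> S2)"
    then have ij: "i < d" "j < a" using c D by auto
    from arg_cong[OF eq[unfolded L Rr], of "\<lambda>M. M $$ (a + i, j)"]
    show "(S2 * map_mat \<tau> ?G) $$ (i,j) = (D * map_mat \<eta> S2) $$ (i,j)"
      using ij c Gc Gc' E D by (simp del: index_mult_mat(1))
  qed (use c D Gc' E in auto)
  have up1: "mge (N + 1) S1" if N: "mge N S1" for N
  proof -
    have "?G * map_mat \<eta> S1 = G0 * map_mat \<eta> S1 + E * map_mat \<eta> S1"
      by (rule add_mult_distrib_mat[of _ a a _ _ d]) (use c Gc E in auto)
    then have "G0 * map_mat \<eta> S1 = S1 * map_mat \<tau> D - E * map_mat \<eta> S1"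
      unfolding e12 by (intro eq_matI) (use c Gc E D in \<open>auto simp del: index_mult_mat(1)\<close>)
    moreover have "mge (N + 1) (S1 * map_mat \<tau> D)"
      by (rule mge_mult[of _ _ _ _ a d d]) (use N c D a in auto)
    moreover have "mge (N + 1) (E * map_mat \<eta> S1)"
      using mge_mult[of 1 E N "map_mat \<eta> S1" a a d] N c E a by (simp add: add.commute)
    ultimately have "mge (N + 1) (G0 * map_mat \<eta> S1)"
      using mge_diff[of "N + 1" "S1 * map_mat \<tau> D" "E * map_mat \<eta> S1" a d] c D E by simp
    then have "mge (N + 1) (H * (G0 * map_mat \<eta> S1))"
      by (rule mge_mult0(1)[of _ _ _ a a d, rotated]) (use c Gc Hc in auto)
    moreover have "H * (G0 * map_mat \<eta> S1) = map_mat \<eta> S1"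
      using assoc_mult_mat[OF Hc(1) Gc, of "map_mat \<eta> S1" d] c H(3) by simp
    ultimately show ?thesis using a by simp
  qed
  have up2: "mge (N + 1) S2" if N: "mge N S2" for N
  proof -
    have mG: "map_mat \<tau> ?G = map_mat \<tau> G0 + map_mat \<tau> E"
      by (rule eq_matI) (use Gc E in \<open>auto simp: aut_simps(3)[OF a(1)]\<close>)
    have "S2 * map_mat \<tau> ?G = S2 * map_mat \<tau> G0 + S2 * map_mat \<tau> E"
      unfolding mG by (rule mult_add_distrib_mat[of _ d a _ a]) (use c Gc E in auto)
    then have "S2 * map_mat \<tau> G0 = D * map_mat \<eta> S2 - S2 * map_mat \<tau> E"
      unfolding e21[symmetric] by (intro eq_matI) (use c Gc E D in \<open>auto simp del: index_mult_mat(1)\<close>)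
    moreover have "mge (N + 1) (S2 * map_mat \<tau> E)"
      by (rule mge_mult[of _ _ _ _ d a a]) (use N c E a in auto)
    moreover have "mge (N + 1) (D * map_mat \<eta> S2)"
      using mge_mult[of 1 D N "map_mat \<eta> S2" d d a] N c D a by (simp add: add.commute)
    ultimately have "mge (N + 1) (S2 * map_mat \<tau> G0)"
      using mge_diff[of "N + 1" "D * map_mat \<eta> S2" "S2 * map_mat \<tau> E" d a] c D E by simp
    then have "mge (N + 1) (S2 * map_mat \<tau> G0 * map_mat \<tau> H)"
      by (rule mge_mult0(2)[of _ _ _ d a a]) (use c Gc Hc a in auto)
    moreover have "S2 * map_mat \<tau> G0 * map_mat \<tau> H = S2"
    proof -
      have "map_mat \<tau> G0 * map_mat \<tau> H = 1\<^sub>m a" using map_mat_mult[OF a(1) Gc Hc(1)] H(2) a by simp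
      then show ?thesis
        using assoc_mult_mat[of S2 d a "map_mat \<tau> G0" a "map_mat \<tau> H" a] c Gc Hc by simp
    qed
    ultimately show ?thesis by simp
  qed
  have zero: "S = 0\<^sub>m p q" if "S \<in> carrier_mat p q" "\<And>N. mge N S \<Longrightarrow> mge (N + 1) S" for S p q
  proof -
    obtain C where C: "mge C S" using mge_lower_bound by blast
    have "mge (C + int k) S" for k
    proof (induction k)
      case (Suc k)
      from that(2)[OF this] show ?case by (simp add: add.commute add.left_commute)
    qed (use C in simp)
    then show ?thesis by (rule mge_all_nat_imp_0[OF _ that(1)])
  qed
  have "R = fb a d R1 R2" unfolding fb_def using Rb zero[OF c(2) up1] zero[OF c(3) up2] by simp
  then show ?thesis using c by blast
qed

end

section \<open>Fitting decomposition and growth of companion maps\<close>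

context dvf
begin

lemma fr_pow_mge:
  assumes "aut \<theta>" "A \<in> carrier_mat n n" "mge 0 A" "X \<in> carrier_mat n n" "mge N X"
  shows "mge N ((fr \<theta> A ^^ l) X)"
proof (induction l)
  case (Suc l)
  let ?Y = "(fr \<theta> A ^^ l) X"
  have "?Y \<in> carrier_mat n n" using assms by simp
  then have "mge N (A * map_mat \<theta> ?Y)"
    using Suc assms by (intro mge_mult0(1)[of _ _ _ n n n]) auto
  then show ?case by (simp add: fr_def[of \<theta> A ?Y])
qed (use assms in simp)

text \<open>Let \<open>k\<close> be the least rank modulo \<pi> among the iterates of
  \<open>A\<close>, read in integral bases as divisibility of the rows from \<open>k\<close> on. It
  is positive since no iterate is divisible by \<pi>, and minimality makes the top left block of the
  chosen iterate invertible over O_L. If \<open>k = n\<close> the map itself is invertible,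
  otherwise the block diagonalization applies.\<close>

lemma fitting:
  assumes a: "aut \<theta>" and A: "A \<in> carrier_mat n n" "mge 0 A" "det A \<noteq> 0"
    and nonnil: "\<And>l. 0 < l \<Longrightarrow> \<not> mge 1 ((fr \<theta> A ^^ l) (1\<^sub>m n))"
  shows "GLO n A \<or> (\<exists>a d l U G0 E D. 0 < a \<and> 0 < d \<and> n = a + d \<and> 0 < l \<and> U \<in> carrier_mat n n \<and>
    invertible_mat U \<and> GLO a G0 \<and> E \<in> carrier_mat a a \<and> mge 1 E \<and> D \<in> carrier_mat d d \<and> mge 1 D \<and>
    (fr \<theta> A ^^ l) U = U * fb a d (G0 + E) D)"
proof -
  define good where "good k l U X \<longleftrightarrow> k \<le> n \<and> 0 < l \<and> GLO n U \<and> X \<in> carrier_mat n n \<and>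
    (fr \<theta> A ^^ l) U = U * X \<and> (\<forall>i j. k \<le> i \<longrightarrow> i < n \<longrightarrow> j < n \<longrightarrow> vge 1 (X $$ (i,j)))" for k l U X
  have "good n 1 (1\<^sub>m n) A" using A fr_one[OF a A(1)] by (auto simp: good_def)
  then have ex: "\<exists>k. \<exists>l U X. good k l U X" by blast
  define k where "k = (LEAST k. \<exists>l U X. good k l U X)"
  obtain l U X where good: "good k l U X" using LeastI_ex[OF ex] unfolding k_def by blast
  have least: "\<not> good k' l' U' X'" if "k' < k" for k' l' U' X'
    using not_less_Least[of k' "\<lambda>k. \<exists>l U X. good k l U X"] that unfolding k_def by blast
  from good have k: "k \<le> n" and l: "0 < l" and U: "GLO n U" and X: "X \<in> carrier_mat n n"
    and eq: "(fr \<theta> A ^^ l) U = U * X" and low: "\<And>i j. k \<le> i \<Longrightarrow> i < n \<Longrightarrow> j < n \<Longrightarrow> vge 1 (X $$ (i,j))"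
    unfolding good_def by auto
  define \<eta> where "\<eta> = \<theta> ^^ l"
  have ae: "aut \<eta>" using a by (simp add: \<eta>_def)
  note Uc = GLO_carrier[OF U]
  obtain U' where U': "GLO n U'" "U * U' = 1\<^sub>m n" "U' * U = 1\<^sub>m n" using GLO_obtain[OF U] by metis
  note U'c = GLO_carrier[OF U'(1)]
  have Xm: "mge 0 X"
  proof -
    have "U' * (U * X) = X" using U'(3) assoc_mult_mat[OF U'c Uc X] X by simp
    moreover have "mge 0 (U' * (U * X))" unfolding eq[symmetric]
      by (rule mge_mult0(1)[of _ _ _ n n n]) (use fr_pow_mge[OF a A(1,2) Uc GLO_mge[OF U]] GLO_mge[OF U'(1)] U'c A Uc in auto)
    ultimately show ?thesis by simp
  qed
  have "k \<noteq> 0"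
  proof
    assume "k = 0"
    then have "mge 1 X" using low X by (auto simp: mge_def)
    have "(fr \<theta> A ^^ l) (1\<^sub>m n) = (fr \<theta> A ^^ l) (U * U')" using U' by simp
    also have "\<dots> = U * X * map_mat \<eta> U'" unfolding fr_pow_mult[OF a A(1) Uc U'c] eq \<eta>_def ..
    finally have "(fr \<theta> A ^^ l) (1\<^sub>m n) = U * X * map_mat \<eta> U'" .
    moreover have "mge 1 (U * X * map_mat \<eta> U')"
    proof (rule mge_mult0(2)[of _ _ _ n n n])
      show "mge 1 (U * X)" by (rule mge_mult0(1)[OF GLO_mge[OF U] \<open>mge 1 X\<close> Uc X])
    qed (use GLO_mge[OF U'(1)] ae Uc U'c X in auto)
    ultimately show False using nonnil[OF l] by simp
  qed
  define d where "d = n - k"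
  have n: "n = k + d" using k by (simp add: d_def)
  have G: "GLO k (top_left k X)"
  proof (rule ccontr)
    assume "\<not> ?thesis"
    moreover have "mge 0 (top_left k X)" using Xm X k by (auto simp: mge_def top_left_def)
    ultimately obtain W0 where W0: "GLO k W0" "\<And>j. j < k \<Longrightarrow> vge 1 ((W0 * top_left k X) $$ (k - 1, j))"
      using not_GLO_row[of "top_left k X" k] by auto
    note W0c = GLO_carrier[OF W0(1)]
    define V where "V = fb k d W0 (1\<^sub>m d)"
    have V: "GLO n V" unfolding V_def n by (rule fb_GLO[OF W0(1) GLO_one])
    note Vc = GLO_carrier[OF V]
    obtain V' where V': "GLO n V'" "V * V' = 1\<^sub>m n" "V' * V = 1\<^sub>m n" using GLO_obtain[OF V] by metis
    note V'c = GLO_carrier[OF V'(1)]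
    \<comment> \<open>After the change of basis \<open>V\<close>, row \<open>k - 1\<close> is
      divisible by \<pi> in the first \<open>k\<close> columns. Multiplication by \<eta>(X), whose
      rows from \<open>k\<close> on are divisible by \<pi>, makes the whole row divisible, so the
      doubled iterate contradicts minimality.\<close>
    define Y where "Y = V * X"
    define M where "M = map_mat \<eta> (map_mat \<eta> V')"
    have c: "Y \<in> carrier_mat n n" "M \<in> carrier_mat n n" "map_mat \<eta> X \<in> carrier_mat n n"
      using Vc X V'c by (auto simp: Y_def M_def)
    have Mm: "mge 0 M" using GLO_mge[OF V'(1)] ae by (simp add: M_def)
    have Ym: "mge 0 Y" unfolding Y_def by (rule mge_mult0(1)[OF GLO_mge[OF V] Xm Vc X])
    have Yrow: "vge 1 (Y $$ (i,j))" if i: "k - 1 \<le> i" "i < n" and j: "j < k" for i j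
    proof -
      have Ys: "Y $$ (i,j) = (\<Sum>q<n. V $$ (i,q) * X $$ (q,j))"
        unfolding Y_def by (rule mult_mat_index[OF Vc X]) (use i j k in auto)
      show ?thesis
      proof (cases "i < k")
        case True
        then have ik: "i = k - 1" using i by simp
        have "(\<Sum>q<n. V $$ (i,q) * X $$ (q,j)) = (\<Sum>q<k. W0 $$ (i,q) * top_left k X $$ (q,j))"
          by (rule sum.mono_neutral_cong_right) (use True n j W0c in \<open>auto simp: V_def fb_def top_left_def\<close>)
        also have "\<dots> = (W0 * top_left k X) $$ (i,j)"
          by (rule mult_mat_index[symmetric, OF W0c top_left_carrier]) (use True j in auto)
        finally show ?thesis using W0(2)[OF j] Ys ik by simp
      next
        case False
        have "(\<Sum>q<n. V $$ (i,q) * X $$ (q,j)) = (\<Sum>q<n. (if i = q then 1 else 0) * X $$ (q,j))"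
          by (rule sum.cong) (use False i n W0c in \<open>auto simp: V_def fb_def\<close>)
        then show ?thesis using Ys low[of i j] False i j k by simp
      qed
    qed
    have row1: "vge 1 ((Y * map_mat \<eta> X) $$ (i,j))" if i: "k - 1 \<le> i" "i < n" and j: "j < n" for i j
    proof -
      have "(Y * map_mat \<eta> X) $$ (i,j) = (\<Sum>q<n. Y $$ (i,q) * map_mat \<eta> X $$ (q,j))"
        by (rule mult_mat_index[OF c(1,3) i(2) j])
      moreover have "vge 1 (Y $$ (i,q) * map_mat \<eta> X $$ (q,j))" if q: "q < n" for q
      proof (cases "q < k")
        case True
        have "vge 0 (map_mat \<eta> X $$ (q,j))" using mge_D[of 0 "map_mat \<eta> X" n n q j] Xm ae c q j by simp
        then show ?thesis using Yrow[OF i True] by (intro vge_mult0(2))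
      next
        case False
        have "vge 1 (map_mat \<eta> X $$ (q,j))" using low[of q j] False q j X aut_vge[OF ae] by simp
        moreover have "vge 0 (Y $$ (i,q))" using mge_D[OF Ym c(1) i(2) q] .
        ultimately show ?thesis by (intro vge_mult0(1))
      qed
      ultimately show ?thesis by (auto intro: vge_sum)
    qed
    define X2 where "X2 = Y * map_mat \<eta> X * M"
    have X2c: "X2 \<in> carrier_mat n n" using c by (simp add: X2_def)
    have row2: "vge 1 (X2 $$ (i,j))" if i: "k - 1 \<le> i" "i < n" and j: "j < n" for i j
    proof -
      have "X2 $$ (i,j) = (\<Sum>q<n. (Y * map_mat \<eta> X) $$ (i,q) * M $$ (q,j))"
        unfolding X2_def by (rule mult_mat_index[of _ n n _ n]) (use c i j in auto)
      moreover have "vge 1 ((Y * map_mat \<eta> X) $$ (i,q) * M $$ (q,j))" if q: "q < n" for q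
        using row1[OF i q] mge_D[OF Mm c(2) q j] by (rule vge_mult0(2))
      ultimately show ?thesis by (auto intro: vge_sum)
    qed
    have "(fr \<theta> A ^^ (l + l)) (U * V') = (fr \<theta> A ^^ l) ((fr \<theta> A ^^ l) (U * V'))" by (simp add: funpow_add)
    also have "(fr \<theta> A ^^ l) (U * V') = U * (X * map_mat \<eta> V')"
      unfolding fr_pow_mult[OF a A(1) Uc V'c] eq \<eta>_def[symmetric] using Uc X V'c
      by (simp add: assoc_mult_mat[of _ n n _ n _ n])
    also have "(fr \<theta> A ^^ l) \<dots> = U * X * map_mat \<eta> (X * map_mat \<eta> V')"
      using fr_pow_mult[OF a A(1) Uc, of "X * map_mat \<eta> V'" n l] X V'c by (simp add: eq \<eta>_def)
    also have "\<dots> = U * (V' * V) * X * (map_mat \<eta> X * M)"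
      using X V'c U'(3) Uc V'(3) by (simp add: map_mat_mult[OF ae X] M_def)
    also have "\<dots> = (U * V') * X2" unfolding X2_def Y_def using Uc V'c Vc X c
      by (simp add: assoc_mult_mat[of _ n n _ n _ n])
    finally have "good (k - 1) (l + l) (U * V') X2"
      unfolding good_def using k l GLO_mult[OF U V'(1)] X2c row2 by auto
    then show False using least[of "k - 1"] \<open>k \<noteq> 0\<close> by auto
  qed
  show ?thesis
  proof (cases "d = 0")
    case True
    then have "GLO n X" using G n X by simp
    let ?B = "(fr \<theta> A ^^ l) (1\<^sub>m n)"
    have Bc: "?B \<in> carrier_mat n n" using A by simp
    have "?B * map_mat \<eta> U = U * X" using fr_pow_eq[OF a A(1) Uc, of l] eq by (simp add: \<eta>_def)
    \<comment> \<open>The determinant of the iterate has \<open>l\<close> times the valuation of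
      \<open>det A\<close>, and it is a unit because \<open>X\<close> and \<open>U\<close> are
      invertible over O_L.\<close>
    then have "det ?B * \<eta> (det U) = det U * det X"
      using det_mult[OF Bc, of "map_mat \<eta> U"] det_mult[OF Uc X] Uc map_mat_det[OF ae, of U] by simp
    moreover have "det ?B \<noteq> 0" "v (det ?B) = int l * v (det A)" using v_det_fr_pow[OF a A(1,3), of l] by auto
    ultimately have "int l * v (det A) = 0"
      using GLO_det[OF U] GLO_det[OF \<open>GLO n X\<close>] v_mult[of "det ?B" "\<eta> (det U)"] v_mult[of "det U" "det X"]
        aut_v[OF ae, of "det U"] aut_simps(8)[OF ae, of "det U"] by simp
    then have "GLO n A" using l A by (intro GLO_det_I) auto
    then show ?thesis by simp
  next
    case False
    define B where "B = mat k d (\<lambda>(i,j). X $$ (i, k + j))"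
    define C where "C = mat d k (\<lambda>(i,j). X $$ (k + i, j))"
    define D0 where "D0 = mat d d (\<lambda>(i,j). X $$ (k + i, k + j))"
    have Xb: "X = four_block_mat (top_left k X) B C D0"
      by (rule eq_matI) (use X n in \<open>auto simp: top_left_def B_def C_def D0_def\<close>)
    have c: "B \<in> carrier_mat k d" "C \<in> carrier_mat d k" "D0 \<in> carrier_mat d d" by (auto simp: B_def C_def D0_def)
    have m: "mge 0 B" "mge 1 C" "mge 1 D0"
      using Xm X low n by (auto simp: mge_def B_def C_def D0_def)
    obtain W E D where W: "W \<in> carrier_mat (k + d) (k + d)" "invertible_mat W" "E \<in> carrier_mat k k" "mge 1 E"
      "D \<in> carrier_mat d d" "mge 1 D" "X * map_mat \<eta> W = W * fb k d (top_left k X + E) D"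
      using block_diagonalize[OF ae G c(1) m(1) c(2) m(2) c(3) m(3)] Xb by metis
    have Wc: "W \<in> carrier_mat n n" using W(1) n by simp
    have fc: "fb k d (top_left k X + E) D \<in> carrier_mat n n" using W n by simp
    have "(fr \<theta> A ^^ l) (U * W) = U * (X * map_mat \<eta> W)"
      unfolding fr_pow_mult[OF a A(1) Uc Wc] eq \<eta>_def[symmetric] using Uc X Wc
      by (simp add: assoc_mult_mat[of _ n n _ n _ n])
    also have "\<dots> = (U * W) * fb k d (top_left k X + E) D"
      unfolding W(7) using Uc Wc fc by (simp add: assoc_mult_mat[of _ n n _ n _ n])
    finally have e: "(fr \<theta> A ^^ l) (U * W) = (U * W) * fb k d (top_left k X + E) D" .
    have "U * W \<in> carrier_mat n n" "invertible_mat (U * W)"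
      using Uc Wc invertible_mat_mult[OF Uc Wc GLO_invertible[OF U] W(2)] by auto
    then show ?thesis using \<open>k \<noteq> 0\<close> False n l G W e by blast
  qed
qed

section \<open>Growth of iterates under a twisted companion map\<close>

definition comb :: "nat \<Rightarrow> nat \<Rightarrow> (nat \<Rightarrow> 'a vec) \<Rightarrow> (nat \<Rightarrow> 'a) \<Rightarrow> 'a vec" where
  "comb n d y u = vec n (\<lambda>k. \<Sum>j<d. u j * y j $ k)"

text \<open>The map induced by \<Phi> on the coefficients of combinations of the first
  \<open>d\<close> iterates of \<open>x\<close>, when \<Phi>^d \<open>x\<close> is the combination
  with coefficients \<open>c\<close>: a shift with feedback through \<open>c\<close>.\<close>

definition cstep :: "('a \<Rightarrow> 'a) \<Rightarrow> nat \<Rightarrow> (nat \<Rightarrow> 'a) \<Rightarrow> (nat \<Rightarrow> 'a) \<Rightarrow> nat \<Rightarrow> 'a" where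
  "cstep \<tau> d c u j = (if j = 0 then 0 else \<tau> (u (j - 1))) + \<tau> (u (d - 1)) * c j"

lemma comb_carrier [simp]: "comb n d y u \<in> carrier_vec n" by (simp add: comb_def)

lemma sl_index:
  assumes "b \<in> carrier_mat n n" "w \<in> carrier_vec n" "k < n"
  shows "sl \<tau> b w $ k = (\<Sum>m<n. b $$ (k,m) * \<tau> (w $ m))"
proof -
  have "sl \<tau> b w $ k = (\<Sum>m<n. b $$ (k,m) * map_vec \<tau> w $ m)"
    unfolding sl_def by (rule mult_mat_vec_index) (use assms in auto)
  also have "\<dots> = (\<Sum>m<n. b $$ (k,m) * \<tau> (w $ m))" by (rule sum.cong) (use assms in auto)
  finally show ?thesis .
qed

lemma sl_comb:
  assumes a: "aut \<tau>" and b: "b \<in> carrier_mat n n" and y: "\<And>j. j < d \<Longrightarrow> y j \<in> carrier_vec n"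
  shows "sl \<tau> b (comb n d y u) = comb n d (\<lambda>j. sl \<tau> b (y j)) (\<lambda>j. \<tau> (u j))"
proof (rule eq_vecI)
  fix k assume "k < dim_vec (comb n d (\<lambda>j. sl \<tau> b (y j)) (\<lambda>j. \<tau> (u j)))"
  then have k: "k < n" by (simp add: comb_def)
  have "sl \<tau> b (comb n d y u) $ k = (\<Sum>m<n. b $$ (k,m) * (\<Sum>j<d. \<tau> (u j) * \<tau> (y j $ m)))"
    unfolding sl_index[OF b comb_carrier k]
    by (rule sum.cong) (auto simp: comb_def aut_sum[OF a] aut_simps(4)[OF a])
  also have "\<dots> = (\<Sum>j<d. \<tau> (u j) * (\<Sum>m<n. b $$ (k,m) * \<tau> (y j $ m)))"
    unfolding sum_distrib_left by (subst sum.swap) (simp add: algebra_simps)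
  also have "\<dots> = (\<Sum>j<d. \<tau> (u j) * sl \<tau> b (y j) $ k)"
    by (rule sum.cong) (use y in \<open>auto simp: sl_index[OF b _ k]\<close>)
  finally show "sl \<tau> b (comb n d y u) $ k = comb n d (\<lambda>j. sl \<tau> b (y j)) (\<lambda>j. \<tau> (u j)) $ k"
    using k by (simp add: comb_def)
qed (use carrier_vecD[OF sl_carrier[OF b]] in \<open>simp add: comb_def\<close>)

lemma sl_comb_step:
  assumes a: "aut \<tau>" and b: "b \<in> carrier_mat n n" and x: "x \<in> carrier_vec n" and d: "0 < d"
    and rel: "(sl \<tau> b ^^ d) x = comb n d (\<lambda>j. (sl \<tau> b ^^ j) x) c"
  shows "(sl \<tau> b ^^ m) (comb n d (\<lambda>j. (sl \<tau> b ^^ j) x) u) = comb n d (\<lambda>j. (sl \<tau> b ^^ j) x) ((cstep \<tau> d c ^^ m) u)"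
proof -
  let ?y = "\<lambda>j. (sl \<tau> b ^^ j) x"
  have one: "sl \<tau> b (comb n d ?y u) = comb n d ?y (cstep \<tau> d c u)" for u
  proof -
    obtain d' where d': "d = Suc d'" using d by (cases d) auto
    have "sl \<tau> b (comb n d ?y u) = comb n d (\<lambda>j. sl \<tau> b (?y j)) (\<lambda>j. \<tau> (u j))"
      by (rule sl_comb[OF a b]) (use b x in auto)
    also have "\<dots> = comb n d ?y (cstep \<tau> d c u)"
    proof (rule eq_vecI)
      fix k assume "k < dim_vec (comb n d ?y (cstep \<tau> d c u))"
      then have k: "k < n" by (simp add: comb_def)
      have "(\<Sum>j<d. \<tau> (u j) * ?y (Suc j) $ k) = (\<Sum>j<d'. \<tau> (u j) * ?y (Suc j) $ k) + \<tau> (u d') * ?y d $ k"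
        by (simp add: d' del: funpow.simps)
      also have "?y d $ k = (\<Sum>j<d. c j * ?y j $ k)" unfolding rel using k by (simp add: comb_def)
      also have "(\<Sum>j<d'. \<tau> (u j) * ?y (Suc j) $ k) = (\<Sum>j<d. (if j = 0 then 0 else \<tau> (u (j - 1))) * ?y j $ k)"
        unfolding d' sum.lessThan_Suc_shift by simp
      finally show "comb n d (\<lambda>j. sl \<tau> b (?y j)) (\<lambda>j. \<tau> (u j)) $ k = comb n d ?y (cstep \<tau> d c u) $ k"
        using k d' by (simp add: comb_def cstep_def sum.distrib sum_distrib_left algebra_simps)
    qed (simp add: comb_def)
    finally show ?thesis .
  qed
  show ?thesis by (induction m) (simp_all add: one)
qed

text \<open>The first linear dependence among the iterates of \<open>x\<close>. Its coefficients are
  not all zero because \<Phi> is injective.\<close>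

lemma krylov_relation:
  assumes a: "aut \<tau>" and b: "b \<in> carrier_mat n n" "invertible_mat b" and x: "x \<in> carrier_vec n" "x \<noteq> 0\<^sub>v n"
  shows "\<exists>d c. 0 < d \<and> d \<le> n \<and> indep n d (\<lambda>j k. (sl \<tau> b ^^ j) x $ k) \<and>
    (sl \<tau> b ^^ d) x = comb n d (\<lambda>j. (sl \<tau> b ^^ j) x) c \<and> (\<exists>i<d. c i \<noteq> 0)"
proof -
  let ?y = "\<lambda>j. (sl \<tau> b ^^ j) x" let ?K = "\<lambda>j k. ?y j $ k"
  have bd: "d \<le> n" if "indep n d ?K" for d using indep_dim[OF that, of "{..<n}"] by simp
  define d where "d = Max {d. indep n d ?K}"
  have S: "finite {d. indep n d ?K}" by (rule finite_subset[of _ "{..n}"]) (use bd in auto)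
  have "0 \<in> {d. indep n d ?K}" by (simp add: indep_def)
  then have ind: "indep n d ?K" using Max_in[OF S] unfolding d_def by blast
  have "\<not> indep n (Suc d) ?K" using Max_ge[OF S, of "Suc d"] unfolding d_def[symmetric] by auto
  then obtain u j0 where u: "\<And>k. k < n \<Longrightarrow> (\<Sum>j<Suc d. u j * ?K j k) = 0" "j0 < Suc d" "u j0 \<noteq> 0"
    unfolding indep_def by blast
  have ud: "u d \<noteq> 0"
  proof
    assume "u d = 0"
    then have "\<And>k. k < n \<Longrightarrow> (\<Sum>j<d. u j * ?K j k) = 0" using u(1) by simp
    from indepD[OF ind this] u(2,3) \<open>u d = 0\<close> show False by (metis less_Suc_eq)
  qed
  define c where "c j = - u j / u d" for j
  have rel: "?y d = comb n d ?y c"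
  proof (rule eq_vecI)
    fix k assume "k < dim_vec (comb n d ?y c)"
    then have k: "k < n" by (simp add: comb_def)
    have "u d * ?K d k = - (\<Sum>j<d. u j * ?K j k)" using u(1)[OF k] by (simp add: add_eq_0_iff)
    then have "?K d k = - (\<Sum>j<d. u j * ?K j k) / u d" using ud by (simp add: field_simps)
    also have "\<dots> = (\<Sum>j<d. c j * ?K j k)" by (simp add: c_def sum_divide_distrib sum_negf)
    finally show "?y d $ k = comb n d ?y c $ k" using k by (simp add: comb_def)
  qed (use carrier_vecD[OF sl_pow_carrier[OF b(1) x(1)]] in \<open>simp add: comb_def\<close>)
  have nz: "?y j \<noteq> 0\<^sub>v n" for j
  proof (induction j)
    case (Suc j)
    show ?case
    proof
      assume z: "?y (Suc j) = 0\<^sub>v n"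
      obtain b' where b': "b' \<in> carrier_mat n n" "b' * b = 1\<^sub>m n" using b invertible_mat_obtain by metis
      have m: "map_vec \<tau> (?y j) \<in> carrier_vec n" using b x by simp
      have "b *\<^sub>v map_vec \<tau> (?y j) = 0\<^sub>v n" using z by (simp add: sl_def[of \<tau> b "?y j"])
      then have "(b' * b) *\<^sub>v map_vec \<tau> (?y j) = 0\<^sub>v n"
        using assoc_mult_mat_vec[OF b'(1) b(1) m] b'(1) by (auto intro!: eq_vecI)
      then have z2: "map_vec \<tau> (?y j) = 0\<^sub>v n" using b'(2) m by simp
      have "?y j = 0\<^sub>v n"
      proof (rule eq_vecI)
        fix k assume "k < dim_vec (0\<^sub>v n :: 'a vec)"
        then have k: "k < n" by simp
        have "\<tau> (?y j $ k) = map_vec \<tau> (?y j) $ k" using k carrier_vecD[OF sl_pow_carrier[OF b(1) x(1)]] by simp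
        then show "?y j $ k = 0\<^sub>v n $ k" using z2 k aut_simps(8)[OF a] by simp
      qed (use carrier_vecD[OF sl_pow_carrier[OF b(1) x(1)]] in simp)
      then show False using Suc by simp
    qed
  qed (use x in simp)
  have "\<exists>i<d. c i \<noteq> 0"
  proof (rule ccontr)
    assume "\<not> ?thesis"
    then have "comb n d ?y c = 0\<^sub>v n" by (intro eq_vecI) (auto simp: comb_def)
    then show False using nz[of d] rel by simp
  qed
  then show ?thesis using bd[OF ind] ind rel by (intro exI[of _ d] exI[of _ c]) auto
qed

text \<open>The fraction \<open>r / s\<close> is the smallest slope of the Newton polygon of the
  relation, the minimum of \<open>v (c i) / (d - i)\<close>; it is written with the denominator of
  an index attaining it, not in lowest terms. Choosing \<open>i0\<close> as the least index of
  equality gives strictness below it.\<close>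

lemma min_slope_exists:
  fixes c :: "nat \<Rightarrow> 'a"
  assumes "\<exists>i<d. c i \<noteq> 0"
  shows "\<exists>(r::int) (s::nat) i0. 0 < s \<and> i0 < d \<and> c i0 \<noteq> 0 \<and> int s * v (c i0) = r * int (d - i0) \<and>
    (\<forall>i<d. c i \<noteq> 0 \<longrightarrow> r * int (d - i) \<le> int s * v (c i)) \<and>
    (\<forall>i<i0. c i \<noteq> 0 \<longrightarrow> r * int (d - i) < int s * v (c i))"
proof -
  let ?J = "{i. i < d \<and> c i \<noteq> 0}"
  let ?q = "\<lambda>i. (of_int (v (c i)) / of_nat (d - i) :: rat)"
  have J: "finite ?J" by (rule finite_subset[of _ "{..<d}"]) auto
  have "Min (?q ` ?J) \<in> ?q ` ?J" by (rule Min_in) (use J assms in auto)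
  then obtain i1 where i1: "i1 < d" "c i1 \<noteq> 0" "?q i1 = Min (?q ` ?J)" by auto
  define r where "r = v (c i1)"
  define s where "s = d - i1"
  have s: "0 < s" using i1 by (simp add: s_def)
  have le: "r * int (d - i) \<le> int s * v (c i)" if "i < d" "c i \<noteq> 0" for i
  proof -
    have "?q i1 \<le> ?q i" unfolding i1(3) by (rule Min_le) (use J that in auto)
    then have "of_int r * (of_nat (d - i) :: rat) \<le> of_nat s * of_int (v (c i))"
      using that s by (simp add: r_def s_def field_simps)
    then have "of_int (r * int (d - i)) \<le> (of_int (int s * v (c i)) :: rat)" by simp
    then show ?thesis by (simp only: of_int_le_iff)
  qed
  let ?P = "\<lambda>i. i < d \<and> c i \<noteq> 0 \<and> int s * v (c i) = r * int (d - i)"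
  have "?P i1" using i1 by (simp add: r_def s_def)
  then have P: "?P (LEAST i. ?P i)" by (rule LeastI)
  have "r * int (d - i) < int s * v (c i)" if "i < (LEAST i. ?P i)" "c i \<noteq> 0" for i
  proof -
    have "\<not> ?P i" using that(1) by (rule not_less_Least)
    moreover have "i < d" using that P by simp
    ultimately show ?thesis using le[of i] that by force
  qed
  then show ?thesis using P s le by (intro exI[of _ r] exI[of _ s] exI[of _ "LEAST i. ?P i"]) auto
qed

text \<open>A weighted valuation in which the i-th iterate counts \<open>r * i / s\<close>,
  multiplied by \<open>s\<close> to stay in the integers.\<close>

definition wg :: "nat \<Rightarrow> int \<Rightarrow> int \<Rightarrow> nat \<Rightarrow> 'a \<Rightarrow> bool" where
  "wg s r \<kappa> i x \<longleftrightarrow> x = 0 \<or> \<kappa> \<le> int s * v x + r * int i"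

text \<open>Asking that the minimum be attained only at indices \<open>\<ge> i0\<close> rules out cancellation under the companion map.\<close>

definition attains :: "nat \<Rightarrow> int \<Rightarrow> nat \<Rightarrow> nat \<Rightarrow> int \<Rightarrow> (nat \<Rightarrow> 'a) \<Rightarrow> bool" where
  "attains s r d i0 \<kappa> u \<longleftrightarrow> (\<forall>i<d. wg s r \<kappa> i (u i)) \<and> (\<forall>i<i0. wg s r (\<kappa> + 1) i (u i)) \<and>
     (\<exists>i. i0 \<le> i \<and> i < d \<and> u i \<noteq> 0 \<and> int s * v (u i) + r * int i = \<kappa>)"

text \<open>The coefficients of weight at least \<kappa> at a fixed index form a fractional ideal;
  its exponent is obtained by rounding.\<close>

lemma wg_iff_vge:
  assumes "0 < s" shows "wg s r \<kappa> i x \<longleftrightarrow> vge (- ((r * int i - \<kappa>) div int s)) x"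
proof -
  have "\<kappa> \<le> int s * v x + r * int i \<longleftrightarrow> - ((r * int i - \<kappa>) div int s) \<le> v x"
  proof -
    have "(- v x \<le> (r * int i - \<kappa>) div int s) \<longleftrightarrow> (- v x) * int s \<le> r * int i - \<kappa>"
    proof
      assume "- v x \<le> (r * int i - \<kappa>) div int s"
      then have "- v x * int s \<le> (r * int i - \<kappa>) div int s * int s" by (rule mult_right_mono) simp
      also have "\<dots> \<le> r * int i - \<kappa>" using assms
        by (metis (no_types) mult.commute of_nat_0_less_iff pos_mod_sign add_le_cancel_left add.right_neutral mult_div_mod_eq)
      finally show "- v x * int s \<le> r * int i - \<kappa>" .
    next
      assume "- v x * int s \<le> r * int i - \<kappa>"
      then have "(- v x * int s) div int s \<le> (r * int i - \<kappa>) div int s" using assms by (intro zdiv_mono1) auto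
      moreover have "(- v x * int s) div int s = - v x" using assms by (intro nonzero_mult_div_cancel_right) simp
      ultimately show "- v x \<le> (r * int i - \<kappa>) div int s" by simp
    qed
    then show ?thesis by (auto simp: mult.commute)
  qed
  then show ?thesis by (simp add: wg_def vge_def)
qed

lemma wg_add: "0 < s \<Longrightarrow> wg s r \<kappa> i x \<Longrightarrow> wg s r \<kappa> i y \<Longrightarrow> wg s r \<kappa> i (x + y)"
  by (simp add: wg_iff_vge vge_add)

text \<open>The shift raises the index by one and so the weight by \<open>r\<close>; the feedback
  replaces index \<open>d\<close> by \<open>j\<close>, and the valuation of \<open>c j\<close> makes
  up for the difference by the choice of \<open>r / s\<close>.\<close>

lemma cstep_wg:
  assumes a: "aut \<tau>" and s: "0 < s" and d: "0 < d"
    and c: "\<And>i. i < d \<Longrightarrow> c i \<noteq> 0 \<Longrightarrow> r * int (d - i) \<le> int s * v (c i)"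
    and u: "\<And>i. i < d \<Longrightarrow> wg s r \<kappa> i (u i)"
  shows "j < d \<Longrightarrow> wg s r (\<kappa> + r) j (cstep \<tau> d c u j)"
proof -
  assume j: "j < d"
  have 1: "wg s r (\<kappa> + r) j (if j = 0 then 0 else \<tau> (u (j - 1)))"
    using u[of "j - 1"] j by (cases j) (auto simp: wg_def aut_v[OF a] aut_simps(1)[OF a] algebra_simps)
  have 2: "wg s r (\<kappa> + r) j (\<tau> (u (d - 1)) * c j)"
  proof (cases "u (d - 1) = 0 \<or> c j = 0")
    case True
    then show ?thesis by (auto simp: wg_def aut_simps(1)[OF a])
  next
    case False
    have "v (\<tau> (u (d - 1)) * c j) = v (u (d - 1)) + v (c j)"
      using False by (simp add: v_mult aut_v[OF a] aut_simps(8)[OF a])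
    moreover have "\<kappa> \<le> int s * v (u (d - 1)) + r * int (d - 1)" using u[of "d - 1"] d False by (simp add: wg_def)
    moreover have "r * int (d - j) \<le> int s * v (c j)" using c[OF j] False by simp
    moreover have "r * int (d - 1) = r * int d - r" "r * int (d - j) = r * int d - r * int j"
      using d j by (simp_all add: of_nat_diff algebra_simps)
    ultimately show ?thesis by (simp add: wg_def algebra_simps)
  qed
  show "wg s r (\<kappa> + r) j (cstep \<tau> d c u j)" unfolding cstep_def by (rule wg_add[OF s 1 2])
qed

lemma cstep_pow_wg:
  assumes a: "aut \<tau>" and s: "0 < s" and d: "0 < d"
    and c: "\<And>i. i < d \<Longrightarrow> c i \<noteq> 0 \<Longrightarrow> r * int (d - i) \<le> int s * v (c i)"
    and u: "\<And>i. i < d \<Longrightarrow> wg s r \<kappa> i (u i)"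
  shows "j < d \<Longrightarrow> wg s r (\<kappa> + r * int m) j ((cstep \<tau> d c ^^ m) u j)"
proof (induction m arbitrary: j)
  case (Suc m)
  have "wg s r (\<kappa> + r * int m + r) j (cstep \<tau> d c ((cstep \<tau> d c ^^ m) u) j)"
    by (rule cstep_wg[OF a s d c]) (use Suc in auto)
  then show ?case by (simp add: algebra_simps)
qed (use u in simp)

text \<open>The weight rises by exactly \<open>r\<close>. If the top coefficient attains the
  minimum, so does its feedback into position \<open>i0\<close>, the neighbour shifted there being
  strictly heavier. Otherwise the attaining position \<open>i\<close> moves to \<open>i + 1\<close>,
  where the feedback is strictly heavier.\<close>

lemma cstep_attains:
  assumes a: "aut \<tau>" and s: "0 < s" and i0: "i0 < d"
    and c: "\<And>i. i < d \<Longrightarrow> c i \<noteq> 0 \<Longrightarrow> r * int (d - i) \<le> int s * v (c i)"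
    and c0: "c i0 \<noteq> 0" "int s * v (c i0) = r * int (d - i0)"
    and c1: "\<And>i. i < i0 \<Longrightarrow> c i \<noteq> 0 \<Longrightarrow> r * int (d - i) < int s * v (c i)"
    and u: "attains s r d i0 \<kappa> u"
  shows "attains s r d i0 (\<kappa> + r) (cstep \<tau> d c u)"
proof -
  have d: "0 < d" using i0 by simp
  have u1: "\<And>i. i < d \<Longrightarrow> wg s r \<kappa> i (u i)" and u2: "\<And>i. i < i0 \<Longrightarrow> wg s r (\<kappa> + 1) i (u i)"
    using u by (auto simp: attains_def)
  obtain i where i: "i0 \<le> i" "i < d" "u i \<noteq> 0" "int s * v (u i) + r * int i = \<kappa>"
    using u unfolding attains_def by blast
  have shift: "wg s r (\<kappa>' + r) j (if j = 0 then 0 else \<tau> (u (j - 1)))"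
    if "0 < j \<Longrightarrow> wg s r \<kappa>' (j - 1) (u (j - 1))" for \<kappa>' j
    using that by (cases j) (auto simp: wg_def aut_v[OF a] aut_simps(1)[OF a] algebra_simps)
  have prod: "wg s r (\<kappa>1 + \<kappa>2 + r) j (\<tau> (u (d - 1)) * c j)"
    if "j < d" "wg s r \<kappa>1 (d - 1) (u (d - 1))" "c j \<noteq> 0 \<Longrightarrow> r * int (d - j) + \<kappa>2 \<le> int s * v (c j)" for j \<kappa>1 \<kappa>2
  proof (cases "u (d - 1) = 0 \<or> c j = 0")
    case True
    then show ?thesis by (auto simp: wg_def aut_simps(1)[OF a])
  next
    case False
    have "v (\<tau> (u (d - 1)) * c j) = v (u (d - 1)) + v (c j)"
      using False by (simp add: v_mult aut_v[OF a] aut_simps(8)[OF a])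
    moreover have "\<kappa>1 \<le> int s * v (u (d - 1)) + r * int (d - 1)" using that(2) False by (simp add: wg_def)
    moreover have "r * int (d - j) + \<kappa>2 \<le> int s * v (c j)" using that(3) False by simp
    moreover have "r * int (d - 1) = r * int d - r" "r * int (d - j) = r * int d - r * int j"
      using d that(1) by (simp_all add: of_nat_diff algebra_simps)
    ultimately show ?thesis by (simp add: wg_def algebra_simps)
  qed
  have A: "\<forall>j<d. wg s r (\<kappa> + r) j (cstep \<tau> d c u j)" using cstep_wg[OF a s d c u1] by blast
  have B: "wg s r (\<kappa> + r + 1) j (cstep \<tau> d c u j)" if j: "j < i0" for j
  proof -
    have 1: "wg s r (\<kappa> + 1 + r) j (if j = 0 then 0 else \<tau> (u (j - 1)))"
      by (rule shift) (use u2 j in auto)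
    have 2: "wg s r (\<kappa> + 1 + r) j (\<tau> (u (d - 1)) * c j)"
      by (rule prod) (use j i0 u1[of "d - 1"] d c1[OF j] in auto)
    show ?thesis using wg_add[OF s 1 2] by (simp add: cstep_def algebra_simps)
  qed
  have exact: "x + y \<noteq> 0 \<and> int s * v (x + y) + r * int j = \<kappa> + r"
    if "x \<noteq> 0" "int s * v x + r * int j = \<kappa> + r" "wg s r (\<kappa> + r + 1) j y" for x y j
  proof -
    have "vge (v x + 1) y"
    proof (cases "y = 0")
      case False
      then have "int s * v x < int s * v y" using that by (simp add: wg_def)
      then show ?thesis using s by (simp add: vge_def)
    qed simp
    from v_dominant_add[OF that(1) this] that(2) show ?thesis by simp
  qed
  have "\<exists>j. i0 \<le> j \<and> j < d \<and> cstep \<tau> d c u j \<noteq> 0 \<and> int s * v (cstep \<tau> d c u j) + r * int j = \<kappa> + r"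
  proof (cases "u (d - 1) \<noteq> 0 \<and> int s * v (u (d - 1)) + r * int (d - 1) = \<kappa>")
    case True
    let ?x = "\<tau> (u (d - 1)) * c i0"
    have x: "?x \<noteq> 0" "v ?x = v (u (d - 1)) + v (c i0)"
      using True c0 by (simp_all add: v_mult aut_v[OF a] aut_simps(8)[OF a])
    have "r * int (d - 1) = r * int d - r" "r * int (d - i0) = r * int d - r * int i0"
      using d i0 by (simp_all add: of_nat_diff algebra_simps)
    then have "int s * v ?x + r * int i0 = \<kappa> + r" using x(2) True c0 by (simp add: algebra_simps)
    moreover have "wg s r (\<kappa> + 1 + r) i0 (if i0 = 0 then 0 else \<tau> (u (i0 - 1)))"
      by (rule shift) (use u2 in auto)
    ultimately have "?x + (if i0 = 0 then 0 else \<tau> (u (i0 - 1))) \<noteq> 0 \<and>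
        int s * v (?x + (if i0 = 0 then 0 else \<tau> (u (i0 - 1)))) + r * int i0 = \<kappa> + r"
      using x(1) by (intro exact) (auto simp: algebra_simps)
    then show ?thesis using i0 by (intro exI[of _ i0]) (auto simp: cstep_def add.commute)
  next
    case False
    then have "i \<noteq> d - 1" using i by auto
    then have i': "Suc i < d" using i by simp
    have "wg s r (\<kappa> + 1) (d - 1) (u (d - 1))" using u1[of "d - 1"] d False by (auto simp: wg_def)
    then have "wg s r (\<kappa> + 1 + 0 + r) (Suc i) (\<tau> (u (d - 1)) * c (Suc i))"
      by (rule prod[OF i']) (use c[OF i'] in auto)
    moreover have "int s * v (\<tau> (u i)) + r * int (Suc i) = \<kappa> + r" using i(4) by (simp add: aut_v[OF a] algebra_simps)
    ultimately have "\<tau> (u i) + \<tau> (u (d - 1)) * c (Suc i) \<noteq> 0 \<and>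
      int s * v (\<tau> (u i) + \<tau> (u (d - 1)) * c (Suc i)) + r * int (Suc i) = \<kappa> + r"
      using i(3) aut_simps(8)[OF a] by (intro exact) (auto simp: algebra_simps)
    then show ?thesis using i i' by (intro exI[of _ "Suc i"]) (auto simp: cstep_def)
  qed
  then show ?thesis using A B unfolding attains_def by auto
qed

lemma cstep_pow_attains:
  assumes "aut \<tau>" "0 < s" "i0 < d"
    and "\<And>i. i < d \<Longrightarrow> c i \<noteq> 0 \<Longrightarrow> r * int (d - i) \<le> int s * v (c i)"
    and "c i0 \<noteq> 0" "int s * v (c i0) = r * int (d - i0)"
    and "\<And>i. i < i0 \<Longrightarrow> c i \<noteq> 0 \<Longrightarrow> r * int (d - i) < int s * v (c i)"
    and u: "attains s r d i0 \<kappa> u"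
  shows "attains s r d i0 (\<kappa> + r * int m) ((cstep \<tau> d c ^^ m) u)"
proof (induction m)
  case (Suc m)
  from cstep_attains[OF assms(1-7) Suc] show ?case by (simp add: algebra_simps)
qed (use u in simp)

lemma attains_unit: "i0 < d \<Longrightarrow> attains s r d i0 (r * int i0) (\<lambda>i. if i = i0 then 1 else 0)"
  unfolding attains_def wg_def by (auto intro!: exI[of _ i0])

end

section \<open>Existence of slope bases\<close>

context dvf
begin

lemma map_vec_mult_mat_vec:
  assumes "aut \<tau>" "X \<in> carrier_mat n m" "t \<in> carrier_vec m"
  shows "map_vec \<tau> (X *\<^sub>v t) = map_mat \<tau> X *\<^sub>v map_vec \<tau> t"
proof -
  interpret comm_ring_hom \<tau> using assms(1) by (rule aut_hom)
  show ?thesis by (rule mult_mat_vec_hom[OF assms(2,3)])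
qed

lemma sl_mult_mat_vec:
  assumes "aut \<tau>" "b \<in> carrier_mat n n" "X \<in> carrier_mat n m" "t \<in> carrier_vec m"
  shows "sl \<tau> b (X *\<^sub>v t) = fr \<tau> b X *\<^sub>v map_vec \<tau> t"
  using assms by (simp add: sl_def fr_def map_vec_mult_mat_vec[of \<tau> X n m t] assoc_mult_mat_vec[of _ n n _ m])

lemma sl_pow_mult_mat_vec:
  assumes "aut \<tau>" "b \<in> carrier_mat n n" "X \<in> carrier_mat n m" "t \<in> carrier_vec m"
  shows "(sl \<tau> b ^^ k) (X *\<^sub>v t) = (fr \<tau> b ^^ k) X *\<^sub>v map_vec (\<tau> ^^ k) t"
proof (induction k)
  case 0
  have "map_vec (\<tau> ^^ 0) t = t" by (intro eq_vecI) auto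
  then show ?case by (subst \<open>map_vec (\<tau> ^^ 0) t = t\<close>) simp
next
  case (Suc k)
  have "map_vec \<tau> (map_vec (\<tau> ^^ k) t) = map_vec (\<tau> ^^ Suc k) t" by (intro eq_vecI) auto
  then show ?case using assms Suc by (simp add: sl_mult_mat_vec[of _ _ n _ m] comp_def)
qed

lemma dg_central: "A \<in> carrier_mat n n \<Longrightarrow> A * dg n (\<lambda>_. c) = dg n (\<lambda>_. c) * A"
  by (simp add: mat_commute_dg_iff)

lemma scaled_iterate:
  assumes a: "aut \<tau>" and b: "b \<in> carrier_mat n n" and Y: "Y \<in> carrier_mat n n" and A: "A \<in> carrier_mat n n"
    and eq: "(fr \<tau> b ^^ s) Y = Y * (dg n (\<lambda>_. r) * A)" and X: "X \<in> carrier_mat n m"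
  shows "(fr \<tau> b ^^ (s * l)) (Y * X) = Y * (dg n (\<lambda>_. r * int l) * (fr (\<tau> ^^ s) A ^^ l) X)"
proof (induction l)
  case 0
  show ?case using Y X by simp
next
  case (Suc l)
  let ?A = "(fr (\<tau> ^^ s) A ^^ l) X" let ?D = "dg n (\<lambda>_. r * int l)"
  have Ac: "?A \<in> carrier_mat n m" using A X by simp
  let ?M = "map_mat (\<tau> ^^ s) ?A"
  have Mc: "?M \<in> carrier_mat n m" using Ac by simp
  have Mc': "?D * ?M \<in> carrier_mat n m" "A * ?M \<in> carrier_mat n m" "?D * (A * ?M) \<in> carrier_mat n m"
    "A * (?D * ?M) \<in> carrier_mat n m"
    using mult_carrier_mat[OF dg_carrier Mc] mult_carrier_mat[OF A Mc] mult_carrier_mat dg_carrier A by blast+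
  have "(fr \<tau> b ^^ (s * Suc l)) (Y * X) = (fr \<tau> b ^^ s) (Y * (?D * ?A))"
    by (simp add: funpow_add Suc)
  also have "\<dots> = Y * (dg n (\<lambda>_. r) * A) * (?D * ?M)"
    using fr_pow_mult[OF a b Y mult_carrier_mat[OF dg_carrier Ac], of s] Ac a
    by (simp add: eq map_mat_mult[OF aut_funpow[OF a], of _ n n _ m])
  also have "\<dots> = Y * (dg n (\<lambda>_. r) * (A * ?D) * ?M)"
    using Y A Mc Mc' by (simp add: assoc_mult_mat[of _ n n _ n _ m] assoc_mult_mat[of _ n n _ n _ n])
  also have "\<dots> = Y * ((dg n (\<lambda>_. r) * ?D) * (A * ?M))"
    unfolding dg_central[OF A] using Y A Mc Mc' by (simp add: assoc_mult_mat[of _ n n _ n _ m] assoc_mult_mat[of _ n n _ n _ n])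
  also have "dg n (\<lambda>_. r) * ?D = dg n (\<lambda>_. r * int (Suc l))" by (simp add: dg_mult_dg algebra_simps)
  finally show ?case by (simp add: fr_def[of "\<tau> ^^ s" A ?A])
qed

lemma attains_scale:
  assumes "attains s r d i0 \<kappa> u"
  shows "attains s r d i0 (\<kappa> + int s * t) (\<lambda>i. \<pi> powi t * u i)"
proof -
  have *: "wg s r (\<kappa>' + int s * t) i (\<pi> powi t * u i)" if "wg s r \<kappa>' i (u i)" for \<kappa>' i
    using that by (cases "u i = 0") (auto simp: wg_def v_mult algebra_simps)
  show ?thesis using assms *[of \<kappa>] *[of "\<kappa> + 1"]
    unfolding attains_def by (auto simp: v_mult algebra_simps)
qed

text \<open>The columns of \<open>Y\<close> span the vectors of weight at least 0 with respect to
  the iterates of a cyclic vector. Since \<Phi>^s raises weights by \<open>r * s\<close>, as does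
  multiplication by \<pi>^r, the matrix \<open>A\<close> of \<pi>^(-r) \<Phi>^s is integral; since
  some weights rise by exactly that amount, no iterate of \<open>A\<close> is divisible by
  \<pi>.\<close>

lemma integral_operator:
  assumes a: "aut \<tau>" "aperiodic \<tau>" and b: "b \<in> carrier_mat n n" "invertible_mat b" and n: "0 < n"
  shows "\<exists>Y A r s. Y \<in> carrier_mat n n \<and> invertible_mat Y \<and> 0 < s \<and> A \<in> carrier_mat n n \<and> mge 0 A \<and>
    (fr \<tau> b ^^ s) Y = Y * (dg n (\<lambda>_. r) * A) \<and>
    (\<forall>l>0. \<not> mge 1 ((fr (\<tau> ^^ s) A ^^ l) (1\<^sub>m n)))"
proof -
  obtain x where x: "x \<in> carrier_vec n" "indep n n (\<lambda>j k. (sl \<tau> b ^^ j) x $ k)"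
    using cyclic_vector_exists[OF a b] by blast
  let ?y = "\<lambda>j. (sl \<tau> b ^^ j) x"
  have "x \<noteq> 0\<^sub>v n"
  proof
    assume z: "x = 0\<^sub>v n"
    have "(\<Sum>j<n. (if j = 0 then 1 else 0) * ?y j $ k) = 0" if "k < n" for k
      by (rule sum.neutral) (use z that in auto)
    from indepD[OF x(2) this, of 0] n show False by simp
  qed
  then obtain d c where dc: "0 < d" "d \<le> n" "?y d = comb n d ?y c" "\<exists>i<d. c i \<noteq> 0"
    using krylov_relation[OF a(1) b x(1)] by blast
  have "d = n"
  proof (rule ccontr)
    assume "d \<noteq> n"
    then have "indep n (Suc d) (\<lambda>j k. ?y j $ k)" using indep_mono[OF x(2)] dc(2) by simp
    moreover have "(\<Sum>j<Suc d. (if j = d then - 1 else c j) * ?y j $ k) = 0" if "k < n" for k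
      using arg_cong[OF dc(3), of "\<lambda>w. w $ k"] that by (simp add: comb_def)
    ultimately show False using indepD[of n "Suc d" _ "\<lambda>j. if j = d then - 1 else c j" d] by fastforce
  qed
  then have rel: "?y n = comb n n ?y c" and cnz: "\<exists>i<n. c i \<noteq> 0" using dc by auto
  from min_slope_exists[OF cnz] obtain r s i0 where s: "0 < s" and i0: "i0 < n" and c0: "c i0 \<noteq> 0" "int s * v (c i0) = r * int (n - i0)"
    and c: "\<And>i. i < n \<Longrightarrow> c i \<noteq> 0 \<Longrightarrow> r * int (n - i) \<le> int s * v (c i)"
    and c1: "\<And>i. i < i0 \<Longrightarrow> c i \<noteq> 0 \<Longrightarrow> r * int (n - i) < int s * v (c i)" by blast
  \<comment> \<open>Scaling by \<pi> moves weights in steps of \<open>s\<close>, so the generator at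
    index \<open>i\<close> takes the rounded exponent.\<close>
  define q where "q i = (r * int i) div int s" for i
  have q: "int s * q i \<le> r * int i" for i
  proof -
    have "0 \<le> (r * int i) mod int s" using s by simp
    then show ?thesis using mult_div_mod_eq[of "int s" "r * int i"] unfolding q_def by linarith
  qed
  have wgq: "wg s r (r * int s * t) i z \<longleftrightarrow> vge (r * t - q i) z" for t i z
  proof -
    have "(r * int i - r * int s * t) div int s = ((- r * t) * int s + r * int i) div int s" by (simp add: algebra_simps)
    also have "\<dots> = - r * t + q i" unfolding q_def by (rule div_mult_self3) (use s in simp)
    finally show ?thesis by (simp add: wg_iff_vge[OF s])
  qed
  define Q where "Q = mat n n (\<lambda>(k,j). ?y j $ k)"
  have Qc: "Q \<in> carrier_mat n n" by (simp add: Q_def)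
  have comb: "comb n n ?y u = Q *\<^sub>v vec n u" for u
    by (rule eq_vecI) (auto simp: comb_def Q_def mult_mat_vec_index[of _ n n] mult.commute simp del: index_mult_mat_vec)
  have Qinj: "vec n u = vec n u'" if "Q *\<^sub>v vec n u = Q *\<^sub>v vec n u'" for u u'
  proof -
    have "(\<Sum>j<n. (u j - u' j) * ?y j $ k) = 0" if "k < n" for k
    proof -
      have "comb n n ?y u $ k = comb n n ?y u' $ k" using \<open>Q *\<^sub>v vec n u = Q *\<^sub>v vec n u'\<close> by (simp only: comb)
      then show ?thesis using that by (simp add: comb_def algebra_simps sum_subtractf)
    qed
    from indepD[OF x(2) this] show ?thesis by (intro eq_vecI) auto
  qed
  have Qinv: "invertible_mat Q"
  proof -
    have "det Q \<noteq> 0"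
    proof
      assume "det Q = 0"
      then obtain w where w: "w \<in> carrier_vec n" "w \<noteq> 0\<^sub>v n" "Q *\<^sub>v w = 0\<^sub>v n"
        using det_0_iff_vec_prod_zero_field[OF Qc] by blast
      have "vec n (\<lambda>i. w $ i) = w" using w(1) by auto
      moreover have "Q *\<^sub>v vec n (\<lambda>_. 0) = 0\<^sub>v n" using Qc by (intro eq_vecI) (auto simp: scalar_prod_def)
      ultimately have "w = vec n (\<lambda>_. 0)" using Qinj[of "\<lambda>i. w $ i" "\<lambda>_. 0"] w(3) by simp
      then show False using w(2) by auto
    qed
    then show ?thesis using invertible_mat_iff_det[OF Qc] by simp
  qed
  define Y where "Y = Q * dg n (\<lambda>i. - q i)"
  have Yc: "Y \<in> carrier_mat n n" and Yi: "invertible_mat Y"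
    using Qc invertible_mat_mult[OF Qc dg_carrier Qinv] by (auto simp: Y_def)
  define U where "U j i = (if i = j then \<pi> powi (- q j) else 0)" for i j
  define C where "C = mat n n (\<lambda>(i,j). ((cstep \<tau> n c ^^ s) (U j)) i)"
  have Cc: "C \<in> carrier_mat n n" by (simp add: C_def)
  have colY: "col Y j = comb n n ?y (U j)" if j: "j < n" for j
  proof (rule eq_vecI)
    fix k assume "k < dim_vec (comb n n ?y (U j))"
    then have k: "k < n" by (simp add: comb_def)
    have "col Y j $ k = Y $$ (k,j)" using j k Yc by simp
    also have "\<dots> = Q $$ (k,j) * \<pi> powi (- q j)" unfolding Y_def by (rule mult_dg_index[OF Qc k j])
    also have "\<dots> = comb n n ?y (U j) $ k"
    proof -
      have "(\<Sum>i<n. U j i * ?y i $ k) = (\<Sum>i<n. if i = j then \<pi> powi (- q j) * ?y j $ k else 0)"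
        by (rule sum.cong) (auto simp: U_def)
      then show ?thesis using j k by (simp add: comb_def Q_def)
    qed
    finally show "col Y j $ k = comb n n ?y (U j) $ k" .
  qed (use Yc in \<open>simp add: comb_def\<close>)
  have frY: "(fr \<tau> b ^^ s) Y = Q * C"
  proof (rule mat_col_eqI)
    fix j assume "j < dim_col (Q * C)"
    then have j: "j < n" using Cc by simp
    have "col ((fr \<tau> b ^^ s) Y) j = (sl \<tau> b ^^ s) (comb n n ?y (U j))"
      using col_fr_pow[OF b(1) Yc j] colY[OF j] by simp
    also have "\<dots> = comb n n ?y ((cstep \<tau> n c ^^ s) (U j))"
      by (rule sl_comb_step[OF a(1) b(1) x(1) n rel])
    also have "\<dots> = Q *\<^sub>v col C j" unfolding comb by (rule arg_cong[of _ _ "\<lambda>w. Q *\<^sub>v w"]) (use j in \<open>auto simp: C_def\<close>)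
    also have "\<dots> = col (Q * C) j" using j Qc Cc by (intro eq_vecI) auto
    finally show "col ((fr \<tau> b ^^ s) Y) j = col (Q * C) j" .
  qed (use fr_pow_carrier[OF b(1) Yc, of s \<tau>] Qc Cc in auto)
  define A where "A = dg n (\<lambda>i. q i - r) * C"
  have Ac: "A \<in> carrier_mat n n" using Cc by (simp add: A_def)
  have "Y * (dg n (\<lambda>_. r) * A) = Q * ((dg n (\<lambda>i. - q i) * (dg n (\<lambda>_. r) * dg n (\<lambda>i. q i - r))) * C)"
    unfolding Y_def A_def using Qc Cc by (simp add: assoc_mult_mat[of _ n n _ n _ n])
  also have "\<dots> = Q * C" using Cc by (simp add: dg_mult_dg)
  finally have eq: "(fr \<tau> b ^^ s) Y = Y * (dg n (\<lambda>_. r) * A)" using frY by simp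
  have Am: "mge 0 A"
  proof (rule mge_I[OF Ac])
    fix i j assume ij: "i < n" "j < n"
    have "wg s r 0 i' (U j i')" for i'
    proof (cases "i' = j")
      case True
      have "0 \<le> int s * (- q j) + r * int j" using q[of j] by simp
      then show ?thesis using True by (simp add: wg_def U_def)
    qed (simp add: wg_def U_def)
    from cstep_pow_wg[OF a(1) s n c this ij(1), of s]
    have "wg s r (r * int s * 1) i (C $$ (i,j))" using ij by (simp add: C_def)
    then have "vge (r - q i) (C $$ (i,j))" unfolding wgq by simp
    then show "vge 0 (A $$ (i,j))" unfolding A_def dg_mult_index[OF Cc ij] by (simp add: vge_powi_mult)
  qed
  have "\<not> mge 1 ((fr (\<tau> ^^ s) A ^^ l) (1\<^sub>m n))" for l
  proof
    let ?A = "(fr (\<tau> ^^ s) A ^^ l) (1\<^sub>m n)"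
    have Alc: "?A \<in> carrier_mat n n" using Ac by simp
    assume Al: "mge 1 ?A"
    \<comment> \<open>A start vector of weight exactly 0 is needed, but scaling by \<pi> changes
      weights by multiples of \<open>s\<close>. The unit vector at \<open>i0\<close> has weight
      \<open>r * i0\<close>; after \<open>s * i0 - i0\<close> steps the weight is
      \<open>r * s * i0\<close>, which \<pi>^(-r i0) then removes.\<close>
    define u1 where "u1 = (cstep \<tau> n c ^^ (s * i0 - i0)) (\<lambda>i. if i = i0 then 1 else 0)"
    have "i0 \<le> s * i0" using s by simp
    then have "attains s r n i0 (r * int s * int i0) u1"
      using cstep_pow_attains[OF a(1) s i0 c c0 c1 attains_unit[OF i0], of "s * i0 - i0"]
      by (simp add: u1_def of_nat_diff algebra_simps)
    from attains_scale[OF this, of "- r * int i0"]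
    have u: "attains s r n i0 0 (\<lambda>i. \<pi> powi (- r * int i0) * u1 i)" by (simp add: algebra_simps)
    define u where "u i = \<pi> powi (- r * int i0) * u1 i" for i
    define w where "w = (cstep \<tau> n c ^^ (s * l)) u"
    have "attains s r n i0 (r * int s * int l) w"
      using cstep_pow_attains[OF a(1) s i0 c c0 c1 u, of "s * l"] by (simp add: w_def u_def[abs_def] algebra_simps)
    then obtain i where i: "i < n" "w i \<noteq> 0" "int s * v (w i) + r * int i = r * int s * int l"
      unfolding attains_def by blast
    define tv where "tv = vec n (\<lambda>i. \<pi> powi (q i) * u i)"
    have tc: "tv \<in> carrier_vec n" by (simp add: tv_def)
    have tm: "vge 0 (tv $ j)" if j: "j < n" for j
    proof -
      have "wg s r (r * int s * 0) j (u j)" using u j by (simp add: attains_def u_def)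
      then have "vge (- q j) (u j)" unfolding wgq by simp
      then show ?thesis using j by (simp add: tv_def vge_powi_mult)
    qed
    have "Y *\<^sub>v tv = Q *\<^sub>v (dg n (\<lambda>i. - q i) *\<^sub>v tv)" unfolding Y_def using Qc tc by (simp add: assoc_mult_mat_vec[of _ n n _ n])
    also have "dg n (\<lambda>i. - q i) *\<^sub>v tv = vec n u"
    proof (rule eq_vecI)
      fix j assume "j < dim_vec (vec n u)"
      then have j: "j < n" by simp
      have "(dg n (\<lambda>i. - q i) *\<^sub>v tv) $ j = (\<Sum>k<n. dg n (\<lambda>i. - q i) $$ (j,k) * tv $ k)"
        by (rule mult_mat_vec_index[OF dg_carrier tc j])
      also have "\<dots> = (\<Sum>k<n. (if j = k then \<pi> powi (- q k) else 0) * tv $ k)"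
        by (rule sum.cong) (use j in \<open>auto simp: dg_def\<close>)
      also have "\<dots> = (\<pi> powi (- q j) * \<pi> powi (q j)) * u j" using j by (simp add: tv_def)
      also have "\<pi> powi (- q j) * \<pi> powi (q j) = 1" by (simp add: powi_add_pi[symmetric])
      finally show "(dg n (\<lambda>i. - q i) *\<^sub>v tv) $ j = vec n u $ j" using j by simp
    qed simp
    finally have Yt: "Y *\<^sub>v tv = comb n n ?y u" by (simp add: comb)
    let ?t = "map_vec (\<tau> ^^ (s * l)) tv"
    have t'c: "?t \<in> carrier_vec n" using tc by simp
    have "comb n n ?y w = (sl \<tau> b ^^ (s * l)) (Y *\<^sub>v tv)"
      unfolding Yt w_def by (rule sl_comb_step[OF a(1) b(1) x(1) n rel, symmetric])
    also have "\<dots> = (fr \<tau> b ^^ (s * l)) (Y * 1\<^sub>m n) *\<^sub>v ?t" using sl_pow_mult_mat_vec[OF a(1) b(1) Yc tc] Yc by simp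
    also have "\<dots> = (Y * (dg n (\<lambda>_. r * int l) * ?A)) *\<^sub>v ?t"
      unfolding scaled_iterate[OF a(1) b(1) Yc Ac eq one_carrier_mat] ..
    also have "Y * (dg n (\<lambda>_. r * int l) * ?A) = Q * (dg n (\<lambda>i. r * int l - q i) * ?A)"
      unfolding Y_def using Qc Alc
      by (simp add: assoc_mult_mat[of _ n n _ n _ n] assoc_mult_mat[symmetric, of "dg n _" n n "dg n _" n _ n] dg_mult_dg)
    also have "\<dots> *\<^sub>v ?t = Q *\<^sub>v ((dg n (\<lambda>i. r * int l - q i) * ?A) *\<^sub>v ?t)"
      using Qc Alc t'c by (simp add: assoc_mult_mat_vec[of _ n n _ n])
    also have "(dg n (\<lambda>i. r * int l - q i) * ?A) *\<^sub>v ?t =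
        vec n (\<lambda>j. ((dg n (\<lambda>i. r * int l - q i) * ?A) *\<^sub>v ?t) $ j)" by (intro eq_vecI) auto
    finally have "vec n w = vec n (\<lambda>j. ((dg n (\<lambda>i. r * int l - q i) * ?A) *\<^sub>v ?t) $ j)"
      unfolding comb by (rule Qinj)
    from arg_cong[OF this, of "\<lambda>w. w $ i"] i(1)
    have "w i = ((dg n (\<lambda>i. r * int l - q i) * ?A) *\<^sub>v ?t) $ i" by simp
    also have "\<dots> = (\<Sum>j<n. (dg n (\<lambda>i. r * int l - q i) * ?A) $$ (i,j) * ?t $ j)"
      by (rule mult_mat_vec_index) (use Alc t'c i in auto)
    also have "vge (r * int l - q i + 1) \<dots>"
    proof (rule vge_sum)
      fix j assume "j \<in> {..<n}"
      then have j: "j < n" by simp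
      have "vge 0 (?t $ j)" using tm[OF j] j aut_vge[OF aut_funpow[OF a(1)]] tc by simp
      moreover have "vge 1 (?A $$ (i,j))" by (rule mge_D[OF Al Alc i(1) j])
      then have "vge (r * int l - q i + 1) ((dg n (\<lambda>i. r * int l - q i) * ?A) $$ (i,j))"
        unfolding dg_mult_index[OF Alc i(1) j] vge_powi_mult by simp
      ultimately show "vge (r * int l - q i + 1) ((dg n (\<lambda>i. r * int l - q i) * ?A) $$ (i,j) * ?t $ j)"
        by (intro vge_mult0(2))
    qed
    \<comment> \<open>The coordinate \<open>i\<close> attains weight exactly
      \<open>r * s * l\<close>, whereas divisibility of the iterate by \<pi> gives it weight at
      least \<open>r * s * l + s\<close>, as \<open>s * q i\<close> is at most
      \<open>r * i\<close>.\<close>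
    finally have "r * int l - q i + 1 \<le> v (w i)" using i(2) by (simp add: vge_def)
    then have "int s * (r * int l - q i + 1) \<le> int s * v (w i)" by (rule mult_left_mono) simp
    then show False using i(3) q[of i] s by (simp add: algebra_simps)
  qed
  then show ?thesis using Yc Yi s Ac Am eq by blast
qed

lemma fr_fb:
  assumes "aut \<tau>" "R1 \<in> carrier_mat a a" "R2 \<in> carrier_mat d d" "X1 \<in> carrier_mat a a" "X2 \<in> carrier_mat d d"
  shows "(fr \<tau> (fb a d R1 R2) ^^ k) (fb a d X1 X2) = fb a d ((fr \<tau> R1 ^^ k) X1) ((fr \<tau> R2 ^^ k) X2)"
proof (induction k)
  case (Suc k)
  let ?X = "(fr \<tau> R1 ^^ k) X1" and ?Y = "(fr \<tau> R2 ^^ k) X2"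
  have "fr \<tau> (fb a d R1 R2) (fb a d ?X ?Y) = fb a d (R1 * map_mat \<tau> ?X) (R2 * map_mat \<tau> ?Y)"
    unfolding fr_def[of \<tau> "fb a d R1 R2"] using assms by (simp add: fb_map fb_mult)
  then show ?case using Suc by (simp add: fr_def[of \<tau> R1 ?X] fr_def[of \<tau> R2 ?Y])
qed simp

lemma slope_basis_direct_sum:
  assumes a: "aut \<tau>" and b: "b \<in> carrier_mat (k + d) (k + d)" and Y: "Y \<in> carrier_mat (k + d) (k + d)" "invertible_mat Y"
    and R: "R1 \<in> carrier_mat k k" "R2 \<in> carrier_mat d d" and eq: "fr \<tau> b Y = Y * fb k d R1 R2"
    and s: "slope_basis \<tau> R1 k P1 S e1" "slope_basis \<tau> R2 d P2 S e2"
  shows "slope_basis \<tau> b (k + d) (Y * fb k d P1 P2) S (\<lambda>i. if i < k then e1 i else e2 (i - k))"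
proof -
  let ?n = "k + d"
  from slope_basis_obtain[OF a R(1) s(1)] obtain T1 K1 where 1: "P1 \<in> carrier_mat k k" "invertible_mat P1" "0 < S"
    "T1 \<in> carrier_mat k k" "fr \<tau> R1 P1 = P1 * T1" "T1 * dg k e1 = dg k e1 * T1"
    "GLO k K1" "(fr \<tau> R1 ^^ S) P1 = P1 * (dg k e1 * K1)" by metis
  from slope_basis_obtain[OF a R(2) s(2)] obtain T2 K2 where 2: "P2 \<in> carrier_mat d d" "invertible_mat P2" "0 < S"
    "T2 \<in> carrier_mat d d" "fr \<tau> R2 P2 = P2 * T2" "T2 * dg d e2 = dg d e2 * T2"
    "GLO d K2" "(fr \<tau> R2 ^^ S) P2 = P2 * (dg d e2 * K2)" by metis
  note K = GLO_carrier[OF 1(7)] GLO_carrier[OF 2(7)]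
  have Rc: "fb k d R1 R2 \<in> carrier_mat ?n ?n" and Pc: "fb k d P1 P2 \<in> carrier_mat ?n ?n" using R 1 2 by auto
  have conj: "(fr \<tau> b ^^ m) (Y * fb k d P1 P2) = Y * fb k d ((fr \<tau> R1 ^^ m) P1) ((fr \<tau> R2 ^^ m) P2)" for m
    unfolding fr_conj[OF a b Y(1) Rc eq Pc] fr_fb[OF a R 1(1) 2(1)] ..
  have "Y * fb k d P1 P2 \<in> carrier_mat ?n ?n" using Y Pc by simp
  moreover have "invertible_mat (Y * fb k d P1 P2)"
    by (rule invertible_mat_mult[OF Y(1) Pc Y(2)]) (use 1 2 fb_invertible in blast)
  moreover have "fb k d T1 T2 \<in> carrier_mat ?n ?n" using 1 2 by simp
  moreover have "fr \<tau> b (Y * fb k d P1 P2) = Y * fb k d P1 P2 * fb k d T1 T2"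
    using conj[of 1] 1 2 Y Pc by (simp add: fb_mult[symmetric] assoc_mult_mat[of _ ?n ?n _ ?n _ ?n])
  moreover have "fb k d T1 T2 * fb k d (dg k e1) (dg d e2) = fb k d (dg k e1) (dg d e2) * fb k d T1 T2"
    using 1 2 by (simp add: fb_mult)
  moreover have "GLO ?n (fb k d K1 K2)" using 1 2 fb_GLO by blast
  moreover have "(fr \<tau> b ^^ S) (Y * fb k d P1 P2) = Y * fb k d P1 P2 * (fb k d (dg k e1) (dg d e2) * fb k d K1 K2)"
    using conj[of S] 1 2 K Y Pc by (simp add: fb_mult[symmetric] assoc_mult_mat[of _ ?n ?n _ ?n _ ?n])
  ultimately show ?thesis unfolding slope_basis_def fb_dg[symmetric] using 1(3) by blast
qed

lemma slope_basis_exists: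
  assumes a: "aut \<tau>" "aperiodic \<tau>" and b: "b \<in> carrier_mat n n" "invertible_mat b"
  shows "\<exists>P S e. slope_basis \<tau> b n P S e"
  using b
proof (induction n arbitrary: b rule: less_induct)
  case (less n)
  show ?case
  proof (cases "n = 0")
    case True
    then have "slope_basis \<tau> b n (1\<^sub>m n) 1 (\<lambda>_. 0)" unfolding slope_basis_def using less.prems(1)
      by (intro conjI exI[of _ b] exI[of _ "1\<^sub>m n"]) (auto simp: fr_def)
    then show ?thesis by blast
  next
    case False
    then obtain Y A r s where Y: "Y \<in> carrier_mat n n" "invertible_mat Y" and s: "0 < s"
      and A: "A \<in> carrier_mat n n" "mge 0 A" and eq: "(fr \<tau> b ^^ s) Y = Y * (dg n (\<lambda>_. r) * A)"
      and nonnil: "\<And>l. 0 < l \<Longrightarrow> \<not> mge 1 ((fr (\<tau> ^^ s) A ^^ l) (1\<^sub>m n))"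
      using integral_operator[OF a less.prems] by blast
    have mat_of: "\<exists>R. R \<in> carrier_mat n n \<and> fr \<tau> b Z = Z * R" if Z: "Z \<in> carrier_mat n n" "invertible_mat Z" for Z
    proof -
      obtain Z' where Z': "Z' \<in> carrier_mat n n" "Z * Z' = 1\<^sub>m n" using invertible_mat_obtain Z by metis
      have "fr \<tau> b Z = Z * (Z' * fr \<tau> b Z)"
        using Z' Z less.prems(1) left_mult_one_mat[OF fr_carrier[OF less.prems(1) Z(1), of \<tau>]]
        by (simp add: assoc_mult_mat[symmetric, of _ n n _ n _ n])
      then show ?thesis using Z' Z less.prems(1) by (intro exI[of _ "Z' * fr \<tau> b Z"]) auto
    qed
    have "invertible_mat ((fr \<tau> b ^^ s) Y)" using fr_pow_invertible[OF a(1) less.prems Y] .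
    then have "det (Y * (dg n (\<lambda>_. r) * A)) \<noteq> 0"
      unfolding eq using invertible_mat_iff_det[of "Y * (dg n (\<lambda>_. r) * A)" n] Y A by simp
    then have Ad: "det A \<noteq> 0" using Y A by (simp add: det_mult[of _ n])
    from fitting[OF aut_funpow[OF a(1)] A Ad nonnil] show ?thesis
    proof
      assume "GLO n A"
      obtain R where R: "R \<in> carrier_mat n n" "fr \<tau> b Y = Y * R" using mat_of[OF Y] by blast
      then have "slope_basis \<tau> b n Y s (\<lambda>_. r)" unfolding slope_basis_def
        using Y s eq \<open>GLO n A\<close> dg_central[OF R(1)] by blast
      then show ?thesis by blast
    next
      assume "\<exists>a d l U G0 E D. 0 < a \<and> 0 < d \<and> n = a + d \<and> 0 < l \<and> U \<in> carrier_mat n n \<and>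
        invertible_mat U \<and> GLO a G0 \<and> E \<in> carrier_mat a a \<and> mge 1 E \<and> D \<in> carrier_mat d d \<and> mge 1 D \<and>
        (fr (\<tau> ^^ s) A ^^ l) U = U * fb a d (G0 + E) D"
      then obtain k d l U G0 E D where k: "0 < k" "0 < d" "n = k + d" "0 < l" and U: "U \<in> carrier_mat n n"
        "invertible_mat U" and G: "GLO k G0" "E \<in> carrier_mat k k" "mge 1 E" "D \<in> carrier_mat d d" "mge 1 D"
        and Ueq: "(fr (\<tau> ^^ s) A ^^ l) U = U * fb k d (G0 + E) D" by blast
      define M where "M = fb k d (G0 + E) D"
      have Mc: "M \<in> carrier_mat n n" using G k by (simp add: M_def)
      define Z where "Z = Y * U"
      have Z: "Z \<in> carrier_mat n n" "invertible_mat Z"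
        using Y U invertible_mat_mult[of Y n U] by (auto simp: Z_def)
      let ?D = "dg n (\<lambda>_. r * int l)" let ?\<eta> = "\<tau> ^^ (s * l)"
      have Zeq: "(fr \<tau> b ^^ (s * l)) Z = Z * (?D * M)"
      proof -
        have "(fr \<tau> b ^^ (s * l)) Z = Y * (?D * (U * M))"
          unfolding Z_def M_def Ueq[symmetric] by (rule scaled_iterate[OF a(1) less.prems(1) Y(1) A(1) eq U(1)])
        also have "?D * (U * M) = U * (?D * M)"
          using U Mc dg_central[OF U(1), of "r * int l"] by (simp add: assoc_mult_mat[symmetric, of _ n n _ n _ n])
        finally show ?thesis using Y U Mc by (simp add: Z_def assoc_mult_mat[of _ n n _ n _ n])
      qed
      obtain R where R: "R \<in> carrier_mat n n" "fr \<tau> b Z = Z * R" using mat_of[OF Z] by blast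
      \<comment> \<open>Up to the scalar \<pi>^(r l), both sides are the matrix of \<Phi>^(s l + 1)
        in the basis \<open>Z\<close>, once as \<Phi> after \<Phi>^(s l) and once in the other
        order.\<close>
      have "R * map_mat \<tau> M = M * map_mat ?\<eta> R"
      proof -
        have c: "map_mat \<tau> M \<in> carrier_mat n n" "map_mat ?\<eta> R \<in> carrier_mat n n" using Mc R by auto
        have "(fr \<tau> b ^^ (s * l + 1)) Z = fr \<tau> b (Z * (?D * M))" by (simp add: Zeq)
        also have "\<dots> = Z * R * (?D * map_mat \<tau> M)"
          using fr_mult[OF a(1) less.prems(1) Z(1), of "?D * M" n] Mc R a(1)
          by (simp add: map_mat_mult[OF a(1), of _ n n _ n])
        also have "\<dots> = Z * (R * ?D * map_mat \<tau> M)" using Z R c by (simp add: assoc_mult_mat[of _ n n _ n _ n])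
        also have "\<dots> = (Z * ?D) * (R * map_mat \<tau> M)" unfolding dg_central[OF R(1)]
          using Z R c by (simp add: assoc_mult_mat[of _ n n _ n _ n])
        finally have 1: "(fr \<tau> b ^^ (s * l + 1)) Z = (Z * ?D) * (R * map_mat \<tau> M)" .
        have "(fr \<tau> b ^^ (s * l + 1)) Z = (fr \<tau> b ^^ (s * l)) (Z * R)" by (simp add: funpow_swap1 R(2))
        also have "\<dots> = Z * (?D * M) * map_mat ?\<eta> R" unfolding fr_pow_mult[OF a(1) less.prems(1) Z(1) R(1)] Zeq ..
        also have "\<dots> = (Z * ?D) * (M * map_mat ?\<eta> R)" using Z Mc c by (simp add: assoc_mult_mat[of _ n n _ n _ n])
        finally have 2: "(Z * ?D) * (R * map_mat \<tau> M) = (Z * ?D) * (M * map_mat ?\<eta> R)" using 1 by simp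
        show ?thesis
          by (rule mult_left_cancel[OF _ _ _ _ 2, of n n]) (use Z R c Mc invertible_mat_mult[OF Z(1) dg_carrier Z(2)] in auto)
      qed
      then obtain R1 R2 where RR: "R1 \<in> carrier_mat k k" "R2 \<in> carrier_mat d d" "R = fb k d R1 R2"
        using commuting_block_diagonal[OF a(1) aut_funpow[OF a(1)] G, of R] R(1) k(3) unfolding M_def by blast
      have "invertible_mat (Z * R)" unfolding R(2)[symmetric] by (rule fr_invertible[OF a(1) less.prems Z])
      then have "det R \<noteq> 0" using invertible_mat_iff_det[of "Z * R" n] Z R by (simp add: det_mult[of _ n])
      then have "invertible_mat R" using invertible_mat_iff_det[OF R(1)] by simp
      then have inv: "invertible_mat R1" "invertible_mat R2" using fb_invertible[OF RR(1,2)] RR(3) by auto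
      obtain P1 S1 e1 where s1: "slope_basis \<tau> R1 k P1 S1 e1" using less.IH[of k R1] k RR inv by auto
      obtain P2 S2 e2 where s2: "slope_basis \<tau> R2 d P2 S2 e2" using less.IH[of d R2] k RR inv by auto
      have S: "0 < S1" "0 < S2" using s1 s2 unfolding slope_basis_def by auto
      have "slope_basis \<tau> R1 k P1 (S1 * S2) (\<lambda>i. int S2 * e1 i)" using slope_basis_multiple[OF a(1) RR(1) s1 S(2)] .
      moreover have "slope_basis \<tau> R2 d P2 (S1 * S2) (\<lambda>i. int S1 * e2 i)"
        using slope_basis_multiple[OF a(1) RR(2) s2 S(1)] by (simp add: mult.commute)
      ultimately show ?thesis
        using slope_basis_direct_sum[OF a(1) _ _ Z(2) RR(1,2)] less.prems(1) Z(1) R(2) RR(3) k(3) by blast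
    qed
  qed
qed

lemma slope_basis_sorted_exists:
  assumes a: "aut \<tau>" "aperiodic \<tau>" and b: "b \<in> carrier_mat n n" "invertible_mat b"
  shows "\<exists>P S e. slope_basis \<tau> b n P S e \<and> antitone n e"
proof -
  obtain P S e where st: "slope_basis \<tau> b n P S e" using slope_basis_exists[OF a b] by blast
  from slope_basis_obtain[OF a(1) b(1) st] obtain R K where s: "P \<in> carrier_mat n n" "invertible_mat P" "0 < S"
    "R \<in> carrier_mat n n" "fr \<tau> b P = P * R" "R * dg n e = dg n e * R"
    "GLO n K" "(fr \<tau> b ^^ S) P = P * (dg n e * K)" by metis
  note K = GLO_carrier[OF s(7)]
  define xs where "xs = sort_key (\<lambda>i. - e i) [0..<n]"
  define g where "g j = xs ! j" for j
  have xs: "length xs = n" "distinct xs" "set xs = {..<n}" "sorted (map (\<lambda>i. - e i) xs)"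
    by (auto simp: xs_def)
  have g: "bij_betw g {..<n} {..<n}"
    unfolding g_def by (rule bij_betw_nth[OF xs(2)]) (use xs in auto)
  have anti: "antitone n (\<lambda>i. e (g i))"
    unfolding antitone_def g_def using sorted_nth_mono[OF xs(4)] xs(1) by auto
  obtain h where h: "\<And>i. i < n \<Longrightarrow> h i < n \<and> g (h i) = i" "\<And>i. i < n \<Longrightarrow> g i < n" using bij_betw_inv_obtain[OF g] by metis
  let ?T = "pmat n g" and ?T' = "pmat n h"
  have T: "?T * ?T' = 1\<^sub>m n" by (rule pmat_inverse[OF g h(1)])
  have T'T: "?T' * ?T = 1\<^sub>m n" by (rule mat_mult_left_right_inverse[OF _ _ T]) auto
  have GT: "GLO n ?T" by (rule pmat_GLO[OF g])
  have GT': "GLO n ?T'" by (rule GLO_invertible_mat[OF GT _ _ T]) auto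
  have mT: "map_mat \<tau>' ?T = ?T" if "aut \<tau>'" for \<tau>'
    by (rule eq_matI) (auto simp: pmat_def aut_simps(1,2)[OF that])
  have DT: "dg n e * ?T = ?T * dg n (\<lambda>i. e (g i))"
  proof (rule eq_matI)
    fix i j assume "i < dim_row (?T * dg n (\<lambda>i. e (g i)))" "j < dim_col (?T * dg n (\<lambda>i. e (g i)))"
    then have ij: "i < n" "j < n" by (auto simp: pmat_def)
    show "(dg n e * ?T) $$ (i,j) = (?T * dg n (\<lambda>i. e (g i))) $$ (i,j)"
      unfolding dg_mult_index[OF pmat_carrier ij] mult_dg_index[OF pmat_carrier ij] using ij by (simp add: pmat_def)
  qed (auto simp: pmat_def)
  let ?D = "dg n (\<lambda>i. e (g i))"
  have DT': "?T' * dg n e = ?D * ?T'"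
  proof -
    have "?T' * dg n e = ?T' * (dg n e * ?T) * ?T'" using T by (simp add: assoc_mult_mat[of _ n n _ n _ n])
    also have "\<dots> = (?T' * ?T) * (?D * ?T')" unfolding DT by (simp add: assoc_mult_mat[of _ n n _ n _ n])
    finally show ?thesis by (simp add: T'T)
  qed
  have TTX: "?T * (?T' * X) = X" if "X \<in> carrier_mat n n" for X
    using T that by (simp add: assoc_mult_mat[symmetric, of _ n n _ n _ n])
  have "slope_basis \<tau> b n (P * ?T) S (\<lambda>i. e (g i))"
  proof -
    have 1: "P * ?T \<in> carrier_mat n n" using s by simp
    have 2: "invertible_mat (P * ?T)" by (rule invertible_mat_mult[OF s(1) _ s(2)]) (use GLO_invertible[OF GT] in auto)
    have 3: "?T' * R * ?T \<in> carrier_mat n n" using s by simp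
    have 4: "fr \<tau> b (P * ?T) = P * ?T * (?T' * R * ?T)"
      using s(1,4) by (simp add: fr_mult[OF a(1) b(1) s(1), of _ n] s(5) mT[OF a(1)] assoc_mult_mat[of _ n n _ n _ n] TTX)
    have 5: "?T' * R * ?T * ?D = ?D * (?T' * R * ?T)"
    proof -
      have "?T' * R * ?T * ?D = ?T' * (R * dg n e) * ?T" using s(4) by (simp add: DT assoc_mult_mat[of _ n n _ n _ n])
      also have "\<dots> = (?T' * dg n e) * (R * ?T)" unfolding s(6) using s(4) by (simp add: assoc_mult_mat[of _ n n _ n _ n])
      finally show ?thesis unfolding DT' using s(4) by (simp add: assoc_mult_mat[of _ n n _ n _ n])
    qed
    have 6: "GLO n (?T' * K * ?T)" by (intro GLO_mult GT GT' s(7))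
    have "P * ?T * (?D * (?T' * K * ?T)) = P * ?T * ((?D * ?T') * (K * ?T))"
      using s(1) K by (simp add: assoc_mult_mat[of _ n n _ n _ n])
    also have "\<dots> = P * (dg n e * K) * ?T"
      unfolding DT'[symmetric] using s(1) K by (simp add: assoc_mult_mat[of _ n n _ n _ n] TTX)
    finally have "(fr \<tau> b ^^ S) (P * ?T) = P * ?T * (?D * (?T' * K * ?T))"
      by (simp add: fr_pow_mult[OF a(1) b(1) s(1), of _ n] s(8) mT[OF aut_funpow[OF a(1)]])
    then show ?thesis unfolding slope_basis_def using 1 2 s(3) 3 4 5 6 by blast
  qed
  then show ?thesis using anti by blast
qed

end

section \<open>Lattices and slope vectors\<close>

context dvf
begin

definition ivec :: "nat \<Rightarrow> 'a vec \<Rightarrow> bool" where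
  "ivec n c \<longleftrightarrow> c \<in> carrier_vec n \<and> (\<forall>i<n. vge 0 (c $ i))"

lemma lattice_of_iff: "x \<in> lattice_of v n A \<longleftrightarrow> (\<exists>c. ivec n c \<and> x = A *\<^sub>v c)"
  by (auto simp: lattice_of_def ivec_def OL_iff)

lemma ivec_mult:
  assumes "A \<in> carrier_mat n n" "mge 0 A" "ivec n c" shows "ivec n (A *\<^sub>v c)"
  unfolding ivec_def
proof (intro conjI allI impI)
  have c: "c \<in> carrier_vec n" using assms by (simp add: ivec_def)
  then show "A *\<^sub>v c \<in> carrier_vec n" using assms(1) by simp
  fix i assume i: "i < n"
  show "vge 0 ((A *\<^sub>v c) $ i)" unfolding mult_mat_vec_index[OF assms(1) c i]
    by (intro vge_sum vge_mult0) (use assms i in \<open>auto simp: ivec_def mge_def\<close>)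
qed

lemma ivec_map: "aut \<tau> \<Longrightarrow> ivec n c \<Longrightarrow> ivec n (map_vec \<tau> c)"
  unfolding ivec_def by (auto simp: aut_vge[of \<tau>])

lemma ivec_unit: "ivec n (unit_vec n j)"
  unfolding ivec_def by (auto simp: unit_vec_def)

lemma mult_unit_vec:
  fixes A :: "'a mat"
  assumes "A \<in> carrier_mat m n" "j < n" shows "A *\<^sub>v unit_vec n j = col A j"
proof (rule eq_vecI)
  fix i assume "i < dim_vec (col A j)"
  then have i: "i < m" using assms by simp
  have "(A *\<^sub>v unit_vec n j) $ i = (\<Sum>k<n. A $$ (i,k) * unit_vec n j $ k)"
    by (rule mult_mat_vec_index[OF assms(1) _ i]) simp
  also have "\<dots> = (\<Sum>k<n. A $$ (i,k) * (if k = j then 1 else 0))"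
    by (rule sum.cong) (use assms in \<open>auto simp: unit_vec_def\<close>)
  finally show "(A *\<^sub>v unit_vec n j) $ i = col A j $ i" using i assms by simp
qed (use assms in auto)

lemma lattice_of_mult_GLO:
  assumes A: "A \<in> carrier_mat n n" and V: "GLO n V"
  shows "lattice_of v n (A * V) = lattice_of v n A"
proof -
  obtain V' where V': "GLO n V'" "V * V' = 1\<^sub>m n" using GLO_obtain[OF V] by metis
  note c = GLO_carrier[OF V] GLO_carrier[OF V'(1)]
  show ?thesis
  proof (intro Set.set_eqI iffI)
    fix x assume "x \<in> lattice_of v n (A * V)"
    then obtain t where t: "ivec n t" "x = (A * V) *\<^sub>v t" unfolding lattice_of_iff by blast
    then have "x = A *\<^sub>v (V *\<^sub>v t)" using A c by (simp add: ivec_def assoc_mult_mat_vec[of _ n n _ n])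
    then show "x \<in> lattice_of v n A" unfolding lattice_of_iff using ivec_mult[OF c(1) GLO_mge[OF V] t(1)] by blast
  next
    fix x assume "x \<in> lattice_of v n A"
    then obtain t where t: "ivec n t" "x = A *\<^sub>v t" unfolding lattice_of_iff by blast
    have tc: "t \<in> carrier_vec n" using t by (simp add: ivec_def)
    have "V *\<^sub>v (V' *\<^sub>v t) = t" using assoc_mult_mat_vec[OF c tc] V'(2) tc by simp
    then have "x = (A * V) *\<^sub>v (V' *\<^sub>v t)" using A c tc t(2) by (simp add: assoc_mult_mat_vec[of _ n n _ n])
    then show "x \<in> lattice_of v n (A * V)"
      unfolding lattice_of_iff using ivec_mult[OF c(2) GLO_mge[OF V'(1)] t(1)] by blast
  qed
qed

lemma lattice_of_subset:
  assumes A: "A \<in> carrier_mat n n" and B: "B \<in> carrier_mat n n"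
    and sub: "lattice_of v n B \<subseteq> lattice_of v n A"
  shows "\<exists>V. V \<in> carrier_mat n n \<and> mge 0 V \<and> B = A * V"
proof -
  have "\<exists>c. ivec n c \<and> col B j = A *\<^sub>v c" if "j < n" for j
  proof -
    have "col B j \<in> lattice_of v n B" unfolding lattice_of_iff
      using ivec_unit mult_unit_vec[OF B that] by metis
    then show ?thesis using sub unfolding lattice_of_iff[symmetric] by blast
  qed
  then obtain c where c: "\<And>j. j < n \<Longrightarrow> ivec n (c j) \<and> col B j = A *\<^sub>v c j" by metis
  define V where "V = mat n n (\<lambda>(i,j). c j $ i)"
  have V: "V \<in> carrier_mat n n" by (simp add: V_def)
  have "mge 0 V" using c by (auto simp: V_def mge_def ivec_def)
  moreover have "B = A * V"
  proof (rule mat_col_eqI)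
    fix j assume "j < dim_col (A * V)"
    then have j: "j < n" using V by simp
    have "col V j = c j" using c[OF j] j by (intro eq_vecI) (auto simp: V_def ivec_def)
    then show "col B j = col (A * V) j" using c[OF j] col_mult2[OF A V j] by simp
  qed (use A B V in auto)
  ultimately show ?thesis using V by blast
qed

lemma lattice_of_eq:
  assumes A: "A \<in> carrier_mat n n" "invertible_mat A" and B: "B \<in> carrier_mat n n"
    and eq: "lattice_of v n A = lattice_of v n B"
  shows "\<exists>V. GLO n V \<and> B = A * V"
proof -
  obtain V where V: "V \<in> carrier_mat n n" "mge 0 V" "B = A * V" using lattice_of_subset[OF A(1) B] eq by blast
  obtain W where W: "W \<in> carrier_mat n n" "mge 0 W" "A = B * W" using lattice_of_subset[OF B A(1)] eq by blast
  have "A * (V * W) = B * W" unfolding V(3) using A V W(1) by (simp add: assoc_mult_mat[of _ n n _ n _ n])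
  then have "A * (V * W) = A * 1\<^sub>m n" using W(3) right_mult_one_mat[OF A(1)] by metis
  then have "V * W = 1\<^sub>m n" by (rule mult_left_cancel[OF A(2,1), rotated -1]) (use V W in auto)
  then show ?thesis using V W GLO_I[of V n W] by blast
qed

lemma Fmap_lattice:
  assumes a: "aut \<sigma>" and B: "B j \<in> carrier_mat n n" and A: "A \<in> carrier_mat n n"
  shows "Fmap \<sigma> B j ` lattice_of v n A = lattice_of v n (B j * map_mat \<sigma> A)"
proof (intro Set.set_eqI iffI)
  have eq: "Fmap \<sigma> B j (A *\<^sub>v t) = (B j * map_mat \<sigma> A) *\<^sub>v map_vec \<sigma> t" if "t \<in> carrier_vec n" for t
    using that A B by (simp add: Fmap_def map_vec_mult_mat_vec[OF a A that] assoc_mult_mat_vec[of _ n n _ n])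
  fix x
  {
    assume "x \<in> Fmap \<sigma> B j ` lattice_of v n A"
    then obtain t where t: "ivec n t" "x = Fmap \<sigma> B j (A *\<^sub>v t)" unfolding image_iff Bex_def lattice_of_iff by blast
    then have "x = (B j * map_mat \<sigma> A) *\<^sub>v map_vec \<sigma> t" using eq[of t] by (simp add: ivec_def)
    then show "x \<in> lattice_of v n (B j * map_mat \<sigma> A)"
      unfolding lattice_of_iff using ivec_map[OF a t(1)] by blast
  next
    assume "x \<in> lattice_of v n (B j * map_mat \<sigma> A)"
    then obtain t where t: "ivec n t" "x = (B j * map_mat \<sigma> A) *\<^sub>v t" unfolding lattice_of_iff by blast
    let ?s = "map_vec (inv_into UNIV \<sigma>) t"
    have s: "ivec n ?s" by (rule ivec_map[OF aut_inv_into[OF a] t(1)])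
    moreover have "map_vec \<sigma> ?s = t" by (intro eq_vecI) (auto simp: aut_inv_simps[OF a])
    ultimately have "x = Fmap \<sigma> B j (A *\<^sub>v ?s)" using eq[of ?s] t(2) by (simp add: ivec_def)
    then show "x \<in> Fmap \<sigma> B j ` lattice_of v n A" unfolding lattice_of_iff image_iff Bex_def using s by blast
  }
qed

section \<open>Slope vectors and slope bases\<close>

lemma span_idx_iff:
  "x \<in> span_idx Rg n P I \<longleftrightarrow>
    (\<exists>c. c \<in> carrier_vec n \<and> (\<forall>i<n. if i \<in> I then c $ i \<in> Rg else c $ i = 0) \<and> x = P *\<^sub>v c)"
  unfolding span_idx_def by blast

lemma commuting_support:
  assumes A: "A \<in> carrier_mat n n" "A * dg n e = dg n e * A" and c: "c \<in> carrier_vec n"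
    and supp: "\<And>i. i < n \<Longrightarrow> e i \<noteq> E \<Longrightarrow> c $ i = 0" and i: "i < n" "e i \<noteq> E"
  shows "(A *\<^sub>v c) $ i = 0"
  unfolding mult_mat_vec_index[OF A(1) c i(1)]
proof (rule sum.neutral, intro ballI)
  fix j assume "j \<in> {..<n}"
  then have j: "j < n" by simp
  show "A $$ (i,j) * c $ j = 0"
  proof (cases "e j = E")
    case True
    then have "e i \<noteq> e j" using i by simp
    then show ?thesis using mat_commute_dg_iff[OF A(1)] A(2) i j by simp
  qed (use supp j in simp)
qed

lemma dg_mult_vec:
  assumes c: "c \<in> carrier_vec n" and supp: "\<And>i. i < n \<Longrightarrow> e i \<noteq> E \<Longrightarrow> c $ i = 0"
  shows "dg n e *\<^sub>v c = \<pi> powi E \<cdot>\<^sub>v c"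
proof (rule eq_vecI)
  fix i assume "i < dim_vec (\<pi> powi E \<cdot>\<^sub>v c)"
  then have i: "i < n" using c by simp
  have "(dg n e *\<^sub>v c) $ i = (\<Sum>k<n. dg n e $$ (i,k) * c $ k)" by (rule mult_mat_vec_index[OF dg_carrier c i])
  also have "\<dots> = (\<Sum>k<n. (if i = k then \<pi> powi (e k) else 0) * c $ k)"
    by (rule sum.cong) (use i in \<open>auto simp: dg_def\<close>)
  finally show "(dg n e *\<^sub>v c) $ i = (\<pi> powi E \<cdot>\<^sub>v c) $ i" using i c supp[OF i] by (cases "e i = E") auto
qed (use c in simp)

lemma funpow_agree:
  assumes "\<And>x. x \<in> carrier_vec n \<Longrightarrow> \<Phi> x = sl \<tau> b x" "b \<in> carrier_mat n n" "x \<in> carrier_vec n"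
  shows "(\<Phi> ^^ k) x = (sl \<tau> b ^^ k) x"
  by (induction k) (use assms in auto)

definition slopes :: "nat \<Rightarrow> nat \<Rightarrow> (nat \<Rightarrow> int) \<Rightarrow> rat list" where
  "slopes n S e = map (\<lambda>i. of_int (e i) / of_nat S) [0..<n]"

lemma slopes_nth: "i < n \<Longrightarrow> slopes n S e ! i = of_int (e i) / of_nat S"
  by (simp add: slopes_def)

text \<open>Every slope is written with the same denominator \<open>S\<close>, and \<open>K\<close>
  is invertible over O_L on each level, so that \<Phi>^S maps the level lattice onto \<pi>^E times
  itself.\<close>

lemma slope_basis_imp_slope_vector:
  assumes a: "aut \<tau>" and b: "b \<in> carrier_mat n n" and st: "slope_basis \<tau> b n P S e" and anti: "antitone n e"
    and \<Phi>: "\<And>x. x \<in> carrier_vec n \<Longrightarrow> \<Phi> x = sl \<tau> b x"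
  shows "is_slope_vector v \<pi> n \<Phi> (slopes n S e)"
proof -
  from slope_basis_obtain[OF a b st] obtain R K where s: "P \<in> carrier_mat n n" "invertible_mat P" "0 < S"
    "R \<in> carrier_mat n n" "fr \<tau> b P = P * R" "R * dg n e = dg n e * R"
    "GLO n K" "(fr \<tau> b ^^ S) P = P * (dg n e * K)" "K * dg n e = dg n e * K" by metis
  obtain K' where K': "GLO n K'" "K * K' = 1\<^sub>m n" using GLO_obtain[OF s(7)] by metis
  note Kc = GLO_carrier[OF s(7)] GLO_carrier[OF K'(1)]
  have K'c: "K' * dg n e = dg n e * K'" by (rule commute_inverse[OF Kc dg_carrier K'(2) s(9)])
  have len: "length (slopes n S e) = n" by (simp add: slopes_def)
  have sorted: "sorted_wrt (\<ge>) (slopes n S e)"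
    unfolding sorted_wrt_iff_nth_less len using anti s(3)
    by (auto simp: slopes_nth antitone_def divide_right_mono)
  have main: "\<Phi> ` span_idx UNIV n P I \<subseteq> span_idx UNIV n P I \<and>
      (\<exists>r::int. \<exists>t::nat. 0 < t \<and> lam = of_int r / of_nat t \<and>
        (\<Phi> ^^ t) ` span_idx (OL v) n P I = (\<lambda>x. (\<pi> powi r) \<cdot>\<^sub>v x) ` span_idx (OL v) n P I)"
    if lam: "lam \<in> set (slopes n S e)" and I: "I = {i. i < n \<and> slopes n S e ! i = lam}" for lam I
  proof -
    obtain i1 where i1: "i1 < n" "lam = of_int (e i1) / of_nat S"
      using lam unfolding in_set_conv_nth len by (metis slopes_nth)
    define E where "E = e i1"
    have Ii: "i \<in> I \<longleftrightarrow> e i = E" if "i < n" for i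
      using that i1 s(3) by (auto simp: I slopes_nth E_def)
    have c1: "\<Phi> ` span_idx UNIV n P I \<subseteq> span_idx UNIV n P I"
    proof
      fix y assume "y \<in> \<Phi> ` span_idx UNIV n P I"
      then obtain c where c: "c \<in> carrier_vec n" "\<And>i. i < n \<Longrightarrow> i \<notin> I \<Longrightarrow> c $ i = 0" "y = \<Phi> (P *\<^sub>v c)"
        unfolding image_iff Bex_def span_idx_iff by metis
      let ?c = "map_vec \<tau> c"
      have "y = (P * R) *\<^sub>v ?c" using \<Phi>[of "P *\<^sub>v c"] s(1) c(1,3) sl_mult_mat_vec[OF a b s(1) c(1)] s(5) by simp
      then have y: "y = P *\<^sub>v (R *\<^sub>v ?c)" using s(1,4) c(1) by (simp add: assoc_mult_mat_vec[of _ n n _ n])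
      have "(R *\<^sub>v ?c) $ i = 0" if "i < n" "i \<notin> I" for i
        by (rule commuting_support[OF s(4,6), of _ E]) (use c that Ii aut_simps(1)[OF a] in auto)
      then show "y \<in> span_idx UNIV n P I" unfolding span_idx_iff using y s(4) c(1)
        by (intro exI[of _ "R *\<^sub>v ?c"]) auto
    qed
    have pw: "(\<Phi> ^^ S) (P *\<^sub>v c) = \<pi> powi E \<cdot>\<^sub>v (P *\<^sub>v (K *\<^sub>v map_vec (\<tau> ^^ S) c))"
      if c: "c \<in> carrier_vec n" "\<And>i. i < n \<Longrightarrow> i \<notin> I \<Longrightarrow> c $ i = 0" for c
    proof -
      let ?c = "map_vec (\<tau> ^^ S) c"
      have cc: "?c \<in> carrier_vec n" "K *\<^sub>v ?c \<in> carrier_vec n" using c Kc by auto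
      have "(\<Phi> ^^ S) (P *\<^sub>v c) = (P * (dg n e * K)) *\<^sub>v ?c"
        using funpow_agree[OF \<Phi> b, of "P *\<^sub>v c" S] sl_pow_mult_mat_vec[OF a b s(1) c(1), of S] s(1,8) c(1) by simp
      also have "\<dots> = P *\<^sub>v (dg n e *\<^sub>v (K *\<^sub>v ?c))"
        using s(1) Kc cc by (simp add: assoc_mult_mat_vec[of _ n n _ n])
      also have "dg n e *\<^sub>v (K *\<^sub>v ?c) = \<pi> powi E \<cdot>\<^sub>v (K *\<^sub>v ?c)"
      proof (rule dg_mult_vec[OF cc(2)])
        fix i assume "i < n" "e i \<noteq> E"
        then show "(K *\<^sub>v ?c) $ i = 0"
          by (intro commuting_support[OF Kc(1) s(9) cc(1), of E]) (use c Ii aut_simps(1)[OF aut_funpow[OF a]] in auto)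
      qed
      finally show ?thesis using s(1) cc by (simp add: mult_mat_vec[of _ n n])
    qed
    have c2: "(\<Phi> ^^ S) ` span_idx (OL v) n P I = (\<lambda>x. (\<pi> powi E) \<cdot>\<^sub>v x) ` span_idx (OL v) n P I"
    proof (intro Set.set_eqI iffI)
      fix y assume "y \<in> (\<Phi> ^^ S) ` span_idx (OL v) n P I"
      then obtain c where c: "c \<in> carrier_vec n" "\<And>i. i < n \<Longrightarrow> (if i \<in> I then c $ i \<in> OL v else c $ i = 0)"
        "y = (\<Phi> ^^ S) (P *\<^sub>v c)" unfolding image_iff Bex_def span_idx_iff by metis
      let ?c = "map_vec (\<tau> ^^ S) c"
      have c0: "\<And>i. i < n \<Longrightarrow> i \<notin> I \<Longrightarrow> c $ i = 0" using c(2) by metis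
      have iv: "ivec n c" using c unfolding ivec_def OL_iff by (metis vge_0)
      have "ivec n (K *\<^sub>v ?c)" by (rule ivec_mult[OF Kc(1) GLO_mge[OF s(7)] ivec_map[OF aut_funpow[OF a] iv]])
      moreover have "(K *\<^sub>v ?c) $ i = 0" if "i < n" "i \<notin> I" for i
        by (rule commuting_support[OF Kc(1) s(9), of _ E]) (use c(1) c0 that Ii aut_simps(1)[OF aut_funpow[OF a]] in auto)
      ultimately have "P *\<^sub>v (K *\<^sub>v ?c) \<in> span_idx (OL v) n P I"
        unfolding span_idx_iff by (intro exI[of _ "K *\<^sub>v ?c"]) (auto simp: ivec_def OL_iff)
      then show "y \<in> (\<lambda>x. (\<pi> powi E) \<cdot>\<^sub>v x) ` span_idx (OL v) n P I" using pw[OF c(1) c0] c(3) by blast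
    next
      fix y assume "y \<in> (\<lambda>x. (\<pi> powi E) \<cdot>\<^sub>v x) ` span_idx (OL v) n P I"
      then obtain c where c: "c \<in> carrier_vec n" "\<And>i. i < n \<Longrightarrow> (if i \<in> I then c $ i \<in> OL v else c $ i = 0)"
        "y = \<pi> powi E \<cdot>\<^sub>v (P *\<^sub>v c)" unfolding image_iff Bex_def span_idx_iff by metis
      have c0: "\<And>i. i < n \<Longrightarrow> i \<notin> I \<Longrightarrow> c $ i = 0" using c(2) by metis
      have iv: "ivec n c" using c unfolding ivec_def OL_iff by (metis vge_0)
      let ?\<rho> = "inv_into UNIV (\<tau> ^^ S)"
      have ar: "aut ?\<rho>" by (rule aut_inv_into[OF aut_funpow[OF a]])
      \<comment> \<open>A preimage under \<Phi>^S, up to the scalar: undo \<open>K\<close>, then the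
        automorphism.\<close>
      define w where "w = map_vec ?\<rho> (K' *\<^sub>v c)"
      have w: "ivec n w" unfolding w_def by (rule ivec_map[OF ar ivec_mult[OF Kc(2) GLO_mge[OF K'(1)] iv]])
      have w0: "w $ i = 0" if "i < n" "i \<notin> I" for i
      proof -
        have "(K' *\<^sub>v c) $ i = 0"
          by (rule commuting_support[OF Kc(2) K'c c(1), of E]) (use c0 that Ii in auto)
        then show ?thesis using that Kc by (simp add: w_def aut_simps(1)[OF ar])
      qed
      have "map_vec (\<tau> ^^ S) w = K' *\<^sub>v c" unfolding w_def
        by (intro eq_vecI) (auto simp: aut_inv_simps[OF aut_funpow[OF a]])
      moreover have "K *\<^sub>v (K' *\<^sub>v c) = c" using assoc_mult_mat_vec[OF Kc c(1)] K'(2) c(1) by simp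
      ultimately have "(\<Phi> ^^ S) (P *\<^sub>v w) = y" using pw[OF _ w0] w c(3) by (simp add: ivec_def)
      moreover have "P *\<^sub>v w \<in> span_idx (OL v) n P I"
        unfolding span_idx_iff using w w0 by (intro exI[of _ w]) (auto simp: ivec_def OL_iff)
      ultimately show "y \<in> (\<Phi> ^^ S) ` span_idx (OL v) n P I" by blast
    qed
    show ?thesis using c1 c2 i1(2) s(3) unfolding E_def by blast
  qed
  show ?thesis unfolding is_slope_vector_def Let_def
    by (rule conjI[OF len conjI[OF sorted]], rule exI[of _ P], rule conjI[OF s(1) conjI[OF s(2)]],
        rule ballI, rule main[OF _ refl])
qed

text \<open>A slope vector comes with a separate fraction for each slope; the product of their
  denominators serves as \<open>S\<close>. Stability of the level subspaces makes \<open>R\<close>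
  block diagonal. For the matrix \<open>G\<close> of \<Phi>^S in the basis \<open>P\<close>, the two
  inclusions in the lattice equation make \<pi>^(-e) \<open>G\<close> and its inverse
  integral.\<close>

lemma slope_vector_imp_star:
  assumes a: "aut \<tau>" and b: "b \<in> carrier_mat n n" "invertible_mat b" and sv: "is_slope_vector v \<pi> n \<Phi> \<nu>"
    and \<Phi>: "\<And>x. x \<in> carrier_vec n \<Longrightarrow> \<Phi> x = sl \<tau> b x"
  shows "\<exists>P S e. slope_basis \<tau> b n P S e \<and> antitone n e \<and> \<nu> = slopes n S e"
proof -
  define I where "I lam = {i. i < n \<and> \<nu> ! i = lam}" for lam
  from sv[unfolded is_slope_vector_def Let_def, folded I_def] obtain P where len: "length \<nu> = n" and sorted: "sorted_wrt (\<ge>) \<nu>"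
    and P: "P \<in> carrier_mat n n" "invertible_mat P"
    and all: "\<forall>lam\<in>set \<nu>. \<Phi> ` span_idx UNIV n P (I lam) \<subseteq> span_idx UNIV n P (I lam) \<and>
      (\<exists>r::int. \<exists>s::nat. 0 < s \<and> lam = of_int r / of_nat s \<and>
      (\<Phi> ^^ s) ` span_idx (OL v) n P (I lam) = (\<lambda>x. (\<pi> powi r) \<cdot>\<^sub>v x) ` span_idx (OL v) n P (I lam))"
    by (elim conjE exE, intro that) assumption+
  have st: "\<Phi> ` span_idx UNIV n P (I lam) \<subseteq> span_idx UNIV n P (I lam)" if "lam \<in> set \<nu>" for lam
    using all that by simp
  have "\<forall>lam\<in>set \<nu>. \<exists>r::int. \<exists>s::nat. 0 < s \<and> lam = of_int r / of_nat s \<and>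
      (\<Phi> ^^ s) ` span_idx (OL v) n P (I lam) = (\<lambda>x. (\<pi> powi r) \<cdot>\<^sub>v x) ` span_idx (OL v) n P (I lam)"
    using all by simp
  then obtain r s where rs: "\<And>lam. lam \<in> set \<nu> \<Longrightarrow> 0 < s lam \<and> lam = of_int (r lam) / of_nat (s lam) \<and>
      (\<Phi> ^^ s lam) ` span_idx (OL v) n P (I lam) = (\<lambda>x. (\<pi> powi r lam) \<cdot>\<^sub>v x) ` span_idx (OL v) n P (I lam)"
    by metis
  define S where "S = (\<Prod>lam\<in>set \<nu>. s lam)"
  have S0: "0 < S" unfolding S_def by (rule prod_pos) (use rs in auto)
  define t where "t lam = S div s lam" for lam
  have St: "S = s lam * t lam" if "lam \<in> set \<nu>" for lam
  proof -
    have "s lam dvd S" unfolding S_def by (rule dvd_prodI) (use that in auto)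
    then show ?thesis by (simp add: t_def)
  qed
  define e where "e i = r (\<nu> ! i) * int (t (\<nu> ! i))" for i
  have mem: "\<nu> ! i \<in> set \<nu>" if "i < n" for i using that len by simp
  have nu: "\<nu> ! i = of_int (e i) / of_nat S" if "i < n" for i
  proof -
    let ?l = "\<nu> ! i"
    have "0 < t ?l" using St[OF mem[OF that]] S0 by (cases "t ?l") auto
    then have "of_int (e i) / of_nat S = (of_int (r ?l) / of_nat (s ?l) :: rat)"
      using St[OF mem[OF that]] rs[OF mem[OF that]] by (simp add: e_def)
    then show ?thesis using rs[OF mem[OF that]] by metis
  qed
  have lev: "\<nu> ! i = \<nu> ! j \<longleftrightarrow> e i = e j" if "i < n" "j < n" for i j
    unfolding nu[OF that(1)] nu[OF that(2)] using S0 by simp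
  have anti: "antitone n e" unfolding antitone_def
  proof (intro allI impI)
    fix i j assume ij: "i \<le> j" "j < n"
    then have "\<nu> ! j \<le> \<nu> ! i" using sorted len unfolding sorted_wrt_iff_nth_less by (cases "i = j") auto
    then have "of_int (e j) \<le> (of_int (e i) :: rat)" using nu[of i] nu[of j] ij S0 by (simp add: divide_le_cancel)
    then show "e j \<le> e i" by simp
  qed
  have nuS: "\<nu> = slopes n S e" by (rule nth_equalityI) (use len nu in \<open>auto simp: slopes_def\<close>)
  have img: "(\<Phi> ^^ (s lam * k)) ` span_idx (OL v) n P (I lam) = (\<lambda>x. (\<pi> powi (r lam * int k)) \<cdot>\<^sub>v x) ` span_idx (OL v) n P (I lam)"
    if lam: "lam \<in> set \<nu>" for lam k
  proof (induction k)
    case (Suc k)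
    let ?L = "span_idx (OL v) n P (I lam)"
    have Lc: "x \<in> carrier_vec n" if "x \<in> ?L" for x using that P(1) unfolding span_idx_iff by auto
    have sc: "(\<Phi> ^^ s lam) (\<pi> powi m \<cdot>\<^sub>v x) = \<pi> powi m \<cdot>\<^sub>v (\<Phi> ^^ s lam) x" if "x \<in> ?L" for x m
      using Lc[OF that] by (simp add: funpow_agree[OF \<Phi> b(1)] sl_pow_smult[OF a b(1)] aut_powi[OF aut_funpow[OF a]])
    have "(\<Phi> ^^ (s lam * Suc k)) ` ?L = (\<Phi> ^^ s lam) ` ((\<Phi> ^^ (s lam * k)) ` ?L)"
      by (simp add: funpow_add image_comp)
    also have "\<dots> = (\<lambda>x. (\<Phi> ^^ s lam) (\<pi> powi (r lam * int k) \<cdot>\<^sub>v x)) ` ?L" unfolding Suc by (simp add: image_comp comp_def)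
    also have "\<dots> = (\<lambda>x. \<pi> powi (r lam * int k) \<cdot>\<^sub>v x) ` ((\<Phi> ^^ s lam) ` ?L)"
      unfolding image_comp comp_def by (rule image_cong) (use sc in auto)
    also have "\<dots> = (\<lambda>x. \<pi> powi (r lam * int k) \<cdot>\<^sub>v (\<pi> powi r lam \<cdot>\<^sub>v x)) ` ?L"
      using rs[OF lam] by (simp add: image_comp comp_def)
    also have "\<dots> = (\<lambda>x. \<pi> powi (r lam * int (Suc k)) \<cdot>\<^sub>v x) ` ?L"
      by (rule image_cong) (simp_all add: smult_smult_assoc powi_add_pi[symmetric] algebra_simps)
    finally show ?case .
  qed simp
  have imgS: "(\<Phi> ^^ S) ` span_idx (OL v) n P (I (\<nu> ! j)) = (\<lambda>x. (\<pi> powi e j) \<cdot>\<^sub>v x) ` span_idx (OL v) n P (I (\<nu> ! j))"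
    if "j < n" for j using img[OF mem[OF that], of "t (\<nu> ! j)"] St[OF mem[OF that]] by (simp add: e_def)
  obtain P' where P': "P' \<in> carrier_mat n n" "P * P' = 1\<^sub>m n" "P' * P = 1\<^sub>m n" using invertible_mat_obtain P by metis
  have Pinj: "x = y" if "x \<in> carrier_vec n" "y \<in> carrier_vec n" "P *\<^sub>v x = P *\<^sub>v y" for x y
  proof -
    have "(P' * P) *\<^sub>v x = (P' * P) *\<^sub>v y" using that P P'(1) by (simp add: assoc_mult_mat_vec[of _ n n _ n])
    then show ?thesis using P'(3) that by simp
  qed
  have coord: "\<exists>M. M \<in> carrier_mat n n \<and> X = P * M" if X: "X \<in> carrier_mat n n" for X
  proof -
    have "X = P * (P' * X)" using X P P' by (simp add: assoc_mult_mat[symmetric, of _ n n _ n _ n])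
    then show ?thesis using X P' by (intro exI[of _ "P' * X"]) auto
  qed
  obtain R where R: "R \<in> carrier_mat n n" "fr \<tau> b P = P * R" using coord[of "fr \<tau> b P"] b P by auto
  obtain G where G: "G \<in> carrier_mat n n" "(fr \<tau> b ^^ S) P = P * G" using coord[of "(fr \<tau> b ^^ S) P"] b P by auto
  have colP: "col P j \<in> span_idx (OL v) n P (I (\<nu> ! j))" if "j < n" for j
    unfolding span_idx_iff
    by (intro exI[of _ "unit_vec n j"]) (use that P mult_unit_vec[OF P(1)] in \<open>auto simp: I_def OL_iff unit_vec_def\<close>)
  have Rcomm: "R * dg n e = dg n e * R"
  proof (subst mat_commute_dg_iff[OF R(1)], intro allI impI)
    fix i j assume ij: "i < n" "j < n" "e i \<noteq> e j"
    have "col P j \<in> span_idx UNIV n P (I (\<nu> ! j))" using colP[OF ij(2)] unfolding span_idx_iff by (metis UNIV_I)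
    then have "\<Phi> (col P j) \<in> span_idx UNIV n P (I (\<nu> ! j))" using st[OF mem[OF ij(2)]] by blast
    then obtain c where c: "c \<in> carrier_vec n" "\<And>i. i < n \<Longrightarrow> i \<notin> I (\<nu> ! j) \<Longrightarrow> c $ i = 0" "\<Phi> (col P j) = P *\<^sub>v c"
      unfolding span_idx_iff by metis
    have "P *\<^sub>v col R j = col (fr \<tau> b P) j" unfolding R(2) by (rule col_mult2[symmetric, OF P(1) R(1) ij(2)])
    also have "\<dots> = \<Phi> (col P j)" using col_fr[OF b(1) P(1) ij(2)] \<Phi>[of "col P j"] P(1) ij(2) by simp
    finally have "col R j = c" using Pinj[of "col R j" c] R ij c by simp
    moreover have "i \<notin> I (\<nu> ! j)" using lev ij by (auto simp: I_def)
    ultimately show "R $$ (i,j) = 0" using c(2)[OF ij(1)] ij R by auto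
  qed
  have Gcol: "\<exists>c. ivec n c \<and> (\<forall>i<n. e i \<noteq> e j \<longrightarrow> c $ i = 0) \<and> col G j = \<pi> powi e j \<cdot>\<^sub>v c" if j: "j < n" for j
  proof -
    have "(\<Phi> ^^ S) (col P j) \<in> (\<lambda>x. (\<pi> powi e j) \<cdot>\<^sub>v x) ` span_idx (OL v) n P (I (\<nu> ! j))"
      using colP[OF j] imgS[OF j] by blast
    then obtain c where c: "c \<in> carrier_vec n" "\<And>i. i < n \<Longrightarrow> (if i \<in> I (\<nu> ! j) then c $ i \<in> OL v else c $ i = 0)"
      "(\<Phi> ^^ S) (col P j) = \<pi> powi e j \<cdot>\<^sub>v (P *\<^sub>v c)" unfolding image_iff Bex_def span_idx_iff by metis
    have "P *\<^sub>v col G j = col ((fr \<tau> b ^^ S) P) j" unfolding G(2) by (rule col_mult2[symmetric, OF P(1) G(1) j])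
    also have "\<dots> = (\<Phi> ^^ S) (col P j)"
      using col_fr_pow[OF b(1) P(1) j, of S \<tau>] funpow_agree[OF \<Phi> b(1), of "col P j" S] P(1) j by simp
    also have "\<dots> = P *\<^sub>v (\<pi> powi e j \<cdot>\<^sub>v c)" using c P by (simp add: mult_mat_vec[of _ n n])
    finally have "col G j = \<pi> powi e j \<cdot>\<^sub>v c" using Pinj[of "col G j" "\<pi> powi e j \<cdot>\<^sub>v c"] G j c by simp
    moreover have "ivec n c" using c unfolding ivec_def OL_iff by (metis vge_0)
    moreover have "c $ i = 0" if "i < n" "e i \<noteq> e j" for i
    proof -
      have "i \<notin> I (\<nu> ! j)" using lev[of i j] that j by (auto simp: I_def)
      then show ?thesis using c(2)[OF that(1)] by simp
    qed
    ultimately show ?thesis by blast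
  qed
  define K where "K = dg n (\<lambda>i. - e i) * G"
  have Kc: "K \<in> carrier_mat n n" using G by (simp add: K_def)
  have Km: "mge 0 K"
  proof (rule mge_I[OF Kc])
    fix i j assume ij: "i < n" "j < n"
    obtain c where c: "ivec n c" "\<And>i. i < n \<Longrightarrow> e i \<noteq> e j \<Longrightarrow> c $ i = 0" "col G j = \<pi> powi e j \<cdot>\<^sub>v c" using Gcol[OF ij(2)] by blast
    have "G $$ (i,j) = col G j $ i" using ij G by simp
    then have "G $$ (i,j) = \<pi> powi e j * c $ i" using c(1,3) ij by (auto simp: ivec_def)
    then have "K $$ (i,j) = \<pi> powi (e j - e i) * c $ i"
      unfolding K_def dg_mult_index[OF G(1) ij] by (simp add: powi_add_pi[symmetric] mult.assoc[symmetric])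
    then show "vge 0 (K $$ (i,j))" using c(1) c(2)[of i] ij by (cases "e i = e j") (auto simp: ivec_def)
  qed
  \<comment> \<open>Surjectivity onto \<pi>^(e j) times the level lattice; the vectors found here
    become, after applying \<tau>^S, the columns of the inverse of \<open>K\<close>.\<close>
  have "\<exists>c. ivec n c \<and> G *\<^sub>v map_vec (\<tau> ^^ S) c = \<pi> powi e j \<cdot>\<^sub>v unit_vec n j" if j: "j < n" for j
  proof -
    have "\<pi> powi e j \<cdot>\<^sub>v col P j \<in> (\<Phi> ^^ S) ` span_idx (OL v) n P (I (\<nu> ! j))"
      unfolding imgS[OF j] using colP[OF j] by blast
    then obtain c where c: "c \<in> carrier_vec n" "\<And>i. i < n \<Longrightarrow> (if i \<in> I (\<nu> ! j) then c $ i \<in> OL v else c $ i = 0)"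
      "\<pi> powi e j \<cdot>\<^sub>v col P j = (\<Phi> ^^ S) (P *\<^sub>v c)" unfolding image_iff Bex_def span_idx_iff by metis
    have "P *\<^sub>v (G *\<^sub>v map_vec (\<tau> ^^ S) c) = (P * G) *\<^sub>v map_vec (\<tau> ^^ S) c"
      using P G c by (simp add: assoc_mult_mat_vec[of _ n n _ n])
    also have "\<dots> = (\<Phi> ^^ S) (P *\<^sub>v c)"
      using funpow_agree[OF \<Phi> b(1), of "P *\<^sub>v c" S] sl_pow_mult_mat_vec[OF a b(1) P(1) c(1), of S] P G(2) c(1) by simp
    also have "\<dots> = P *\<^sub>v (\<pi> powi e j \<cdot>\<^sub>v unit_vec n j)"
      unfolding c(3)[symmetric] using P j by (simp add: mult_mat_vec[of _ n n] mult_unit_vec)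
    finally have "G *\<^sub>v map_vec (\<tau> ^^ S) c = \<pi> powi e j \<cdot>\<^sub>v unit_vec n j"
      by (rule Pinj[rotated 2]) (use G c in auto)
    moreover have "ivec n c" using c unfolding ivec_def OL_iff by (metis vge_0)
    ultimately show ?thesis by blast
  qed
  then obtain c where c: "\<And>j. j < n \<Longrightarrow> ivec n (c j) \<and> G *\<^sub>v map_vec (\<tau> ^^ S) (c j) = \<pi> powi e j \<cdot>\<^sub>v unit_vec n j" by metis
  define C where "C = mat n n (\<lambda>(i,j). (\<tau> ^^ S) (c j $ i))"
  have C: "C \<in> carrier_mat n n" by (simp add: C_def)
  have Cm: "mge 0 C" using c by (auto simp: C_def mge_def ivec_def aut_vge[OF aut_funpow[OF a]])
  have "G * C = dg n e"
  proof (rule mat_col_eqI)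
    fix j assume "j < dim_col (dg n e)"
    then have j: "j < n" by simp
    have "col C j = map_vec (\<tau> ^^ S) (c j)" using c[OF j] j by (intro eq_vecI) (auto simp: C_def ivec_def)
    then have "col (G * C) j = \<pi> powi e j \<cdot>\<^sub>v unit_vec n j" using c[OF j] col_mult2[OF G(1) C j] by simp
    also have "\<dots> = col (dg n e) j" using j by (intro eq_vecI) (auto simp: dg_def unit_vec_def)
    finally show "col (G * C) j = col (dg n e) j" .
  qed (use G C in auto)
  then have "K * C = 1\<^sub>m n" unfolding K_def using G C by (simp add: assoc_mult_mat[of _ n n _ n _ n] dg_inverse)
  then have KG: "GLO n K" by (rule GLO_I[OF Kc C Km Cm])
  have "dg n e * K = G" unfolding K_def using G by (simp add: assoc_mult_mat[symmetric, of _ n n _ n _ n] dg_inverse)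
  then have "slope_basis \<tau> b n P S e" unfolding slope_basis_def using P S0 R Rcomm KG G(2) by blast
  then show ?thesis using anti nuS by blast
qed

text \<open>Existence and uniqueness together justify the definite description in
  \<open>slope_vector\<close>.\<close>

lemma slope_vector_eq:
  assumes a: "aut \<tau>" and b: "b \<in> carrier_mat n n" "invertible_mat b" and st: "slope_basis \<tau> b n P S e" and anti: "antitone n e"
    and \<Phi>: "\<And>x. x \<in> carrier_vec n \<Longrightarrow> \<Phi> x = sl \<tau> b x"
  shows "slope_vector v \<pi> n \<Phi> = slopes n S e"
  unfolding slope_vector_def
proof (rule the_equality)
  show "is_slope_vector v \<pi> n \<Phi> (slopes n S e)" by (rule slope_basis_imp_slope_vector[OF a b(1) st anti \<Phi>])
  fix \<nu> assume "is_slope_vector v \<pi> n \<Phi> \<nu>"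
  from slope_vector_imp_star[OF a b this \<Phi>] obtain P' S' e' where
    s': "slope_basis \<tau> b n P' S' e'" "antitone n e'" "\<nu> = slopes n S' e'" by blast
  have S: "0 < S" "0 < S'" using st s' unfolding slope_basis_def by auto
  have "of_int (e' i) / of_nat S' = (of_int (e i) / of_nat S :: rat)" if "i < n" for i
  proof -
    have "int S' * e i = int S * e' i" by (rule slope_basis_unique[OF a b(1) st s'(1) anti s'(2) that])
    then have "of_int (int S' * e i) = (of_int (int S * e' i) :: rat)" by (simp only:)
    then show ?thesis using S by (simp add: field_simps)
  qed
  then show "\<nu> = slopes n S e" unfolding s'(3) slopes_def by simp
qed

end

section \<open>The Newton polygon lies below the Hodge polygon\<close>

text \<open>Transport of a basis matrix along F from the component 0 to the component
  \<open>k mod f\<close>; with \<open>X\<close> the identity and \<open>k = f\<close> it is the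
  matrix of \<Phi>.\<close>

fun mchain :: "nat \<Rightarrow> ('a::field \<Rightarrow> 'a) \<Rightarrow> (nat \<Rightarrow> 'a mat) \<Rightarrow> 'a mat \<Rightarrow> nat \<Rightarrow> 'a mat" where
  "mchain f \<sigma> B X 0 = X"
| "mchain f \<sigma> B X (Suc k) = B (Suc k mod f) * map_mat \<sigma> (mchain f \<sigma> B X k)"

context dvf
begin

lemma mchain_carrier:
  assumes "1 \<le> f" "\<And>j. j < f \<Longrightarrow> B j \<in> carrier_mat n n" "X \<in> carrier_mat n m"
  shows "mchain f \<sigma> B X k \<in> carrier_mat n m"
proof (induction k)
  case (Suc k)
  have "B (Suc k mod f) \<in> carrier_mat n n" using assms(1,2) by simp
  then show ?case using Suc by (simp add: mult_carrier_mat[of _ n n _ m])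
qed (use assms in simp)

lemma mchain_invertible:
  assumes "aut \<sigma>" "1 \<le> f" "\<And>j. j < f \<Longrightarrow> B j \<in> carrier_mat n n \<and> invertible_mat (B j)"
    "X \<in> carrier_mat n n" "invertible_mat X"
  shows "invertible_mat (mchain f \<sigma> B X k)"
proof (induction k)
  case (Suc k)
  have B: "B (Suc k mod f) \<in> carrier_mat n n" "invertible_mat (B (Suc k mod f))" using assms(2,3) by auto
  have c: "mchain f \<sigma> B X k \<in> carrier_mat n n" by (rule mchain_carrier) (use assms in auto)
  show ?case using B c Suc map_mat_invertible[OF assms(1) c] by (auto intro!: invertible_mat_mult[of _ n])
qed (use assms in simp)

lemma mchain_mult:
  assumes "aut \<sigma>" "1 \<le> f" "\<And>j. j < f \<Longrightarrow> B j \<in> carrier_mat n n" "X \<in> carrier_mat n m" "C \<in> carrier_mat m l"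
  shows "mchain f \<sigma> B (X * C) k = mchain f \<sigma> B X k * map_mat (\<sigma> ^^ k) C"
proof (induction k)
  case (Suc k)
  let ?M = "mchain f \<sigma> B X k" let ?C = "map_mat (\<sigma> ^^ k) C"
  have B: "B (Suc k mod f) \<in> carrier_mat n n" using assms(2,3) by auto
  have M: "?M \<in> carrier_mat n m" "map_mat \<sigma> ?M \<in> carrier_mat n m" using mchain_carrier[OF assms(2,3,4)] by auto
  have C: "?C \<in> carrier_mat m l" "map_mat \<sigma> ?C \<in> carrier_mat m l" using assms by auto
  have "map_mat \<sigma> ?C = map_mat (\<sigma> ^^ Suc k) C" by (simp add: map_mat_comp comp_def)
  then show ?case using Suc assoc_mult_mat[OF B M(2) C(2)] map_mat_mult[OF assms(1) M(1) C(1)]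
    by (simp add: comp_def)
qed simp

lemma mchain_fr:
  assumes "aut \<sigma>" "1 \<le> f" "\<And>j. j < f \<Longrightarrow> B j \<in> carrier_mat n n" "X \<in> carrier_mat n m"
  shows "fr (\<sigma> ^^ f) (mchain f \<sigma> B (1\<^sub>m n) f) X = mchain f \<sigma> B X f"
  using mchain_mult[OF assms(1-3) one_carrier_mat assms(4), where k = f] assms(4) by (simp add: fr_def)

lemma Fiter_eq:
  assumes a: "aut \<sigma>" and f: "1 \<le> f" and B: "\<And>j. j < f \<Longrightarrow> B j \<in> carrier_mat n n" and x: "x \<in> carrier_vec n"
  shows "Fiter f \<sigma> B k x = mchain f \<sigma> B (1\<^sub>m n) k *\<^sub>v map_vec (\<sigma> ^^ k) x"
proof (induction k)
  case 0
  have "map_vec (\<sigma> ^^ 0) x = x" by (intro eq_vecI) auto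
  then have "mchain f \<sigma> B (1\<^sub>m n) 0 *\<^sub>v map_vec (\<sigma> ^^ 0) x = x" using x by (simp only: mchain.simps one_mult_mat_vec)
  then show ?case by (simp only: Fiter.simps)
next
  case (Suc k)
  let ?M = "mchain f \<sigma> B (1\<^sub>m n) k" let ?x = "map_vec (\<sigma> ^^ k) x"
  have Bc: "B (Suc k mod f) \<in> carrier_mat n n" using f B by auto
  have M: "?M \<in> carrier_mat n n" "map_mat \<sigma> ?M \<in> carrier_mat n n" using mchain_carrier[OF f B one_carrier_mat] by auto
  have xc: "?x \<in> carrier_vec n" "map_vec \<sigma> ?x \<in> carrier_vec n" using x by auto
  have "map_vec \<sigma> ?x = map_vec (\<sigma> ^^ Suc k) x" by (intro eq_vecI) auto
  then show ?case
    using Suc assoc_mult_mat_vec[OF Bc M(2) xc(2)] map_vec_mult_mat_vec[OF a M(1) xc(1)]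
    by (simp add: Fmap_def comp_def)
qed

lemma Frob_f_eq:
  assumes "aut \<sigma>" "1 \<le> f" "\<And>j. j < f \<Longrightarrow> B j \<in> carrier_mat n n" "x \<in> carrier_vec n"
  shows "Frob_f f \<sigma> B x = sl (\<sigma> ^^ f) (mchain f \<sigma> B (1\<^sub>m n) f) x"
  unfolding Frob_f_def sl_def by (rule Fiter_eq[OF assms])

lemma inv_is_iff:
  "inv_is v \<pi> n M M' \<mu> \<longleftrightarrow> dominant n \<mu> \<and> (\<exists>A. A \<in> carrier_mat n n \<and> invertible_mat A \<and> M = lattice_of v n A \<and>
     M' = lattice_of v n (A * dg n (\<lambda>i. \<mu> ! i)))"
  by (simp add: inv_is_def dg_def)

lemma dominant_antitone: "dominant n \<mu> \<Longrightarrow> antitone n (\<lambda>i. \<mu> ! i)"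
  unfolding dominant_def antitone_def sorted_wrt_iff_nth_less
  by (metis le_neq_implies_less order_refl)

lemma dominance_slopes_iff:
  assumes S: "0 < S"
  shows "dominance_le (slopes n S e) (map (\<lambda>i. of_int (m i)) [0..<n]) \<longleftrightarrow>
    (\<forall>k\<le>n. (\<Sum>i<k. e i) \<le> (\<Sum>i<k. int S * m i)) \<and> (\<Sum>i<n. e i) = (\<Sum>i<n. int S * m i)"
proof -
  have tk: "sum_list (take k (map g [0..<n])) = (\<Sum>i<k. g i)" if "k \<le> n" for k and g :: "nat \<Rightarrow> rat"
    using that by (simp add: take_map sum_list_distinct_conv_sum_set atLeast0LessThan min_def)
  have c: "(\<Sum>i<k. of_int (e i) / of_nat S) = (of_int (\<Sum>i<k. e i) / of_nat S :: rat)" for k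
    by (simp add: sum_divide_distrib)
  have le: "of_int x / of_nat S \<le> (of_int y :: rat) \<longleftrightarrow> x \<le> int S * y" for x y
  proof -
    have "of_int x / of_nat S \<le> (of_int y :: rat) \<longleftrightarrow> of_int x \<le> (of_int (int S * y) :: rat)"
      using S by (simp add: field_simps)
    then show ?thesis by (simp only: of_int_le_iff)
  qed
  have eq: "of_int x / of_nat S = (of_int y :: rat) \<longleftrightarrow> x = int S * y" for x y
  proof -
    have "of_int x / of_nat S = (of_int y :: rat) \<longleftrightarrow> of_int x = (of_int (int S * y) :: rat)"
      using S by (simp add: field_simps)
    then show ?thesis by (simp only: of_int_eq_iff)
  qed
  have s: "(\<Sum>i<k. of_int (m i)) = (of_int (\<Sum>i<k. m i) :: rat)" for k by simp
  have d: "(\<Sum>i<k. int S * m i) = int S * (\<Sum>i<k. m i)" for k by (simp add: sum_distrib_left)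
  have len: "length (slopes n S e) = n" by (simp add: slopes_def)
  have P: "sum_list (take k (slopes n S e)) \<le> sum_list (take k (map (\<lambda>i. of_int (m i)) [0..<n])) \<longleftrightarrow>
      (\<Sum>i<k. e i) \<le> (\<Sum>i<k. int S * m i)" if "k \<le> n" for k
    unfolding slopes_def tk[OF that] c s le d ..
  have Q: "sum_list (slopes n S e) = sum_list (map (\<lambda>i. of_int (m i)) [0..<n]) \<longleftrightarrow>
      (\<Sum>i<n. e i) = (\<Sum>i<n. int S * m i)"
  proof -
    have "sum_list (slopes n S e) = (\<Sum>i<n. of_int (e i) / of_nat S)"
      using tk[of n "\<lambda>i. of_int (e i) / of_nat S"] by (simp add: slopes_def)
    moreover have "sum_list (map (\<lambda>i. of_int (m i)) [0..<n]) = (\<Sum>i<n. of_int (m i) :: rat)"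
      using tk[of n "\<lambda>i. of_int (m i)"] by simp
    ultimately show ?thesis unfolding c s d by (simp only: eq)
  qed
  show ?thesis unfolding dominance_le_def len using P Q by auto
qed

text \<open>The slope basis \<open>P\<close> of N_0 is transported by F to bases of all N_j. In
  these F is the identity except on the step that closes the cycle, where it is \<open>R\<close>, so
  the determinant of the stable block is collected at the index 0.\<close>

lemma mazur_inequality:
  fixes f :: nat and \<mu> :: "nat \<Rightarrow> int list"
  assumes a: "aut \<sigma>" and f: "1 \<le> f" and B: "\<And>j. j < f \<Longrightarrow> B j \<in> carrier_mat n n \<and> invertible_mat (B j)"
    and adlv: "ADLV_nonempty v \<sigma> \<pi> n f \<mu> B"
    and st: "slope_basis (\<sigma> ^^ f) (mchain f \<sigma> B (1\<^sub>m n) f) n P S e" and anti: "antitone n e"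
  shows "k \<le> n \<Longrightarrow> (\<Sum>i<k. e i) \<le> (\<Sum>i<k. int S * (\<Sum>j<f. \<mu> j ! i))"
    and "(\<Sum>i<n. e i) = (\<Sum>i<n. int S * (\<Sum>j<f. \<mu> j ! i))"
proof -
  let ?\<tau> = "\<sigma> ^^ f" let ?b = "mchain f \<sigma> B (1\<^sub>m n) f" let ?p = "\<lambda>j. (j + f - 1) mod f"
  have Bc: "\<And>j. j < f \<Longrightarrow> B j \<in> carrier_mat n n" using B by simp
  have at: "aut ?\<tau>" using a by simp
  have bc: "?b \<in> carrier_mat n n" by (rule mchain_carrier[OF f Bc one_carrier_mat])
  from slope_basis_obtain[OF at bc st] obtain R K where s: "P \<in> carrier_mat n n" "invertible_mat P" "0 < S"
    "R \<in> carrier_mat n n" "fr ?\<tau> ?b P = P * R" "R * dg n e = dg n e * R"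
    "GLO n K" "K * dg n e = dg n e * K" "(fr ?\<tau> R ^^ S) (1\<^sub>m n) = dg n e * K" by metis
  obtain M where M: "\<And>j. j < f \<Longrightarrow> inv_is v \<pi> n (M j) (Fmap \<sigma> B j ` M (?p j)) (\<mu> j)"
    using adlv unfolding ADLV_nonempty_def by blast
  have dom: "antitone n (\<lambda>i. \<mu> j ! i)" if "j < f" for j
    using M[OF that] dominant_antitone unfolding inv_is_iff by blast
  have "\<forall>j. \<exists>A. j < f \<longrightarrow> A \<in> carrier_mat n n \<and> invertible_mat A \<and> M j = lattice_of v n A \<and>
    Fmap \<sigma> B j ` M (?p j) = lattice_of v n (A * dg n (\<lambda>i. \<mu> j ! i))" using M unfolding inv_is_iff by blast
  then obtain A where A: "\<And>j. j < f \<Longrightarrow> A j \<in> carrier_mat n n \<and> invertible_mat (A j) \<and> M j = lattice_of v n (A j) \<and>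
    Fmap \<sigma> B j ` M (?p j) = lattice_of v n (A j * dg n (\<lambda>i. \<mu> j ! i))" by metis
  have pf: "?p j < f" for j using f by simp
  have exV: "\<exists>V. GLO n V \<and> B j * map_mat \<sigma> (A (?p j)) = A j * dg n (\<lambda>i. \<mu> j ! i) * V" if j: "j < f" for j
  proof (rule lattice_of_eq)
    show "A j * dg n (\<lambda>i. \<mu> j ! i) \<in> carrier_mat n n" "invertible_mat (A j * dg n (\<lambda>i. \<mu> j ! i))"
      using A[OF j] invertible_mat_mult[of "A j" n "dg n (\<lambda>i. \<mu> j ! i)"] by auto
    show "B j * map_mat \<sigma> (A (?p j)) \<in> carrier_mat n n" using Bc[OF j] A[OF pf, of j] by simp
    show "lattice_of v n (A j * dg n (\<lambda>i. \<mu> j ! i)) = lattice_of v n (B j * map_mat \<sigma> (A (?p j)))"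
      using A[OF j] A[OF pf, of j] Fmap_lattice[of \<sigma> B j n "A (?p j)", OF a Bc[OF j]] by simp
  qed
  define V where "V j = (SOME V. GLO n V \<and> B j * map_mat \<sigma> (A (?p j)) = A j * dg n (\<lambda>i. \<mu> j ! i) * V)" for j
  have V: "GLO n (V j) \<and> B j * map_mat \<sigma> (A (?p j)) = A j * dg n (\<lambda>i. \<mu> j ! i) * V j" if "j < f" for j
    unfolding V_def by (rule someI_ex[OF exV[OF that]])
  let ?P = "mchain f \<sigma> B P"
  have Pc: "?P j \<in> carrier_mat n n" "invertible_mat (?P j)" for j
    using mchain_carrier[OF f Bc s(1)] mchain_invertible[OF a f B s(1,2)] by auto
  have "\<exists>N. N \<in> carrier_mat n n \<and> invertible_mat N \<and> ?P j * N = A j" if j: "j < f" for j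
  proof -
    obtain Q where Q: "Q \<in> carrier_mat n n" "?P j * Q = 1\<^sub>m n" "Q * ?P j = 1\<^sub>m n" using invertible_mat_obtain Pc by metis
    have Ac: "A j \<in> carrier_mat n n" using A[OF j] by simp
    have "?P j * (Q * A j) = A j" using Q(2) assoc_mult_mat[OF Pc(1)[of j] Q(1) Ac] left_mult_one_mat[OF Ac] by metis
    moreover have "invertible_mat Q" by (rule invertible_matI[OF Q(1) Pc(1) Q(3,2)])
    ultimately show ?thesis using Q A[OF j] invertible_mat_mult[of Q n "A j"] by (intro exI[of _ "Q * A j"]) auto
  qed
  then obtain N where N: "\<And>j. j < f \<Longrightarrow> N j \<in> carrier_mat n n \<and> invertible_mat (N j) \<and> ?P j * N j = A j" by metis
  define RR where "RR j = (if j = 0 then R else 1\<^sub>m n)" for j :: nat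
  have RRc: "RR j \<in> carrier_mat n n" for j using s(4) by (simp add: RR_def)
  have BP: "B j * map_mat \<sigma> (?P (?p j)) = ?P j * RR j" if j: "j < f" for j
  proof (cases j)
    case 0
    obtain f' where f': "f = Suc f'" using f by (cases f) auto
    have "B 0 * map_mat \<sigma> (?P f') = ?P f" by (simp add: f')
    also have "\<dots> = P * R" using mchain_fr[OF a f Bc s(1)] s(5) by simp
    finally show ?thesis using 0 by (simp add: RR_def f')
  next
    case (Suc i)
    have "?p j = i" using Suc j f by simp
    moreover have "?P (Suc i) = B (Suc i) * map_mat \<sigma> (?P i)" using j Suc by simp
    ultimately have "B j * map_mat \<sigma> (?P (?p j)) = ?P j" using Suc by simp
    then show ?thesis using Suc right_mult_one_mat[OF Pc(1)[of j]] by (simp add: RR_def del: mchain.simps)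
  qed
  have eq: "N j * (1\<^sub>m n * (dg n (\<lambda>i. \<mu> j ! i) * V j)) = RR j * map_mat \<sigma> (N (?p j))" if j: "j < f" for j
  proof -
    let ?D = "dg n (\<lambda>i. \<mu> j ! i)"
    have Nc: "N j \<in> carrier_mat n n" "N (?p j) \<in> carrier_mat n n" "map_mat \<sigma> (N (?p j)) \<in> carrier_mat n n"
      using N[OF j] N[OF pf, of j] by auto
    have Vc: "V j \<in> carrier_mat n n" using V[OF j] GLO_carrier by blast
    have "?P j * (N j * (1\<^sub>m n * (?D * V j))) = (?P j * N j) * ?D * V j"
      using Pc Nc Vc by (simp add: assoc_mult_mat[of _ n n _ n _ n])
    also have "\<dots> = B j * map_mat \<sigma> (?P (?p j) * N (?p j))" using N[OF j] N[OF pf, of j] V[OF j] by simp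
    also have "\<dots> = B j * map_mat \<sigma> (?P (?p j)) * map_mat \<sigma> (N (?p j))"
      using map_mat_mult[OF a Pc(1) Nc(2)] Bc[OF j] Pc(1)[of "?p j"] Nc by (simp add: assoc_mult_mat[of _ n n _ n _ n])
    also have "\<dots> = ?P j * (RR j * map_mat \<sigma> (N (?p j)))"
      unfolding BP[OF j] using Pc RRc Nc by (simp add: assoc_mult_mat[of _ n n _ n _ n])
    finally show ?thesis
      by (rule mult_left_cancel[OF Pc(2,1), rotated -1]) (use Nc Vc RRc in auto)
  qed
  have sumR: "(\<Sum>j<f. v (det (top_left k (RR j)))) = v (det (top_left k R))" if "k \<le> n" for k
  proof -
    have "(\<Sum>j<f. v (det (top_left k (RR j)))) = (\<Sum>j<f. if j = 0 then v (det (top_left k R)) else 0)"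
      by (rule sum.cong) (use that in \<open>auto simp: RR_def\<close>)
    then show ?thesis using f by simp
  qed
  have swap: "(\<Sum>j<f. \<Sum>i<k. \<mu> j ! i) = (\<Sum>i<k. \<Sum>j<f. \<mu> j ! i)" for k by (rule sum.swap)
  have mz: "v (det (top_left k R)) \<le> (\<Sum>i<k. \<Sum>j<f. \<mu> j ! i)"
    "k = n \<Longrightarrow> v (det (top_left k R)) = (\<Sum>i<k. \<Sum>j<f. \<mu> j ! i)" if k: "k \<le> n" and up: "upk n k R" for k
  proof -
    have c1: "\<And>j. j < f \<Longrightarrow> N j \<in> carrier_mat n n \<and> invertible_mat (N j)" using N by blast
    have c2: "\<And>j. j < f \<Longrightarrow> RR j \<in> carrier_mat n n \<and> upk n k (RR j)" using RRc up k by (simp add: RR_def)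
    have c3: "\<And>j. j < f \<Longrightarrow> GLO n ((\<lambda>_. 1\<^sub>m n) j) \<and> GLO n (V j)" using V by simp
    note mb = mazur_blocks[where N = N and R = RR and U = "\<lambda>_. 1\<^sub>m n" and V = V and \<mu> = "\<lambda>j i. \<mu> j ! i",
        OF a f k c1 c2 c3 dom eq]
    have "(\<Sum>j<f. v (det (top_left k (RR j)))) \<le> (\<Sum>j<f. \<Sum>i<k. \<mu> j ! i)" by (rule mb(1))
    then show "v (det (top_left k R)) \<le> (\<Sum>i<k. \<Sum>j<f. \<mu> j ! i)" using sumR[OF k] swap by simp
    have "(\<Sum>j<f. v (det (top_left k (RR j)))) = (\<Sum>j<f. \<Sum>i<k. \<mu> j ! i)" if "k = n" using that by (intro mb(2))
    then show "v (det (top_left k R)) = (\<Sum>i<k. \<Sum>j<f. \<mu> j ! i)" if "k = n" using that sumR[OF k] swap by simp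
  qed
  show total: "(\<Sum>i<n. e i) = (\<Sum>i<n. int S * (\<Sum>j<f. \<mu> j ! i))"
  proof -
    have "int S * v (det (top_left n R)) = (\<Sum>i<n. e i)"
      by (rule slope_block_det[OF at bc s(4,6,7,8,9) _ _ s(3)]) auto
    then show ?thesis using mz(2)[of n] by (simp add: sum_distrib_left)
  qed
  show "(\<Sum>i<k. e i) \<le> (\<Sum>i<k. int S * (\<Sum>j<f. \<mu> j ! i))" if "k \<le> n"
  proof (rule partial_sums_le_of_breaks[OF total _ _ that])
    show "int S * (\<Sum>j'<f. \<mu> j' ! j) \<le> int S * (\<Sum>j<f. \<mu> j ! i)" if "i \<le> j" "j < n" for i j
      by (intro mult_left_mono sum_mono) (use dom that in \<open>auto simp: antitone_def\<close>)
    fix k assume k: "0 < k" "k < n" "e k < e (k - 1)"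
    note br = upk_of_break[OF _ _ anti k]
    have "int S * v (det (top_left k R)) = (\<Sum>i<k. e i)"
      by (rule slope_block_det[OF at bc s(4,6,7,8,9) br _ s(3)]) (use k in auto)
    moreover have "int S * v (det (top_left k R)) \<le> int S * (\<Sum>i<k. \<Sum>j<f. \<mu> j ! i)"
      by (rule mult_left_mono) (use mz(1)[of k] br[OF s(4,6)] k in auto)
    ultimately show "(\<Sum>i<k. e i) \<le> (\<Sum>i<k. int S * (\<Sum>j<f. \<mu> j ! i))" by (simp add: sum_distrib_left)
  qed
qed

text \<open>A relation among the iterates of a vector of slope \<open>E / S\<close> has no Newton
  slope below \<open>E / S\<close>. Two growth rates are compared: the lattice estimate gains at
  least \<open>E\<close> in \<open>S\<close> steps, while the weighted valuation gains exactly
  \<open>r\<close> per step, with \<open>r / s\<close> the smallest slope of the relation; hence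
  \<open>E / S \<le> r / s\<close>.\<close>

lemma isoclinic_relation_slope:
  assumes a: "aut \<tau>" and R: "R \<in> carrier_mat n n" "R * dg n e = dg n e * R" and S: "0 < S"
    and K: "GLO n K" "K * dg n e = dg n e * K" and RS: "(fr \<tau> R ^^ S) (1\<^sub>m n) = dg n e * K"
    and z: "z \<in> carrier_vec n" "\<And>i. i < n \<Longrightarrow> e i \<noteq> E \<Longrightarrow> z $ i = 0"
    and ind: "indep n d (\<lambda>j k. (sl \<tau> R ^^ j) z $ k)"
    and rel: "(sl \<tau> R ^^ d) z = comb n d (\<lambda>j. (sl \<tau> R ^^ j) z) c"
    and cnz: "\<exists>i<d. c i \<noteq> 0" and j: "j < d" "c j \<noteq> 0"
  shows "E * int (d - j) \<le> int S * v (c j)"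
proof -
  note Kc = GLO_carrier[OF K(1)]
  let ?y = "\<lambda>j. (sl \<tau> R ^^ j) z"
  from min_slope_exists[OF cnz] obtain r s i0 where s: "0 < s" and i0: "i0 < d" and c0: "c i0 \<noteq> 0" "int s * v (c i0) = r * int (d - i0)"
    and c: "\<And>i. i < d \<Longrightarrow> c i \<noteq> 0 \<Longrightarrow> r * int (d - i) \<le> int s * v (c i)"
    and c1: "\<And>i. i < i0 \<Longrightarrow> c i \<noteq> 0 \<Longrightarrow> r * int (d - i) < int s * v (c i)" by blast
  have d: "0 < d" using i0 by simp
  have supp1: "(sl \<tau> R w) $ i = 0" if "w \<in> carrier_vec n" "\<And>i. i < n \<Longrightarrow> e i \<noteq> E \<Longrightarrow> w $ i = 0" "i < n" "e i \<noteq> E" for w i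
    unfolding sl_def by (rule commuting_support[OF R, of _ E]) (use that aut_simps(1)[OF a] in auto)
  have supp: "?y k $ i = 0" if "i < n" "e i \<noteq> E" for k i
    using that by (induction k arbitrary: i) (use z R supp1 in auto)
  \<comment> \<open>The dual functionals recover the coefficients of a combination of iterates from
    its coordinates, changing valuations by a bounded amount \<open>C1\<close>.\<close>
  obtain zf where zf: "\<And>i j. i < d \<Longrightarrow> j < d \<Longrightarrow> ip n (zf i) (\<lambda>k. ?y j $ k) = (if i = j then 1 else 0)"
    using indep_left_inverse[OF ind] by blast
  obtain C1 where C1: "\<And>i k. i < d \<Longrightarrow> k < n \<Longrightarrow> vge C1 (zf i k)"
  proof -
    obtain C where "mge C (mat d n (\<lambda>(i,k). zf i k))" using mge_lower_bound by blast
    then show ?thesis using that[of C] by (auto simp: mge_def)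
  qed
  \<comment> \<open>Starting from the \<open>i0\<close>-th iterate makes the exact growth of weights
    available.\<close>
  define w0 where "w0 = ?y i0"
  have w0: "w0 \<in> carrier_vec n" "\<And>i. i < n \<Longrightarrow> e i \<noteq> E \<Longrightarrow> w0 $ i = 0" using z R supp by (auto simp: w0_def)
  obtain C0 where C0: "\<And>i. i < n \<Longrightarrow> vge C0 (w0 $ i)"
  proof -
    obtain C where "mge C (mat n 1 (\<lambda>(i,k). w0 $ i))" using mge_lower_bound by blast
    then show ?thesis using that[of C] by (auto simp: mge_def)
  qed
  have grow: "\<forall>i<n. vge (C0 + E * int l) ((sl \<tau> R ^^ (S * l)) w0 $ i) \<and> (e i \<noteq> E \<longrightarrow> (sl \<tau> R ^^ (S * l)) w0 $ i = 0)" for l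
  proof (induction l)
    case 0
    show ?case using C0 w0 by simp
  next
    case (Suc l)
    let ?w = "(sl \<tau> R ^^ (S * l)) w0" let ?w' = "map_vec (\<tau> ^^ S) ?w"
    have wc: "?w \<in> carrier_vec n" "?w' \<in> carrier_vec n" "K *\<^sub>v ?w' \<in> carrier_vec n" using w0 R Kc by auto
    have w'0: "?w' $ i = 0" if "i < n" "e i \<noteq> E" for i
      using Suc that wc(1) aut_simps(1)[OF aut_funpow[OF a]] by auto
    have Kw0: "(K *\<^sub>v ?w') $ i = 0" if "i < n" "e i \<noteq> E" for i
      by (rule commuting_support[OF Kc K(2) wc(2) w'0 that])
    have "(sl \<tau> R ^^ (S * Suc l)) w0 = (sl \<tau> R ^^ S) (1\<^sub>m n *\<^sub>v ?w)" using wc by (simp add: funpow_add)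
    also have "\<dots> = (dg n e * K) *\<^sub>v ?w'"
      unfolding sl_pow_mult_mat_vec[OF a R(1) one_carrier_mat wc(1)] RS ..
    also have "\<dots> = dg n e *\<^sub>v (K *\<^sub>v ?w')" using Kc wc by (simp add: assoc_mult_mat_vec[of _ n n _ n])
    also have "\<dots> = \<pi> powi E \<cdot>\<^sub>v (K *\<^sub>v ?w')" by (rule dg_mult_vec[OF wc(3) Kw0])
    finally have e1: "(sl \<tau> R ^^ (S * Suc l)) w0 = \<pi> powi E \<cdot>\<^sub>v (K *\<^sub>v ?w')" .
    have "vge (C0 + E * int l) ((K *\<^sub>v ?w') $ i)" if "i < n" for i
      unfolding mult_mat_vec_index[OF Kc wc(2) that]
      by (intro vge_sum vge_mult0(1)) (use Suc that wc Kc GLO_mge[OF K(1)] aut_vge[OF aut_funpow[OF a]] in \<open>auto simp: mge_def\<close>)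
    moreover have "(\<pi> powi E \<cdot>\<^sub>v (K *\<^sub>v ?w')) $ i = \<pi> powi E * (K *\<^sub>v ?w') $ i" if "i < n" for i
      using carrier_vecD[OF wc(3)] that by (intro index_smult_vec(1)) simp
    ultimately show ?case unfolding e1 using Kw0 by (simp add: vge_powi_mult algebra_simps)
  qed
  \<comment> \<open>The term with \<open>2 * d\<close> absorbs the index difference
    \<open>i0 - i\<close>, so the error stays constant as \<open>l\<close> grows.\<close>
  have key: "int s * (C1 + C0 + E * int l) \<le> \<bar>r\<bar> * int (2 * d) + r * int (S * l)" for l
  proof -
    define u where "u = (cstep \<tau> d c ^^ (S * l)) (\<lambda>i. if i = i0 then 1 else 0)"
    have "attains s r d i0 (r * int i0 + r * int (S * l)) u"
      unfolding u_def by (rule cstep_pow_attains[OF a s i0 c c0 c1 attains_unit[OF i0]])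
    then obtain i where i: "i < d" "u i \<noteq> 0" "int s * v (u i) + r * int i = r * int i0 + r * int (S * l)"
      unfolding attains_def by blast
    have "comb n d ?y (\<lambda>i. if i = i0 then 1 else 0) = w0"
    proof (rule eq_vecI)
      fix k assume "k < dim_vec w0"
      then have k: "k < n" using w0 by simp
      have "(\<Sum>j<d. (if j = i0 then 1 else 0) * ?y j $ k) = (\<Sum>j<d. if j = i0 then ?y i0 $ k else 0)"
        by (rule sum.cong) auto
      then show "comb n d ?y (\<lambda>i. if i = i0 then 1 else 0) $ k = w0 $ k" using k i0 by (simp add: comb_def w0_def)
    qed (use w0 in \<open>simp add: comb_def\<close>)
    then have e2: "(sl \<tau> R ^^ (S * l)) w0 = comb n d ?y u"
      unfolding u_def using sl_comb_step[OF a R(1) z(1) d rel, of "S * l" "\<lambda>i. if i = i0 then 1 else 0"] by simp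
    have "ip n (zf i) (\<lambda>k. comb n d ?y u $ k) = ip n (zf i) (\<lambda>k. \<Sum>j<d. u j * ?y j $ k)"
      by (rule ip_cong) (simp add: comb_def)
    also have "\<dots> = (\<Sum>j<d. u j * ip n (zf i) (\<lambda>k. ?y j $ k))" by (rule ip_sum)
    also have "\<dots> = (\<Sum>j<d. u j * (if j = i then 1 else 0))" by (rule sum.cong) (use zf i in auto)
    also have "\<dots> = u i" using i by simp
    finally have "u i = (\<Sum>k<n. zf i k * comb n d ?y u $ k)" by (simp add: ip_def)
    also have "vge (C1 + (C0 + E * int l)) \<dots>"
      by (intro vge_sum vge_mult) (use C1[OF i(1)] grow[of l] e2 in auto)
    finally have "C1 + (C0 + E * int l) \<le> v (u i)" using i(2) by (simp add: vge_def)
    then have "int s * (C1 + (C0 + E * int l)) \<le> int s * v (u i)" by (rule mult_left_mono) simp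
    also have "\<dots> = r * (int i0 - int i) + r * int (S * l)" using i(3) by (simp add: algebra_simps)
    also have "r * (int i0 - int i) \<le> \<bar>r\<bar> * int (2 * d)"
    proof -
      have "r * (int i0 - int i) \<le> \<bar>r * (int i0 - int i)\<bar>" by simp
      also have "\<dots> = \<bar>r\<bar> * \<bar>int i0 - int i\<bar>" by (rule abs_mult)
      also have "\<dots> \<le> \<bar>r\<bar> * int (2 * d)" by (rule mult_left_mono) (use i(1) i0 in auto)
      finally show ?thesis .
    qed
    finally show ?thesis by (simp add: algebra_simps)
  qed
  have slope: "int s * E \<le> r * int S"
  proof (rule ccontr)
    assume "\<not> ?thesis"
    then have pos: "1 \<le> int s * E - r * int S" by simp
    define X where "X = \<bar>r\<bar> * int (2 * d) - int s * (C1 + C0)"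
    have "(int s * E - r * int S) * int l \<le> X" for l using key[of l] by (simp add: X_def algebra_simps)
    from this[of "nat (X + 1)"] have "(int s * E - r * int S) * int (nat (X + 1)) \<le> X" .
    moreover have "int (nat (X + 1)) \<le> (int s * E - r * int S) * int (nat (X + 1))"
      using mult_right_mono[OF pos, of "int (nat (X + 1))"] by simp
    moreover have "X + 1 \<le> int (nat (X + 1))" by simp
    ultimately show False by linarith
  qed
  have "int s * (E * int (d - j)) = (int s * E) * int (d - j)" by simp
  also have "\<dots> \<le> (r * int S) * int (d - j)" by (rule mult_right_mono[OF slope]) simp
  also have "\<dots> = int S * (r * int (d - j))" by simp
  also have "\<dots> \<le> int S * (int s * v (c j))" by (rule mult_left_mono[OF c[OF j]]) simp
  finally have "int s * (E * int (d - j)) \<le> int s * (int S * v (c j))" by (simp add: algebra_simps)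
  then show ?thesis using s by simp
qed

end

section \<open>Lattices with prescribed Hodge polygon\<close>

context dvf
begin

section \<open>Twisted polynomials annihilating a vector\<close>

lemma sl_pow_comb:
  assumes a: "aut \<tau>" and b: "b \<in> carrier_mat n n" and y: "\<And>j. j < d \<Longrightarrow> y j \<in> carrier_vec n"
  shows "(sl \<tau> b ^^ i) (comb n d y u) = comb n d (\<lambda>j. (sl \<tau> b ^^ i) (y j)) (\<lambda>j. (\<tau> ^^ i) (u j))"
proof (induction i)
  case (Suc i)
  have "sl \<tau> b (comb n d (\<lambda>j. (sl \<tau> b ^^ i) (y j)) (\<lambda>j. (\<tau> ^^ i) (u j))) =
    comb n d (\<lambda>j. sl \<tau> b ((sl \<tau> b ^^ i) (y j))) (\<lambda>j. \<tau> ((\<tau> ^^ i) (u j)))"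
    by (rule sl_comb[OF a b]) (use y b in auto)
  then show ?case using Suc by simp
qed simp

text \<open>Multiplication in the twisted polynomial ring, where \<Phi> \<open>a\<close> =
  \<open>\<tau> a\<close> \<Phi>: applying \<open>g\<close> after \<open>c\<close> is applying their
  twisted product.\<close>

lemma comb_compose:
  assumes a: "aut \<tau>" and b: "b \<in> carrier_mat n n" and y: "y \<in> carrier_vec n"
    and c: "\<And>k. m < k \<Longrightarrow> c k = 0" and g: "\<And>k. l < k \<Longrightarrow> g k = 0"
  shows "comb n (Suc l) (\<lambda>i. (sl \<tau> b ^^ i) (comb n (Suc m) (\<lambda>j. (sl \<tau> b ^^ j) y) c)) g =
    comb n (Suc (l + m)) (\<lambda>k. (sl \<tau> b ^^ k) y) (\<lambda>k. \<Sum>i\<le>k. g i * (\<tau> ^^ i) (c (k - i)))"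
proof (rule eq_vecI)
  let ?y = "\<lambda>k. (sl \<tau> b ^^ k) y"
  fix q assume "q < dim_vec (comb n (Suc (l + m)) ?y (\<lambda>k. \<Sum>i\<le>k. g i * (\<tau> ^^ i) (c (k - i))))"
  then have q: "q < n" by (simp add: comb_def)
  define F where "F i j = g i * (\<tau> ^^ i) (c j) * ?y (i + j) $ q" for i j
  have F0: "F i j = 0" if "l < i \<or> m < j" for i j
    using that c g aut_simps(1)[OF aut_funpow[OF a]] by (auto simp: F_def)
  have "comb n (Suc l) (\<lambda>i. (sl \<tau> b ^^ i) (comb n (Suc m) ?y c)) g $ q =
      (\<Sum>i<Suc l. g i * (\<Sum>j<Suc m. (\<tau> ^^ i) (c j) * ?y (i + j) $ q))"
  proof -
    have "(sl \<tau> b ^^ i) (comb n (Suc m) ?y c) $ q = (\<Sum>j<Suc m. (\<tau> ^^ i) (c j) * ?y (i + j) $ q)" for i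
    proof -
      have "(sl \<tau> b ^^ i) (comb n (Suc m) ?y c) = comb n (Suc m) (\<lambda>j. (sl \<tau> b ^^ i) (?y j)) (\<lambda>j. (\<tau> ^^ i) (c j))"
        by (rule sl_pow_comb[OF a b]) (use y b in auto)
      then show ?thesis using q by (simp add: comb_def funpow_add)
    qed
    then show ?thesis using q by (simp add: comb_def)
  qed
  also have "\<dots> = (\<Sum>i\<le>l. \<Sum>j\<le>m. F i j)"
    unfolding lessThan_Suc_atMost sum_distrib_left F_def by (simp add: mult.assoc)
  also have "\<dots> = (\<Sum>(i,j)\<in>{..l} \<times> {..m}. F i j)" by (rule sum.cartesian_product)
  also have "\<dots> = (\<Sum>(i,j)\<in>{(i,j). i + j \<le> l + m}. F i j)"
  proof (rule sum.mono_neutral_left)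
    show "finite {(i, j). i + j \<le> l + m}" by (rule finite_subset[of _ "{..l + m} \<times> {..l + m}"]) auto
    show "\<forall>i\<in>{(i, j). i + j \<le> l + m} - {..l} \<times> {..m}. (case i of (i, j) \<Rightarrow> F i j) = 0"
      using F0 by (auto; metis not_le)
  qed auto
  also have "\<dots> = (\<Sum>k\<le>l + m. \<Sum>i\<le>k. F i (k - i))" by (rule sum.triangle_reindex_eq)
  also have "\<dots> = (\<Sum>k<Suc (l + m). (\<Sum>i\<le>k. g i * (\<tau> ^^ i) (c (k - i))) * ?y k $ q)"
    unfolding lessThan_Suc_atMost by (rule sum.cong) (auto simp: F_def sum_distrib_right)
  finally show "comb n (Suc l) (\<lambda>i. (sl \<tau> b ^^ i) (comb n (Suc m) ?y c)) g $ q =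
    comb n (Suc (l + m)) ?y (\<lambda>k. \<Sum>i\<le>k. g i * (\<tau> ^^ i) (c (k - i))) $ q" using q by (simp add: comb_def)
qed (simp add: comb_def)

lemma sl_pow_support:
  assumes a: "aut \<tau>" and R: "R \<in> carrier_mat n n" "R * dg n e = dg n e * R" and w: "w \<in> carrier_vec n"
    and supp: "\<And>i. i < n \<Longrightarrow> e i \<in> L \<Longrightarrow> w $ i = 0" and i: "i < n" "e i \<in> L"
  shows "(sl \<tau> R ^^ k) w $ i = 0"
  using i
proof (induction k arbitrary: i)
  case (Suc k)
  have wc: "(sl \<tau> R ^^ k) w \<in> carrier_vec n" using R w by simp
  have "sl \<tau> R ((sl \<tau> R ^^ k) w) $ i = 0" unfolding sl_index[OF R(1) wc Suc.prems(1)]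
  proof (rule sum.neutral, intro ballI)
    fix m assume "m \<in> {..<n}"
    then have m: "m < n" by simp
    show "R $$ (i,m) * \<tau> ((sl \<tau> R ^^ k) w $ m) = 0"
    proof (cases "e m = e i")
      case True
      then show ?thesis using Suc.IH[OF m] Suc.prems aut_simps(1)[OF a] by simp
    next
      case False
      then show ?thesis using mat_commute_dg_iff[OF R(1)] R(2) m Suc.prems by simp
    qed
  qed
  then show ?case by simp
qed (use supp in simp)

text \<open>On \<open>J\<close> the vector \<open>y\<close> may be replaced by its component
  \<open>z\<close> of level \<open>E\<close>. The minimal relation of \<open>z\<close> has degree
  \<open>d \<le> m\<close>, and multiplying it by \<Phi>^(m - d) pads it to degree exactly
  \<open>m\<close> without changing the slope bound.\<close>

lemma level_annihilator:
  assumes a: "aut \<tau>" and R: "R \<in> carrier_mat n n" "R * dg n e = dg n e * R" "invertible_mat R" and S: "0 < S"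
    and K: "GLO n K" "K * dg n e = dg n e * K" and RS: "(fr \<tau> R ^^ S) (1\<^sub>m n) = dg n e * K"
    and y: "y \<in> carrier_vec n" and J: "J = {i. i < n \<and> e i = E}" and m: "m = card J"
  shows "\<exists>g. g m = 1 \<and> (\<forall>k>m. g k = 0) \<and> (\<forall>k\<le>m. g k \<noteq> 0 \<longrightarrow> E * int (m - k) \<le> int S * v (g k)) \<and>
    (\<forall>i\<in>J. comb n (Suc m) (\<lambda>k. (sl \<tau> R ^^ k) y) g $ i = 0)"
proof -
  define z where "z = vec n (\<lambda>i. if e i = E then y $ i else 0)"
  have zc: "z \<in> carrier_vec n" by (simp add: z_def)
  have z0: "\<And>i. i < n \<Longrightarrow> e i \<noteq> E \<Longrightarrow> z $ i = 0" by (simp add: z_def)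
  have finJ: "finite J" by (simp add: J)
  have proj: "(sl \<tau> R ^^ k) y $ i = (sl \<tau> R ^^ k) z $ i" if "i \<in> J" for k i
  proof -
    have i: "i < n" "e i \<in> {E}" using that by (auto simp: J)
    have yz: "y = z + (y + (-1) \<cdot>\<^sub>v z)" using y zc by (intro eq_vecI) auto
    have w: "y + (-1) \<cdot>\<^sub>v z \<in> carrier_vec n" using y zc by simp
    have "(sl \<tau> R ^^ k) (y + (-1) \<cdot>\<^sub>v z) $ i = 0"
      by (rule sl_pow_support[OF a R(1,2) w _ i]) (use y in \<open>auto simp: z_def\<close>)
    moreover have "(sl \<tau> R ^^ k) y = (sl \<tau> R ^^ k) z + (sl \<tau> R ^^ k) (y + (-1) \<cdot>\<^sub>v z)"
      by (subst yz, rule sl_pow_add[OF a R(1) zc w])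
    ultimately show ?thesis using i carrier_vecD[OF sl_pow_carrier[OF R(1) w, of k \<tau>]] by simp
  qed
  have key: "\<exists>g. g m = 1 \<and> (\<forall>k>m. g k = 0) \<and> (\<forall>k\<le>m. g k \<noteq> 0 \<longrightarrow> E * int (m - k) \<le> int S * v (g k)) \<and>
    (\<forall>i<n. (\<Sum>k\<le>m. g k * (sl \<tau> R ^^ k) z $ i) = 0)"
  proof (cases "z = 0\<^sub>v n")
    case True
    have zz: "(sl \<tau> R ^^ k) z $ i = 0" if "i < n" for k i
      by (rule sl_pow_support[OF a R(1,2) zc, of UNIV]) (use True that in auto)
    show ?thesis by (rule exI[of _ "\<lambda>k. if k = m then 1 else 0"]) (auto simp: zz)
  next
    case False
    obtain d c where d: "0 < d" "indep n d (\<lambda>j k. (sl \<tau> R ^^ j) z $ k)"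
      "(sl \<tau> R ^^ d) z = comb n d (\<lambda>j. (sl \<tau> R ^^ j) z) c" "\<exists>i<d. c i \<noteq> 0"
      using krylov_relation[OF a R(1,3) zc False] by blast
    have dm: "d \<le> m" unfolding m
    proof (rule indep_dim[OF d(2) finJ])
      fix j k assume "k < n" "k \<notin> J"
      then show "(sl \<tau> R ^^ j) z $ k = 0"
        by (intro sl_pow_support[OF a R(1,2) zc, of "- {E}"]) (use z0 in \<open>auto simp: J\<close>)
    qed
    have cb: "E * int (d - j) \<le> int S * v (c j)" if "j < d" "c j \<noteq> 0" for j
      by (rule isoclinic_relation_slope[OF a R(1,2) S K RS zc z0 d(2-4) that])
    define p where "p = m - d"
    \<comment> \<open>The coefficients of \<Phi>^p times the minimal relation; moving \<Phi>^p past
      them is what applies \<tau>^p.\<close>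
    define g where "g k = (if k = m then 1 else if p \<le> k \<and> k < m then - (\<tau> ^^ p) (c (k - p)) else 0)" for k
    have "E * int (m - k) \<le> int S * v (g k)" if "k \<le> m" "g k \<noteq> 0" for k
    proof (cases "k = m")
      case False
      then have k: "p \<le> k" "k < m" "c (k - p) \<noteq> 0"
        using that aut_simps(1)[OF aut_funpow[OF a]] by (auto simp: g_def split: if_splits)
      have "k - p < d" "d - (k - p) = m - k" using k dm by (auto simp: p_def)
      then show ?thesis using cb[of "k - p"] k by (simp add: g_def aut_v[OF aut_funpow[OF a]])
    qed (simp add: g_def)
    moreover have "(\<Sum>k\<le>m. g k * (sl \<tau> R ^^ k) z $ i) = 0" if i: "i < n" for i
    proof -
      have mp: "m = p + d" using dm by (simp add: p_def)
      have "(sl \<tau> R ^^ m) z = (sl \<tau> R ^^ p) (comb n d (\<lambda>j. (sl \<tau> R ^^ j) z) c)"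
        unfolding mp funpow_add by (simp add: d(3))
      also have "\<dots> = comb n d (\<lambda>j. (sl \<tau> R ^^ p) ((sl \<tau> R ^^ j) z)) (\<lambda>j. (\<tau> ^^ p) (c j))"
        by (rule sl_pow_comb[OF a R(1)]) (use R zc in auto)
      finally have 1: "(sl \<tau> R ^^ m) z $ i = (\<Sum>j<d. (\<tau> ^^ p) (c j) * (sl \<tau> R ^^ (p + j)) z $ i)"
        using i by (simp add: comb_def funpow_add)
      have "(\<Sum>k\<le>m. g k * (sl \<tau> R ^^ k) z $ i) = (sl \<tau> R ^^ m) z $ i + (\<Sum>k<m. g k * (sl \<tau> R ^^ k) z $ i)"
        by (simp add: lessThan_Suc_atMost[symmetric] g_def)
      also have "(\<Sum>k<m. g k * (sl \<tau> R ^^ k) z $ i) = (\<Sum>k\<in>{p..<m}. g k * (sl \<tau> R ^^ k) z $ i)"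
        by (rule sum.mono_neutral_right) (auto simp: g_def)
      also have "\<dots> = (\<Sum>j<d. - ((\<tau> ^^ p) (c j) * (sl \<tau> R ^^ (p + j)) z $ i))"
        by (rule sum.reindex_bij_witness[of _ "\<lambda>j. p + j" "\<lambda>k. k - p"]) (use mp in \<open>auto simp: g_def\<close>)
      finally show ?thesis unfolding 1 by (simp add: sum_negf)
    qed
    ultimately show ?thesis by (intro exI[of _ g]) (auto simp: g_def)
  qed
  then obtain g where g: "g m = 1" "\<forall>k>m. g k = 0" "\<forall>k\<le>m. g k \<noteq> 0 \<longrightarrow> E * int (m - k) \<le> int S * v (g k)"
    "\<And>i. i < n \<Longrightarrow> (\<Sum>k\<le>m. g k * (sl \<tau> R ^^ k) z $ i) = 0" by blast
  have "comb n (Suc m) (\<lambda>k. (sl \<tau> R ^^ k) y) g $ i = 0" if "i \<in> J" for i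
  proof -
    have i: "i < n" using that by (simp add: J)
    have "comb n (Suc m) (\<lambda>k. (sl \<tau> R ^^ k) y) g $ i = (\<Sum>k\<le>m. g k * (sl \<tau> R ^^ k) z $ i)"
      using i proj[OF that] by (simp add: comb_def lessThan_Suc_atMost)
    then show ?thesis using g(4)[OF i] by simp
  qed
  then show ?thesis using g by blast
qed

text \<open>A product of annihilators, one for each level. As twisted polynomials do not commute,
  the new factor is chosen for the image \<open>w\<close> of \<open>y\<close> under the product so
  far; the earlier levels stay annihilated because \<Phi> preserves the vanishing of components.
  Recording an index set \<open>I\<close> for each coefficient lets the bounds of two factors be
  added.\<close>

lemma annihilator:
  assumes a: "aut \<tau>" and R: "R \<in> carrier_mat n n" "R * dg n e = dg n e * R" "invertible_mat R" and S: "0 < S"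
    and K: "GLO n K" "K * dg n e = dg n e * K" and RS: "(fr \<tau> R ^^ S) (1\<^sub>m n) = dg n e * K"
    and y: "y \<in> carrier_vec n" and L: "finite L"
  shows "\<exists>c. c (card {i. i < n \<and> e i \<in> L}) = 1 \<and> (\<forall>k>card {i. i < n \<and> e i \<in> L}. c k = 0) \<and>
    (\<forall>k\<le>card {i. i < n \<and> e i \<in> L}. c k \<noteq> 0 \<longrightarrow> (\<exists>I\<subseteq>{i. i < n \<and> e i \<in> L}.
      card I = card {i. i < n \<and> e i \<in> L} - k \<and> (\<Sum>i\<in>I. e i) \<le> int S * v (c k))) \<and>
    (\<forall>i<n. e i \<in> L \<longrightarrow> comb n (Suc (card {i. i < n \<and> e i \<in> L})) (\<lambda>k. (sl \<tau> R ^^ k) y) c $ i = 0)"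
  using L
proof (induction L rule: finite_induct)
  case empty
  show ?case by (rule exI[of _ "\<lambda>k. if k = 0 then 1 else 0"]) auto
next
  case (insert E L)
  define J where "J = {i. i < n \<and> e i \<in> L}"
  define JE where "JE = {i. i < n \<and> e i = E}"
  define m where "m = card J"
  define l where "l = card JE"
  have fin: "finite J" "finite JE" by (auto simp: J_def JE_def)
  have dis: "J \<inter> JE = {}" using insert.hyps by (auto simp: J_def JE_def)
  have un: "{i. i < n \<and> e i \<in> insert E L} = JE \<union> J" by (auto simp: J_def JE_def)
  have cun: "card (JE \<union> J) = l + m" unfolding l_def m_def by (rule card_Un_disjoint) (use fin dis in auto)
  let ?y = "\<lambda>k. (sl \<tau> R ^^ k) y"
  obtain c where c: "c m = 1" "\<And>k. m < k \<Longrightarrow> c k = 0"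
    "\<And>k. k \<le> m \<Longrightarrow> c k \<noteq> 0 \<Longrightarrow> \<exists>I\<subseteq>J. card I = m - k \<and> (\<Sum>i\<in>I. e i) \<le> int S * v (c k)"
    "\<And>i. i < n \<Longrightarrow> e i \<in> L \<Longrightarrow> comb n (Suc m) ?y c $ i = 0"
    using insert.IH unfolding J_def[symmetric] m_def[symmetric] by blast
  define w where "w = comb n (Suc m) ?y c"
  have wc: "w \<in> carrier_vec n" by (simp add: w_def)
  obtain g where g: "g l = 1" "\<And>k. l < k \<Longrightarrow> g k = 0" "\<And>k. k \<le> l \<Longrightarrow> g k \<noteq> 0 \<Longrightarrow> E * int (l - k) \<le> int S * v (g k)"
    "\<And>i. i \<in> JE \<Longrightarrow> comb n (Suc l) (\<lambda>k. (sl \<tau> R ^^ k) w) g $ i = 0"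
    using level_annihilator[OF a R S K RS wc JE_def l_def] by blast
  define h where "h k = (\<Sum>i\<le>k. g i * (\<tau> ^^ i) (c (k - i)))" for k
  have comp: "comb n (Suc l) (\<lambda>k. (sl \<tau> R ^^ k) w) g = comb n (Suc (l + m)) ?y h"
    unfolding w_def h_def[abs_def] by (rule comb_compose[OF a R(1) y c(2) g(2)])
  have h1: "h (l + m) = 1"
  proof -
    have "h (l + m) = (\<Sum>i\<le>l + m. if i = l then 1 else 0)" unfolding h_def
    proof (rule sum.cong)
      fix i assume "i \<in> {..l + m}"
      show "g i * (\<tau> ^^ i) (c (l + m - i)) = (if i = l then 1 else 0)"
      proof (cases "i < l")
        case True
        then have "c (l + m - i) = 0" by (intro c(2)) simp
        then show ?thesis using True aut_simps(1)[OF aut_funpow[OF a]] by simp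
      next
        case False
        then show ?thesis using g(1) g(2)[of i] c(1) aut_simps(2)[OF aut_funpow[OF a]] by (cases "i = l") auto
      qed
    qed simp
    then show ?thesis by simp
  qed
  have h0: "h k = 0" if k: "l + m < k" for k
    unfolding h_def
  proof (rule sum.neutral, intro ballI)
    fix i assume "i \<in> {..k}"
    show "g i * (\<tau> ^^ i) (c (k - i)) = 0"
    proof (cases "l < i")
      case False
      then have "c (k - i) = 0" using k by (intro c(2)) simp
      then show ?thesis using aut_simps(1)[OF aut_funpow[OF a]] by simp
    qed (simp add: g(2))
  qed
  have hb: "\<exists>I\<subseteq>JE \<union> J. card I = l + m - k \<and> (\<Sum>i\<in>I. e i) \<le> int S * v (h k)" if k: "k \<le> l + m" "h k \<noteq> 0" for k
  proof -
    \<comment> \<open>Some summand of the twisted product has valuation at most that of the sum; the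
      index sets of its two factors lie in disjoint levels and are united.\<close>
    have "\<exists>i\<le>k. \<not> vge (v (h k) + 1) (g i * (\<tau> ^^ i) (c (k - i)))"
    proof (rule ccontr)
      assume "\<not> ?thesis"
      then have "vge (v (h k) + 1) (h k)" unfolding h_def[of k] by (intro vge_sum) (auto simp: h_def[symmetric])
      then show False using k(2) by (simp add: vge_def)
    qed
    then obtain i where i: "i \<le> k" "\<not> vge (v (h k) + 1) (g i * (\<tau> ^^ i) (c (k - i)))" by blast
    then have nz: "g i \<noteq> 0" "c (k - i) \<noteq> 0"
      using aut_simps(1)[OF aut_funpow[OF a]] by auto
    have le: "i \<le> l" "k - i \<le> m" using nz c(2)[of "k - i"] g(2)[of i] by (meson not_le)+
    have vv: "v (g i) + v (c (k - i)) \<le> v (h k)"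
    proof -
      have "v (g i * (\<tau> ^^ i) (c (k - i))) = v (g i) + v (c (k - i))"
        using nz aut_simps(8)[OF aut_funpow[OF a]] by (simp add: v_mult aut_v[OF aut_funpow[OF a]])
      then show ?thesis using i(2) by (auto simp: vge_def)
    qed
    obtain I where I: "I \<subseteq> J" "card I = m - (k - i)" "(\<Sum>i\<in>I. e i) \<le> int S * v (c (k - i))" using c(3)[OF le(2) nz(2)] by blast
    obtain I' where I': "I' \<subseteq> JE" "card I' = l - i"
      using obtain_subset_with_card_n[of "l - i" JE] l_def by (metis diff_le_self)
    have "(\<Sum>i\<in>I'. e i) = (\<Sum>i\<in>I'. E)" by (rule sum.cong) (use I'(1) in \<open>auto simp: JE_def\<close>)
    then have s1: "(\<Sum>i\<in>I'. e i) \<le> int S * v (g i)" using I'(2) g(3)[OF le(1) nz(1)] by (simp add: mult.commute)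
    have fI: "finite I" "finite I'" "I \<inter> I' = {}" using I I' fin finite_subset dis by blast+
    have "card (I \<union> I') = l + m - k" using card_Un_disjoint[OF fI] I(2) I'(2) le i(1) by simp
    moreover have "(\<Sum>i\<in>I \<union> I'. e i) \<le> int S * v (h k)"
    proof -
      have "(\<Sum>i\<in>I \<union> I'. e i) = (\<Sum>i\<in>I. e i) + (\<Sum>i\<in>I'. e i)" by (rule sum.union_disjoint[OF fI])
      also have "\<dots> \<le> int S * (v (g i) + v (c (k - i)))" using I(3) s1 by (simp add: algebra_simps)
      also have "\<dots> \<le> int S * v (h k)" by (rule mult_left_mono[OF vv]) simp
      finally show ?thesis .
    qed
    ultimately show ?thesis using I(1) I'(1) by (intro exI[of _ "I \<union> I'"]) auto
  qed
  have hk: "comb n (Suc (l + m)) ?y h $ i = 0" if i: "i < n" "e i \<in> insert E L" for i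
  proof (cases "e i = E")
    case True
    then show ?thesis unfolding comp[symmetric] using i by (intro g(4)) (simp add: JE_def)
  next
    case False
    then have L: "e i \<in> L" using i by simp
    have "(sl \<tau> R ^^ k) w $ i = 0" for k
      by (rule sl_pow_support[OF a R(1,2) wc _ i(1) L]) (use c(4) in \<open>simp add: w_def\<close>)
    then show ?thesis unfolding comp[symmetric] using i by (simp add: comb_def)
  qed
  show ?case unfolding un cun using h1 h0 hb hk by (intro exI[of _ h]) blast
qed

text \<open>The Horner sums satisfy \<Phi> \<open>D (k + 1)\<close> = \<pi>^(m k)
  (\<open>D k\<close> - \<alpha>_k \<open>x\<close>) with \<open>D 0 = 0\<close> and
  \<open>D n = x\<close>, which gives a companion matrix \<open>A\<close> times \<pi>^m on the basis
  \<open>D 1\<close>, ..., \<open>D n\<close>. Dominance bounds the coefficients of the annihilator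
  and makes \<open>A\<close> integral; equality of the totals makes \<open>det A\<close> a
  unit.\<close>

lemma lattice_basis:
  assumes a: "aut \<tau>" "aperiodic \<tau>" and R: "R \<in> carrier_mat n n" "R * dg n e = dg n e * R" "invertible_mat R" and S: "0 < S"
    and K: "GLO n K" "K * dg n e = dg n e * K" and RS: "(fr \<tau> R ^^ S) (1\<^sub>m n) = dg n e * K" and anti: "antitone n e"
    and dom: "\<And>k. k \<le> n \<Longrightarrow> (\<Sum>i<k. e i) \<le> (\<Sum>i<k. int S * m i)" and total: "(\<Sum>i<n. e i) = (\<Sum>i<n. int S * m i)"
  shows "\<exists>Y A. Y \<in> carrier_mat n n \<and> invertible_mat Y \<and> GLO n A \<and> fr \<tau> R Y = Y * (A * dg n m)"
proof -
  obtain x where x: "x \<in> carrier_vec n" "indep n n (\<lambda>j k. (sl \<tau> R ^^ j) x $ k)"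
    using cyclic_vector_exists[OF a R(1,3)] by blast
  let ?y = "\<lambda>k. (sl \<tau> R ^^ k) x"
  have yc: "?y k \<in> carrier_vec n" for k using R x by simp
  have J: "{i. i < n \<and> e i \<in> e ` {..<n}} = {..<n}" by auto
  obtain c where c: "c n = 1" "\<And>k. n < k \<Longrightarrow> c k = 0"
    "\<And>k. k \<le> n \<Longrightarrow> c k \<noteq> 0 \<Longrightarrow> \<exists>I\<subseteq>{..<n}. card I = n - k \<and> (\<Sum>i\<in>I. e i) \<le> int S * v (c k)"
    "\<And>i. i < n \<Longrightarrow> comb n (Suc n) ?y c $ i = 0"
    using annihilator[OF a(1) R S K RS x(1), of "e ` {..<n}"] unfolding J by auto
  \<comment> \<open>The scaling exponent of the k-th Horner sum: consecutive ones differ by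
    \<open>m k\<close>, and the tail sum bounds the valuation of the coefficient of degree
    \<open>k\<close> from below.\<close>
  define W where "W k = (\<Sum>i\<in>{k..<n}. m i)" for k
  have WSuc: "W k = m k + W (Suc k)" if "k < n" for k
    using that by (simp add: W_def sum.atLeast_Suc_lessThan)
  have cW: "vge (W k) (c k)" if k: "k \<le> n" for k
  proof (cases "c k = 0")
    case False
    obtain I where I: "I \<subseteq> {..<n}" "card I = n - k" "(\<Sum>i\<in>I. e i) \<le> int S * v (c k)" using c(3)[OF k False] by blast
    have split: "(\<Sum>i<n. g i) = (\<Sum>i<k. g i) + (\<Sum>i\<in>{k..<n}. g i)" for g :: "nat \<Rightarrow> int"
      using k sum.atLeastLessThan_concat[of 0 k n g] by (simp add: lessThan_atLeast0)
    have "int S * W k = (\<Sum>i\<in>{k..<n}. int S * m i)" by (simp add: W_def sum_distrib_left)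
    also have "\<dots> \<le> (\<Sum>i\<in>{k..<n}. e i)" using dom[OF k] total split[of e] split[of "\<lambda>i. int S * m i"] by simp
    also have "{k..<n} = {n - card I..<n}" using I k by simp
    also have "(\<Sum>i\<in>{n - card I..<n}. e i) \<le> (\<Sum>i\<in>I. e i)"
      by (rule sum_subset_ge_tail) (use anti I in \<open>auto simp: antitone_def\<close>)
    also have "\<dots> \<le> int S * v (c k)" by (rule I)
    finally have "W k \<le> v (c k)" using S by simp
    then show ?thesis by (simp add: vge_def)
  qed simp
  define \<rho> where "\<rho> = inv_into UNIV \<tau>"
  have ar: "aut \<rho>" using aut_inv_into[OF a(1)] by (simp add: \<rho>_def)
  have tr: "\<tau> (\<rho> z) = z" for z by (simp add: \<rho>_def aut_inv_simps[OF a(1)])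
  have ark: "aut (\<rho> ^^ k)" for k using ar by simp
  \<comment> \<open>the coefficients of the truncated Horner sums of the annihilator of \<open>x\<close>\<close>
  define q where "q k i = \<pi> powi (- W k) * (\<rho> ^^ k) (c (k + i))" for k i
  define D where "D k = comb n (Suc n) ?y (q k)" for k
  define \<alpha> where "\<alpha> k = q k 0" for k
  have q0: "q k i = 0" if "n < k + i" for k i using c(2)[OF that] aut_simps(1)[OF ark] by (simp add: q_def)
  have al: "vge 0 (\<alpha> k)" if "k \<le> n" for k
    using cW[OF that] by (simp add: \<alpha>_def q_def vge_powi_mult aut_vge[OF ark])
  have qs: "\<tau> (q (Suc k) i) = \<pi> powi (m k) * q k (Suc i)" if "k < n" for k i
  proof -
    have "\<tau> (q (Suc k) i) = \<pi> powi (- W (Suc k)) * (\<rho> ^^ k) (c (Suc k + i))"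
      by (simp add: q_def aut_simps(4)[OF a(1)] aut_powi[OF a(1)] tr)
    also have "- W (Suc k) = m k + - W k" using WSuc[OF that] by simp
    finally show ?thesis unfolding powi_add_pi by (simp add: q_def)
  qed
  have D0: "D 0 $ r = 0" if "r < n" for r
  proof -
    have "D 0 $ r = \<pi> powi (- W 0) * comb n (Suc n) ?y c $ r"
      using that by (simp add: D_def comb_def q_def sum_distrib_left algebra_simps)
    then show ?thesis using c(4)[OF that] by simp
  qed
  have Dn: "D n $ r = x $ r" if "r < n" for r
  proof -
    have "(\<Sum>i<Suc n. q n i * ?y i $ r) = (\<Sum>i<Suc n. if i = 0 then x $ r else 0)"
    proof (rule sum.cong)
      fix i assume "i \<in> {..<Suc n}"
      show "q n i * ?y i $ r = (if i = 0 then x $ r else 0)"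
        using q0[of n i] c(1) aut_simps(2)[OF ark] by (cases i) (auto simp: q_def W_def)
    qed simp
    then show ?thesis using that by (simp add: D_def comb_def)
  qed
  \<comment> \<open>Applying \<tau> turns the coefficients of \<open>D (Suc k)\<close> into \<pi>^(m
    k) times those of \<open>D k\<close> moved down by one place, and \<Phi> moves them up again;
    the constant coefficient \<alpha>_k is what is lost.\<close>
  have slD: "sl \<tau> R (D (Suc k)) $ r = \<pi> powi (m k) * (D k $ r - \<alpha> k * x $ r)" if k: "k < n" and r: "r < n" for k r
  proof -
    have "sl \<tau> R (D (Suc k)) = comb n (Suc n) (\<lambda>i. sl \<tau> R (?y i)) (\<lambda>i. \<tau> (q (Suc k) i))"
      unfolding D_def by (rule sl_comb[OF a(1) R(1)]) (rule yc)
    then have "sl \<tau> R (D (Suc k)) $ r = (\<Sum>i<Suc n. \<pi> powi (m k) * (q k (Suc i) * ?y (Suc i) $ r))"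
      using r by (simp add: comb_def qs[OF k] mult.assoc)
    also have "\<dots> = \<pi> powi (m k) * (\<Sum>i<Suc n. q k (Suc i) * ?y (Suc i) $ r)" by (rule sum_distrib_left[symmetric])
    also have "(\<Sum>i<Suc n. q k (Suc i) * ?y (Suc i) $ r) = (\<Sum>i<n. q k (Suc i) * ?y (Suc i) $ r)"
      using q0[of k "Suc n"] by simp
    also have "\<dots> = D k $ r - \<alpha> k * x $ r"
      using r by (simp add: D_def comb_def \<alpha>_def sum.lessThan_Suc_shift del: sum.lessThan_Suc)
    finally show ?thesis .
  qed
  define E where "E = mat n n (\<lambda>(i,k). D (Suc k) $ i)"
  have Ec: "E \<in> carrier_mat n n" by (simp add: E_def)
  have colE: "col E k = D (Suc k)" if "k < n" for k
    using that by (intro eq_vecI) (auto simp: E_def D_def comb_def)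
  \<comment> \<open>Column \<open>k\<close> stands for \<open>D k\<close> minus \<alpha>_k
    \<open>D n\<close>. As column \<open>i\<close> of \<open>E\<close> is \<open>D (Suc i)\<close>,
    the entry 1 sits in row \<open>k - 1\<close>; for \<open>k = 0\<close> it is absent, in
    accordance with \<open>D 0 = 0\<close>.\<close>
  define A where "A = mat n n (\<lambda>(i,k). (if Suc i = k then 1 else 0) - (if i = n - 1 then \<alpha> k else 0))"
  have Ac: "A \<in> carrier_mat n n" by (simp add: A_def)
  have Am: "mge 0 A" by (rule mge_I[OF Ac]) (use al in \<open>auto simp: A_def intro!: vge_diff\<close>)
  have frE: "fr \<tau> R E = E * (A * dg n m)"
  proof (rule eq_matI)
    fix r k assume "r < dim_row (E * (A * dg n m))" "k < dim_col (E * (A * dg n m))"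
    then have rk: "r < n" "k < n" using Ec by auto
    have "fr \<tau> R E $$ (r,k) = col (fr \<tau> R E) k $ r"
      using rk carrier_matD[OF fr_carrier[OF R(1) Ec, of \<tau>]] by (intro index_col[symmetric]) auto
    also have "\<dots> = \<pi> powi (m k) * (D k $ r - \<alpha> k * D n $ r)"
      using col_fr[OF R(1) Ec rk(2)] colE[OF rk(2)] slD[OF rk(2,1)] Dn[OF rk(1)] by simp
    also have "\<dots> = (E * (A * dg n m)) $$ (r,k)"
    proof -
      have "(E * (A * dg n m)) $$ (r,k) = (\<Sum>i<n. E $$ (r,i) * (A * dg n m) $$ (i,k))"
        by (rule mult_mat_index[of _ n n _ n]) (use Ec Ac rk in auto)
      also have "\<dots> = (\<Sum>i<n. (if Suc i = k then \<pi> powi (m k) * D k $ r else 0)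
          - (if i = n - 1 then \<pi> powi (m k) * (\<alpha> k * D n $ r) else 0))"
      proof (rule sum.cong)
        fix i assume "i \<in> {..<n}"
        then have i: "i < n" by simp
        show "E $$ (r,i) * (A * dg n m) $$ (i,k) = (if Suc i = k then \<pi> powi (m k) * D k $ r else 0)
          - (if i = n - 1 then \<pi> powi (m k) * (\<alpha> k * D n $ r) else 0)"
          unfolding mult_dg_index[OF Ac i rk(2)] using i rk by (auto simp: A_def E_def algebra_simps)
      qed simp
      also have "\<dots> = (\<Sum>i<n. if Suc i = k then \<pi> powi (m k) * D k $ r else 0) - \<pi> powi (m k) * (\<alpha> k * D n $ r)"
        using rk by (simp add: sum_subtractf)
      also have "(\<Sum>i<n. if Suc i = k then \<pi> powi (m k) * D k $ r else 0) = \<pi> powi (m k) * D k $ r"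
        using rk D0[OF rk(1)] by (cases k) auto
      finally show ?thesis by (simp add: algebra_simps)
    qed
    finally show "fr \<tau> R E $$ (r,k) = (E * (A * dg n m)) $$ (r,k)" .
  qed (use fr_carrier[OF R(1) Ec, of \<tau>] Ec in auto)
  have dE: "det E \<noteq> 0"
  proof
    assume "det E = 0"
    then obtain u where u: "u \<in> carrier_vec n" "u \<noteq> 0\<^sub>v n" "E *\<^sub>v u = 0\<^sub>v n"
      using det_0_iff_vec_prod_zero_field[OF Ec] by blast
    have "(\<Sum>i<n. (\<Sum>k<n. u $ k * q (Suc k) i) * ?y i $ r) = 0" if r: "r < n" for r
    proof -
      have "0 = (E *\<^sub>v u) $ r" using u(3) r by simp
      also have "\<dots> = (\<Sum>k<n. E $$ (r,k) * u $ k)" by (rule mult_mat_vec_index[OF Ec u(1) r])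
      also have "\<dots> = (\<Sum>k<n. \<Sum>i<n. u $ k * q (Suc k) i * ?y i $ r)"
      proof (rule sum.cong)
        fix k assume "k \<in> {..<n}"
        then have k: "k < n" by simp
        have "E $$ (r,k) = (\<Sum>i<n. q (Suc k) i * ?y i $ r)"
          using k r q0[of "Suc k" n] by (simp add: E_def D_def comb_def)
        then show "E $$ (r,k) * u $ k = (\<Sum>i<n. u $ k * q (Suc k) i * ?y i $ r)"
          by (simp add: sum_distrib_left sum_distrib_right algebra_simps)
      qed simp
      also have "\<dots> = (\<Sum>i<n. (\<Sum>k<n. u $ k * q (Suc k) i) * ?y i $ r)"
        unfolding sum_distrib_right by (rule sum.swap)
      finally show ?thesis by simp
    qed
    then have co: "(\<Sum>k<n. u $ k * q (Suc k) i) = 0" if "i < n" for i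
      using indepD[OF x(2), of "\<lambda>i. \<Sum>k<n. u $ k * q (Suc k) i" i] that by blast
    \<comment> \<open>\<open>D (Suc k)\<close> has degree \<open>n - Suc k\<close> in \<Phi> with
      nonzero leading coefficient, so the degrees are distinct and the \<open>u $ k\<close> vanish
      one after the other, from the top degree down.\<close>
    have "u $ k = 0" if "k < n" for k using that
    proof (induction k rule: less_induct)
      case (less k)
      let ?i = "n - Suc k"
      have "(\<Sum>k'<n. u $ k' * q (Suc k') ?i) = (\<Sum>k'<n. if k' = k then u $ k * q (Suc k) ?i else 0)"
      proof (rule sum.cong)
        fix k' assume "k' \<in> {..<n}"
        then show "u $ k' * q (Suc k') ?i = (if k' = k then u $ k * q (Suc k) ?i else 0)"
          using less q0[of "Suc k'" ?i] by (cases k' k rule: linorder_cases) auto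
      qed simp
      then have "u $ k * q (Suc k) ?i = 0" using co[of ?i] less.prems by simp
      moreover have "q (Suc k) ?i = \<pi> powi (- W (Suc k))"
        using less.prems c(1) aut_simps(2)[OF ark[of "Suc k"]] by (simp add: q_def del: funpow.simps)
      ultimately show ?case by simp
    qed
    then show False using u(1,2) by auto
  qed
  \<comment> \<open>The valuation of \<open>det R\<close> is the total of \<open>m\<close>, already
    accounted for by \<pi>^m, so nothing is left for \<open>det A\<close>.\<close>
  have "int S * v (det (top_left n R)) = (\<Sum>i<n. e i)"
    by (rule slope_block_det[OF a(1) R(1) R(1,2) K RS _ _ S]) auto
  then have vR: "v (det R) = (\<Sum>i<n. m i)" using total S R(1) by (simp add: sum_distrib_left[symmetric])
  have dR: "det R \<noteq> 0" using R(1,3) invertible_mat_iff_det by blast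
  have "det (fr \<tau> R E) = det R * \<tau> (det E)"
    unfolding fr_def using det_mult[OF R(1), of "map_mat \<tau> E"] Ec map_mat_det[OF a(1)] by simp
  moreover have "det (E * (A * dg n m)) = det E * (det A * det (dg n m))"
    using Ec Ac by (simp add: det_mult[of _ n])
  ultimately have dd: "det R * \<tau> (det E) = det E * (det A * det (dg n m))" using frE by simp
  have tE: "\<tau> (det E) \<noteq> 0" using dE aut_simps(8)[OF a(1)] by simp
  have dA: "det A \<noteq> 0" using dd dR tE by auto
  have dm: "det (dg n m) \<noteq> 0" using invertible_mat_iff_det[OF dg_carrier, of n m] by simp
  have "v (det R) + v (\<tau> (det E)) = v (det E) + (v (det A) + v (det (dg n m)))"
    using arg_cong[OF dd, of v] dR tE dE dA dm by (simp add: v_mult)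
  then have "v (det A) = 0" using vR v_det_dg[of n m] aut_v[OF a(1)] by simp
  then have "GLO n A" using GLO_det_I[OF Ac Am dA] by simp
  moreover have "invertible_mat E" using dE invertible_mat_iff_det[OF Ec] by simp
  ultimately show ?thesis using Ec frE by blast
qed

lemma ADLV_nonempty_of_dominance:
  fixes f :: nat and \<mu> :: "nat \<Rightarrow> int list"
  assumes a: "aut \<sigma>" "aperiodic (\<sigma> ^^ f)" and f: "1 \<le> f"
    and B: "\<And>j. j < f \<Longrightarrow> B j \<in> carrier_mat n n \<and> invertible_mat (B j)" and dom: "\<And>j. j < f \<Longrightarrow> dominant n (\<mu> j)"
    and st: "slope_basis (\<sigma> ^^ f) (mchain f \<sigma> B (1\<^sub>m n) f) n P S e" and anti: "antitone n e"
    and le: "\<And>k. k \<le> n \<Longrightarrow> (\<Sum>i<k. e i) \<le> (\<Sum>i<k. int S * (\<Sum>j<f. \<mu> j ! i))"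
    and total: "(\<Sum>i<n. e i) = (\<Sum>i<n. int S * (\<Sum>j<f. \<mu> j ! i))"
  shows "ADLV_nonempty v \<sigma> \<pi> n f \<mu> B"
proof -
  let ?\<tau> = "\<sigma> ^^ f" let ?b = "mchain f \<sigma> B (1\<^sub>m n) f"
  have Bc: "\<And>j. j < f \<Longrightarrow> B j \<in> carrier_mat n n" using B by simp
  have at: "aut ?\<tau>" using a by simp
  have bc: "?b \<in> carrier_mat n n" by (rule mchain_carrier[OF f Bc one_carrier_mat])
  have bi: "invertible_mat ?b" by (rule mchain_invertible[OF a(1) f B one_carrier_mat one_invertible])
  from slope_basis_obtain[OF at bc st] obtain R K where s: "P \<in> carrier_mat n n" "invertible_mat P" "0 < S"
    "R \<in> carrier_mat n n" "fr ?\<tau> ?b P = P * R" "R * dg n e = dg n e * R"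
    "GLO n K" "K * dg n e = dg n e * K" "(fr ?\<tau> R ^^ S) (1\<^sub>m n) = dg n e * K" by metis
  have "invertible_mat (P * R)" unfolding s(5)[symmetric] by (rule fr_invertible[OF at bc bi s(1,2)])
  then have Ri: "invertible_mat R"
    using s(1,4) invertible_mat_iff_det[of "P * R" n] invertible_mat_iff_det[OF s(4)] by (simp add: det_mult[of _ n])
  define m where "m i = (\<Sum>j<f. \<mu> j ! i)" for i
  obtain Y A where Y: "Y \<in> carrier_mat n n" "invertible_mat Y" "GLO n A" "fr ?\<tau> R Y = Y * (A * dg n m)"
    using lattice_basis[OF at a(2) s(4,6) Ri s(3,7,8,9) anti, of m] le total unfolding m_def by blast
  note Ac = GLO_carrier[OF Y(3)]
  define Y0 where "Y0 = P * Y"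
  have Y0: "Y0 \<in> carrier_mat n n" "invertible_mat Y0"
    using s Y invertible_mat_mult[OF s(1) Y(1) s(2) Y(2)] by (auto simp: Y0_def)
  have frY0: "mchain f \<sigma> B Y0 f = Y0 * (A * dg n m)"
  proof -
    have "mchain f \<sigma> B Y0 f = (fr ?\<tau> ?b ^^ 1) (P * Y)" using mchain_fr[OF a(1) f Bc Y0(1)] by (simp add: Y0_def)
    also have "\<dots> = P * (Y * (A * dg n m))" using fr_conj[OF at bc s(1,4,5) Y(1), of 1] Y(4) by simp
    finally show ?thesis using s(1) Y(1) Ac by (simp add: Y0_def assoc_mult_mat[of _ n n _ n _ n])
  qed
  \<comment> \<open>Scaling the transported basis by \<pi> to the power -(\<mu>_1 + ... + \<mu>_j)
    gives the step from j - 1 to j the invariant \<mu>_j. The step closing the cycle is left with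
    the total minus \<mu>_1, ..., \<mu>_(f-1), that is \<mu>_0.\<close>
  define t where "t j i = (\<Sum>l\<in>{1..<Suc j}. \<mu> l ! i)" for j i
  define Z where "Z j = mchain f \<sigma> B Y0 j * dg n (\<lambda>i. - t j i)" for j
  have cc: "mchain f \<sigma> B Y0 j \<in> carrier_mat n n" "invertible_mat (mchain f \<sigma> B Y0 j)" for j
    using mchain_carrier[OF f Bc Y0(1)] mchain_invertible[OF a(1) f B Y0] by auto
  have Zc: "Z j \<in> carrier_mat n n" "invertible_mat (Z j)" for j
    using cc invertible_mat_mult[OF cc(1) dg_carrier cc(2)] by (auto simp: Z_def)
  have step: "B (Suc j mod f) * map_mat \<sigma> (Z j) = mchain f \<sigma> B Y0 (Suc j) * dg n (\<lambda>i. - t j i)" for j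
  proof -
    have "B (Suc j mod f) \<in> carrier_mat n n" using Bc f by simp
    then show ?thesis using cc(1)[of j] a(1)
      by (simp add: Z_def map_mat_mult[OF a(1), of _ n n _ n] assoc_mult_mat[of _ n n _ n _ n])
  qed
  have "inv_is v \<pi> n (lattice_of v n (Z j)) (Fmap \<sigma> B j ` lattice_of v n (Z ((j + f - 1) mod f))) (\<mu> j)" if j: "j < f" for j
  proof (cases j)
    case 0
    obtain f' where f': "f = Suc f'" using f by (cases f) auto
    have p: "(j + f - 1) mod f = f'" using 0 f' by simp
    have "B 0 * map_mat \<sigma> (Z f') = Y0 * (A * dg n m) * dg n (\<lambda>i. - t f' i)"
      using step[of f'] frY0 f' by (simp del: mchain.simps)
    also have "\<dots> = Y0 * A * (dg n m * dg n (\<lambda>i. - t f' i))" using Y0 Ac by (simp add: assoc_mult_mat[of _ n n _ n _ n])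
    also have "dg n m * dg n (\<lambda>i. - t f' i) = dg n (\<lambda>i. \<mu> 0 ! i)"
    proof -
      have "m i = \<mu> 0 ! i + t f' i" for i
        unfolding m_def t_def f' lessThan_atLeast0 by (simp add: sum.atLeast_Suc_lessThan del: sum.atLeastLessThan_Suc)
      then show ?thesis unfolding dg_mult_dg by simp
    qed
    finally have e1: "B 0 * map_mat \<sigma> (Z f') = Y0 * A * dg n (\<lambda>i. \<mu> 0 ! i)" .
    have Z0: "Z 0 = Y0" using Y0 by (simp add: Z_def t_def)
    \<comment> \<open>Here the lattice takes the basis \<open>Y0 * A\<close> instead of
      \<open>Y0\<close>, because \<open>A\<close> stands to the left of the powers of \<pi>.\<close>
    show ?thesis unfolding inv_is_iff p
    proof (intro conjI exI[of _ "Y0 * A"])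
      show "dominant n (\<mu> j)" by (rule dom[OF j])
      show "Y0 * A \<in> carrier_mat n n" using Y0 Ac by simp
      show "invertible_mat (Y0 * A)" by (rule invertible_mat_mult[OF Y0(1) Ac Y0(2) GLO_invertible[OF Y(3)]])
      show "lattice_of v n (Z j) = lattice_of v n (Y0 * A)"
        using lattice_of_mult_GLO[OF Y0(1) Y(3)] 0 Z0 by simp
      show "Fmap \<sigma> B j ` lattice_of v n (Z f') = lattice_of v n (Y0 * A * dg n (\<lambda>i. \<mu> j ! i))"
        using Fmap_lattice[of \<sigma> B j n "Z f'", OF a(1) Bc[OF j] Zc(1)] e1 0 by simp
    qed
  next
    case (Suc i)
    have p: "(j + f - 1) mod f = i" using Suc j by simp
    have "t j l = t i l + \<mu> j ! l" for l unfolding t_def Suc by simp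
    then have td: "dg n (\<lambda>l. - t i l) = dg n (\<lambda>l. - t j l) * dg n (\<lambda>l. \<mu> j ! l)" unfolding dg_mult_dg by simp
    have "B j * map_mat \<sigma> (Z i) = mchain f \<sigma> B Y0 j * dg n (\<lambda>l. - t i l)"
      using step[of i] Suc j by (simp del: mchain.simps)
    also have "\<dots> = Z j * dg n (\<lambda>l. \<mu> j ! l)"
      unfolding td Z_def using cc by (simp add: assoc_mult_mat[of _ n n _ n _ n])
    finally have e1: "B j * map_mat \<sigma> (Z i) = Z j * dg n (\<lambda>l. \<mu> j ! l)" .
    show ?thesis unfolding inv_is_iff p
      using dom[OF j] Zc[of j] Fmap_lattice[of \<sigma> B j n "Z i", OF a(1) Bc[OF j] Zc(1)] e1 by auto
  qed
  moreover have "is_lattice v n (lattice_of v n (Z j))" for j unfolding is_lattice_def using Zc by blast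
  ultimately show ?thesis unfolding ADLV_nonempty_def by (intro exI[of _ "\<lambda>j. lattice_of v n (Z j)"]) auto
qed

lemma nonempty_iff_in_B_G_mu:
  fixes f :: nat and \<mu> :: "nat \<Rightarrow> int list"
  assumes a: "aut \<sigma>" "aperiodic (\<sigma> ^^ f)" and f: "1 \<le> f"
    and B: "\<And>j. j < f \<Longrightarrow> B j \<in> carrier_mat n n \<and> invertible_mat (B j)" and dom: "\<And>j. j < f \<Longrightarrow> dominant n (\<mu> j)"
  shows "ADLV_nonempty v \<sigma> \<pi> n f \<mu> B \<longleftrightarrow> in_B_G_mu v \<sigma> \<pi> n f \<mu> B"
proof -
  let ?\<tau> = "\<sigma> ^^ f" let ?b = "mchain f \<sigma> B (1\<^sub>m n) f"
  have Bc: "\<And>j. j < f \<Longrightarrow> B j \<in> carrier_mat n n" using B by simp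
  have at: "aut ?\<tau>" using a by simp
  have bc: "?b \<in> carrier_mat n n" by (rule mchain_carrier[OF f Bc one_carrier_mat])
  have bi: "invertible_mat ?b" by (rule mchain_invertible[OF a(1) f B one_carrier_mat one_invertible])
  obtain P S e where st: "slope_basis ?\<tau> ?b n P S e" and anti: "antitone n e" using slope_basis_sorted_exists[OF at a(2) bc bi] by blast
  have S: "0 < S" using st unfolding slope_basis_def by blast
  have sv: "slope_vector v \<pi> n (Frob_f f \<sigma> B) = slopes n S e"
    by (rule slope_vector_eq[OF at bc bi st anti]) (rule Frob_f_eq[OF a(1) f Bc])
  have iff: "in_B_G_mu v \<sigma> \<pi> n f \<mu> B \<longleftrightarrow>
    (\<forall>k\<le>n. (\<Sum>i<k. e i) \<le> (\<Sum>i<k. int S * (\<Sum>j<f. \<mu> j ! i))) \<and> (\<Sum>i<n. e i) = (\<Sum>i<n. int S * (\<Sum>j<f. \<mu> j ! i))"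
    unfolding in_B_G_mu_def sv by (rule dominance_slopes_iff[OF S])
  show ?thesis unfolding iff
  proof
    assume ne: "ADLV_nonempty v \<sigma> \<pi> n f \<mu> B"
    have 1: "(\<Sum>i<k. e i) \<le> (\<Sum>i<k. int S * (\<Sum>j<f. \<mu> j ! i))" if "k \<le> n" for k
      using B ne st anti that by (rule mazur_inequality(1)[OF a(1) f])
    have 2: "(\<Sum>i<n. e i) = (\<Sum>i<n. int S * (\<Sum>j<f. \<mu> j ! i))"
      using B ne st anti by (rule mazur_inequality(2)[OF a(1) f])
    show "(\<forall>k\<le>n. (\<Sum>i<k. e i) \<le> (\<Sum>i<k. int S * (\<Sum>j<f. \<mu> j ! i))) \<and>
      (\<Sum>i<n. e i) = (\<Sum>i<n. int S * (\<Sum>j<f. \<mu> j ! i))" using 1 2 by blast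
  next
    assume d: "(\<forall>k\<le>n. (\<Sum>i<k. e i) \<le> (\<Sum>i<k. int S * (\<Sum>j<f. \<mu> j ! i))) \<and>
      (\<Sum>i<n. e i) = (\<Sum>i<n. int S * (\<Sum>j<f. \<mu> j ! i))"
    show "ADLV_nonempty v \<sigma> \<pi> n f \<mu> B"
      using B dom st anti d[THEN conjunct1, rule_format] d[THEN conjunct2]
      by (rule ADLV_nonempty_of_dominance[OF a f])
  qed
qed

end

section \<open>The arithmetic setting: Frobenius has infinite order\<close>

lemma local_setting_dvf:
  assumes "local_setting p v \<sigma> \<pi>" shows "dvf v \<pi>"
  using assms unfolding local_setting_def by unfold_locales blast+

lemma local_setting_aut:
  assumes "local_setting p v \<sigma> \<pi>" shows "dvf.aut v \<pi> \<sigma>"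
  using assms unfolding dvf.aut_def[OF local_setting_dvf[OF assms]] local_setting_def by blast

lemma frobenius_power_congruence:
  fixes \<sigma> :: "'a::field \<Rightarrow> 'a"
  assumes ls: "local_setting p v \<sigma> \<pi>" and q: "\<And>x. x \<in> OL v \<Longrightarrow> \<sigma> x - x ^ q \<in> mL v" and x: "x \<in> OL v"
  shows "(\<sigma> ^^ k) x - x ^ (q ^ k) \<in> mL v"
proof -
  interpret dvf v \<pi> by (rule local_setting_dvf[OF ls])
  have a: "aut \<sigma>" by (rule local_setting_aut[OF ls])
  have mL: "y \<in> mL v \<longleftrightarrow> vge 1 y" for y by (simp add: mL_def vge_def)
  have pw: "y ^ i \<in> OL v" if "y \<in> OL v" for y i
    using that unfolding OL_iff by (induction i) (auto intro: vge_mult0)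
  show ?thesis
  proof (induction k)
    case 0
    show ?case by (simp add: mL)
  next
    case (Suc k)
    have "vge 1 (\<sigma> ((\<sigma> ^^ k) x - x ^ (q ^ k)))" using Suc unfolding mL aut_vge[OF a] .
    then have 1: "vge 1 (\<sigma> ((\<sigma> ^^ k) x) - \<sigma> (x ^ (q ^ k)))" unfolding aut_simps(7)[OF a] .
    have 2: "vge 1 (\<sigma> (x ^ (q ^ k)) - (x ^ (q ^ k)) ^ q)" using q[OF pw[OF x]] unfolding mL .
    have "(x ^ (q ^ k)) ^ q = x ^ (q ^ Suc k)" by (simp add: power_mult[symmetric] mult.commute)
    then show ?case using vge_add[OF 1 2] unfolding mL by simp
  qed
qed

text \<open>On the residue field \<sigma> is a Frobenius power map, and no positive power of it
  fixes every element of an algebraically closed field.\<close>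

lemma local_setting_aperiodic:
  fixes \<sigma> :: "'a::field \<Rightarrow> 'a"
  assumes ls: "local_setting p v \<sigma> \<pi>" and f: "1 \<le> f"
  shows "dvf.aperiodic (\<sigma> ^^ f)"
proof -
  interpret dvf v \<pi> by (rule local_setting_dvf[OF ls])
  have mL: "y \<in> mL v \<longleftrightarrow> vge 1 y" for y by (simp add: mL_def vge_def)
  note L = ls[unfolded local_setting_def]
  have p: "prime p" using L by (elim conjE)
  have roots: "\<forall>d::nat. \<forall>c :: nat \<Rightarrow> 'a. 1 \<le> d \<longrightarrow> (\<forall>i<d. c i \<in> OL v) \<longrightarrow>
    (\<exists>x\<in>OL v. x ^ d + (\<Sum>i<d. c i * x ^ i) \<in> mL v)" using L by (elim conjE)
  have "\<exists>r::nat. 1 \<le> r \<and> (\<forall>x\<in>OL v. \<sigma> x - x ^ (p ^ r) \<in> mL v)" using L by (elim conjE)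
  then obtain r :: nat where r: "1 \<le> r" "\<And>x. x \<in> OL v \<Longrightarrow> \<sigma> x - x ^ (p ^ r) \<in> mL v" by blast
  have "\<exists>x. ((\<sigma> ^^ f) ^^ m) x \<noteq> x" if m: "1 \<le> m" for m
  proof -
    define N where "N = f * m"
    define d where "d = (p ^ r) ^ N"
    have "1 \<le> N" using f m by (simp add: N_def)
    have p2: "2 \<le> p" using p by (simp add: prime_ge_2_nat)
    have d2: "2 \<le> d"
    proof -
      have "p ^ 1 \<le> p ^ (r * N)" by (rule power_increasing) (use r \<open>1 \<le> N\<close> p2 in auto)
      then show ?thesis using p2 by (simp add: d_def power_mult)
    qed
    \<comment> \<open>a residual root of \<open>x ^ d - x - 1\<close> is moved by \<open>\<sigma> ^^ N\<close>\<close>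
    let ?c = "\<lambda>i::nat. if i = 0 \<or> i = 1 then - 1 else (0::'a)"
    have "\<forall>i<d. ?c i \<in> OL v" by (simp add: OL_iff)
    then obtain x where x: "x \<in> OL v" "x ^ d + (\<Sum>i<d. ?c i * x ^ i) \<in> mL v"
      using roots[rule_format, of d ?c] d2 by auto
    have "(\<Sum>i<d. ?c i * x ^ i) = (\<Sum>i\<in>{0,1}. ?c i * x ^ i)"
      by (rule sum.mono_neutral_right) (use d2 in auto)
    also have "\<dots> = - x - 1" by simp
    finally have "x ^ d + (\<Sum>i<d. ?c i * x ^ i) = x ^ d - x - 1" by simp
    then have 1: "vge 1 (x ^ d - x - 1)" using x(2) unfolding mL by metis
    have 2: "vge 1 ((\<sigma> ^^ N) x - x ^ d)"
      using frobenius_power_congruence[OF ls r(2) x(1), of N] by (simp add: mL d_def)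
    have "(\<sigma> ^^ N) x \<noteq> x"
    proof
      assume "(\<sigma> ^^ N) x = x"
      then have "vge 1 (- 1 :: 'a)" using vge_add[OF 1 2] by simp
      then show False by (simp add: vge_def)
    qed
    then show ?thesis by (auto simp: N_def funpow_mult mult.commute)
  qed
  then show ?thesis unfolding aperiodic_def by blast
qed

theorem theorem5p1:
  fixes p :: nat and v :: "'a::field \<Rightarrow> int" and \<sigma> :: "'a \<Rightarrow> 'a" and \<pi> :: 'a
    and n f :: nat and \<mu> :: "nat \<Rightarrow> int list" and B :: "nat \<Rightarrow> 'a mat"
  assumes "local_setting p v \<sigma> \<pi>"
    and "1 \<le> f"
    and "\<forall>j<f. dominant n (\<mu> j)"
    and "\<forall>j<f. B j \<in> carrier_mat n n \<and> invertible_mat (B j)"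
  shows "ADLV_nonempty v \<sigma> \<pi> n f \<mu> B \<longleftrightarrow> in_B_G_mu v \<sigma> \<pi> n f \<mu> B"
  by (rule dvf.nonempty_iff_in_B_G_mu[OF local_setting_dvf[OF assms(1)] local_setting_aut[OF assms(1)]
      local_setting_aperiodic[OF assms(1,2)] assms(2)]) (use assms(3,4) in auto)

end
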